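(* Let $\Lambda$ be a basic finite-dimensional $\mathbb C$-algebra of finite representation type, $J$ a two-sided ideal of $\Lambda$, and $A=\Lambda/J$. There is a ring map $\phi:\widetilde R_A\to\widetilde R_\Lambda$ defined by $$\phi(\overline u_{\overline M})=\prod_{N\in\mathrm{ind}\,K_\Lambda}u_N^{[\pi N:\overline M]}\qquad(\overline M\in\mathrm{ind}\,K_A).$$
   Context: Setting: $\Lambda$ is a basic finite-dimensional associative $\mathbb C$-algebra of finite representation type, with complete set of pairwise orthogonal primitive idempotents $e_1,\dots,e_n$. $\mathrm{mod}\,\Lambda$ is the category of finite-dimensional right modules, $P_i=e_i\Lambda$. $K_\Lambda$ is the full subcategory of the homotopy category $K^b(\mathrm{proj}\,\Lambda)$ (shift $\Sigma$) of complexes $X=(X^{-1}\to X^0)$ concentrated in degrees $-1,0$. $\mathrm{ind}\,K_\Lambda$ is the finite set of isomorphism classes of its indecomposables. $H^0(X)=\mathrm{coker}(X^{-1}\to X^0)$. The $g$-vector $g(X)\in\mathbb Z^n$ has $i$-th entry (multiplicity of $P_i$ in $X^0$) $-$ (multiplicity of $P_i$ in $X^{-1}$). $\langle-,-\rangle$ is the standard inner product; $\hom=\dim_{\mathbb C}\mathrm{Hom}$. For $M\in\mathrm{mod}\,\Lambda$, $\mathrm{Gr}_{\mathbf d}(M)$ is the projective variety of submodules of $M$ of dimension vector $\mathbf d\in\mathbb Z^n_{\ge0}$, $\chi$ is the Euler characteristic, and $$\widehat F_M=\sum_{\mathbf d}\chi(\mathrm{Gr}_{\mathbf d}(M))\prod_{V\in\mathrm{ind}\,K_\Lambda}u_V^{\hom_\Lambda(H^0V,M)-\langle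 g(V),\mathbf d\rangle}\in\mathbb Z[u_V\mid V\in\mathrm{ind}\,K_\Lambda];$$ $\widehat F_X:=\widehat F_{H^0X}$ for $X\in K_\Lambda$. $\widetilde R_\Lambda=\mathbb C[u_X\mid X\in\mathrm{ind}\,K_\Lambda]/\langle\widehat F_X-1\mid X\in\mathrm{ind}\,K_\Lambda\rangle$. The quotient $A$ is again of finite representation type, and $\widetilde R_A$ is defined in the same way for $A$, with variables denoted $\overline u_{\overline M}$, $\overline M\in\mathrm{ind}\,K_A$. $\pi=-\otimes_\Lambda A:K_\Lambda\to K_A$. For $\overline N\in K_A$ and $\overline M\in\mathrm{ind}\,K_A$, $[\overline N:\overline M]$ is the multiplicity of $\overline M$ as an indecomposable direct summand of $\overline N$. *)

theory Defs
  imports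
    "HOL-Algebra.QuotRing"
    "HOL-Algebra.Free_Abelian_Groups"
    "HOL-Homology.Homology"
    "HOL-Library.Poly_Mapping"
    "Jordan_Normal_Form.VS_Connect"
begin

section \<open>Finite-dimensional complex algebras\<close>

text \<open>Vector spaces over the complex numbers are \<open>vectorspace class_ring V\<close>, where
  \<open>class_ring\<close> is the field of complex numbers as a HOL-Algebra record.\<close>

abbreviation CC :: "complex ring" where
  "CC \<equiv> class_ring"

abbreviation cdim :: "(complex, 'v) module \<Rightarrow> nat" where
  "cdim V \<equiv> vectorspace.dim CC V"

locale fd_complex_algebra = ring \<Lambda> + cvs: vectorspace CC \<Lambda>
  for \<Lambda> :: "(complex, 'a) module" (structure) +
  assumes smult_mult_left:
      "\<lbrakk>x \<in> carrier \<Lambda>; y \<in> carrier \<Lambda>\<rbrakk> \<Longrightarrow> (c \<odot> x) \<otimes> y = c \<odot> (x \<otimes> y)"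
    and smult_mult_right:
      "\<lbrakk>x \<in> carrier \<Lambda>; y \<in> carrier \<Lambda>\<rbrakk> \<Longrightarrow> x \<otimes> (c \<odot> y) = c \<odot> (x \<otimes> y)"
    and finite_dimensional: "vectorspace.fin_dim CC \<Lambda>"

definition quotient_algebra ::
    "(complex, 'a) module \<Rightarrow> 'a set \<Rightarrow> (complex, 'a set) module" where
  "quotient_algebra \<Lambda> J =
    \<lparr>carrier = carrier (\<Lambda> Quot J), monoid.mult = monoid.mult (\<Lambda> Quot J), one = one (\<Lambda> Quot J),
     ring.zero = ring.zero (\<Lambda> Quot J), ring.add = ring.add (\<Lambda> Quot J),
     smult = (\<lambda>c C. \<Union>x\<in>C. J +>\<^bsub>\<Lambda>\<^esub> (c \<odot>\<^bsub>\<Lambda>\<^esub> x))\<rparr>"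

definition idempotent_in :: "('a, 'r) ring_scheme \<Rightarrow> 'a \<Rightarrow> bool" where
  "idempotent_in R e \<longleftrightarrow> e \<in> carrier R \<and> e \<otimes>\<^bsub>R\<^esub> e = e"

definition primitive_idempotent :: "('a, 'r) ring_scheme \<Rightarrow> 'a \<Rightarrow> bool" where
  "primitive_idempotent R e \<longleftrightarrow> idempotent_in R e \<and> e \<noteq> \<zero>\<^bsub>R\<^esub> \<and>
    (\<forall>f g. idempotent_in R f \<and> idempotent_in R g \<and>
       f \<otimes>\<^bsub>R\<^esub> g = \<zero>\<^bsub>R\<^esub> \<and> g \<otimes>\<^bsub>R\<^esub> f = \<zero>\<^bsub>R\<^esub> \<and> e = f \<oplus>\<^bsub>R\<^esub> g
       \<longrightarrow> f = \<zero>\<^bsub>R\<^esub> \<or> g = \<zero>\<^bsub>R\<^esub>)"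

definition complete_primitive_idempotents ::
    "('a, 'r) ring_scheme \<Rightarrow> 'a list \<Rightarrow> bool" where
  "complete_primitive_idempotents R es \<longleftrightarrow>
    (\<forall>e\<in>set es. primitive_idempotent R e) \<and>
    (\<forall>i<length es. \<forall>j<length es. i \<noteq> j \<longrightarrow> es ! i \<otimes>\<^bsub>R\<^esub> es ! j = \<zero>\<^bsub>R\<^esub>) \<and>
    (\<Oplus>\<^bsub>R\<^esub>i\<in>{..<length es}. es ! i) = \<one>\<^bsub>R\<^esub>"


section \<open>Right modules\<close>

text \<open>A right module over \<open>R\<close> is a module record in which \<open>a \<odot>\<^bsub>M\<^esub> m\<close> stands for the right
  action \<open>m a\<close>; its fields \<open>mult\<close> and \<open>one\<close> play no role.\<close>

locale right_module = R?: ring R + M?: abelian_group M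
  for R :: "('a, 'r) ring_scheme" and M :: "('a, 'm) module" +
  assumes act_closed:
      "\<lbrakk>a \<in> carrier R; x \<in> carrier M\<rbrakk> \<Longrightarrow> a \<odot>\<^bsub>M\<^esub> x \<in> carrier M"
    and act_add_scalar:
      "\<lbrakk>a \<in> carrier R; b \<in> carrier R; x \<in> carrier M\<rbrakk> \<Longrightarrow>
        (a \<oplus>\<^bsub>R\<^esub> b) \<odot>\<^bsub>M\<^esub> x = a \<odot>\<^bsub>M\<^esub> x \<oplus>\<^bsub>M\<^esub> b \<odot>\<^bsub>M\<^esub> x"
    and act_add:
      "\<lbrakk>a \<in> carrier R; x \<in> carrier M; y \<in> carrier M\<rbrakk> \<Longrightarrow>
        a \<odot>\<^bsub>M\<^esub> (x \<oplus>\<^bsub>M\<^esub> y) = a \<odot>\<^bsub>M\<^esub> x \<oplus>\<^bsub>M\<^esub> a \<odot>\<^bsub>M\<^esub> y"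
    and act_act:
      "\<lbrakk>a \<in> carrier R; b \<in> carrier R; x \<in> carrier M\<rbrakk> \<Longrightarrow>
        (a \<otimes>\<^bsub>R\<^esub> b) \<odot>\<^bsub>M\<^esub> x = b \<odot>\<^bsub>M\<^esub> (a \<odot>\<^bsub>M\<^esub> x)"
    and act_one: "x \<in> carrier M \<Longrightarrow> \<one>\<^bsub>R\<^esub> \<odot>\<^bsub>M\<^esub> x = x"

definition right_submodule ::
    "('a, 'r) ring_scheme \<Rightarrow> ('a, 'm) module \<Rightarrow> 'm set \<Rightarrow> bool" where
  "right_submodule R M N \<longleftrightarrow> N \<subseteq> carrier M \<and> \<zero>\<^bsub>M\<^esub> \<in> N \<and>
    (\<forall>x\<in>N. \<forall>y\<in>N. x \<oplus>\<^bsub>M\<^esub> y \<in> N) \<and>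
    (\<forall>a\<in>carrier R. \<forall>x\<in>N. a \<odot>\<^bsub>M\<^esub> x \<in> N)"

definition quotient_module :: "('a, 'm) module \<Rightarrow> 'm set \<Rightarrow> ('a, 'm set) module" where
  "quotient_module M N =
    \<lparr>carrier = a_rcosets\<^bsub>M\<^esub> N, monoid.mult = undefined, one = undefined,
     ring.zero = N, ring.add = set_add M,
     smult = (\<lambda>a C. \<Union>x\<in>C. N +>\<^bsub>M\<^esub> (a \<odot>\<^bsub>M\<^esub> x))\<rparr>"

definition rhom ::
    "('a, 'r) ring_scheme \<Rightarrow> ('a, 'm) module \<Rightarrow> ('a, 'n) module \<Rightarrow> ('m \<Rightarrow> 'n) set" where
  "rhom R M N = {f \<in> carrier M \<rightarrow>\<^sub>E carrier N.
    (\<forall>x\<in>carrier M. \<forall>y\<in>carrier M. f (x \<oplus>\<^bsub>M\<^esub> y) = f x \<oplus>\<^bsub>N\<^esub> f y) \<and>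
    (\<forall>a\<in>carrier R. \<forall>x\<in>carrier M. f (a \<odot>\<^bsub>M\<^esub> x) = a \<odot>\<^bsub>N\<^esub> f x)}"

definition rmod_iso ::
    "('a, 'r) ring_scheme \<Rightarrow> ('a, 'm) module \<Rightarrow> ('a, 'n) module \<Rightarrow> bool" where
  "rmod_iso R M N \<longleftrightarrow> (\<exists>f\<in>rhom R M N. bij_betw f (carrier M) (carrier N))"

text \<open>External direct sum of a finite list of modules; its elements are the families
  indexed by the positions of the list.\<close>

definition rmod_dsum :: "('a, 'm) module list \<Rightarrow> ('a, nat \<Rightarrow> 'm) module" where
  "rmod_dsum Ms =
    \<lparr>carrier = (\<Pi>\<^sub>E j\<in>{..<length Ms}. carrier (Ms ! j)),
     monoid.mult = undefined, one = undefined,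
     ring.zero = (\<lambda>j\<in>{..<length Ms}. \<zero>\<^bsub>Ms ! j\<^esub>),
     ring.add = (\<lambda>x y. \<lambda>j\<in>{..<length Ms}. x j \<oplus>\<^bsub>Ms ! j\<^esub> y j),
     smult = (\<lambda>a x. \<lambda>j\<in>{..<length Ms}. a \<odot>\<^bsub>Ms ! j\<^esub> x j)\<rparr>"

definition right_regular :: "('a, 'r) ring_scheme \<Rightarrow> ('a, 'a) module" where
  "right_regular R =
    \<lparr>carrier = carrier R, monoid.mult = undefined, one = undefined,
     ring.zero = \<zero>\<^bsub>R\<^esub>, ring.add = ring.add R, smult = (\<lambda>a x. x \<otimes>\<^bsub>R\<^esub> a)\<rparr>"

definition idem_proj :: "('a, 'r) ring_scheme \<Rightarrow> 'a \<Rightarrow> ('a, 'a) module" where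
  "idem_proj R e = (right_regular R)\<lparr>carrier := {e \<otimes>\<^bsub>R\<^esub> x | x. x \<in> carrier R}\<rparr>"

text \<open>Finitely generated projective modules: direct summands of free modules of finite rank.\<close>

definition fg_projective :: "('a, 'r) ring_scheme \<Rightarrow> ('a, 'm) module \<Rightarrow> bool" where
  "fg_projective R P \<longleftrightarrow> right_module R P \<and>
    (\<exists>k. \<exists>i\<in>rhom R P (rmod_dsum (replicate k (right_regular R))).
         \<exists>p\<in>rhom R (rmod_dsum (replicate k (right_regular R))) P.
           \<forall>x\<in>carrier P. p (i x) = x)"

definition basic_algebra :: "('a, 'r) ring_scheme \<Rightarrow> 'a list \<Rightarrow> bool" where
  "basic_algebra R es \<longleftrightarrow> (\<forall>i<length es. \<forall>j<length es.
     i \<noteq> j \<longrightarrow> \<not> rmod_iso R (idem_proj R (es ! i)) (idem_proj R (es ! j)))"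

text \<open>The complex vector space underlying a right module over a complex algebra: a scalar
  \<open>c\<close> acts as the algebra element \<open>c 1\<close>.\<close>

definition cspace ::
    "(complex, 'a) module \<Rightarrow> ('a, 'm) module \<Rightarrow> (complex, 'm) module" where
  "cspace \<Lambda> M =
    \<lparr>carrier = carrier M, monoid.mult = monoid.mult M, one = one M, ring.zero = \<zero>\<^bsub>M\<^esub>, ring.add = ring.add M,
     smult = (\<lambda>c x. (c \<odot>\<^bsub>\<Lambda>\<^esub> \<one>\<^bsub>\<Lambda>\<^esub>) \<odot>\<^bsub>M\<^esub> x)\<rparr>"

definition fd_right_module :: "(complex, 'a) module \<Rightarrow> ('a, 'm) module \<Rightarrow> bool" where
  "fd_right_module \<Lambda> M \<longleftrightarrow> right_module \<Lambda> M \<and> vectorspace.fin_dim CC (cspace \<Lambda> M)"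

definition hom_space ::
    "(complex, 'a) module \<Rightarrow> ('a, 'm) module \<Rightarrow> ('a, 'n) module \<Rightarrow> (complex, 'm \<Rightarrow> 'n) module" where
  "hom_space \<Lambda> M N =
    \<lparr>carrier = rhom \<Lambda> M N, monoid.mult = undefined, one = undefined,
     ring.zero = (\<lambda>x\<in>carrier M. \<zero>\<^bsub>N\<^esub>),
     ring.add = (\<lambda>f g. \<lambda>x\<in>carrier M. f x \<oplus>\<^bsub>N\<^esub> g x),
     smult = (\<lambda>c f. \<lambda>x\<in>carrier M. (c \<odot>\<^bsub>\<Lambda>\<^esub> \<one>\<^bsub>\<Lambda>\<^esub>) \<odot>\<^bsub>N\<^esub> f x)\<rparr>"

definition hom_dim ::
    "(complex, 'a) module \<Rightarrow> ('a, 'm) module \<Rightarrow> ('a, 'n) module \<Rightarrow> nat" where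
  "hom_dim \<Lambda> M N = cdim (hom_space \<Lambda> M N)"

text \<open>Isomorphism classes are formed among modules whose elements lie in the type
  \<^typ>\<open>nat \<Rightarrow> 'a\<close>. Every finite-dimensional right module over the algebra has an isomorphic
  copy there: a nonzero such module has the cardinality of the continuum, and so has a
  nonzero algebra.\<close>

definition indec_module :: "(complex, 'a) module \<Rightarrow> ('a, nat \<Rightarrow> 'a) module \<Rightarrow> bool" where
  "indec_module \<Lambda> M \<longleftrightarrow> fd_right_module \<Lambda> M \<and> carrier M \<noteq> {\<zero>\<^bsub>M\<^esub>} \<and>
    (\<forall>Y Z :: ('a, nat \<Rightarrow> 'a) module.
       fd_right_module \<Lambda> Y \<and> fd_right_module \<Lambda> Z \<and> rmod_iso \<Lambda> M (rmod_dsum [Y, Z])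
       \<longrightarrow> carrier Y = {\<zero>\<^bsub>Y\<^esub>} \<or> carrier Z = {\<zero>\<^bsub>Z\<^esub>})"

definition rmod_class ::
    "(complex, 'a) module \<Rightarrow> ('a, nat \<Rightarrow> 'a) module \<Rightarrow> ('a, nat \<Rightarrow> 'a) module set" where
  "rmod_class \<Lambda> M = {N. fd_right_module \<Lambda> N \<and> rmod_iso \<Lambda> M N}"

definition finite_rep_type :: "(complex, 'a) module \<Rightarrow> bool" where
  "finite_rep_type \<Lambda> \<longleftrightarrow> finite {rmod_class \<Lambda> M | M. indec_module \<Lambda> M}"


section \<open>The category of two-term complexes of projectives\<close>

record ('a, 'm) two_term =
  tm1 :: "('a, 'm) module"
  t0 :: "('a, 'm) module"
  tdiff :: "'m \<Rightarrow> 'm"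

definition two_term_proj :: "('a, 'r) ring_scheme \<Rightarrow> ('a, 'm) two_term \<Rightarrow> bool" where
  "two_term_proj R X \<longleftrightarrow>
    fg_projective R (tm1 X) \<and> fg_projective R (t0 X) \<and> tdiff X \<in> rhom R (tm1 X) (t0 X)"

definition chain_maps ::
    "('a, 'r) ring_scheme \<Rightarrow> ('a, 'm) two_term \<Rightarrow> ('a, 'n) two_term
      \<Rightarrow> (('m \<Rightarrow> 'n) \<times> ('m \<Rightarrow> 'n)) set" where
  "chain_maps R X Y = {(f1, f0). f1 \<in> rhom R (tm1 X) (tm1 Y) \<and> f0 \<in> rhom R (t0 X) (t0 Y) \<and>
    (\<forall>x\<in>carrier (tm1 X). f0 (tdiff X x) = tdiff Y (f1 x))}"

definition chain_homotopic ::
    "('a, 'r) ring_scheme \<Rightarrow> ('a, 'm) two_term \<Rightarrow> ('a, 'n) two_term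
      \<Rightarrow> ('m \<Rightarrow> 'n) \<times> ('m \<Rightarrow> 'n) \<Rightarrow> ('m \<Rightarrow> 'n) \<times> ('m \<Rightarrow> 'n) \<Rightarrow> bool" where
  "chain_homotopic R X Y f g \<longleftrightarrow> (\<exists>h\<in>rhom R (t0 X) (tm1 Y).
    (\<forall>x\<in>carrier (tm1 X). fst f x = fst g x \<oplus>\<^bsub>tm1 Y\<^esub> h (tdiff X x)) \<and>
    (\<forall>x\<in>carrier (t0 X). snd f x = snd g x \<oplus>\<^bsub>t0 Y\<^esub> tdiff Y (h x)))"

text \<open>Isomorphism in the homotopy category.\<close>

definition K_iso ::
    "('a, 'r) ring_scheme \<Rightarrow> ('a, 'm) two_term \<Rightarrow> ('a, 'n) two_term \<Rightarrow> bool" where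
  "K_iso R X Y \<longleftrightarrow> (\<exists>(f1, f0)\<in>chain_maps R X Y. \<exists>(g1, g0)\<in>chain_maps R Y X.
     chain_homotopic R X X (g1 \<circ> f1, g0 \<circ> f0) (id, id) \<and>
     chain_homotopic R Y Y (f1 \<circ> g1, f0 \<circ> g0) (id, id))"

definition K_dsum :: "('a, 'm) two_term list \<Rightarrow> ('a, nat \<Rightarrow> 'm) two_term" where
  "K_dsum Xs =
    \<lparr>tm1 = rmod_dsum (map tm1 Xs), t0 = rmod_dsum (map t0 Xs),
     tdiff = (\<lambda>x\<in>carrier (rmod_dsum (map tm1 Xs)). \<lambda>j\<in>{..<length Xs}. tdiff (Xs ! j) (x j))\<rparr>"

definition K_zero :: "('a, 'r) ring_scheme \<Rightarrow> ('a, 'm) two_term \<Rightarrow> bool" where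
  "K_zero R X \<longleftrightarrow> K_iso R X (K_dsum ([] :: ('a, 'm) two_term list))"

text \<open>As for modules, isomorphism classes are formed among complexes with elements in
  \<^typ>\<open>nat \<Rightarrow> 'a\<close>, which contains the free modules of finite rank. An element of
  \<open>ind_K R\<close> is a whole isomorphism class; \<open>K_rep\<close> picks a member.\<close>

definition indec_K :: "('a, 'r) ring_scheme \<Rightarrow> ('a, nat \<Rightarrow> 'a) two_term \<Rightarrow> bool" where
  "indec_K R X \<longleftrightarrow> two_term_proj R X \<and> \<not> K_zero R X \<and>
    (\<forall>Y Z :: ('a, nat \<Rightarrow> 'a) two_term.
       two_term_proj R Y \<and> two_term_proj R Z \<and> K_iso R X (K_dsum [Y, Z])
       \<longrightarrow> K_zero R Y \<or> K_zero R Z)"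

type_synonym 'a K_class = "('a, nat \<Rightarrow> 'a) two_term set"

definition K_class :: "('a, 'r) ring_scheme \<Rightarrow> ('a, nat \<Rightarrow> 'a) two_term \<Rightarrow> 'a K_class" where
  "K_class R X = {Y. two_term_proj R Y \<and> K_iso R X Y}"

definition ind_K :: "('a, 'r) ring_scheme \<Rightarrow> 'a K_class set" where
  "ind_K R = {K_class R X | X. indec_K R X}"

definition K_rep :: "'a K_class \<Rightarrow> ('a, nat \<Rightarrow> 'a) two_term" where
  "K_rep V = (SOME X. X \<in> V)"

definition H0 :: "('a, 'm) two_term \<Rightarrow> ('a, 'm set) module" where
  "H0 X = quotient_module (t0 X) (tdiff X ` carrier (tm1 X))"

text \<open>Multiplicities are read off from a chosen decomposition into indecomposables; they do
  not depend on it by the Krull-Schmidt theorem.\<close>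

definition K_decomposition ::
    "('a, 'r) ring_scheme \<Rightarrow> ('a, 'm) two_term \<Rightarrow> ('a, nat \<Rightarrow> 'a) two_term list" where
  "K_decomposition R X =
    (SOME Xs. (\<forall>Y\<in>set Xs. indec_K R Y) \<and> K_iso R X (K_dsum Xs))"

definition K_mult :: "('a, 'r) ring_scheme \<Rightarrow> ('a, 'm) two_term \<Rightarrow> 'a K_class \<Rightarrow> nat" where
  "K_mult R X V = length (filter (\<lambda>Y. Y \<in> V) (K_decomposition R X))"

definition proj_decomposition ::
    "('a, 'r) ring_scheme \<Rightarrow> 'a list \<Rightarrow> ('a, 'm) module \<Rightarrow> nat list" where
  "proj_decomposition R es P =
    (SOME is. set is \<subseteq> {..<length es} \<and>
       rmod_iso R P (rmod_dsum (map (\<lambda>i. idem_proj R (es ! i)) is)))"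

definition g_vector ::
    "('a, 'r) ring_scheme \<Rightarrow> 'a list \<Rightarrow> ('a, 'm) two_term \<Rightarrow> nat \<Rightarrow> int" where
  "g_vector R es X i =
    int (count_list (proj_decomposition R es (t0 X)) i)
    - int (count_list (proj_decomposition R es (tm1 X)) i)"


section \<open>Extension of scalars\<close>

text \<open>\<open>base_change R S \<rho> M\<close> is the tensor product of the right \<open>R\<close>-module \<open>M\<close> with \<open>S\<close>, where
  \<open>r \<in> R\<close> acts on \<open>S\<close> from the left through the ring map \<open>\<rho>\<close>: the free abelian group on the
  pairs \<open>(m, s)\<close> modulo biadditivity and \<open>(m r, s) = (m, \<rho>(r) s)\<close>.\<close>

definition tensor_free ::
    "('a, 'm) module \<Rightarrow> ('b, 's) ring_scheme \<Rightarrow> ('b, 'm \<times> 'b \<Rightarrow>\<^sub>0 int) module" where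
  "tensor_free M S =
    \<lparr>carrier = carrier (free_Abelian_group (carrier M \<times> carrier S)),
     monoid.mult = undefined, one = undefined, ring.zero = 0, ring.add = (+),
     smult = (\<lambda>t. frag_extend (\<lambda>(m, s). frag_of (m, s \<otimes>\<^bsub>S\<^esub> t)))\<rparr>"

definition tensor_relations ::
    "('a, 'r) ring_scheme \<Rightarrow> ('b, 's) ring_scheme \<Rightarrow> ('a \<Rightarrow> 'b) \<Rightarrow> ('a, 'm) module
      \<Rightarrow> ('m \<times> 'b \<Rightarrow>\<^sub>0 int) set" where
  "tensor_relations R S \<rho> M =
    {frag_of (x \<oplus>\<^bsub>M\<^esub> y, s) - frag_of (x, s) - frag_of (y, s) | x y s.
       x \<in> carrier M \<and> y \<in> carrier M \<and> s \<in> carrier S} \<union>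
    {frag_of (x, s \<oplus>\<^bsub>S\<^esub> t) - frag_of (x, s) - frag_of (x, t) | x s t.
       x \<in> carrier M \<and> s \<in> carrier S \<and> t \<in> carrier S} \<union>
    {frag_of (r \<odot>\<^bsub>M\<^esub> x, s) - frag_of (x, \<rho> r \<otimes>\<^bsub>S\<^esub> s) | x r s.
       x \<in> carrier M \<and> r \<in> carrier R \<and> s \<in> carrier S}"

definition tensor_kernel ::
    "('a, 'r) ring_scheme \<Rightarrow> ('b, 's) ring_scheme \<Rightarrow> ('a \<Rightarrow> 'b) \<Rightarrow> ('a, 'm) module
      \<Rightarrow> ('m \<times> 'b \<Rightarrow>\<^sub>0 int) set" where
  "tensor_kernel R S \<rho> M =
    generate (free_Abelian_group (carrier M \<times> carrier S)) (tensor_relations R S \<rho> M)"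

definition base_change ::
    "('a, 'r) ring_scheme \<Rightarrow> ('b, 's) ring_scheme \<Rightarrow> ('a \<Rightarrow> 'b) \<Rightarrow> ('a, 'm) module
      \<Rightarrow> ('b, ('m \<times> 'b \<Rightarrow>\<^sub>0 int) set) module" where
  "base_change R S \<rho> M = quotient_module (tensor_free M S) (tensor_kernel R S \<rho> M)"

definition base_change_map ::
    "('a, 'r) ring_scheme \<Rightarrow> ('b, 's) ring_scheme \<Rightarrow> ('a \<Rightarrow> 'b)
      \<Rightarrow> ('a, 'm) module \<Rightarrow> ('a, 'n) module \<Rightarrow> ('m \<Rightarrow> 'n)
      \<Rightarrow> ('m \<times> 'b \<Rightarrow>\<^sub>0 int) set \<Rightarrow> ('n \<times> 'b \<Rightarrow>\<^sub>0 int) set" where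
  "base_change_map R S \<rho> M N f =
    (\<lambda>C\<in>carrier (base_change R S \<rho> M).
       \<Union>c\<in>C. tensor_kernel R S \<rho> N +>\<^bsub>tensor_free N S\<^esub>
         frag_extend (\<lambda>(m, s). frag_of (f m, s)) c)"

definition base_change_K ::
    "('a, 'r) ring_scheme \<Rightarrow> ('b, 's) ring_scheme \<Rightarrow> ('a \<Rightarrow> 'b) \<Rightarrow> ('a, 'm) two_term
      \<Rightarrow> ('b, ('m \<times> 'b \<Rightarrow>\<^sub>0 int) set) two_term" where
  "base_change_K R S \<rho> X =
    \<lparr>tm1 = base_change R S \<rho> (tm1 X), t0 = base_change R S \<rho> (t0 X),
     tdiff = base_change_map R S \<rho> (tm1 X) (t0 X) (tdiff X)\<rparr>"

definition quot_K ::
    "(complex, 'a) module \<Rightarrow> 'a set \<Rightarrow> ('a, 'm) two_term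
      \<Rightarrow> ('a set, ('m \<times> 'a set \<Rightarrow>\<^sub>0 int) set) two_term" where
  "quot_K \<Lambda> J = base_change_K \<Lambda> (quotient_algebra \<Lambda> J) (\<lambda>x. J +>\<^bsub>\<Lambda>\<^esub> x)"


section \<open>Euler characteristics of submodule Grassmannians\<close>

definition abelian_rank :: "('g, 'r) monoid_scheme \<Rightarrow> nat" where
  "abelian_rank G = Sup {card S | S. finite S \<and> S \<subseteq> carrier G \<and>
     (\<forall>n :: 'g \<Rightarrow> int. (\<Otimes>\<^bsub>G\<^esub>x\<in>S. x [^]\<^bsub>G\<^esub> n x) = \<one>\<^bsub>G\<^esub> \<longrightarrow> (\<forall>x\<in>S. n x = 0))}"

text \<open>Only used for projective varieties, whose singular homology is finitely generated and
  vanishes in almost all degrees, so that the sum below is finite.\<close>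

definition euler_char :: "'x topology \<Rightarrow> int" where
  "euler_char X = (\<Sum>p | abelian_rank (homology_group (int p) X) \<noteq> 0.
     (- 1) ^ p * int (abelian_rank (homology_group (int p) X)))"

definition subspaces_of_dim :: "(complex, 'v) module \<Rightarrow> nat \<Rightarrow> 'v set set" where
  "subspaces_of_dim V k = {W. VectorSpace.subspace CC W V \<and> cdim (V\<lparr>carrier := W\<rparr>) = k}"

definition row_span ::
    "(complex, 'v) module \<Rightarrow> nat \<Rightarrow> 'v list \<Rightarrow> (nat \<Rightarrow> nat \<Rightarrow> complex) \<Rightarrow> 'v set" where
  "row_span V k vs c = LinearCombinations.module.span CC V
     ((\<lambda>i. \<Oplus>\<^bsub>V\<^esub>j\<in>{..<length vs}. c i j \<odot>\<^bsub>V\<^esub> vs ! j) ` {..<k})"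

text \<open>The complex (analytic) topology on the Grassmannian of a finite-dimensional space: the
  quotient topology from the space of \<open>k\<close>-frames. Frames are given by the rows of a matrix
  \<open>c\<close> of coordinates with respect to vectors \<open>vs\<close>; letting \<open>vs\<close> range over all finite lists
  rather than one basis avoids a choice and gives the same topology. Matrices whose rows are
  dependent are excluded automatically, as the members of \<open>U\<close> have dimension \<open>k\<close>.\<close>

definition grassmannian :: "(complex, 'v) module \<Rightarrow> nat \<Rightarrow> 'v set topology" where
  "grassmannian V k = topology (\<lambda>U. U \<subseteq> subspaces_of_dim V k \<and>
     (\<forall>vs. set vs \<subseteq> carrier V \<longrightarrow> open {c. row_span V k vs c \<in> U}))"

lemma openin_grassmannian:
  "openin (grassmannian V k) U \<longleftrightarrow> U \<subseteq> subspaces_of_dim V k \<and>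
     (\<forall>vs. set vs \<subseteq> carrier V \<longrightarrow> open {c. row_span V k vs c \<in> U})"
proof -
  have "istopology (\<lambda>U. U \<subseteq> subspaces_of_dim V k \<and>
     (\<forall>vs. set vs \<subseteq> carrier V \<longrightarrow> open {c. row_span V k vs c \<in> U}))"
    unfolding istopology_def
  proof (intro conjI allI impI)
    fix S T vs
    assume "S \<subseteq> subspaces_of_dim V k \<and>
        (\<forall>vs. set vs \<subseteq> carrier V \<longrightarrow> open {c. row_span V k vs c \<in> S})"
      and "T \<subseteq> subspaces_of_dim V k \<and>
        (\<forall>vs. set vs \<subseteq> carrier V \<longrightarrow> open {c. row_span V k vs c \<in> T})"
      and "set vs \<subseteq> carrier V"
    then show "open {c. row_span V k vs c \<in> S \<inter> T}"
      using open_Int[of "{c. row_span V k vs c \<in> S}" "{c. row_span V k vs c \<in> T}"]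
      by (simp add: Collect_conj_eq)
  next
    fix \<K> vs
    assume "\<forall>K\<in>\<K>. K \<subseteq> subspaces_of_dim V k \<and>
        (\<forall>vs. set vs \<subseteq> carrier V \<longrightarrow> open {c. row_span V k vs c \<in> K})"
      and "set vs \<subseteq> carrier V"
    then have "open (\<Union>K\<in>\<K>. {c. row_span V k vs c \<in> K})"
      by (intro open_UN) blast
    then show "open {c. row_span V k vs c \<in> \<Union>\<K>}"
      by (simp add: UN_iff Collect_bex_eq[symmetric] Bex_def Union_eq)
  qed auto
  then show ?thesis
    by (simp add: grassmannian_def)
qed

definition dim_vector ::
    "(complex, 'a) module \<Rightarrow> 'a list \<Rightarrow> ('a, 'm) module \<Rightarrow> 'm set \<Rightarrow> nat \<Rightarrow> nat" where
  "dim_vector \<Lambda> es M N =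
    (\<lambda>i\<in>{..<length es}. cdim ((cspace \<Lambda> M)\<lparr>carrier := (\<lambda>x. es ! i \<odot>\<^bsub>M\<^esub> x) ` N\<rparr>))"

definition submodules_of_dim ::
    "(complex, 'a) module \<Rightarrow> 'a list \<Rightarrow> ('a, 'm) module \<Rightarrow> (nat \<Rightarrow> nat) \<Rightarrow> 'm set set" where
  "submodules_of_dim \<Lambda> es M d = {N. right_submodule \<Lambda> M N \<and> dim_vector \<Lambda> es M N = d}"

definition Gr ::
    "(complex, 'a) module \<Rightarrow> 'a list \<Rightarrow> ('a, 'm) module \<Rightarrow> (nat \<Rightarrow> nat) \<Rightarrow> 'm set topology" where
  "Gr \<Lambda> es M d =
    subtopology (grassmannian (cspace \<Lambda> M) (\<Sum>i<length es. d i)) (submodules_of_dim \<Lambda> es M d)"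


section \<open>The ring of a finite-dimensional algebra\<close>

type_synonym 'v cpoly = "('v \<Rightarrow>\<^sub>0 nat) \<Rightarrow>\<^sub>0 complex"

definition poly_const :: "complex \<Rightarrow> 'v cpoly" where
  "poly_const c = Poly_Mapping.single 0 c"

definition poly_var :: "'v \<Rightarrow> 'v cpoly" where
  "poly_var v = Poly_Mapping.single (Poly_Mapping.single v 1) 1"

definition poly_ring :: "'v set \<Rightarrow> 'v cpoly ring" where
  "poly_ring I =
    \<lparr>carrier = {p. \<forall>m\<in>Poly_Mapping.keys p. Poly_Mapping.keys m \<subseteq> I},
     monoid.mult = (*), one = 1, ring.zero = 0, ring.add = (+)\<rparr>"

text \<open>The sum ranges over the finitely many dimension vectors with nonempty Grassmannian,
  since the Euler characteristic of the empty space is 0; for these the exponents are nonnegative, so the conversion to \<^typ>\<open>nat\<close> loses nothing.\<close>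

definition F_hat ::
    "(complex, 'a) module \<Rightarrow> 'a list \<Rightarrow> ('a, 'm) module \<Rightarrow> 'a K_class cpoly" where
  "F_hat \<Lambda> es M =
    (\<Sum>d | submodules_of_dim \<Lambda> es M d \<noteq> {}.
       of_int (euler_char (Gr \<Lambda> es M d)) *
       (\<Prod>V\<in>ind_K \<Lambda>. poly_var V ^
          nat (int (hom_dim \<Lambda> (H0 (K_rep V)) M)
               - (\<Sum>i<length es. g_vector \<Lambda> es (K_rep V) i * int (d i)))))"

definition R_ideal :: "(complex, 'a) module \<Rightarrow> 'a list \<Rightarrow> 'a K_class cpoly set" where
  "R_ideal \<Lambda> es = Idl\<^bsub>poly_ring (ind_K \<Lambda>)\<^esub>
     {F_hat \<Lambda> es (H0 (K_rep X)) - 1 | X. X \<in> ind_K \<Lambda>}"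

definition R_tilde :: "(complex, 'a) module \<Rightarrow> 'a list \<Rightarrow> 'a K_class cpoly set ring" where
  "R_tilde \<Lambda> es = poly_ring (ind_K \<Lambda>) Quot R_ideal \<Lambda> es"

definition R_class ::
    "(complex, 'a) module \<Rightarrow> 'a list \<Rightarrow> 'a K_class cpoly \<Rightarrow> 'a K_class cpoly set" where
  "R_class \<Lambda> es p = R_ideal \<Lambda> es +>\<^bsub>poly_ring (ind_K \<Lambda>)\<^esub> p"

abbreviation R_var ::
    "(complex, 'a) module \<Rightarrow> 'a list \<Rightarrow> 'a K_class \<Rightarrow> 'a K_class cpoly set" where
  "R_var \<Lambda> es V \<equiv> R_class \<Lambda> es (poly_var V)"

abbreviation R_const ::
    "(complex, 'a) module \<Rightarrow> 'a list \<Rightarrow> complex \<Rightarrow> 'a K_class cpoly set" where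
  "R_const \<Lambda> es c \<equiv> R_class \<Lambda> es (poly_const c)"

end

theory Submission
  imports Defs
begin

text \<open>
Restriction of scalars along $\Lambda \to A$ does not change the submodule Grassmannians, and tensoring
gives $\mathrm{Hom}_\Lambda(H^0 V, M) \cong \mathrm{Hom}_A(H^0(\pi V), M)$ and $g(\pi V) = \overline{g(V)}$ for an
$A$-module $M$. By the Krull--Schmidt decomposition of $\pi V$, both terms of the exponent are additive, so
substituting $\prod_N u_N^{[\pi N:\overline M]}$ for $\overline u_{\overline M}$ in $\widehat F_M$ over $A$ yields
$\widehat F_M$ over $\Lambda$. For $X$ indecomposable, $H^0 X$ is zero or indecomposable, so a minimal
projective presentation over $\Lambda$ exhibits it as $H^0 Z$ with $Z$ indecomposable; hence the relation
$\widehat F_X - 1$ is sent into the ideal of relations over $\Lambda$.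
\<close>

text \<open>The list \<open>fs\<close> is any complete set of primitive idempotents of A, not the
  image of \<open>es\<close>, so dimension vectors over A and over the big algebra are indexed by
  unrelated sets and g-vectors cannot be compared entry by entry. The way out is to eliminate both:
  for a submodule N of dimension vector d the pairing of g(X) with d equals hom(X^0, N) - hom(X^-1,
  N) (\<open>chi\<close>), so an exponent is built from Hom dimensions alone (\<open>expo\<close>).
  These are invariant under homotopy equivalence, additive, and pass through extension of scalars by
  adjunction.

  The tensor product enters only through the predicate \<open>BC\<close>, which says that Q is P/PJ.
  The same predicate covers direct sums, idempotent projectives and cokernels, and it allows
  projectives and complexes over A to be lifted.

  Indecomposability is a homotopy notion, whereas the arguments run on chain endomorphisms that are
  nilpotent or bijective (Fitting). Every class of indecomposables has a member with this property,
  and the property descends to H^0, where it permits summands to be exchanged as in the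
  Krull-Schmidt theorem.\<close>

locale fd_algebra = fd_complex_algebra R for R :: "(complex, 'a) module" (structure)

abbreviation (input) car where "car \<equiv> carrier"

abbreviation (input) zero_sub ("\<zero>\<^sub>_" [1000] 1000) where "\<zero>\<^sub>M \<equiv> \<zero>\<^bsub>M\<^esub>"
abbreviation (input) one_sub ("\<one>\<^sub>_" [1000] 1000) where "\<one>\<^sub>M \<equiv> \<one>\<^bsub>M\<^esub>"
abbreviation (input) oplus_sub ("(_ \<oplus>\<^sub>_ _)" [65, 1000, 66] 65) where "x \<oplus>\<^sub>M y \<equiv> x \<oplus>\<^bsub>M\<^esub> y"
abbreviation (input) ominus_sub ("(_ \<ominus>\<^sub>_ _)" [65, 1000, 66] 65) where "x \<ominus>\<^sub>M y \<equiv> x \<ominus>\<^bsub>M\<^esub> y"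
abbreviation (input) uminus_sub ("(\<ominus>\<^sub>_ _)" [1000, 81] 80) where "\<ominus>\<^sub>M x \<equiv> \<ominus>\<^bsub>M\<^esub> x"
abbreviation (input) odot_sub ("(_ \<odot>\<^sub>_ _)" [70, 1000, 71] 70) where "a \<odot>\<^sub>M x \<equiv> a \<odot>\<^bsub>M\<^esub> x"
abbreviation (input) otimes_sub ("(_ \<otimes>\<^sub>_ _)" [70, 1000, 71] 70) where "x \<otimes>\<^sub>M y \<equiv> x \<otimes>\<^bsub>M\<^esub> y"

section \<open>Linear algebra: dimension bounds, extensions and products\<close>

lemma linear_mapI:
 assumes "vectorspace K V" "vectorspace K W"
  and "\<And>x. x \<in> car V ==> T x \<in> car W"
  and "\<And>x y. x \<in> car V ==> y \<in> car V ==> T (x \<oplus>\<^sub>V y) = T x \<oplus>\<^sub>W T y"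
  and "\<And>c x. c \<in> car K ==> x \<in> car V ==> T (c \<odot>\<^sub>V x) = c \<odot>\<^sub>W T x"
 shows "linear_map K V W T" using assms
 unfolding linear_map_def mod_hom_def mod_hom_axioms_def vectorspace_def module_hom_def by blast

context linear_map
begin

lemma lin_indpt_inj_image:
 assumes inj: "inj_on T (car V)" and B: "finite B" "B \<subseteq> car V" "V.module.lin_indpt B"
 shows "W.module.lin_indpt (T ` B)"
proof (rule W.module.finite_lin_indpt2)
 show "finite (T ` B)" "T ` B \<subseteq> car W" using B by auto
 fix a assume a: "a \<in> T ` B \<rightarrow> car K" and lc: "W.module.lincomb a (T ` B) = \<zero>\<^sub>W"
 have aT: "a \<circ> T \<in> B \<rightarrow> car K" using a by auto
 have "T (V.module.lincomb (a \<circ> T) B) = T \<zero>\<^sub>V"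
  using lincomb_linear_image[OF inj B(2) a B(1)] lc by simp
 hence "V.module.lincomb (a \<circ> T) B = \<zero>\<^sub>V"
  using inj_onD[OF inj] V.module.lincomb_closed[OF B(2) aT] V.module.M.zero_closed by blast
 hence "a \<circ> T \<in> B \<rightarrow> {\<zero>\<^sub>K}"
  using V.not_lindepD[OF B(3) B(1) order_refl aT] by blast
 thus "\<forall>v\<in>T ` B. a v = \<zero>\<^sub>K" by auto
qed

text \<open>An independent set of V has an independent image, so its size is at most
  \<open>W.dim\<close>. A maximal independent set therefore exists; it is a basis of V.\<close>

lemma inj_fin_dim:
 assumes inj: "inj_on T (car V)" and fd: "W.fin_dim"
 shows "V.fin_dim" and "V.dim \<le> W.dim"
proof -
 have bound: "card A \<le> W.dim" if "finite A" "A \<subseteq> car V" "V.module.lin_indpt A" for A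
 proof -
  have "T ` A \<subseteq> car W" using that by auto
  hence "card (T ` A) \<le> W.dim"
   using W.li_le_dim(2)[OF fd _ lin_indpt_inj_image[OF inj that]] by blast
  thus ?thesis using card_image[OF inj_on_subset[OF inj that(2)]] by simp
 qed
 have fin: "finite A \<and> card A \<le> W.dim" if A: "A \<subseteq> car V \<and> V.module.lin_indpt A" for A
 proof -
  have "finite A"
  proof (rule ccontr)
   assume "infinite A"
   then obtain B where "B \<subseteq> A" "finite B" "card B = Suc W.dim"
    by (meson infinite_arbitrarily_large)
   with A bound[of B] V.module.subset_li_is_li[of A B] show False by auto
  qed
  thus ?thesis using bound A by blast
 qed
 have "V.module.lin_indpt {}" unfolding V.module.lin_dep_def by auto
 hence "\<exists>A. finite A \<and> maximal A (\<lambda>S. S \<subseteq> car V \<and> V.module.lin_indpt S)"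
  by (intro maximal_exists[where B = "{}", OF fin]) auto
 then obtain A where A: "finite A" "V.basis A" using V.max_li_is_basis by blast
 thus "V.fin_dim" unfolding V.fin_dim_def V.basis_def by auto
 show "V.dim \<le> W.dim" using V.dim_basis[OF A] bound[OF A(1)] A(2) unfolding V.basis_def by auto
qed

lemma surj_dim_le:
 assumes "T ` car V = car W" "V.fin_dim"
 shows "W.fin_dim" and "W.dim \<le> V.dim"
proof -
 show "W.fin_dim" using surj_fin_dim assms by blast
 show "W.dim \<le> V.dim" using rank_nullity[OF assms(2)] surj_imp_imT_carrier[OF assms(1)] by auto
qed

lemma bij_dim:
 assumes "bij_betw T (car V) (car W)" "W.fin_dim"
 shows "V.fin_dim" and "V.dim = W.dim"
proof -
 show fd: "V.fin_dim" using inj_fin_dim assms by (auto simp: bij_betw_def)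
 show "V.dim = W.dim" using dim_eq[OF fd] assms by (auto simp: bij_betw_def)
qed

text \<open>Generators of the kernel together with preimages of generators of W generate V: two
  elements with the same image differ by a kernel element.\<close>

lemma fin_dim_extension:
 assumes surj: "T ` car V = car W"
  and fdk: "vectorspace.fin_dim K (V.vs kerT)" and fdw: "W.fin_dim"
 shows "V.fin_dim"
proof -
 interpret ker: vectorspace K "V.vs kerT" using V.subspace_is_vs[OF kerT_is_subspace] .
 obtain A where A: "finite A" "A \<subseteq> kerT" "ker.module.span A = kerT"
  using fdk unfolding ker.fin_dim_def by auto
 obtain C where C: "finite C" "C \<subseteq> car W" "W.module.span C = car W"
  using fdw unfolding W.fin_dim_def by auto
 obtain B where B: "finite B" "B \<subseteq> car V" "T ` B = C"
  using C(1,2) surj by (metis finite_subset_image)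
 have Ak: "A \<subseteq> car V" using A(2) by (auto simp: ker_def)
 let ?U = "V.module.span (A \<union> B)"
 have U: "submodule K ?U V" using V.module.span_is_submodule[of "A \<union> B"] Ak B(2) by auto
 hence Uc: "?U \<subseteq> car V" by (rule submodule.subset)
 have kerU: "kerT \<subseteq> ?U"
 proof -
  have "kerT = V.module.span A"
   using A(2,3) V.module.span_li_not_depend(1)[of A kerT] kerT_is_subspace
   by (simp add: subspace_def)
  thus ?thesis using V.module.span_is_monotone[of A "A \<union> B"] by auto
 qed
 have TU: "submodule K (T ` ?U) W"
 proof -
  note cl = submodule.m_closed[OF U] submodule.smult_closed[OF U]
  show ?thesis unfolding submodule_def
  proof (intro conjI allI impI ballI)
   show "module K W" by (rule W.module.module_axioms)
   show "T ` ?U \<subseteq> car W" using Uc by auto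
   show "\<zero>\<^sub>W \<in> T ` ?U"
    using submodule.zero_closed[OF U] T0_is_0 by (metis imageI)
  next
   fix v w assume "v \<in> T ` ?U" "w \<in> T ` ?U"
   then obtain x y where xy: "x \<in> ?U" "y \<in> ?U" and vw: "v = T x" "w = T y" by blast
   have "v \<oplus>\<^sub>W w = T (x \<oplus>\<^sub>V y)"
    using T_add xy Uc unfolding vw by (metis subsetD)
   thus "v \<oplus>\<^sub>W w \<in> T ` ?U" using cl(1)[OF xy] by blast
  next
   fix c v assume c: "c \<in> car K" and "v \<in> T ` ?U"
   then obtain x where x: "x \<in> ?U" and v: "v = T x" by blast
   have "c \<odot>\<^sub>W v = T (c \<odot>\<^sub>V x)"
    using T_smult c x Uc unfolding v by (metis subsetD)
   thus "c \<odot>\<^sub>W v \<in> T ` ?U" using cl(2)[OF c x] by blast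
  qed
 qed
 have "C \<subseteq> T ` ?U" using B V.module.in_own_span[of "A \<union> B"] Ak by auto
 hence TUW: "car W \<subseteq> T ` ?U" using W.module.span_is_subset[of C "T ` ?U"] TU C(3) by auto
 have "car V \<subseteq> ?U"
 proof
  fix v assume v: "v \<in> car V"
  then obtain u where u: "u \<in> ?U" "T v = T u"
   using TUW T_im by (metis (full_types) imageE subset_iff)
  let ?w = "v \<ominus>\<^sub>V u"
  have uc: "u \<in> car V" using u Uc by auto
  have "?w \<in> kerT" using u uc v by (auto simp: ker_def W.module.M.r_neg a_minus_def)
  hence "?w \<in> ?U" using kerU by auto
  hence "?w \<oplus>\<^sub>V u \<in> ?U" using U u by (simp add: submodule.m_closed)
  moreover have "?w \<oplus>\<^sub>V u = v"
   using uc v by (simp add: a_minus_def V.module.M.a_assoc V.module.M.l_neg)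
  ultimately show "v \<in> ?U" by simp
 qed
 thus ?thesis unfolding V.fin_dim_def using A B Ak Uc by (intro exI[of _ "A \<union> B"]) auto
qed

end

text \<open>The bijection with pairs says that p is onto Y and that q identifies the kernel of p
  with Z; rank-nullity for p then adds the dimensions.\<close>

lemma dim_pair:
 assumes p: "linear_map K V Y p" and q: "linear_map K V Z q"
  and bij: "bij_betw (\<lambda>v. (p v, q v)) (car V) (car Y \<times> car Z)"
  and fdY: "vectorspace.fin_dim K Y" and fdZ: "vectorspace.fin_dim K Z"
 shows "vectorspace.fin_dim K V"
  and "vectorspace.dim K V = vectorspace.dim K Y + vectorspace.dim K Z"
proof -
 interpret p: linear_map K V Y p by (rule p)
 interpret q: linear_map K V Z q by (rule q)
 interpret ker: vectorspace K "p.V.vs p.kerT" using p.V.subspace_is_vs[OF p.kerT_is_subspace] .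
 have surj: "p ` car V = car Y"
 proof
  show "car Y \<subseteq> p ` car V"
  proof
   fix y assume "y \<in> car Y"
   hence "(y, \<zero>\<^sub>Z) \<in> (\<lambda>v. (p v, q v)) ` car V"
    using bij by (simp add: bij_betw_def q.W.module.M.zero_closed)
   thus "y \<in> p ` car V" by auto
  qed
 qed auto
 have kq: "linear_map K (p.V.vs p.kerT) Z q"
  by (rule linear_mapI[OF ker.vectorspace_axioms q.W.vectorspace_axioms])
   (auto simp: p.ker_def q.T_add q.T_smult)
 interpret kq: linear_map K "p.V.vs p.kerT" Z q by (rule kq)
 have "bij_betw q (car (p.V.vs p.kerT)) (car Z)"
 proof (rule bij_betw_imageI)
  show "inj_on q (car (p.V.vs p.kerT))" using bij by (auto simp: bij_betw_def inj_on_def p.ker_def)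
  show "q ` car (p.V.vs p.kerT) = car Z"
  proof
   show "car Z \<subseteq> q ` car (p.V.vs p.kerT)"
   proof
    fix z assume "z \<in> car Z"
    hence "(\<zero>\<^sub>Y, z) \<in> (\<lambda>v. (p v, q v)) ` car V"
     using bij by (simp add: bij_betw_def p.W.module.M.zero_closed)
    thus "z \<in> q ` car (p.V.vs p.kerT)" by (auto simp: p.ker_def)
   qed
  qed (auto simp: p.ker_def)
 qed
 note k = kq.bij_dim[OF this fdZ]
 show fd: "vectorspace.fin_dim K V" by (rule p.fin_dim_extension[OF surj k(1) fdY])
 show "vectorspace.dim K V = vectorspace.dim K Y + vectorspace.dim K Z"
  using p.rank_nullity[OF fd] p.surj_imp_imT_carrier[OF surj] k(2) by simp
qed

section \<open>Right modules, homomorphisms, submodules and quotients\<close>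

definition rlin ::
  "('a, 'r) ring_scheme => ('a, 'm) module => ('a, 'n) module => ('m => 'n) => bool" where
 "rlin R M N f \<longleftrightarrow> f \<in> car M \<rightarrow> car N \<and>
  (\<forall>x\<in>car M. \<forall>y\<in>car M. f (x \<oplus>\<^sub>M y) = f x \<oplus>\<^sub>N f y) \<and>
  (\<forall>a\<in>car R. \<forall>x\<in>car M. f (a \<odot>\<^sub>M x) = a \<odot>\<^sub>N f x)"

text \<open>\<open>rlin\<close> leaves out the extensionality of \<open>rhom\<close>, so that
  composites, sums and \<open>id\<close> are homomorphisms as they stand. The way back is
  \<open>rlin_restrict\<close>.\<close>

lemma rhom_iff: "f \<in> rhom R M N \<longleftrightarrow> rlin R M N f \<and> f \<in> extensional (car M)"
 by (auto simp: rhom_def rlin_def PiE_def)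

lemma rlin_cl: "rlin R M N f ==> x \<in> car M ==> f x \<in> car N"
 and rlin_add: "rlin R M N f ==> x \<in> car M ==> y \<in> car M ==>
  f (x \<oplus>\<^sub>M y) = f x \<oplus>\<^sub>N f y"
 and rlin_act: "rlin R M N f ==> a \<in> car R ==> x \<in> car M ==> f (a \<odot>\<^sub>M x) = a \<odot>\<^sub>N f x"
 by (auto simp: rlin_def)

lemma rlinI:
 assumes "\<And>x. x \<in> car M ==> f x \<in> car N"
  and "\<And>x y. x \<in> car M ==> y \<in> car M ==> f (x \<oplus>\<^sub>M y) = f x \<oplus>\<^sub>N f y"
  and "\<And>a x. a \<in> car R ==> x \<in> car M ==> f (a \<odot>\<^sub>M x) = a \<odot>\<^sub>N f x"
 shows "rlin R M N f" using assms by (auto simp: rlin_def)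

lemma rlin_o: "rlin R M N f ==> rlin R L M g ==> rlin R L N (f \<circ> g)"
 by (auto simp: rlin_def Pi_iff)

lemma rlin_id: "rlin R M M id" by (auto simp: rlin_def)

text \<open>Additive inverses come from the action of minus one, so the zero action is supplied in
  place of an inverse axiom.\<close>

lemma right_moduleI:
 assumes R: "ring R"
  and zero: "\<zero>\<^sub>M \<in> car M"
  and add: "\<And>x y. x \<in> car M ==> y \<in> car M ==> x \<oplus>\<^sub>M y \<in> car M"
  and act: "\<And>a x. a \<in> car R ==> x \<in> car M ==> a \<odot>\<^sub>M x \<in> car M"
  and assoc: "\<And>x y z. x \<in> car M ==> y \<in> car M ==> z \<in> car M ==>
    (x \<oplus>\<^sub>M y) \<oplus>\<^sub>M z = x \<oplus>\<^sub>M (y \<oplus>\<^sub>M z)"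
  and comm: "\<And>x y. x \<in> car M ==> y \<in> car M ==> x \<oplus>\<^sub>M y = y \<oplus>\<^sub>M x"
  and l_zero: "\<And>x. x \<in> car M ==> \<zero>\<^sub>M \<oplus>\<^sub>M x = x"
  and zero_act: "\<And>x. x \<in> car M ==> \<zero>\<^sub>R \<odot>\<^sub>M x = \<zero>\<^sub>M"
  and act_add_scalar: "\<And>a b x. a \<in> car R ==> b \<in> car R ==> x \<in> car M ==>
    (a \<oplus>\<^sub>R b) \<odot>\<^sub>M x = a \<odot>\<^sub>M x \<oplus>\<^sub>M b \<odot>\<^sub>M x"
  and act_add: "\<And>a x y. a \<in> car R ==> x \<in> car M ==> y \<in> car M ==>
    a \<odot>\<^sub>M (x \<oplus>\<^sub>M y) = a \<odot>\<^sub>M x \<oplus>\<^sub>M a \<odot>\<^sub>M y"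
  and act_act: "\<And>a b x. a \<in> car R ==> b \<in> car R ==> x \<in> car M ==>
    (a \<otimes>\<^sub>R b) \<odot>\<^sub>M x = b \<odot>\<^sub>M (a \<odot>\<^sub>M x)"
  and act_one: "\<And>x. x \<in> car M ==> \<one>\<^sub>R \<odot>\<^sub>M x = x"
 shows "right_module R M"
proof -
 interpret R: ring R by (rule R)
 have "abelian_group M"
 proof (rule abelian_groupI)
  fix x assume x: "x \<in> car M"
  have "((\<ominus>\<^bsub>R\<^esub> \<one>\<^sub>R) \<oplus>\<^sub>R \<one>\<^sub>R) \<odot>\<^sub>M x = \<zero>\<^sub>M"
   using x zero_act by (simp add: R.l_neg)
  hence "(\<ominus>\<^bsub>R\<^esub> \<one>\<^sub>R) \<odot>\<^sub>M x \<oplus>\<^sub>M x = \<zero>\<^sub>M"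
   using x by (simp add: act_add_scalar act_one)
  thus "\<exists>y\<in>car M. y \<oplus>\<^sub>M x = \<zero>\<^sub>M"
   using x act[of "\<ominus>\<^sub>R \<one>\<^sub>R" x] by auto
 qed (use assms in auto)
 thus ?thesis unfolding right_module_def right_module_axioms_def using assms by auto
qed

context right_module
begin

lemma zero_act: "x \<in> car M ==> \<zero>\<^sub>R \<odot>\<^sub>M x = \<zero>\<^sub>M"
proof -
 assume x: "x \<in> car M"
 have "\<zero>\<^sub>R \<odot>\<^sub>M x \<oplus>\<^sub>M \<zero>\<^sub>R \<odot>\<^sub>M x = \<zero>\<^sub>R \<odot>\<^sub>M x"
  using act_add_scalar[of "\<zero>\<^sub>R" "\<zero>\<^sub>R" x] x by simp
 thus ?thesis
  using M.add.l_cancel_one[of "\<zero>\<^sub>R \<odot>\<^sub>M x" "\<zero>\<^sub>R \<odot>\<^sub>M x"] x act_closed by simp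
qed

lemma act_zero: "a \<in> car R ==> a \<odot>\<^sub>M \<zero>\<^sub>M = \<zero>\<^sub>M"
 using act_act[of "\<zero>\<^sub>R" a "\<zero>\<^sub>M"] zero_act by simp

lemma minus_one_act: "x \<in> car M ==> (\<ominus>\<^bsub>R\<^esub> \<one>\<^sub>R) \<odot>\<^sub>M x = \<ominus>\<^sub>M x"
proof -
 assume x: "x \<in> car M"
 have "(\<ominus>\<^bsub>R\<^esub> \<one>\<^sub>R) \<odot>\<^sub>M x \<oplus>\<^sub>M x = \<zero>\<^sub>M"
  using act_add_scalar[of "\<ominus>\<^sub>R \<one>\<^sub>R" "\<one>\<^sub>R" x] x by (simp add: R.l_neg zero_act act_one)
 thus ?thesis
  using M.minus_equality[of "(\<ominus>\<^bsub>R\<^esub> \<one>\<^sub>R) \<odot>\<^sub>M x" x] x act_closed by simp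
qed

lemma act_minus: "a \<in> car R ==> x \<in> car M ==> a \<odot>\<^sub>M (\<ominus>\<^bsub>M\<^esub> x) = \<ominus>\<^sub>M (a \<odot>\<^sub>M x)"
 using act_add[of a "\<ominus>\<^sub>M x" x] M.minus_equality[of "a \<odot>\<^sub>M (\<ominus>\<^bsub>M\<^esub> x)" "a \<odot>\<^sub>M x"] act_zero act_closed
 by (simp add: M.l_neg)

lemma submodule_minus:
 assumes N: "right_submodule R M N" and x: "x \<in> N"
 shows "\<ominus>\<^sub>M x \<in> N"
proof -
 have "(\<ominus>\<^bsub>R\<^esub> \<one>\<^sub>R) \<odot>\<^sub>M x \<in> N"
  using N x by (auto simp: right_submodule_def)
 thus ?thesis using N x minus_one_act[of x] by (auto simp: right_submodule_def subset_iff)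
qed

lemma submodule_is_module:
 assumes "right_submodule R M N"
 shows "right_module R (M\<lparr>carrier := N\<rparr>)"
proof -
 have N: "x \<in> N ==> x \<in> car M" for x using assms by (auto simp: right_submodule_def)
 show ?thesis using assms by (intro right_moduleI[OF R.ring_axioms])
   (auto simp: right_submodule_def N M.a_assoc zero_act act_add_scalar act_add
    act_act act_one intro: M.a_comm)
qed

lemma submodule_subgroup:
 assumes "right_submodule R M N"
 shows "abelian_subgroup N M"
proof (rule abelian_subgroupI3[OF _ M.abelian_group_axioms])
 have "subgroup N (add_monoid M)" using assms submodule_minus[OF assms]
  by (intro subgroup.intro) (auto simp: right_submodule_def a_inv_def)
 thus "additive_subgroup N M" by (rule additive_subgroup.intro)
qed

end

lemma rlin_zero:
 assumes "right_module R M" "right_module R N" "rlin R M N f"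
 shows "f \<zero>\<^sub>M = \<zero>\<^sub>N"
proof -
 interpret M: right_module R M by fact
 interpret N: right_module R N by fact
 have "f (\<zero>\<^sub>R \<odot>\<^sub>M \<zero>\<^sub>M) = \<zero>\<^sub>R \<odot>\<^sub>N f \<zero>\<^sub>M"
  by (intro rlin_act[OF assms(3)]) auto
 thus ?thesis by (simp add: M.zero_act N.zero_act rlin_cl[OF assms(3)])
qed

lemma rlin_minus:
 assumes "right_module R M" "right_module R N" "rlin R M N f" "x \<in> car M"
 shows "f (\<ominus>\<^bsub>M\<^esub> x) = \<ominus>\<^sub>N f x"
proof -
 interpret M: right_module R M by fact
 interpret N: right_module R N by fact
 have "f ((\<ominus>\<^bsub>R\<^esub> \<one>\<^sub>R) \<odot>\<^sub>M x) = (\<ominus>\<^bsub>R\<^esub> \<one>\<^sub>R) \<odot>\<^sub>N f x"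
  using assms(4) by (intro rlin_act[OF assms(3)]) auto
 thus ?thesis using assms(4) by (simp add: M.minus_one_act N.minus_one_act rlin_cl[OF assms(3)])
qed

lemma rlin_image_submodule:
 assumes M: "right_module R M" and N: "right_module R N" and f: "rlin R M N f"
 shows "right_submodule R N (f ` car M)"
proof -
 interpret M: right_module R M by fact
 show ?thesis unfolding right_submodule_def
 proof (intro conjI ballI)
  show "f ` car M \<subseteq> car N" using rlin_cl[OF f] by blast
  show "\<zero>\<^sub>N \<in> f ` car M" using rlin_zero[OF M N f] M.M.zero_closed by (metis imageI)
 next
  fix x y assume "x \<in> f ` car M" "y \<in> f ` car M"
  then obtain u v where "u \<in> car M" "v \<in> car M" "x = f u" "y = f v" by blast
  thus "x \<oplus>\<^sub>N y \<in> f ` car M" using rlin_add[OF f, of u v] M.M.add.m_closed[of u v] by (metis imageI)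
 next
  fix a x assume a: "a \<in> car R" and "x \<in> f ` car M"
  then obtain u where "u \<in> car M" "x = f u" by blast
  with a show "a \<odot>\<^sub>N x \<in> f ` car M" using rlin_act[OF f, of a u] M.act_closed[of a u] by (metis imageI)
 qed
qed

lemma rlin_const_zero: "right_module R N ==> rlin R M N (\<lambda>_. \<zero>\<^sub>N)"
proof -
 assume "right_module R N"
 then interpret N: right_module R N .
 show ?thesis by (rule rlinI) (auto simp: N.act_zero)
qed

lemma rlin_plus:
 assumes "right_module R N" "rlin R M N f" "rlin R M N g"
 shows "rlin R M N (\<lambda>x. f x \<oplus>\<^sub>N g x)"
proof -
 interpret N: right_module R N by fact
 show ?thesis using rlin_cl[OF assms(2)] rlin_cl[OF assms(3)]
  by (intro rlinI) (auto simp: rlin_add[OF assms(2)] rlin_add[OF assms(3)] rlin_act[OF assms(2)]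
    rlin_act[OF assms(3)] N.act_add N.M.add.m_ac)
qed

lemma rlin_uminus:
 assumes "right_module R N" "rlin R M N f"
 shows "rlin R M N (\<lambda>x. \<ominus>\<^sub>N f x)"
proof -
 interpret N: right_module R N by fact
 show ?thesis using rlin_cl[OF assms(2)]
  by (intro rlinI) (auto simp: rlin_add[OF assms(2)] rlin_act[OF assms(2)] N.act_minus
    N.M.minus_add)
qed

lemma rlin_restrict:
 assumes "right_module R M" "rlin R M N f"
 shows "restrict f (car M) \<in> rhom R M N"
proof -
 interpret M: right_module R M by fact
 show ?thesis using assms(2) by (auto simp: rhom_iff rlin_def M.act_closed)
qed

text \<open>Transport of structure along a surjection; \<open>\<rho>\<close> is the identity for quotient modules and
 isomorphic copies, and a quotient map of rings for extension of scalars.\<close>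

lemma right_module_image:
 assumes M: "right_module R M" and S: "ring S" and \<rho>: "\<rho> \<in> Ring.ring_hom R S" "\<rho> ` car R = car S"
  and \<eta>: "\<eta> ` car M = car N" and zero: "\<zero>\<^sub>N = \<eta> \<zero>\<^sub>M"
  and add: "\<And>x y. x \<in> car M ==> y \<in> car M ==> \<eta> (x \<oplus>\<^sub>M y) = \<eta> x \<oplus>\<^sub>N \<eta> y"
  and act: "\<And>a x. a \<in> car R ==> x \<in> car M ==> \<eta> (a \<odot>\<^sub>M x) = \<rho> a \<odot>\<^sub>N \<eta> x"
 shows "right_module S N"
proof -
 interpret M: right_module R M by fact
 have inN: "\<exists>x\<in>car M. y = \<eta> x" if "y \<in> car N" for y using that \<eta> by blast
 have inS: "\<exists>a\<in>car R. s = \<rho> a" if "s \<in> car S" for s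
  using that \<rho>(2) by blast
 have cl: "\<eta> x \<in> car N" if "x \<in> car M" for x using that \<eta> by blast
 have \<rho>0: "\<rho> \<zero>\<^sub>R = \<zero>\<^sub>S"
  using ring_hom_zero[OF \<rho>(1) M.R.ring_axioms S] .
 note s = add[symmetric] act[symmetric] ring_hom_add[OF \<rho>(1), symmetric]
  ring_hom_mult[OF \<rho>(1), symmetric]
 show ?thesis
 proof (rule right_moduleI[OF S], goal_cases)
  case 1 show ?case using zero cl by auto
 next
  case (2 x y) thus ?case using cl by (auto dest!: inN simp: s)
 next
  case (3 a x) thus ?case using cl by (auto dest!: inN inS simp: s M.act_closed)
 next
  case (4 x y z) thus ?case by (auto dest!: inN simp: s M.M.a_assoc)
 next
  case (5 x y) thus ?case by (auto dest!: inN simp: s M.M.a_comm)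
 next
  case (6 x) thus ?case by (auto dest!: inN simp: zero s)
 next
  case (7 x) thus ?case by (auto dest!: inN simp: zero s \<rho>0[symmetric] M.zero_act)
 next
  case (8 a b x) thus ?case by (auto dest!: inN inS simp: s M.act_closed M.act_add_scalar)
 next
  case (9 a x y) thus ?case by (auto dest!: inN inS simp: s M.act_closed M.act_add)
 next
  case (10 a b x) thus ?case by (auto dest!: inN inS simp: s M.act_closed M.act_act)
 next
  case (11 x) thus ?case
   by (auto dest!: inN simp: s ring_hom_one[OF \<rho>(1), symmetric] M.act_one)
 qed
qed

lemma (in ring) id_ring_hom: "id \<in> Ring.ring_hom R R" by (auto simp: ring_hom_def)

lemma quotient_module_simps:
 "car (quotient_module M N) = a_rcosets\<^bsub>M\<^esub> N"
 "\<zero>\<^bsub>quotient_module M N\<^esub> = N"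
 "(\<oplus>\<^bsub>quotient_module M N\<^esub>) = set_add M" by (simp_all add: quotient_module_def)

text \<open>Everything is transported along the coset map by \<open>right_module_image\<close>, with
  the identity as ring map.\<close>

lemma quotient_module_facts:
 assumes "right_module R M" "right_submodule R M N"
 shows carrier_quotient_module: "car (quotient_module M N) = (\<lambda>x. N +>\<^bsub>M\<^esub> x) ` car M"
  and quotient_module_rlin: "rlin R M (quotient_module M N) (\<lambda>x. N +>\<^bsub>M\<^esub> x)"
  and quotient_module_zero: "\<zero>\<^bsub>quotient_module M N\<^esub> = N +>\<^bsub>M\<^esub> \<zero>\<^sub>M"
  and quotient_module_is_module: "right_module R (quotient_module M N)"
  and quotient_module_eq_iff: "x \<in> car M ==> y \<in> car M ==>
   N +>\<^bsub>M\<^esub> x = N +>\<^bsub>M\<^esub> y \<longleftrightarrow> x \<ominus>\<^sub>M y \<in> N"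
proof -
 interpret M: right_module R M by fact
 interpret N: abelian_subgroup N M by (rule M.submodule_subgroup[OF assms(2)])
 show c: "car (quotient_module M N) = (\<lambda>x. N +>\<^bsub>M\<^esub> x) ` car M"
  by (auto simp: quotient_module_def A_RCOSETS_def')
 show z: "\<zero>\<^bsub>quotient_module M N\<^esub> = N +>\<^bsub>M\<^esub> \<zero>\<^sub>M"
  using N.a_subset by (simp add: quotient_module_def)
 show eq: "N +>\<^bsub>M\<^esub> x = N +>\<^bsub>M\<^esub> y \<longleftrightarrow> x \<ominus>\<^sub>M y \<in> N" if "x \<in> car M" "y \<in> car M" for x y
  using N.a_rcos_module[OF that(2,1)] N.a_rcos_self[OF that(1)]
   N.a_repr_independence'[OF _ that(2), of x] unfolding a_minus_def by metis
 have ad: "N +>\<^bsub>M\<^esub> (x \<oplus>\<^sub>M y) = (N +>\<^bsub>M\<^esub> x) \<oplus>\<^bsub>quotient_module M N\<^esub> (N +>\<^bsub>M\<^esub> y)"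
  if "x \<in> car M" "y \<in> car M" for x y
  using that by (simp add: quotient_module_def N.a_rcos_sum)
 have ac: "N +>\<^bsub>M\<^esub> (a \<odot>\<^sub>M x) = a \<odot>\<^bsub>quotient_module M N\<^esub> (N +>\<^bsub>M\<^esub> x)"
  if a: "a \<in> car R" and x: "x \<in> car M" for a x
 proof -
  \<comment> \<open>The action on a coset is defined as a union over all its members; it is a single
    coset because members differ by an element of N and N absorbs the action.\<close>
  have "N +>\<^bsub>M\<^esub> (a \<odot>\<^sub>M y) = N +>\<^bsub>M\<^esub> (a \<odot>\<^sub>M x)" if y: "y \<in> N +>\<^bsub>M\<^esub> x" for y
  proof -
   have yc: "y \<in> car M" using y x N.a_elemrcos_carrier by blast
   obtain n where n: "n \<in> N" "y = n \<oplus>\<^sub>M x"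
    using y by (auto simp: a_r_coset_def')
   have nc: "n \<in> car M" using n N.a_subset by auto
   have "a \<odot>\<^sub>M y \<ominus>\<^sub>M a \<odot>\<^sub>M x = a \<odot>\<^sub>M n"
    using M.act_closed[OF a x] M.act_closed[OF a nc] a x nc n(2)
    by (simp add: M.act_add M.M.a_assoc a_minus_def M.M.r_neg)
   also have "\<dots> \<in> N" using assms(2) n a by (auto simp: right_submodule_def)
   finally show ?thesis using eq[OF M.act_closed[OF a yc] M.act_closed[OF a x]] by simp
  qed
  hence "(\<Union>y\<in>N +>\<^bsub>M\<^esub> x. N +>\<^bsub>M\<^esub> (a \<odot>\<^sub>M y)) = N +>\<^bsub>M\<^esub> (a \<odot>\<^sub>M x)"
   using N.a_rcos_self[OF x] by blast
  thus ?thesis by (simp add: quotient_module_def)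
 qed
 show "rlin R M (quotient_module M N) (\<lambda>x. N +>\<^bsub>M\<^esub> x)"
  using c by (intro rlinI ad ac) auto
 show "right_module R (quotient_module M N)"
 proof (rule right_module_image[OF assms(1) M.R.ring_axioms M.R.id_ring_hom])
  show "(\<lambda>x. N +>\<^bsub>M\<^esub> x) ` car M = car (quotient_module M N)"
   by (rule c[symmetric])
 qed (simp_all only: id_apply image_id ad ac z)
qed

context linear_map
begin

text \<open>Replacing W by the image of T makes T surjective, so \<open>fin_dim_extension\<close>
  applies.\<close>

lemma fin_dim_of_ker:
 assumes fdk: "vectorspace.fin_dim K (V.vs kerT)" and fdw: "W.fin_dim"
 shows "V.fin_dim"
proof -
 interpret im: vectorspace K "W.vs imT" using W.subspace_is_vs[OF imT_is_subspace] .
 have sub: "imT \<subseteq> car W" by (auto simp: im_def)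
 have "linear_map K (W.vs imT) W id"
  using sub by (intro linear_mapI) (auto simp: im.vectorspace_axioms W.vectorspace_axioms)
 hence fdi: "im.fin_dim" by (rule linear_map.inj_fin_dim(1)) (auto simp: fdw)
 have T': "linear_map K V (W.vs imT) T"
  by (rule linear_mapI[OF V.vectorspace_axioms im.vectorspace_axioms]) (auto simp: im_def)
 interpret T': linear_map K V "W.vs imT" T by (rule T')
 show ?thesis by (rule T'.fin_dim_extension)
   (use fdi fdk in \<open>simp_all add: T'.ker_def ker_def\<close>, simp add: im_def)
qed

end

section \<open>Complex structure on modules and spaces of homomorphisms\<close>

context fd_algebra
begin

definition sc :: "complex => 'a" where
 "sc c = c \<odot> \<one>"

lemma sc_closed [simp]: "sc c \<in> car R" using cvs.smult_closed[of c \<one>] by (simp add: sc_def)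

lemma sc_add: "sc (c + d) = sc c \<oplus> sc d"
 using cvs.smult_l_distr[of c d \<one>] by (simp add: sc_def)

lemma sc_mult_left: "x \<in> car R ==> sc c \<otimes> x = c \<odot> x"
 by (simp add: sc_def smult_mult_left)

lemma sc_comm: "x \<in> car R ==> sc c \<otimes> x = x \<otimes> sc c"
 by (simp add: sc_def smult_mult_left smult_mult_right)

lemma sc_mult: "sc (c * d) = sc c \<otimes> sc d"
 using cvs.smult_assoc1[of c d \<one>] by (simp add: sc_mult_left) (simp add: sc_def)

lemma sc_one: "sc 1 = \<one>" using cvs.smult_one[of \<one>] by (simp add: sc_def)

lemma cspace_simps [simp]:
 "car (cspace R M) = car M" "\<zero>\<^bsub>cspace R M\<^esub> = \<zero>\<^sub>M"
 "(\<oplus>\<^bsub>cspace R M\<^esub>) = (\<oplus>\<^bsub>M\<^esub>)" "c \<odot>\<^bsub>cspace R M\<^esub> x = sc c \<odot>\<^sub>M x"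
 by (simp_all add: cspace_def sc_def)

lemma hom_space_simps:
 "car (hom_space R M N) = rhom R M N"
 "\<zero>\<^bsub>hom_space R M N\<^esub> = (\<lambda>x\<in>car M. \<zero>\<^sub>N)"
 "f \<oplus>\<^bsub>hom_space R M N\<^esub> g = (\<lambda>x\<in>car M. f x \<oplus>\<^sub>N g x)"
 "c \<odot>\<^bsub>hom_space R M N\<^esub> f = (\<lambda>x\<in>car M. sc c \<odot>\<^sub>N f x)"
 by (simp_all add: hom_space_def sc_def)

lemma cspace_vs:
 assumes "right_module R M"
 shows "vectorspace CC (cspace R M)"
proof -
 interpret M: right_module R M by fact
 show ?thesis by (rule vs_criteria[OF class_field])
   (auto simp: M.M.a_assoc M.act_closed sc_add sc_one M.act_one
    M.act_add_scalar M.act_add M.act_act[symmetric] sc_mult[symmetric] mult.commute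
    intro: bexI[OF _ M.M.a_inv_closed] M.M.r_neg M.M.a_comm)
qed

lemma rlin_linear_map:
 assumes "right_module R M" "right_module R N" "rlin R M N f"
 shows "linear_map CC (cspace R M) (cspace R N) f"
 using assms by (intro linear_mapI cspace_vs) (auto simp: rlin_def)

text \<open>The elements \<open>sc c\<close> are central (\<open>sc_comm\<close>), hence multiplying
  by a complex scalar commutes with the action of the algebra.\<close>

lemma rlin_scale:
 assumes "right_module R N" "rlin R M N f"
 shows "rlin R M N (\<lambda>x. sc c \<odot>\<^sub>N f x)"
proof -
 interpret N: right_module R N by fact
 show ?thesis using rlin_cl[OF assms(2)]
  by (intro rlinI) (auto simp: rlin_add[OF assms(2)] rlin_act[OF assms(2)] N.act_add
    N.act_closed N.act_act[symmetric] sc_comm)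
qed

lemma hom_space_vs:
 assumes "right_module R M" "right_module R N"
 shows "vectorspace CC (hom_space R M N)"
proof -
 interpret M: right_module R M by fact
 interpret N: right_module R N by fact
 note rr = rlin_restrict[OF assms(1)]
 have cl: "f x \<in> car N" if "f \<in> rhom R M N" "x \<in> car M" for f x
  using that by (auto simp: rhom_iff rlin_cl)
 have ex: "(\<lambda>x\<in>car M. f x) = f" if "f \<in> rhom R M N" for f
  using that by (auto simp: rhom_iff extensional_restrict)
 have lin: "rlin R M N f" if "f \<in> rhom R M N" for f using that by (auto simp: rhom_iff)
 show ?thesis
 proof (rule vs_criteria[OF class_field]; unfold hom_space_simps class_ring_simps; (intro allI ballI impI)?, (elim conjE)?)
  show "(\<lambda>x\<in>car M. \<zero>\<^sub>N) \<in> rhom R M N"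
   by (rule rr[OF rlin_const_zero[OF assms(2)]])
 next
  fix v w assume vw: "v \<in> rhom R M N" "w \<in> rhom R M N"
  show "(\<lambda>x\<in>car M. v x \<oplus>\<^sub>N w x) \<in> rhom R M N"
   by (rule rr[OF rlin_plus[OF assms(2) lin lin]]) (use vw in auto)
  show "(\<lambda>x\<in>car M. v x \<oplus>\<^sub>N w x) = (\<lambda>x\<in>car M. w x \<oplus>\<^sub>N v x)"
   using cl vw by (intro restrict_ext) (auto intro: N.M.a_comm)
  fix a
  show "(\<lambda>x\<in>car M. sc a \<odot>\<^sub>N restrict (\<lambda>x. v x \<oplus>\<^sub>N w x) (car M) x) =
   (\<lambda>x\<in>car M. restrict (\<lambda>x. sc a \<odot>\<^sub>N v x) (car M) x
     \<oplus>\<^sub>N restrict (\<lambda>x. sc a \<odot>\<^sub>N w x) (car M) x)"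
   using cl vw by (intro restrict_ext) (auto simp: N.act_add)
 next
  fix v w u assume vw: "v \<in> rhom R M N" "w \<in> rhom R M N" "u \<in> rhom R M N"
  show "(\<lambda>x\<in>car M. restrict (\<lambda>x. v x \<oplus>\<^sub>N w x) (car M) x \<oplus>\<^sub>N u x) =
   (\<lambda>x\<in>car M. v x \<oplus>\<^sub>N restrict (\<lambda>x. w x \<oplus>\<^sub>N u x) (car M) x)"
   using cl vw by (intro restrict_ext) (auto intro: N.M.a_assoc)
 next
  fix v assume v: "v \<in> rhom R M N"
  show "\<exists>w\<in>rhom R M N. (\<lambda>x\<in>car M. v x \<oplus>\<^sub>N w x) = (\<lambda>x\<in>car M. \<zero>\<^sub>N)"
   by (rule bexI[OF _ rr[OF rlin_uminus[OF assms(2) lin[OF v]]]])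
    (use cl v in \<open>auto intro!: restrict_ext N.M.r_neg\<close>)
  show "(\<lambda>x\<in>car M. v x \<oplus>\<^sub>N restrict (\<lambda>x. \<zero>\<^sub>N) (car M) x) = v"
   by (subst (2) ex[OF v, symmetric]) (use cl v in \<open>auto intro!: restrict_ext\<close>)
  show "(\<lambda>x\<in>car M. sc 1 \<odot>\<^sub>N v x) = v"
   by (subst (2) ex[OF v, symmetric]) (use cl v in \<open>auto intro!: restrict_ext simp: sc_one N.act_one\<close>)
  fix a b
  show "(\<lambda>x\<in>car M. sc a \<odot>\<^sub>N v x) \<in> rhom R M N"
   by (rule rr[OF rlin_scale[OF assms(2) lin[OF v]]])
  show "(\<lambda>x\<in>car M. sc (a * b) \<odot>\<^sub>N v x) =
    (\<lambda>x\<in>car M. sc a \<odot>\<^sub>N restrict (\<lambda>x. sc b \<odot>\<^sub>N v x) (car M) x)"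
   using cl v by (intro restrict_ext) (auto simp: N.act_act[symmetric] sc_mult[symmetric] mult.commute)
  show "(\<lambda>x\<in>car M. sc (a + b) \<odot>\<^sub>N v x) =
    (\<lambda>x\<in>car M. restrict (\<lambda>x. sc a \<odot>\<^sub>N v x) (car M) x
     \<oplus>\<^sub>N restrict (\<lambda>x. sc b \<odot>\<^sub>N v x) (car M) x)"
   using cl v by (intro restrict_ext) (auto simp: sc_add N.act_add_scalar)
 qed
qed

lemma hom_precompose:
 assumes "right_module R L" "right_module R M" "right_module R N" and h: "rlin R L M h"
 shows "linear_map CC (hom_space R M N) (hom_space R L N) (\<lambda>f. restrict (f \<circ> h) (car L))"
proof (rule linear_mapI[OF hom_space_vs[OF assms(2,3)] hom_space_vs[OF assms(1,3)]])
 fix f assume "f \<in> car (hom_space R M N)"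
 thus "restrict (f \<circ> h) (car L) \<in> car (hom_space R L N)"
  using rlin_restrict[OF assms(1) rlin_o[OF _ h]] by (auto simp: hom_space_simps rhom_iff)
qed (use rlin_cl[OF h] in \<open>auto simp: hom_space_simps intro!: restrict_ext\<close>)

lemma hom_postcompose:
 assumes "right_module R L" "right_module R M" "right_module R N" and h: "rlin R M N h"
 shows "linear_map CC (hom_space R L M) (hom_space R L N) (\<lambda>f. restrict (h \<circ> f) (car L))"
proof (rule linear_mapI[OF hom_space_vs[OF assms(1,2)] hom_space_vs[OF assms(1,3)]])
 fix f assume "f \<in> car (hom_space R L M)"
 thus "restrict (h \<circ> f) (car L) \<in> car (hom_space R L N)"
  using rlin_restrict[OF assms(1) rlin_o[OF h]] by (auto simp: hom_space_simps rhom_iff)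
qed (auto simp: hom_space_simps rhom_iff rlin_cl rlin_add[OF h] rlin_act[OF h] intro!: restrict_ext)

lemma hom_evaluation:
 assumes "right_module R M" "right_module R N" and x: "x \<in> car M"
 shows "linear_map CC (hom_space R M N) (cspace R N) (\<lambda>f. f x)"
 by (rule linear_mapI[OF hom_space_vs[OF assms(1,2)] cspace_vs[OF assms(2)]])
  (use x in \<open>auto simp: hom_space_simps rhom_iff rlin_cl\<close>)

end

text \<open>X is the direct sum of Y and Z, witnessed by inclusions j, j' and projections q, q'. The
  relational form lets the three modules have different element types and refers to no particular
  construction of the sum.\<close>

definition mbip :: "('a, 'r) ring_scheme => ('a, 'm) module => ('a, 'n) module => ('a, 'k) module => bool" where
 "mbip R X Y Z \<longleftrightarrow> (\<exists>j q j' q'. rlin R Y X j \<and> rlin R X Y q \<and> rlin R Z X j' \<and> rlin R X Z q' \<and>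
  (\<forall>y\<in>car Y. q (j y) = y \<and> q' (j y) = \<zero>\<^sub>Z) \<and>
  (\<forall>z\<in>car Z. q' (j' z) = z \<and> q (j' z) = \<zero>\<^sub>Y) \<and>
  (\<forall>x\<in>car X. j (q x) \<oplus>\<^sub>X j' (q' x) = x))"

text \<open>This is the universal property of a quotient, phrased by fibres instead of kernels: as f
  is constant on the fibres of the surjection, any choice of preimages defines the same
  homomorphism.\<close>

lemma rlin_factor:
 assumes P: "right_module R P" and \<eta>: "rlin R P C \<eta>" "\<eta> ` car P = car C"
  and f: "rlin R P N f" and eq: "\<And>x y. x \<in> car P ==> y \<in> car P ==> \<eta> x = \<eta> y ==> f x = f y"
 obtains g where "rlin R C N g" "\<And>x. x \<in> car P ==> g (\<eta> x) = f x"
proof -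
 interpret P: right_module R P by fact
 define g where "g c = f (SOME x. x \<in> car P \<and> \<eta> x = c)" for c
 have g: "g (\<eta> x) = f x" if x: "x \<in> car P" for x unfolding g_def
  using someI[of "\<lambda>y. y \<in> car P \<and> \<eta> y = \<eta> x", OF conjI[OF x refl]] eq[OF _ x] by blast
 have "rlin R C N g"
 proof (rule rlinI)
  fix c assume "c \<in> car C"
  then obtain x where x: "x \<in> car P" "c = \<eta> x" using \<eta>(2) by blast
  show "g c \<in> car N" unfolding x(2) g[OF x(1)] by (rule rlin_cl[OF f x(1)])
  fix a assume a: "a \<in> car R"
  show "g (a \<odot>\<^sub>C c) = a \<odot>\<^sub>N g c"
   unfolding x(2) rlin_act[OF \<eta>(1) a x(1), symmetric] g[OF x(1)] g[OF P.act_closed[OF a x(1)]]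
   by (rule rlin_act[OF f a x(1)])
 next
  fix c c' assume "c \<in> car C" "c' \<in> car C"
  then obtain x y where x: "x \<in> car P" "c = \<eta> x" and y: "y \<in> car P" "c' = \<eta> y"
   using \<eta>(2) by blast
  show "g (c \<oplus>\<^sub>C c') = g c \<oplus>\<^sub>N g c'"
   unfolding x(2) y(2) rlin_add[OF \<eta>(1) x(1) y(1), symmetric] g[OF x(1)] g[OF y(1)]
    g[OF P.M.add.m_closed[OF x(1) y(1)]] by (rule rlin_add[OF f x(1) y(1)])
 qed
 with g show thesis by (rule that[rotated])
qed

context fd_algebra
begin

lemma fdD: "fd_right_module R M ==> right_module R M" by (simp add: fd_right_module_def)

lemma fd_surj_image:
 assumes "fd_right_module R M" "right_module R N" "rlin R M N f" "f ` car M = car N"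
 shows "fd_right_module R N"
 using linear_map.surj_dim_le(1)[OF rlin_linear_map[OF fdD assms(2,3)]] assms
 by (auto simp: fd_right_module_def)

lemma fd_inj_domain:
 assumes "right_module R M" "fd_right_module R N" "rlin R M N f" "inj_on f (car M)"
 shows "fd_right_module R M"
 using linear_map.inj_fin_dim(1)[OF rlin_linear_map[OF assms(1) fdD assms(3)]] assms
 by (auto simp: fd_right_module_def)

lemma rlin_submodule_incl: "right_submodule R M N ==> rlin R (M\<lparr>carrier := N\<rparr>) M id"
 by (auto simp: rlin_def right_submodule_def)

lemma fd_submodule:
 assumes "fd_right_module R M" "right_submodule R M N"
 shows "fd_right_module R (M\<lparr>carrier := N\<rparr>)"
proof -
 interpret M: right_module R M by (rule fdD[OF assms(1)])
 show ?thesis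
  by (rule fd_inj_domain[OF M.submodule_is_module[OF assms(2)] assms(1) rlin_submodule_incl[OF assms(2)]]) auto
qed

lemma fd_quotient:
 assumes "fd_right_module R M" "right_submodule R M N"
 shows "fd_right_module R (quotient_module M N)" by (rule fd_surj_image[OF assms(1)])
  (use quotient_module_facts[OF fdD[OF assms(1)] assms(2)] in auto)

text \<open>Evaluate homomorphisms at the vectors of a finite spanning set one after another. Each
  evaluation lands in the finite-dimensional N, and its kernel consists of the maps that vanish at
  one more vector, until only the zero map is left.\<close>

lemma hom_space_fin_dim:
 assumes M: "fd_right_module R M" and N: "fd_right_module R N"
 shows "vectorspace.fin_dim CC (hom_space R M N)"
proof -
 note m = fdD[OF M] fdD[OF N]
 let ?H = "hom_space R M N"
 interpret cM: vectorspace CC "cspace R M" by (rule cspace_vs[OF m(1)])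
 interpret H: vectorspace CC ?H by (rule hom_space_vs[OF m])
 interpret N: right_module R N by (rule m)
 interpret M: right_module R M by (rule m)
 define W where "W B = {f \<in> rhom R M N. \<forall>b\<in>B. f b = \<zero>\<^sub>N}" for B
 have sub: "VectorSpace.subspace CC (W B) ?H" if B: "B \<subseteq> car M" for B
 proof -
  note cl = H.M.add.m_closed H.smult_closed H.M.zero_closed
  have "LinearCombinations.submodule CC (W B) ?H" unfolding submodule_def
  proof (intro conjI allI impI ballI)
   show "module CC ?H" by (rule H.module_axioms)
   show "W B \<subseteq> car ?H" by (auto simp: W_def hom_space_simps)
   show "\<zero>\<^sub>?H \<in> W B"
    using H.M.zero_closed B by (auto simp: W_def hom_space_simps)
  next
   fix v w assume "v \<in> W B" "w \<in> W B"
   thus "v \<oplus>\<^sub>?H w \<in> W B"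
    using H.M.add.m_closed[of v w] B by (auto simp: W_def hom_space_simps)
  next
   fix c v assume "c \<in> car CC" "v \<in> W B"
   thus "c \<odot>\<^sub>?H v \<in> W B"
    using H.smult_closed[of c v] B by (auto simp: W_def hom_space_simps N.act_zero)
  qed
  thus ?thesis using H.vectorspace_axioms by (simp add: VectorSpace.subspace_def)
 qed
 \<comment> \<open>Maps in \<open>W B\<close> already vanish on B, and C lists the vectors still to
   be evaluated. The union of B and C spans throughout, so for empty C the only map left is
   zero.\<close>
 have *: "vectorspace.fin_dim CC (?H\<lparr>carrier := W B\<rparr>)"
  if "finite C" "B \<union> C \<subseteq> car M" "cM.span (B \<union> C) = car M" for B C using that
 proof (induction C arbitrary: B rule: finite_induct)
  case empty
  interpret V: vectorspace CC "?H\<lparr>carrier := W B\<rparr>"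
   using H.subspace_is_vs[OF sub] empty by auto
  have "f = \<zero>\<^sub>?H" if f: "f \<in> W B" for f
  proof -
   have lf: "rlin R M N f" "f \<in> extensional (car M)" "\<And>b. b \<in> B ==> f b = \<zero>\<^sub>N"
    using f by (auto simp: W_def rhom_iff)
   interpret f: linear_map CC "cspace R M" "cspace R N" f by (rule rlin_linear_map[OF m lf(1)])
   have "B \<subseteq> f.kerT" using empty lf by (auto simp: f.ker_def)
   hence "cM.span B \<subseteq> f.kerT"
    using f.kerT_is_subspace by (intro cM.span_is_subset) (auto simp: VectorSpace.subspace_def)
   hence "f x = \<zero>\<^sub>N" if "x \<in> car M" for x
    using empty that by (auto simp: f.ker_def)
   thus ?thesis using lf(2) by (intro extensionalityI[of _ "car M"]) (auto simp: hom_space_simps)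
  qed
  hence "W B = {\<zero>\<^sub>?H}"
   using sub[of B] empty submodule.zero_closed by (auto simp: VectorSpace.subspace_def)
  thus ?case using V.span_empty unfolding V.fin_dim_def by (intro exI[of _ "{}"]) simp
 next
  case (insert c C)
  have c: "c \<in> car M" using insert by auto
  have V: "vectorspace CC (?H\<lparr>carrier := W B\<rparr>)"
   using H.subspace_is_vs[OF sub] insert by auto
  have ev: "linear_map CC (?H\<lparr>carrier := W B\<rparr>) (cspace R N) (\<lambda>f. f c)"
   by (rule linear_mapI[OF V cspace_vs[OF m(2)]])
    (use c in \<open>auto simp: hom_space_simps W_def rhom_iff rlin_cl\<close>)
  interpret ev: linear_map CC "?H\<lparr>carrier := W B\<rparr>" "cspace R N" "\<lambda>f. f c" by (rule ev)
  have k: "ev.kerT = W (insert c B)" unfolding ev.ker_def by (auto simp: W_def)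
  show ?case
  proof (rule ev.fin_dim_of_ker)
   show "vectorspace.fin_dim CC (?H\<lparr>carrier := W B, carrier := ev.kerT\<rparr>)"
    unfolding k using insert.IH[of "insert c B"] insert.prems by simp
   show "vectorspace.fin_dim CC (cspace R N)" using N by (simp add: fd_right_module_def)
  qed
 qed
 obtain C where "finite C" "C \<subseteq> car M" "cM.span C = car M"
  using M unfolding fd_right_module_def cM.fin_dim_def by auto
 hence "vectorspace.fin_dim CC (?H\<lparr>carrier := W {}\<rparr>)" using *[of C "{}"] by simp
 moreover have "?H\<lparr>carrier := W {}\<rparr> = ?H" by (simp add: W_def hom_space_def)
 ultimately show ?thesis by simp
qed

text \<open>Precomposition with a surjection is injective on homomorphisms; dually,
  \<open>hom_dim_le_of_inj\<close> uses postcomposition with an injection.\<close>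

lemma hom_dim_le_of_surj:
 assumes Q: "fd_right_module R Q" and P: "right_module R P" and N: "fd_right_module R N"
  and h: "rlin R Q P h" "h ` car Q = car P"
 shows "hom_dim R P N \<le> hom_dim R Q N" unfolding hom_dim_def
proof (rule linear_map.inj_fin_dim(2)[OF hom_precompose[OF fdD[OF Q] P fdD[OF N] h(1)]])
 show "inj_on (\<lambda>f. restrict (f \<circ> h) (car Q)) (car (hom_space R P N))"
 proof (rule inj_onI)
  fix f g assume fg: "f \<in> car (hom_space R P N)" "g \<in> car (hom_space R P N)"
   and eq: "restrict (f \<circ> h) (car Q) = restrict (g \<circ> h) (car Q)"
  have "f y = g y" if y: "y \<in> car P" for y
  proof -
   obtain x where "x \<in> car Q" "y = h x" using h(2) y by blast
   thus ?thesis using fun_cong[OF eq, of x] by simp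
  qed
  thus "f = g"
   using fg by (intro extensionalityI[of _ "car P"]) (auto simp: hom_space_simps rhom_iff)
 qed
qed (rule hom_space_fin_dim[OF Q N])

lemma hom_dim_le_of_inj:
 assumes M: "fd_right_module R M" and N: "right_module R N" and N': "fd_right_module R N'"
  and h: "rlin R N N' h" "inj_on h (car N)"
 shows "hom_dim R M N \<le> hom_dim R M N'" unfolding hom_dim_def
proof (rule linear_map.inj_fin_dim(2)[OF hom_postcompose[OF fdD[OF M] N fdD[OF N'] h(1)]])
 show "inj_on (\<lambda>f. restrict (h \<circ> f) (car M)) (car (hom_space R M N))"
 proof (rule inj_onI)
  fix f g assume fg: "f \<in> car (hom_space R M N)" "g \<in> car (hom_space R M N)"
   and eq: "restrict (h \<circ> f) (car M) = restrict (h \<circ> g) (car M)"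
  have "f y = g y" if "y \<in> car M" for y using fun_cong[OF eq, of y] that fg h(2)
   by (auto simp: hom_space_simps rhom_iff rlin_cl dest: inj_onD)
  thus "f = g"
   using fg by (intro extensionalityI[of _ "car M"]) (auto simp: hom_space_simps rhom_iff)
 qed
qed (rule hom_space_fin_dim[OF M N'])

text \<open>A map out of a direct sum is the same as a pair of maps out of the summands, and
  \<open>dim_pair\<close> turns this bijection into additivity.\<close>

lemma hom_dim_mbip:
 assumes X: "right_module R X" and Y: "fd_right_module R Y" and Z: "fd_right_module R Z"
  and N: "fd_right_module R N" and b: "mbip R X Y Z"
 shows "hom_dim R X N = hom_dim R Y N + hom_dim R Z N"
proof -
 note m = X fdD[OF Y] fdD[OF Z] fdD[OF N]
 interpret N: right_module R N by (rule m(4))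
 obtain j q j' q' where l: "rlin R Y X j" "rlin R X Y q" "rlin R Z X j'" "rlin R X Z q'"
  and e: "\<And>y. y\<in>car Y ==> q (j y) = y" "\<And>y. y\<in>car Y ==> q' (j y) = \<zero>\<^sub>Z"
   "\<And>z. z\<in>car Z ==> q' (j' z) = z" "\<And>z. z\<in>car Z ==> q (j' z) = \<zero>\<^sub>Y"
   "\<And>x. x\<in>car X ==> j (q x) \<oplus>\<^sub>X j' (q' x) = x"
  using b unfolding mbip_def by blast
 show ?thesis unfolding hom_dim_def
 proof (rule dim_pair(2)[OF hom_precompose[OF m(2,1,4) l(1)] hom_precompose[OF m(3,1,4) l(3)]
    _ hom_space_fin_dim[OF Y N] hom_space_fin_dim[OF Z N]], rule bij_betw_imageI)
  let ?T = "\<lambda>v. (restrict (v \<circ> j) (car Y), restrict (v \<circ> j') (car Z))"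
  have dec: "f x = f (j (q x)) \<oplus>\<^sub>N f (j' (q' x))" if "rlin R X N f" "x \<in> car X" for f x
   using rlin_add[OF that(1), of "j (q x)" "j' (q' x)"] e(5)[OF that(2)] that l
   by (auto simp: rlin_cl)
  show "inj_on ?T (car (hom_space R X N))"
  proof (rule inj_onI)
   fix f g assume fg: "f \<in> car (hom_space R X N)" "g \<in> car (hom_space R X N)"
    and eq: "?T f = ?T g"
   have lfg: "rlin R X N f" "rlin R X N g" using fg by (auto simp: hom_space_simps rhom_iff)
   have "f (j y) = g (j y)" if "y \<in> car Y" for y
    using fun_cong[OF conjunct1[OF eq[unfolded prod.inject]], of y] that by simp
   moreover have "f (j' y) = g (j' y)" if "y \<in> car Z" for y
    using fun_cong[OF conjunct2[OF eq[unfolded prod.inject]], of y] that by simp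
   ultimately have "f x = g x" if x: "x \<in> car X" for x
    using dec[OF lfg(1) x] dec[OF lfg(2) x] rlin_cl[OF l(2) x] rlin_cl[OF l(4) x] by simp
   thus "f = g"
    using fg by (intro extensionalityI[of _ "car X"]) (auto simp: hom_space_simps rhom_iff)
  qed
  show "?T ` car (hom_space R X N) = car (hom_space R Y N) \<times> car (hom_space R Z N)"
  proof
   show "?T ` car (hom_space R X N) \<subseteq> car (hom_space R Y N) \<times> car (hom_space R Z N)"
    using rlin_restrict[OF m(2) rlin_o[OF _ l(1)]] rlin_restrict[OF m(3) rlin_o[OF _ l(3)]]
    by (auto simp: hom_space_simps rhom_iff)
   show "car (hom_space R Y N) \<times> car (hom_space R Z N) \<subseteq> ?T ` car (hom_space R X N)"
   proof
    fix p assume "p \<in> car (hom_space R Y N) \<times> car (hom_space R Z N)"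
    then obtain a b where p: "p = (a, b)" and ab: "rlin R Y N a" "rlin R Z N b"
     "a \<in> extensional (car Y)" "b \<in> extensional (car Z)"
     by (auto simp: hom_space_simps rhom_iff)
    define f where "f = restrict (\<lambda>x. (a \<circ> q) x \<oplus>\<^sub>N (b \<circ> q') x) (car X)"
    have f: "f \<in> car (hom_space R X N)" unfolding f_def hom_space_simps
     by (intro rlin_restrict[OF X] rlin_plus[OF m(4)] rlin_o[OF ab(1) l(2)] rlin_o[OF ab(2) l(4)])
    have "restrict (f \<circ> j) (car Y) = a"
     using ab e rlin_cl[OF l(1)] rlin_zero[OF m(3,4) ab(2)] rlin_cl[OF ab(1)]
     by (intro extensionalityI[of _ "car Y"]) (auto simp: f_def)
    moreover have "restrict (f \<circ> j') (car Z) = b"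
     using ab e rlin_cl[OF l(3)] rlin_zero[OF m(2,4) ab(1)] rlin_cl[OF ab(2)]
     by (intro extensionalityI[of _ "car Z"]) (auto simp: f_def)
    ultimately have "p = ?T f" by (simp add: p)
    thus "p \<in> ?T ` car (hom_space R X N)" using f by blast
   qed
  qed
 qed
qed

text \<open>Rank-nullity for precomposition with d: its image lies in Hom(Q, N), and its kernel
  comes from Hom of the cokernel of d. This inequality later makes the exponents
  nonnegative.\<close>

lemma hom_dim_le_coker:
 assumes P: "fd_right_module R P" and Q: "fd_right_module R Q" and N: "fd_right_module R N"
  and d: "rlin R Q P d"
 shows "hom_dim R P N \<le> hom_dim R (quotient_module P (d ` car Q)) N + hom_dim R Q N"
proof -
 note m = fdD[OF P] fdD[OF Q] fdD[OF N]
 interpret P: right_module R P by (rule m)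
 interpret Q: right_module R Q by (rule m)
 interpret N: right_module R N by (rule m)
 let ?I = "d ` car Q" let ?C = "quotient_module P ?I" let ?T = "\<lambda>f. restrict (f \<circ> d) (car Q)"
 have I: "right_submodule R P ?I" by (rule rlin_image_submodule[OF m(2,1) d])
 note qf = quotient_module_facts[OF m(1) I]
 interpret T: linear_map CC "hom_space R P N" "hom_space R Q N" ?T
  by (rule hom_precompose[OF m(2,1,3) d])
 have rn: "cdim (hom_space R P N) = cdim (hom_space R Q N\<lparr>carrier := T.imT\<rparr>) + cdim (hom_space R P N\<lparr>carrier := T.kerT\<rparr>)"
  using T.rank_nullity[OF hom_space_fin_dim[OF P N]] by simp
 have 1: "cdim (hom_space R Q N\<lparr>carrier := T.imT\<rparr>) \<le> cdim (hom_space R Q N)"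
 proof (rule linear_map.inj_fin_dim(2)[OF linear_mapI[where T = id]])
  show "vectorspace CC (hom_space R Q N\<lparr>carrier := T.imT\<rparr>)"
   using T.W.subspace_is_vs[OF T.imT_is_subspace] .
 qed (use T.W.vectorspace_axioms hom_space_fin_dim[OF Q N] T.T_im in \<open>auto simp: T.im_def\<close>)
 \<comment> \<open>A map that vanishes on the image of d factors through the cokernel, so Hom of the
   cokernel maps onto the kernel.\<close>
 have 2: "cdim (hom_space R P N\<lparr>carrier := T.kerT\<rparr>) \<le> cdim (hom_space R ?C N)"
 proof -
  have K: "vectorspace CC (hom_space R P N\<lparr>carrier := T.kerT\<rparr>)"
   using T.V.subspace_is_vs[OF T.kerT_is_subspace] .
  have C: "fd_right_module R ?C" by (rule fd_quotient[OF P I])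
  let ?p = "\<lambda>x. ?I +>\<^bsub>P\<^esub> x"
  let ?U = "\<lambda>f. restrict (f \<circ> ?p) (car P)"
  interpret U: linear_map CC "hom_space R ?C N" "hom_space R P N" ?U
   by (rule hom_precompose[OF m(1) qf(4) m(3) qf(2)])
  have pd: "?p (d y) = \<zero>\<^sub>?C" if "y \<in> car Q" for y
   using qf(5)[of "d y" "\<zero>\<^sub>P"] that rlin_cl[OF d that] P.M.minus_equality[of "\<zero>\<^sub>P" "\<zero>\<^sub>P"]
   by (simp add: qf(3) a_minus_def)
  have Uk: "?U f \<in> T.kerT" if f: "f \<in> car (hom_space R ?C N)" for f
  proof -
   have lf: "rlin R ?C N f" using f by (simp add: hom_space_simps rhom_iff)
   have "?T (?U f) = (\<lambda>x\<in>car Q. \<zero>\<^sub>N)"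
    using rlin_cl[OF d] pd rlin_zero[OF qf(4) m(3) lf] by (intro restrict_ext) simp
   thus ?thesis using U.T_im[OF f] unfolding T.ker_def by (simp add: hom_space_simps)
  qed
  have lin: "linear_map CC (hom_space R ?C N) (hom_space R P N\<lparr>carrier := T.kerT\<rparr>) ?U"
   by (rule linear_mapI[OF U.V.vectorspace_axioms K]) (simp_all add: Uk)
  show ?thesis
  proof (rule linear_map.surj_dim_le(2)[OF lin _ hom_space_fin_dim[OF C N]])
   show "?U ` car (hom_space R ?C N) = car (hom_space R P N\<lparr>carrier := T.kerT\<rparr>)"
   proof
    show "?U ` car (hom_space R ?C N) \<subseteq> car (hom_space R P N\<lparr>carrier := T.kerT\<rparr>)"
     using Uk by auto
    show "car (hom_space R P N\<lparr>carrier := T.kerT\<rparr>) \<subseteq> ?U ` car (hom_space R ?C N)"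
    proof
     fix f assume "f \<in> car (hom_space R P N\<lparr>carrier := T.kerT\<rparr>)"
     hence lf: "rlin R P N f" and fe: "f \<in> extensional (car P)"
      and Tf: "?T f = (\<lambda>x\<in>car Q. \<zero>\<^sub>N)"
      by (auto simp: T.ker_def hom_space_simps rhom_iff)
     have fd: "f (d y) = \<zero>\<^sub>N" if "y \<in> car Q" for y
      using fun_cong[OF Tf, of y] that by simp
     have eq: "f x = f y" if x: "x \<in> car P" and y: "y \<in> car P" and xy: "?p x = ?p y" for x y
     proof -
      obtain z where z: "z \<in> car Q" "x \<ominus>\<^sub>P y = d z"
       using qf(5)[OF x y] xy by auto
      have "x = d z \<oplus>\<^sub>P y"
       unfolding z(2)[symmetric] using x y by (simp add: a_minus_def P.M.a_assoc P.M.l_neg)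
      thus ?thesis using rlin_add[OF lf rlin_cl[OF d z(1)] y] fd[OF z(1)] rlin_cl[OF lf y] by simp
     qed
     obtain g where g: "rlin R ?C N g" "\<And>x. x \<in> car P ==> g (?p x) = f x"
      using rlin_factor[OF m(1) qf(2) qf(1)[symmetric] lf eq] by blast
     have "f = ?U (restrict g (car ?C))"
      using fe g(2) qf(1) by (intro extensionalityI[of _ "car P"]) auto
     moreover have "restrict g (car ?C) \<in> car (hom_space R ?C N)"
      using rlin_restrict[OF qf(4) g(1)] by (simp add: hom_space_simps)
     ultimately show "f \<in> ?U ` car (hom_space R ?C N)" by blast
    qed
   qed
  qed
 qed
 show ?thesis unfolding hom_dim_def using rn 1 2 by linarith
qed

end

lemma rlin_inverse:
 assumes M: "right_module R M" and f: "rlin R M N f" "bij_betw f (car M) (car N)"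
 obtains g where "rlin R N M g" "\<And>x. x \<in> car M ==> g (f x) = x" "\<And>y. y \<in> car N ==> f (g y) = y"
proof -
 have "id x = id y" if "x \<in> car M" "y \<in> car M" "f x = f y" for x y
  using that f(2) by (simp add: bij_betw_def inj_on_def)
 then obtain g where g: "rlin R N M g" "\<And>x. x \<in> car M ==> g (f x) = id x"
  using rlin_factor[OF M f(1) bij_betw_imp_surj_on[OF f(2)] rlin_id] by metis
 moreover have "f (g y) = y" if "y \<in> car N" for y
  using that f(2) g(2) unfolding bij_betw_def by force
 ultimately show thesis using that[of g] by simp
qed

section \<open>Direct sums, free modules and projective modules\<close>

lemma dsum_simps:
 "car (rmod_dsum Ms) = (\<Pi>\<^sub>E j\<in>{..<length Ms}. car (Ms ! j))"
 "\<zero>\<^bsub>rmod_dsum Ms\<^esub> = (\<lambda>j\<in>{..<length Ms}. \<zero>\<^bsub>Ms ! j\<^esub>)"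
 "x \<oplus>\<^bsub>rmod_dsum Ms\<^esub> y = (\<lambda>j\<in>{..<length Ms}. x j \<oplus>\<^bsub>Ms ! j\<^esub> y j)"
 "a \<odot>\<^bsub>rmod_dsum Ms\<^esub> x = (\<lambda>j\<in>{..<length Ms}. a \<odot>\<^bsub>Ms ! j\<^esub> x j)"
 by (simp_all add: rmod_dsum_def)

lemma dsum_cong:
 assumes "x \<in> extensional {..<n}" "y \<in> extensional {..<n}" "\<And>j. j < n ==> x j = y j"
 shows "x = (y :: nat => 'm)" using assms by (intro extensionalityI[of _ "{..<n}"]) auto

lemma dsum_module:
 assumes R: "ring R" and "\<And>M. M \<in> set Ms ==> right_module R M"
 shows "right_module R (rmod_dsum Ms)"
proof -
 have m: "right_module R (Ms ! j)" if "j < length Ms" for j using assms(2) that by simp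
 note ag = right_module.axioms(2)[OF m]
 note am = abelian_group.axioms(1)[OF ag]
 note cl = abelian_monoid.a_closed[OF am] right_module.act_closed[OF m] abelian_monoid.zero_closed[OF am]
 note laws = abelian_monoid.a_assoc[OF am] abelian_monoid.l_zero[OF am] right_module.zero_act[OF m]
  right_module.act_add_scalar[OF m] right_module.act_add[OF m] right_module.act_act[OF m]
  right_module.act_one[OF m]
 have ext: "x \<in> extensional {..<length Ms}" and mem: "j < length Ms ==> x j \<in> car (Ms ! j)"
  if "x \<in> car (rmod_dsum Ms)" for x j using that by (auto simp: dsum_simps PiE_def)
 show ?thesis
 proof (rule right_moduleI[OF R], goal_cases)
  case 1 show ?case by (auto simp: dsum_simps cl)
 next case (2 x y) thus ?case by (auto simp: dsum_simps intro!: cl)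
 next case (3 a x) thus ?case by (auto simp: dsum_simps intro!: cl)
 next case (4 x y z) thus ?case by (auto simp: dsum_simps(3) mem intro!: restrict_ext laws)
 next case (5 x y) thus ?case
   by (auto simp: dsum_simps(3) mem intro!: restrict_ext abelian_monoid.a_comm[OF am])
 next case (6 x) thus ?case
   by (intro dsum_cong[of _ "length Ms"]) (auto simp: dsum_simps(2,3) mem ext laws)
 next case (7 x) thus ?case by (auto simp: dsum_simps(2,4) mem intro!: restrict_ext laws)
 next case (8 a b x) thus ?case by (auto simp: dsum_simps(3,4) mem intro!: restrict_ext laws)
 next case (9 a x y) thus ?case by (auto simp: dsum_simps(3,4) mem intro!: restrict_ext laws)
 next case (10 a b x) thus ?case by (auto simp: dsum_simps(4) mem intro!: restrict_ext laws)
 next case (11 x) thus ?case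
   by (intro dsum_cong[of _ "length Ms"]) (auto simp: dsum_simps(4) mem ext laws)
 qed
qed

text \<open>Cons for families indexed by positions; n is the length of the tail, and the restriction
  keeps the family extensional. With \<open>dtl\<close> it makes recursion along the list of
  summands possible.\<close>

definition dcons :: "nat => 'm => (nat => 'm) => nat => 'm" where
 "dcons n x y = (\<lambda>j\<in>{..<Suc n}. case j of 0 => x | Suc k => y k)"

definition dtl :: "nat => (nat => 'm) => nat => 'm" where
 "dtl n x = (\<lambda>k\<in>{..<n}. x (Suc k))"

lemma dcons_0 [simp]: "dcons n x y 0 = x"
 and dcons_Suc [simp]: "k < n ==> dcons n x y (Suc k) = y k" by (simp_all add: dcons_def)

lemma dtl_dcons [simp]: "y \<in> extensional {..<n} ==> dtl n (dcons n x y) = y"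
 by (intro dsum_cong[of _ n]) (auto simp: dtl_def)

lemma dcons_closed:
 "x \<in> car M ==> y \<in> car (rmod_dsum Ms) ==> dcons (length Ms) x y \<in> car (rmod_dsum (M # Ms))"
 by (auto simp: dsum_simps dcons_def PiE_iff split: nat.split)

lemma dtl_closed:
 "x \<in> car (rmod_dsum (M # Ms)) ==> dtl (length Ms) x \<in> car (rmod_dsum Ms)"
 and dhd_closed: "x \<in> car (rmod_dsum (M # Ms)) ==> x 0 \<in> car M"
 by (force simp: dsum_simps dtl_def PiE_iff)+

lemma rmod_dsum_ext: "x \<in> car (rmod_dsum Ms) ==> x \<in> extensional {..<length Ms}"
 by (auto simp: dsum_simps PiE_def)

lemma dcons_hd_tl: "x \<in> car (rmod_dsum (M # Ms)) ==> dcons (length Ms) (x 0) (dtl (length Ms) x) = x"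
 using rmod_dsum_ext[of x "M # Ms"]
 by (intro dsum_cong[of _ "Suc (length Ms)"]) (auto simp: dcons_def dtl_def split: nat.split)

lemma dcons_add:
 "dcons (length Ms) x y \<oplus>\<^bsub>rmod_dsum (M # Ms)\<^esub> dcons (length Ms) x' y' =
  dcons (length Ms) (x \<oplus>\<^sub>M x') (y \<oplus>\<^bsub>rmod_dsum Ms\<^esub> y')"
 by (rule dsum_cong[of _ "Suc (length Ms)"]) (auto simp: dsum_simps dcons_def split: nat.split)

lemma dcons_act:
 "a \<odot>\<^bsub>rmod_dsum (M # Ms)\<^esub> dcons (length Ms) x y = dcons (length Ms) (a \<odot>\<^sub>M x) (a \<odot>\<^bsub>rmod_dsum Ms\<^esub> y)"
 by (rule dsum_cong[of _ "Suc (length Ms)"]) (auto simp: dsum_simps dcons_def split: nat.split)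

lemma dcons_zero: "dcons (length Ms) \<zero>\<^sub>M \<zero>\<^bsub>rmod_dsum Ms\<^esub> = \<zero>\<^bsub>rmod_dsum (M # Ms)\<^esub>"
 by (rule dsum_cong[of _ "Suc (length Ms)"]) (auto simp: dsum_simps dcons_def split: nat.split)

lemma rlin_dhd: "rlin R (rmod_dsum (M # Ms)) M (\<lambda>x. x 0)"
 by (rule rlinI, simp_all add: dhd_closed) (simp_all add: dsum_simps)

lemma rlin_dtl: "rlin R (rmod_dsum (M # Ms)) (rmod_dsum Ms) (dtl (length Ms))"
 by (rule rlinI, simp add: dtl_closed) (simp_all add: dsum_simps dtl_def fun_eq_iff)

lemma rlin_dcons:
 assumes "rlin R X M f" "rlin R X (rmod_dsum Ms) g"
 shows "rlin R X (rmod_dsum (M # Ms)) (\<lambda>x. dcons (length Ms) (f x) (g x))"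
 using assms by (intro rlinI) (auto simp: rlin_cl rlin_add rlin_act dcons_closed dcons_add dcons_act)

definition dinl :: "('a, 'm) module list => 'm => nat => 'm" where
 "dinl Ms x = dcons (length Ms) x \<zero>\<^bsub>rmod_dsum Ms\<^esub>"

definition dinr :: "('a, 'm) module => ('a, 'm) module list => (nat => 'm) => nat => 'm" where
 "dinr M Ms y = dcons (length Ms) \<zero>\<^sub>M y"

text \<open>The identities are recorded for explicit maps, beside the packaged form
  \<open>mbip_dsum\<close>, because complexes and extension of scalars work with these very
  maps.\<close>

lemma dsum_biproduct:
 assumes M: "right_module R M" and Ms: "right_module R (rmod_dsum Ms)"
 shows "rlin R M (rmod_dsum (M # Ms)) (dinl Ms)"
  and "rlin R (rmod_dsum Ms) (rmod_dsum (M # Ms)) (dinr M Ms)"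
  and "dinl Ms x 0 = x" and "dtl (length Ms) (dinl Ms x) = \<zero>\<^bsub>rmod_dsum Ms\<^esub>"
  and "dinr M Ms y 0 = \<zero>\<^sub>M"
  and "y \<in> car (rmod_dsum Ms) ==> dtl (length Ms) (dinr M Ms y) = y"
  and "v \<in> car (rmod_dsum (M # Ms)) ==>
   dinl Ms (v 0) \<oplus>\<^bsub>rmod_dsum (M # Ms)\<^esub> dinr M Ms (dtl (length Ms) v) = v"
proof -
 interpret M: right_module R M by fact
 interpret Ms: right_module R "rmod_dsum Ms" by fact
 show "rlin R M (rmod_dsum (M # Ms)) (dinl Ms)"
  unfolding dinl_def using rlin_dcons[OF rlin_id rlin_const_zero[OF Ms]] by simp
 show "rlin R (rmod_dsum Ms) (rmod_dsum (M # Ms)) (dinr M Ms)"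
  unfolding dinr_def using rlin_dcons[OF rlin_const_zero[OF M] rlin_id] by simp
 show "dinl Ms x 0 = x" "dinr M Ms y 0 = \<zero>\<^sub>M"
  by (simp_all add: dinl_def dinr_def)
 show "dtl (length Ms) (dinl Ms x) = \<zero>\<^bsub>rmod_dsum Ms\<^esub>"
  using rmod_dsum_ext[OF Ms.M.zero_closed] by (simp add: dinl_def)
 show "dtl (length Ms) (dinr M Ms y) = y" if "y \<in> car (rmod_dsum Ms)"
  using rmod_dsum_ext[OF that] by (simp add: dinr_def)
 show "dinl Ms (v 0) \<oplus>\<^bsub>rmod_dsum (M # Ms)\<^esub> dinr M Ms (dtl (length Ms) v) = v"
  if "v \<in> car (rmod_dsum (M # Ms))"
  using dhd_closed[OF that] dtl_closed[OF that] dcons_hd_tl[OF that]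
  by (simp add: dinl_def dinr_def dcons_add)
qed

lemma mbip_dsum:
 assumes M: "right_module R M" and Ms: "right_module R (rmod_dsum Ms)"
 shows "mbip R (rmod_dsum (M # Ms)) M (rmod_dsum Ms)" unfolding mbip_def
 by (rule exI[of _ "dinl Ms"], rule exI[of _ "\<lambda>x. x 0"], rule exI[of _ "dinr M Ms"],
   rule exI[of _ "dtl (length Ms)"]) (simp add: dsum_biproduct[OF assms] rlin_dhd rlin_dtl)

lemma reg_simps:
 "car (right_regular R) = car R" "\<zero>\<^bsub>right_regular R\<^esub> = \<zero>\<^sub>R"
 "(\<oplus>\<^bsub>right_regular R\<^esub>) = (\<oplus>\<^bsub>R\<^esub>)" "a \<odot>\<^bsub>right_regular R\<^esub> x = x \<otimes>\<^sub>R a"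
 by (simp_all add: right_regular_def)

lemma (in ring) right_regular_is_module: "right_module R (right_regular R)"
 by (rule right_moduleI[OF ring_axioms]) (simp_all add: reg_simps a_assoc r_distr l_distr m_assoc, erule (1) a_comm)

abbreviation free_module :: "('a, 'r) ring_scheme => nat => ('a, nat => 'a) module" where
 "free_module R k \<equiv> rmod_dsum (replicate k (right_regular R))"

lemma (in ring) free_module_is_module: "right_module R (free_module R k)"
 by (rule dsum_module[OF ring_axioms]) (metis right_regular_is_module in_set_replicate)

lemma rlin_from_regular:
 assumes "right_module R M" "m \<in> car M"
 shows "rlin R (right_regular R) M (\<lambda>a. a \<odot>\<^sub>M m)"
proof -
 interpret M: right_module R M by fact
 show ?thesis
  using assms(2) by (intro rlinI) (auto simp: reg_simps M.act_closed M.act_add_scalar M.act_act)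
qed

lemma rlin_regular_eq:
 assumes "right_module R M" "rlin R (right_regular R) M f" "a \<in> car R"
 shows "f a = a \<odot>\<^sub>M f \<one>\<^sub>R"
proof -
 interpret M: right_module R M by fact
 show ?thesis
  using rlin_act[OF assms(2), of a "\<one>\<^sub>R"] assms(3) by (simp add: reg_simps)
qed

lemma rlin_cong: "rlin R M N f ==> (\<And>x. x \<in> car M ==> f x = g x) ==> right_module R M ==> rlin R M N g"
proof -
 assume f: "rlin R M N f" and eq: "\<And>x. x \<in> car M ==> f x = g x" and M: "right_module R M"
 interpret M: right_module R M by fact
 show ?thesis using f M.act_closed by (simp add: rlin_def eq[symmetric] Pi_iff)
qed

text \<open>Lift the restrictions of f to the two summands separately, then project and add the
  lifts.\<close>

lemma mbip_lift:
 assumes b: "mbip R X Y Z" and X: "right_module R X" and M: "right_module R M" and N: "right_module R N"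
  and g: "rlin R M N g" and f: "rlin R X N f"
  and Y: "\<And>f. rlin R Y N f ==> \<exists>h. rlin R Y M h \<and> (\<forall>y\<in>car Y. g (h y) = f y)"
  and Z: "\<And>f. rlin R Z N f ==> \<exists>h. rlin R Z M h \<and> (\<forall>y\<in>car Z. g (h y) = f y)"
 shows "\<exists>h. rlin R X M h \<and> (\<forall>x\<in>car X. g (h x) = f x)"
proof -
 obtain j q j' q' where l: "rlin R Y X j" "rlin R X Y q" "rlin R Z X j'" "rlin R X Z q'"
  and e: "\<And>x. x\<in>car X ==> j (q x) \<oplus>\<^sub>X j' (q' x) = x"
  using b unfolding mbip_def by blast
 obtain h1 where h1: "rlin R Y M h1" "\<And>y. y \<in> car Y ==> g (h1 y) = f (j y)"
  using Y[OF rlin_o[OF f l(1)]] by auto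
 obtain h2 where h2: "rlin R Z M h2" "\<And>y. y \<in> car Z ==> g (h2 y) = f (j' y)"
  using Z[OF rlin_o[OF f l(3)]] by auto
 let ?h = "\<lambda>x. (h1 \<circ> q) x \<oplus>\<^sub>M (h2 \<circ> q') x"
 have "rlin R X M ?h" by (intro rlin_plus[OF M] rlin_o[OF h1(1) l(2)] rlin_o[OF h2(1) l(4)])
 moreover have "g (?h x) = f x" if x: "x \<in> car X" for x
 proof -
  have c: "q x \<in> car Y" "q' x \<in> car Z" using rlin_cl[OF l(2) x] rlin_cl[OF l(4) x] .
  have "g (?h x) = f (j (q x)) \<oplus>\<^sub>N f (j' (q' x))"
   using rlin_add[OF g rlin_cl[OF h1(1) c(1)] rlin_cl[OF h2(1) c(2)]] h1(2)[OF c(1)] h2(2)[OF c(2)] by simp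
  also have "\<dots> = f x"
   using rlin_add[OF f rlin_cl[OF l(1) c(1)] rlin_cl[OF l(3) c(2)]] e[OF x] by simp
  finally show ?thesis .
 qed
 ultimately show ?thesis by blast
qed

text \<open>Induction on the rank. A map out of the regular module is fixed by the image of 1, and
  that element has a preimage under g.\<close>

lemma free_module_lift:
 assumes M: "right_module R M" and N: "right_module R N"
  and g: "rlin R M N g" "g ` car M = car N" and f: "rlin R (free_module R k) N f"
 shows "\<exists>h. rlin R (free_module R k) M h \<and> (\<forall>x\<in>car (free_module R k). g (h x) = f x)"
 using f
proof (induction k arbitrary: f)
 case 0
 interpret M: right_module R M by fact
 have "f x = \<zero>\<^sub>N" if "x \<in> car (free_module R 0)" for x
  using rlin_zero[OF M.R.free_module_is_module N 0] that by (simp add: dsum_simps)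
 thus ?case using rlin_const_zero[OF M] rlin_zero[OF M N g(1)] by auto
next
 case (Suc k)
 interpret M: right_module R M by fact
 interpret N: right_module R N by fact
 have base: "\<exists>h. rlin R (right_regular R) M h \<and> (\<forall>y\<in>car (right_regular R). g (h y) = f y)"
  if f: "rlin R (right_regular R) N f" for f
 proof -
  have "f \<one>\<^sub>R \<in> car N" using rlin_cl[OF f] by (simp add: reg_simps)
  then obtain m where m: "m \<in> car M" "g m = f \<one>\<^sub>R" using g(2) by (metis imageE)
  have "g (a \<odot>\<^sub>M m) = f a" if "a \<in> car R" for a
   using rlin_regular_eq[OF N f that] rlin_act[OF g(1) that m(1)] m(2) by simp
  thus ?thesis unfolding reg_simps
   by (intro exI[of _ "\<lambda>a. a \<odot>\<^sub>M m"] conjI rlin_from_regular[OF M m(1)] ballI)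
 qed
 show ?case unfolding replicate_Suc
  by (rule mbip_lift[OF mbip_dsum[OF M.R.right_regular_is_module M.R.free_module_is_module]
     M.R.free_module_is_module[of "Suc k", unfolded replicate_Suc] M N g(1)
     Suc.prems[unfolded replicate_Suc] base Suc.IH])
qed

lemma fg_projectiveE:
 assumes "fg_projective R P"
 obtains k i p where "rlin R P (free_module R k) i" "rlin R (free_module R k) P p"
  "\<And>x. x \<in> car P ==> p (i x) = x"
 using assms unfolding fg_projective_def Bex_def rhom_iff by blast

lemma fg_projective_lift:
 assumes P: "fg_projective R P" and M: "right_module R M" and N: "right_module R N"
  and g: "rlin R M N g" "g ` car M = car N" and f: "rlin R P N f"
 shows "\<exists>h. rlin R P M h \<and> (\<forall>x\<in>car P. g (h x) = f x)"
proof -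
 obtain k i p where ip: "rlin R P (free_module R k) i" "rlin R (free_module R k) P p"
  "\<And>x. x \<in> car P ==> p (i x) = x" using fg_projectiveE[OF P] by metis
 obtain h where h: "rlin R (free_module R k) M h" "\<And>x. x \<in> car (free_module R k) ==> g (h x) = f (p x)"
  using free_module_lift[OF M N g rlin_o[OF f ip(2)]] by auto
 thus ?thesis using rlin_o[OF h(1) ip(1)] h(2)[OF rlin_cl[OF ip(1)]] ip(3)
  by (intro exI[of _ "h \<circ> i"]) simp
qed

lemma fg_projectiveI:
 assumes "right_module R P" "rlin R P (free_module R k) i" "rlin R (free_module R k) P p"
  and "\<And>x. x \<in> car P ==> p (i x) = x"
 shows "fg_projective R P"
proof -
 interpret P: right_module R P by fact
 show ?thesis unfolding fg_projective_def
 proof (intro conjI assms(1), rule exI[of _ k], rule bexI[OF _ rlin_restrict[OF assms(1,2)]],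
   rule bexI[OF _ rlin_restrict[OF P.R.free_module_is_module assms(3)]], rule ballI)
  fix x assume "x \<in> car P"
  thus "restrict p (car (free_module R k)) (restrict i (car P) x) = x"
   using assms(4) rlin_cl[OF assms(2)] by simp
 qed
qed

lemma fg_projective_module: "fg_projective R P ==> right_module R P"
 by (simp add: fg_projective_def)

lemma fg_projective_retract:
 assumes P: "fg_projective R P" and Q: "right_module R Q" and "rlin R Q P i" "rlin R P Q p"
  and "\<And>x. x \<in> car Q ==> p (i x) = x"
 shows "fg_projective R Q"
proof -
 obtain k i' p' where ip: "rlin R P (free_module R k) i'" "rlin R (free_module R k) P p'"
  "\<And>x. x \<in> car P ==> p' (i' x) = x" using fg_projectiveE[OF P] by metis
 show ?thesis by (rule fg_projectiveI[OF Q rlin_o[OF ip(1) assms(3)] rlin_o[OF assms(4) ip(2)]])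
   (simp add: ip(3) rlin_cl[OF assms(3)] assms(5))
qed

text \<open>Left multiplication by e retracts the regular module onto eR, which makes eR projective;
  eR consists of the fixed points of this retraction.\<close>

lemma (in ring) idem_proj_facts:
 assumes "idempotent_in R e"
 shows idem_proj_carrier: "car (idem_proj R e) = {x \<in> car R. e \<otimes> x = x}"
  and idem_proj_submodule: "right_submodule R (right_regular R) (car (idem_proj R e))"
  and idem_proj_is_module: "right_module R (idem_proj R e)"
  and idem_proj_projective: "fg_projective R (idem_proj R e)"
  and rlin_idem_proj: "rlin R (right_regular R) (idem_proj R e) (\<lambda>x. e \<otimes> x)"
  and rlin_idem_incl: "rlin R (idem_proj R e) (right_regular R) id"
proof -
 have e: "e \<in> car R" "e \<otimes> e = e" using assms by (auto simp: idempotent_in_def)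
 show c: "car (idem_proj R e) = {x \<in> car R. e \<otimes> x = x}"
 proof
  show "car (idem_proj R e) \<subseteq> {x \<in> car R. e \<otimes> x = x}"
   using e by (auto simp: idem_proj_def m_assoc[symmetric])
  show "{x \<in> car R. e \<otimes> x = x} \<subseteq> car (idem_proj R e)"
  proof
   fix x assume "x \<in> {x \<in> car R. e \<otimes> x = x}"
   hence "x \<in> car R" "x = e \<otimes> x" by auto
   thus "x \<in> car (idem_proj R e)" unfolding idem_proj_def by fastforce
  qed
 qed
 interpret RR: right_module R "right_regular R" by (rule right_regular_is_module)
 have ops: "\<zero>\<^bsub>idem_proj R e\<^esub> = \<zero>" "(\<oplus>\<^bsub>idem_proj R e\<^esub>) = (\<oplus>)" "a \<odot>\<^bsub>idem_proj R e\<^esub> x = x \<otimes> a" for a x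
  by (simp_all add: idem_proj_def reg_simps)
 show s: "right_submodule R (right_regular R) (car (idem_proj R e))"
  unfolding c right_submodule_def using e by (auto simp: reg_simps r_distr m_assoc[symmetric])
 have eqm: "(right_regular R)\<lparr>carrier := car (idem_proj R e)\<rparr> = idem_proj R e"
  by (simp add: idem_proj_def)
 show m: "right_module R (idem_proj R e)" using RR.submodule_is_module[OF s] by (simp add: eqm)
 show l1: "rlin R (right_regular R) (idem_proj R e) (\<lambda>x. e \<otimes> x)"
  using e by (intro rlinI) (auto simp: c ops reg_simps r_distr m_assoc[symmetric])
 show l2: "rlin R (idem_proj R e) (right_regular R) id" by (rule rlinI) (auto simp: c ops reg_simps)
 have nil: "right_module R (rmod_dsum ([] :: ('a, 'a) module list))"
  using free_module_is_module[of 0] by simp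
 have "rlin R (idem_proj R e) (free_module R 1) (dinl ([] :: ('a, 'a) module list) \<circ> id)"
  using rlin_o[OF dsum_biproduct(1)[OF right_regular_is_module nil] l2] by simp
 moreover have "rlin R (free_module R 1) (idem_proj R e) ((\<lambda>x. e \<otimes> x) \<circ> (\<lambda>v. v 0))"
  using rlin_o[OF l1 rlin_dhd[of R "right_regular R" "[]"]] by simp
 ultimately show "fg_projective R (idem_proj R e)"
  by (rule fg_projectiveI[OF m]) (simp add: c dinl_def)
qed

context fd_algebra
begin

lemma sc_mult_right: "x \<in> car R ==> x \<otimes> sc c = c \<odot> x"
 by (simp add: sc_def smult_mult_right)

text \<open>On the kernel of q the map j' undoes q', so this kernel embeds into Z, while q itself
  lands in Y.\<close>

lemma fd_mbip:
 assumes X: "right_module R X" and Y: "fd_right_module R Y" and Z: "fd_right_module R Z" and b: "mbip R X Y Z"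
 shows "fd_right_module R X"
proof -
 note m = X fdD[OF Y] fdD[OF Z]
 interpret X: right_module R X by fact
 obtain j q j' q' where l: "rlin R Y X j" "rlin R X Y q" "rlin R Z X j'" "rlin R X Z q'"
  and e: "\<And>x. x\<in>car X ==> j (q x) \<oplus>\<^sub>X j' (q' x) = x"
  using b unfolding mbip_def by blast
 interpret q: linear_map CC "cspace R X" "cspace R Y" q by (rule rlin_linear_map[OF m(1,2) l(2)])
 have K: "vectorspace CC (cspace R X\<lparr>carrier := q.kerT\<rparr>)"
  using q.V.subspace_is_vs[OF q.kerT_is_subspace] .
 have kq: "x \<in> car X" "j' (q' x) = x" if "x \<in> q.kerT" for x
 proof -
  have x: "x \<in> car X" "q x = \<zero>\<^sub>Y" using that by (auto simp: q.ker_def)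
  show "x \<in> car X" by (rule x)
  show "j' (q' x) = x"
   using e[OF x(1)] rlin_zero[OF m(2,1) l(1)] x rlin_cl[OF l(3)] rlin_cl[OF l(4)] by simp
 qed
 have "linear_map CC (cspace R X\<lparr>carrier := q.kerT\<rparr>) (cspace R Z) q'"
  by (rule linear_mapI[OF K cspace_vs[OF m(3)]])
   (simp_all add: kq rlin_cl[OF l(4)] rlin_add[OF l(4)] rlin_act[OF l(4)])
 hence "vectorspace.fin_dim CC (cspace R X\<lparr>carrier := q.kerT\<rparr>)"
 proof (rule linear_map.inj_fin_dim(1))
  show "inj_on q' (car (cspace R X\<lparr>carrier := q.kerT\<rparr>))"
   by (rule inj_on_inverseI[of _ j']) (simp add: kq)
  show "vectorspace.fin_dim CC (cspace R Z)" using Z by (simp add: fd_right_module_def)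
 qed
 hence "q.V.fin_dim"
  by (rule q.fin_dim_of_ker) (use Y in \<open>simp add: fd_right_module_def\<close>)
 thus ?thesis using X by (simp add: fd_right_module_def)
qed

lemma fd_trivial:
 assumes M: "right_module R M" and "car M = {\<zero>\<^sub>M}"
 shows "fd_right_module R M"
proof -
 interpret V: vectorspace CC "cspace R M" by (rule cspace_vs[OF M])
 have "V.span {} = car (cspace R M)" unfolding V.span_empty cspace_simps assms(2) ..
 hence "finite {} \<and> {} \<subseteq> car (cspace R M) \<and> V.span {} = car (cspace R M)"
  by simp
 hence "V.fin_dim" unfolding V.fin_dim_def by (rule exI)
 with M show ?thesis unfolding fd_right_module_def ..
qed

lemma fd_dsum:
 assumes "\<And>M. M \<in> set Ms ==> fd_right_module R M"
 shows "fd_right_module R (rmod_dsum Ms)" using assms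
proof (induction Ms)
 case Nil
 have "right_module R (rmod_dsum ([] :: ('a, 'b) module list))"
  by (rule dsum_module[OF ring_axioms]) simp
 thus ?case by (rule fd_trivial) (simp add: dsum_simps restrict_def)
next
 case (Cons M Ms)
 have m: "\<And>M'. M' \<in> set (M # Ms) ==> right_module R M'" using Cons.prems fdD by blast
 show ?case
  by (rule fd_mbip[OF dsum_module[OF ring_axioms m] _ _ mbip_dsum[OF m dsum_module[OF ring_axioms m]]])
   (use Cons in simp_all)
qed

lemma fd_regular: "fd_right_module R (right_regular R)"
proof -
 have "linear_map CC (cspace R (right_regular R)) R id"
  by (rule linear_mapI[OF cspace_vs[OF right_regular_is_module] cvs.vectorspace_axioms])
   (simp_all add: reg_simps sc_mult_right)
 hence "vectorspace.fin_dim CC (cspace R (right_regular R))"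
  by (rule linear_map.inj_fin_dim(1)) (simp_all add: finite_dimensional)
 thus ?thesis by (simp add: fd_right_module_def right_regular_is_module)
qed

lemma fd_free: "fd_right_module R (free_module R k)"
 by (rule fd_dsum) (metis fd_regular in_set_replicate)

lemma fd_projective:
 assumes "fg_projective R P"
 shows "fd_right_module R P"
proof -
 obtain k i p where ip: "rlin R P (free_module R k) i" "\<And>x. x \<in> car P ==> p (i x) = x"
  using fg_projectiveE[OF assms] by metis
 show ?thesis by (rule fd_inj_domain[OF fg_projective_module[OF assms] fd_free ip(1)])
   (rule inj_on_inverseI[of _ p], rule ip(2))
qed

text \<open>A spanning set over the complex numbers also generates over the algebra: map one unit
  vector of a free module to each of its members. The image is a complex subspace that contains the
  spanning set.\<close>

lemma fd_finitely_generated: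
 assumes M: "fd_right_module R M"
 shows "\<exists>k f. rlin R (free_module R k) M f \<and> f ` car (free_module R k) = car M"
proof -
 note m = fdD[OF M]
 interpret M: right_module R M by (rule m)
 have *: "\<exists>f. rlin R (free_module R (length cs)) M f \<and> set cs \<subseteq> f ` car (free_module R (length cs))"
  if "set cs \<subseteq> car M" for cs using that
 proof (induction cs)
  case Nil
  show ?case by (intro exI[of _ "\<lambda>_. \<zero>\<^sub>M"]) (simp add: rlin_const_zero[OF m])
 next
  case (Cons c cs)
  let ?F = "free_module R (length cs)" and ?G = "free_module R (length (c # cs))"
  obtain f where f: "rlin R ?F M f" "set cs \<subseteq> f ` car ?F" using Cons by auto
  have G: "?G = rmod_dsum (right_regular R # replicate (length cs) (right_regular R))" by simp
  note bp = dsum_biproduct[OF right_regular_is_module free_module_is_module[of "length cs"],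
    unfolded length_replicate, folded replicate_Suc]
  have c: "c \<in> car M" using Cons by auto
  \<comment> \<open>The head coordinate acts on the new generator c, and the tail is mapped by the
    previous f. The preimage of c is the unit vector of the head.\<close>
  let ?g = "\<lambda>v. ((\<lambda>a. a \<odot>\<^sub>M c) \<circ> (\<lambda>v. v 0)) v \<oplus>\<^sub>M (f \<circ> dtl (length cs)) v"
  have g: "rlin R ?G M ?g"
   using rlin_plus[OF m rlin_o[OF rlin_from_regular[OF m c] rlin_dhd] rlin_o[OF f(1) rlin_dtl[of R "right_regular R" "replicate (length cs) (right_regular R)", unfolded length_replicate]]]
   unfolding G by simp
  have "x \<in> ?g ` car ?G" if "x \<in> set (c # cs)" for x
  proof (cases "x = c")
   case True
   have "dinl (replicate (length cs) (right_regular R)) \<one> \<in> car ?G"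
    using rlin_cl[OF bp(1), of \<one>] by (simp add: reg_simps)
   moreover have "c = ?g (dinl (replicate (length cs) (right_regular R)) \<one>)"
    using bp(3,4) rlin_zero[OF free_module_is_module m f(1)] c by (simp add: M.act_one)
   ultimately show ?thesis unfolding True by (rule image_eqI[where f = ?g, rotated])
  next
   case False
   hence "x \<in> f ` car ?F" using that f(2) by auto
   then obtain y where y: "y \<in> car ?F" "x = f y" by blast
   let ?z = "dinr (right_regular R) (replicate (length cs) (right_regular R)) y"
   have "?z \<in> car ?G" using rlin_cl[OF bp(2), of y] y by simp
   moreover have "x = ?g ?z"
    using bp(5)[of y] bp(6)[of y] y rlin_cl[OF f(1) y(1)] c by (simp add: M.zero_act reg_simps)
   ultimately show ?thesis by (rule image_eqI[where f = ?g, rotated])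
  qed
  thus ?case using g by blast
 qed
 interpret V: vectorspace CC "cspace R M" by (rule cspace_vs[OF m])
 obtain C where C: "finite C" "C \<subseteq> car M" "V.span C = car M"
  using M unfolding fd_right_module_def V.fin_dim_def by auto
 then obtain cs where cs: "set cs = C" using finite_list by blast
 then obtain f where f: "rlin R (free_module R (length cs)) M f" "C \<subseteq> f ` car (free_module R (length cs))"
  using *[of cs] C by auto
 interpret f: linear_map CC "cspace R (free_module R (length cs))" "cspace R M" f
  by (rule rlin_linear_map[OF free_module_is_module m f(1)])
 have im: "f.imT = f ` car (free_module R (length cs))" by (simp add: f.im_def)
 have "V.span C \<subseteq> f.imT"
 proof (rule V.span_is_subset)
  show "LinearCombinations.submodule CC f.imT (cspace R M)"
   using f.imT_is_subspace by (simp add: VectorSpace.subspace_def)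
 qed (use f(2) im in simp)
 hence "f ` car (free_module R (length cs)) = car M"
  unfolding C(3) im using rlin_cl[OF f(1)] by blast
 thus ?thesis using f(1) by blast
qed

text \<open>Choose a surjection from a free module onto X. Maps out of Y and out of Z lift through
  it, hence so does the identity of X, which splits the surjection.\<close>

lemma fg_projective_mbip:
 assumes X: "right_module R X" and Y: "fg_projective R Y" and Z: "fg_projective R Z" and b: "mbip R X Y Z"
 shows "fg_projective R X"
proof -
 have fX: "fd_right_module R X" by (rule fd_mbip[OF X fd_projective[OF Y] fd_projective[OF Z] b])
 obtain k f where f: "rlin R (free_module R k) X f" "f ` car (free_module R k) = car X"
  using fd_finitely_generated[OF fX] by blast
 have "\<exists>h. rlin R X (free_module R k) h \<and> (\<forall>x\<in>car X. f (h x) = id x)"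
  by (rule mbip_lift[OF b X free_module_is_module X f(1) rlin_id])
   (erule fg_projective_lift[OF Y free_module_is_module X f]
    fg_projective_lift[OF Z free_module_is_module X f])+
 then obtain s where "rlin R X (free_module R k) s" "\<And>x. x \<in> car X ==> f (s x) = x"
  by (auto simp only: id_apply)
 thus ?thesis by (intro fg_projectiveI[OF X _ f(1)])
qed

lemma fg_projective_dsum:
 assumes "\<And>P. P \<in> set Ps ==> fg_projective R P"
 shows "fg_projective R (rmod_dsum Ps)" using assms
proof (induction Ps)
 case Nil
 have N: "right_module R (rmod_dsum ([] :: ('a, 'b) module list))"
  by (rule dsum_module[OF ring_axioms]) simp
 show ?case by (rule fg_projectiveI[OF N, of 0 "\<lambda>_ _. undefined" "\<lambda>_ _. undefined"])
   (auto simp: rlin_def dsum_simps)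
next
 case (Cons P Ps)
 have m: "\<And>P'. P' \<in> set (P # Ps) ==> right_module R P'"
  using Cons.prems fg_projective_module by blast
 show ?case
  by (rule fg_projective_mbip[OF dsum_module[OF ring_axioms m] _ _ mbip_dsum[OF m dsum_module[OF ring_axioms m]]])
   (use Cons in simp_all)
qed

end

section \<open>Two-term complexes, chain homotopies and biproducts up to homotopy\<close>

definition cplx :: "('a, 'r) ring_scheme => ('a, 'm) two_term => bool" where
 "cplx R X \<longleftrightarrow> right_module R (tm1 X) \<and> right_module R (t0 X) \<and> rlin R (tm1 X) (t0 X) (tdiff X)"

definition cmap :: "('a, 'r) ring_scheme => ('a, 'm) two_term => ('a, 'n) two_term
  => ('m => 'n) \<times> ('m => 'n) => bool" where
 "cmap R X Y f \<longleftrightarrow> rlin R (tm1 X) (tm1 Y) (fst f) \<and> rlin R (t0 X) (t0 Y) (snd f) \<and>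
  (\<forall>x\<in>car (tm1 X). snd f (tdiff X x) = tdiff Y (fst f x))"

definition ccomp :: "('n => 'k) \<times> ('n => 'k) => ('m => 'n) \<times> ('m => 'n) => ('m => 'k) \<times> ('m => 'k)"
  (infixl "\<odot>c" 70) where
 "f \<odot>c g = (fst f \<circ> fst g, snd f \<circ> snd g)"

definition cadd :: "('a, 'n) two_term => ('m => 'n) \<times> ('m => 'n) => ('m => 'n) \<times> ('m => 'n)
  => ('m => 'n) \<times> ('m => 'n)" where
 "cadd Y f g = (\<lambda>x. fst f x \<oplus>\<^bsub>tm1 Y\<^esub> fst g x, \<lambda>x. snd f x \<oplus>\<^bsub>t0 Y\<^esub> snd g x)"

definition czero :: "('a, 'n) two_term => ('m => 'n) \<times> ('m => 'n)" where
 "czero Y = (\<lambda>_. \<zero>\<^bsub>tm1 Y\<^esub>, \<lambda>_. \<zero>\<^bsub>t0 Y\<^esub>)"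

abbreviation cid :: "('m => 'm) \<times> ('m => 'm)" where
 "cid \<equiv> (id, id)"

text \<open>Maps are arbitrary off the carriers, so equality is tested on the carriers only.\<close>

definition ceq :: "('a, 'm) two_term => ('m => 'n) \<times> ('m => 'n) => ('m => 'n) \<times> ('m => 'n) => bool" where
 "ceq X f g \<longleftrightarrow> (\<forall>x\<in>car (tm1 X). fst f x = fst g x) \<and> (\<forall>x\<in>car (t0 X). snd f x = snd g x)"

definition heq :: "('a, 'r) ring_scheme => ('a, 'm) two_term => ('a, 'n) two_term
  => ('m => 'n) \<times> ('m => 'n) => ('m => 'n) \<times> ('m => 'n) => bool" where
 "heq R X Y f g \<longleftrightarrow> (\<exists>h. rlin R (t0 X) (tm1 Y) h \<and>
  (\<forall>x\<in>car (tm1 X). fst f x = fst g x \<oplus>\<^bsub>tm1 Y\<^esub> h (tdiff X x)) \<and>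
  (\<forall>x\<in>car (t0 X). snd f x = snd g x \<oplus>\<^bsub>t0 Y\<^esub> tdiff Y (h x)))"

lemma cplxD: "cplx R X ==> right_module R (tm1 X)" "cplx R X ==> right_module R (t0 X)"
 "cplx R X ==> rlin R (tm1 X) (t0 X) (tdiff X)" by (auto simp: cplx_def)

lemma cmapD: "cmap R X Y f ==> rlin R (tm1 X) (tm1 Y) (fst f)"
 "cmap R X Y f ==> rlin R (t0 X) (t0 Y) (snd f)"
 "cmap R X Y f ==> x \<in> car (tm1 X) ==> snd f (tdiff X x) = tdiff Y (fst f x)"
 by (auto simp: cmap_def)

text \<open>The homotopy calculus is developed for complexes of arbitrary modules; this specialises
  it to complexes of projectives.\<close>

lemma ttp_cplx: "two_term_proj R X ==> cplx R X"
 by (auto simp: two_term_proj_def cplx_def rhom_iff fg_projective_module)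

lemma ccomp_assoc: "f \<odot>c (g \<odot>c h) = f \<odot>c g \<odot>c h"
 by (simp add: ccomp_def o_assoc)

lemma ccomp_id [simp]: "f \<odot>c cid = f" "cid \<odot>c f = f" by (simp_all add: ccomp_def)

lemma ccomp_apply [simp]: "fst (f \<odot>c g) x = fst f (fst g x)" "snd (f \<odot>c g) x = snd f (snd g x)"
 by (simp_all add: ccomp_def)

lemma czero_comp [simp]: "czero Y \<odot>c f = czero Y" by (simp add: ccomp_def czero_def comp_def)

lemma cmap_comp: "cmap R Y Z f ==> cmap R X Y g ==> cmap R X Z (f \<odot>c g)"
 unfolding cmap_def by (auto simp: ccomp_def rlin_o rlin_cl)

lemma cmap_id: "cmap R X X cid" by (simp add: cmap_def rlin_id)

lemma cmap_zero: "cplx R X ==> cplx R Y ==> cmap R X Y (czero Y)" unfolding cmap_def czero_def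
 by (simp add: cplxD rlin_const_zero rlin_zero[OF cplxD(1,2,3)])

lemma cmap_add:
 assumes Y: "cplx R Y" and f: "cmap R X Y f" and g: "cmap R X Y g"
 shows "cmap R X Y (cadd Y f g)" unfolding cmap_def cadd_def
 using rlin_plus[OF cplxD(1)[OF Y] cmapD(1)[OF f] cmapD(1)[OF g]]
  rlin_plus[OF cplxD(2)[OF Y] cmapD(2)[OF f] cmapD(2)[OF g]]
  cmapD(3)[OF f] cmapD(3)[OF g] rlin_cl[OF cmapD(1)[OF f]] rlin_cl[OF cmapD(1)[OF g]]
 by (simp add: rlin_add[OF cplxD(3)[OF Y]])

lemma heq_sym:
 assumes X: "cplx R X" and Y: "cplx R Y" and f: "cmap R X Y f" and g: "cmap R X Y g"
  and h: "heq R X Y f g"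
 shows "heq R X Y g f"
proof -
 interpret Y1: right_module R "tm1 Y" by (rule cplxD[OF Y])
 interpret Y0: right_module R "t0 Y" by (rule cplxD[OF Y])
 obtain h where h: "rlin R (t0 X) (tm1 Y) h"
  "\<And>x. x\<in>car (tm1 X) ==> fst f x = fst g x \<oplus>\<^bsub>tm1 Y\<^esub> h (tdiff X x)"
  "\<And>x. x\<in>car (t0 X) ==> snd f x = snd g x \<oplus>\<^bsub>t0 Y\<^esub> tdiff Y (h x)"
  using assms(5) unfolding heq_def by metis
 note dX = rlin_cl[OF cplxD(3)[OF X]] and dY = rlin_cl[OF cplxD(3)[OF Y]]
 note cl = rlin_cl[OF h(1)] rlin_cl[OF cmapD(1)[OF g]] rlin_cl[OF cmapD(2)[OF g]]
 show ?thesis unfolding heq_def by (rule exI[of _ "\<lambda>x. \<ominus>\<^bsub>tm1 Y\<^esub> h x"])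
   (simp add: rlin_uminus[OF cplxD(1)[OF Y] h(1)] h(2,3) cl dX dY Y1.M.a_assoc Y1.M.r_neg
    Y0.M.a_assoc Y0.M.r_neg rlin_minus[OF cplxD(1,2,3)[OF Y]])
qed

lemma heq_trans:
 assumes X: "cplx R X" and Y: "cplx R Y" and k: "cmap R X Y k"
  and fg: "heq R X Y f g" and gk: "heq R X Y g k"
 shows "heq R X Y f k"
proof -
 interpret Y1: right_module R "tm1 Y" by (rule cplxD[OF Y])
 interpret Y0: right_module R "t0 Y" by (rule cplxD[OF Y])
 obtain h where h: "rlin R (t0 X) (tm1 Y) h"
  "\<And>x. x\<in>car (tm1 X) ==> fst f x = fst g x \<oplus>\<^bsub>tm1 Y\<^esub> h (tdiff X x)"
  "\<And>x. x\<in>car (t0 X) ==> snd f x = snd g x \<oplus>\<^bsub>t0 Y\<^esub> tdiff Y (h x)"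
  using fg unfolding heq_def by metis
 obtain l where l: "rlin R (t0 X) (tm1 Y) l"
  "\<And>x. x\<in>car (tm1 X) ==> fst g x = fst k x \<oplus>\<^bsub>tm1 Y\<^esub> l (tdiff X x)"
  "\<And>x. x\<in>car (t0 X) ==> snd g x = snd k x \<oplus>\<^bsub>t0 Y\<^esub> tdiff Y (l x)"
  using gk unfolding heq_def by metis
 note dX = rlin_cl[OF cplxD(3)[OF X]] and dY = rlin_cl[OF cplxD(3)[OF Y]]
 note cl = rlin_cl[OF h(1)] rlin_cl[OF l(1)] rlin_cl[OF cmapD(1)[OF k]] rlin_cl[OF cmapD(2)[OF k]]
 show ?thesis unfolding heq_def
  by (rule exI[of _ "\<lambda>x. l x \<oplus>\<^bsub>tm1 Y\<^esub> h x"])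
   (simp add: rlin_plus[OF cplxD(1)[OF Y] l(1) h(1)] h(2,3) l(2,3) cl dX dY Y1.M.a_assoc
    Y0.M.a_assoc rlin_add[OF cplxD(3)[OF Y]])
qed

lemma heq_ceq:
 assumes X: "cplx R X" and Y: "cplx R Y" and g: "cmap R X Y g" and fg: "ceq X f g"
 shows "heq R X Y f g"
proof -
 interpret Y1: right_module R "tm1 Y" by (rule cplxD[OF Y])
 interpret Y0: right_module R "t0 Y" by (rule cplxD[OF Y])
 show ?thesis unfolding heq_def using fg rlin_cl[OF cmapD(1)[OF g]] rlin_cl[OF cmapD(2)[OF g]]
  by (intro exI[of _ "\<lambda>_. \<zero>\<^bsub>tm1 Y\<^esub>"])
   (simp add: ceq_def rlin_const_zero[OF cplxD(1)[OF Y]] rlin_zero[OF cplxD(1,2,3)[OF Y]])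
qed

lemma heq_ceq_trans:
 assumes "ceq X f g" "heq R X Y g k" shows "heq R X Y f k"
 using assms unfolding heq_def ceq_def by simp

lemma heq_refl: "cplx R X ==> cplx R Y ==> cmap R X Y f ==> heq R X Y f f"
 by (rule heq_ceq) (auto simp: ceq_def)

lemma heq_comp_left:
 assumes Y: "cplx R Y" and Z: "cplx R Z" and X: "cplx R X"
  and k: "cmap R Y Z k" and g: "cmap R X Y g" and fg: "heq R X Y f g"
 shows "heq R X Z (k \<odot>c f) (k \<odot>c g)"
proof -
 obtain h where h: "rlin R (t0 X) (tm1 Y) h"
  "\<And>x. x\<in>car (tm1 X) ==> fst f x = fst g x \<oplus>\<^bsub>tm1 Y\<^esub> h (tdiff X x)"
  "\<And>x. x\<in>car (t0 X) ==> snd f x = snd g x \<oplus>\<^bsub>t0 Y\<^esub> tdiff Y (h x)"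
  using fg unfolding heq_def by metis
 note dX = rlin_cl[OF cplxD(3)[OF X]] and dY = rlin_cl[OF cplxD(3)[OF Y]]
 note cl = rlin_cl[OF h(1)] rlin_cl[OF cmapD(1)[OF g]] rlin_cl[OF cmapD(2)[OF g]]
 show ?thesis unfolding heq_def by (rule exI[of _ "fst k \<circ> h"])
   (simp add: rlin_o[OF cmapD(1)[OF k] h(1)] h(2,3) cl dX dY rlin_add[OF cmapD(1)[OF k]]
    rlin_add[OF cmapD(2)[OF k]] cmapD(3)[OF k])
qed

lemma heq_comp_right:
 assumes X: "cplx R X" and W: "cplx R W" and k: "cmap R W X k" and fg: "heq R X Y f g"
 shows "heq R W Y (f \<odot>c k) (g \<odot>c k)"
proof -
 obtain h where h: "rlin R (t0 X) (tm1 Y) h"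
  "\<And>x. x\<in>car (tm1 X) ==> fst f x = fst g x \<oplus>\<^bsub>tm1 Y\<^esub> h (tdiff X x)"
  "\<And>x. x\<in>car (t0 X) ==> snd f x = snd g x \<oplus>\<^bsub>t0 Y\<^esub> tdiff Y (h x)"
  using fg unfolding heq_def by metis
 show ?thesis unfolding heq_def by (rule exI[of _ "h \<circ> snd k"])
   (simp add: rlin_o[OF h(1) cmapD(2)[OF k]] h(2,3) rlin_cl[OF cmapD(1)[OF k]]
    rlin_cl[OF cmapD(2)[OF k]] cmapD(3)[OF k])
qed

lemma heq_add:
 assumes X: "cplx R X" and Y: "cplx R Y"
  and g: "cmap R X Y g" "cmap R X Y g'" and fg: "heq R X Y f g" "heq R X Y f' g'"
 shows "heq R X Y (cadd Y f f') (cadd Y g g')"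
proof -
 interpret Y1: right_module R "tm1 Y" by (rule cplxD[OF Y])
 interpret Y0: right_module R "t0 Y" by (rule cplxD[OF Y])
 obtain h where h: "rlin R (t0 X) (tm1 Y) h"
  "\<And>x. x\<in>car (tm1 X) ==> fst f x = fst g x \<oplus>\<^bsub>tm1 Y\<^esub> h (tdiff X x)"
  "\<And>x. x\<in>car (t0 X) ==> snd f x = snd g x \<oplus>\<^bsub>t0 Y\<^esub> tdiff Y (h x)"
  using fg(1) unfolding heq_def by metis
 obtain l where l: "rlin R (t0 X) (tm1 Y) l"
  "\<And>x. x\<in>car (tm1 X) ==> fst f' x = fst g' x \<oplus>\<^bsub>tm1 Y\<^esub> l (tdiff X x)"
  "\<And>x. x\<in>car (t0 X) ==> snd f' x = snd g' x \<oplus>\<^bsub>t0 Y\<^esub> tdiff Y (l x)"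
  using fg(2) unfolding heq_def by metis
 note dX = rlin_cl[OF cplxD(3)[OF X]] and dY = rlin_cl[OF cplxD(3)[OF Y]]
 note cl = rlin_cl[OF h(1)] rlin_cl[OF l(1)] rlin_cl[OF cmapD(1)[OF g(1)]] rlin_cl[OF cmapD(2)[OF g(1)]]
  rlin_cl[OF cmapD(1)[OF g(2)]] rlin_cl[OF cmapD(2)[OF g(2)]]
 show ?thesis unfolding heq_def cadd_def
  by (rule exI[of _ "\<lambda>x. h x \<oplus>\<^bsub>tm1 Y\<^esub> l x"])
   (simp add: rlin_plus[OF cplxD(1)[OF Y] h(1) l(1)] h(2,3) l(2,3) cl dX dY Y1.M.add.m_ac
    Y0.M.add.m_ac rlin_add[OF cplxD(3)[OF Y]])
qed

lemma ceq_comp_zero: "cplx R Y ==> cplx R Z ==> cmap R Y Z k ==> ceq X (k \<odot>c czero Y) (czero Z)"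
 by (simp add: ceq_def czero_def rlin_zero[OF cplxD(1) cplxD(1) cmapD(1)] rlin_zero[OF cplxD(2) cplxD(2) cmapD(2)])

text \<open>Null-homotopic maps form a two-sided ideal. Together with \<open>heq_id_sandwich\<close>
  this allows a homotopy to be used in the middle of a composite.\<close>

lemma heq_zero_sandwich:
 assumes "cplx R X" "cplx R Y" "cplx R Z" "cplx R W"
  and k: "cmap R Z W k" and u: "cmap R Y Z u" "heq R Y Z u (czero Z)" and f: "cmap R X Y f"
 shows "heq R X W (k \<odot>c u \<odot>c f) (czero W)"
proof -
 have "heq R Y W (k \<odot>c u) (k \<odot>c czero Z)"
  by (rule heq_comp_left[OF assms(3,4,2) k cmap_zero[OF assms(2,3)] u(2)])
 hence "heq R Y W (k \<odot>c u) (czero W)"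
  by (rule heq_trans[OF assms(2,4) cmap_zero[OF assms(2,4)] _ heq_ceq[OF assms(2,4) cmap_zero[OF assms(2,4)]
      ceq_comp_zero[OF assms(3,4) k]]])
 from heq_comp_right[OF assms(2,1) f this] show ?thesis by simp
qed

lemma heq_id_sandwich:
 assumes "cplx R X" "cplx R Y" "cplx R W"
  and k: "cmap R Y W k" and u: "cmap R Y Y u" "heq R Y Y u cid" and f: "cmap R X Y f"
 shows "heq R X W (k \<odot>c u \<odot>c f) (k \<odot>c f)"
 using heq_comp_right[OF assms(2,1) f heq_comp_left[OF assms(2,3,2) k cmap_id u(2)]] by simp

text \<open>\<open>K_iso\<close> asks for extensional maps, so f and g are restricted to the
  carriers; the homotopies are tested only there and survive the restriction.\<close>

lemma K_isoI:
 assumes X: "cplx R X" and Y: "cplx R Y" and f: "cmap R X Y f" and g: "cmap R Y X g"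
  and "heq R X X (g \<odot>c f) cid" "heq R Y Y (f \<odot>c g) cid"
 shows "K_iso R X Y"
proof -
 have restr: "\<exists>f1 f0. (f1, f0) \<in> chain_maps R X Y \<and> (\<forall>x\<in>car (tm1 X). f1 x = fst f x) \<and>
   (\<forall>x\<in>car (t0 X). f0 x = snd f x)"
  if X: "cplx R X" and f: "cmap R X Y f" for X :: "('a, 'x) two_term" and Y :: "('a, 'y) two_term" and f
  by (rule exI[of _ "restrict (fst f) (car (tm1 X))"], rule exI[of _ "restrict (snd f) (car (t0 X))"])
   (simp add: chain_maps_def rlin_restrict[OF cplxD(1)[OF X] cmapD(1)[OF f]] rlin_cl[OF cplxD(3)[OF X]]
    rlin_restrict[OF cplxD(2)[OF X] cmapD(2)[OF f]] cmapD(3)[OF f])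
 have hom: "chain_homotopic R X X (g1 \<circ> f1, g0 \<circ> f0) (id, id)"
  if X: "cplx R X" and f: "cmap R X Y f" and h: "heq R X X (g \<odot>c f) cid"
   and f1: "\<forall>x\<in>car (tm1 X). f1 x = fst f x" and f0: "\<forall>x\<in>car (t0 X). f0 x = snd f x"
   and g1: "\<forall>x\<in>car (tm1 Y). g1 x = fst g x" and g0: "\<forall>x\<in>car (t0 Y). g0 x = snd g x"
  for X :: "('a, 'x) two_term" and Y :: "('a, 'y) two_term" and f g f1 f0 g1 g0
 proof -
  obtain h where h: "rlin R (t0 X) (tm1 X) h"
   "\<And>x. x\<in>car (tm1 X) ==> fst (g \<odot>c f) x = x \<oplus>\<^bsub>tm1 X\<^esub> h (tdiff X x)"
   "\<And>x. x\<in>car (t0 X) ==> snd (g \<odot>c f) x = x \<oplus>\<^bsub>t0 X\<^esub> tdiff X (h x)"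
   using h unfolding heq_def by auto
  show ?thesis unfolding chain_homotopic_def
   by (rule bexI[OF _ rlin_restrict[OF cplxD(2)[OF X] h(1)]])
    (use h(2,3) in \<open>simp add: f1 f0 g1 g0 rlin_cl[OF cmapD(1)[OF f]] rlin_cl[OF cmapD(2)[OF f]]
     rlin_cl[OF cplxD(3)[OF X]]\<close>)
 qed
 obtain f1 f0 where f': "(f1, f0) \<in> chain_maps R X Y" "\<forall>x\<in>car (tm1 X). f1 x = fst f x"
  "\<forall>x\<in>car (t0 X). f0 x = snd f x" using restr[OF X f] by metis
 obtain g1 g0 where g': "(g1, g0) \<in> chain_maps R Y X" "\<forall>x\<in>car (tm1 Y). g1 x = fst g x"
  "\<forall>x\<in>car (t0 Y). g0 x = snd g x" using restr[OF Y g] by metis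
 have "chain_homotopic R X X (g1 \<circ> f1, g0 \<circ> f0) (id, id)"
  by (rule hom[OF X f assms(5) f'(2,3) g'(2,3)])
 moreover have "chain_homotopic R Y Y (f1 \<circ> g1, f0 \<circ> g0) (id, id)"
  by (rule hom[OF Y g assms(6) g'(2,3) f'(2,3)])
 ultimately show ?thesis
  unfolding K_iso_def by (intro bexI[OF _ f'(1)] case_prodI bexI[OF _ g'(1)] conjI)
qed

lemma K_isoE:
 assumes "K_iso R X Y"
 obtains f g where "cmap R X Y f" "cmap R Y X g" "heq R X X (g \<odot>c f) cid" "heq R Y Y (f \<odot>c g) cid"
proof -
 obtain f1 f0 g1 g0 where c: "(f1, f0) \<in> chain_maps R X Y" "(g1, g0) \<in> chain_maps R Y X"
  "chain_homotopic R X X (g1 \<circ> f1, g0 \<circ> f0) (id, id)" "chain_homotopic R Y Y (f1 \<circ> g1, f0 \<circ> g0) (id, id)"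
  using assms unfolding K_iso_def by blast
 show thesis by (rule that[of "(f1, f0)" "(g1, g0)"])
   (use c in \<open>auto simp: chain_maps_def chain_homotopic_def heq_def cmap_def rhom_iff ccomp_def\<close>)
qed

lemma K_iso_refl: "cplx R X ==> K_iso R X X"
 using K_isoI[of R X X cid cid] cmap_id heq_refl[OF _ _ cmap_id] by (metis ccomp_id(1))

lemma K_iso_sym: "cplx R X ==> cplx R Y ==> K_iso R X Y ==> K_iso R Y X"
 by (erule K_isoE) (rule K_isoI)

lemma K_iso_trans:
 assumes X: "cplx R X" and Y: "cplx R Y" and Z: "cplx R Z" and "K_iso R X Y" "K_iso R Y Z"
 shows "K_iso R X Z"
proof -
 obtain f g where fg: "cmap R X Y f" "cmap R Y X g" "heq R X X (g \<odot>c f) cid" "heq R Y Y (f \<odot>c g) cid"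
  using assms(4) by (rule K_isoE)
 obtain k l where kl: "cmap R Y Z k" "cmap R Z Y l" "heq R Y Y (l \<odot>c k) cid" "heq R Z Z (k \<odot>c l) cid"
  using assms(5) by (rule K_isoE)
 show ?thesis
 proof (rule K_isoI[OF X Z cmap_comp[OF kl(1) fg(1)] cmap_comp[OF fg(2) kl(2)]])
  show "heq R X X (g \<odot>c l \<odot>c (k \<odot>c f)) cid"
   using heq_trans[OF X X cmap_id heq_id_sandwich[OF X Y X fg(2) cmap_comp[OF kl(2,1)] kl(3) fg(1)] fg(3)]
   by (simp add: ccomp_assoc)
  show "heq R Z Z (k \<odot>c f \<odot>c (g \<odot>c l)) cid"
   using heq_trans[OF Z Z cmap_id heq_id_sandwich[OF Z Y Z kl(1) cmap_comp[OF fg(1,2)] fg(4) kl(2)] kl(4)]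
   by (simp add: ccomp_assoc)
 qed
qed

text \<open>Contractibility. \<open>K_zero_iff\<close> identifies it with \<open>K_zero\<close>, the
  isomorphism with an empty sum.\<close>

definition kzero :: "('a, 'r) ring_scheme => ('a, 'm) two_term => bool" where
 "kzero R X \<longleftrightarrow> heq R X X cid (czero X)"

text \<open>The counterpart of \<open>mbip\<close> in the homotopy category: the five biproduct
  identities hold up to homotopy. \<open>K_iso_pair_iff\<close> relates it to
  \<open>K_dsum [Y, Z]\<close>.\<close>

definition kbip :: "('a, 'r) ring_scheme => ('a, 'm) two_term => ('a, 'n) two_term => ('a, 'k) two_term => bool" where
 "kbip R X Y Z \<longleftrightarrow> (\<exists>j q j' q'. cmap R Y X j \<and> cmap R X Y q \<and> cmap R Z X j' \<and> cmap R X Z q' \<and>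
  heq R Y Y (q \<odot>c j) cid \<and> heq R Z Z (q' \<odot>c j') cid \<and> heq R Y Z (q' \<odot>c j) (czero Z) \<and>
  heq R Z Y (q \<odot>c j') (czero Y) \<and> heq R X X (cadd X (j \<odot>c q) (j' \<odot>c q')) cid)"

lemma kzero_iso:
 assumes X: "cplx R X" and Y: "cplx R Y" and "kzero R X" "kzero R Y"
 shows "K_iso R X Y" by (rule K_isoI[OF X Y cmap_zero[OF X Y] cmap_zero[OF Y X]])
  (use assms(3,4) in \<open>simp_all add: kzero_def heq_sym[OF X X cmap_id cmap_zero] heq_sym[OF Y Y cmap_id cmap_zero] X Y\<close>)

lemma kzero_cong:
 assumes X: "cplx R X" and Y: "cplx R Y" and XY: "K_iso R X Y" and z: "kzero R X"
 shows "kzero R Y"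
proof -
 obtain f g where fg: "cmap R X Y f" "cmap R Y X g" "heq R X X (g \<odot>c f) cid" "heq R Y Y (f \<odot>c g) cid"
  using XY by (rule K_isoE)
 have "heq R Y Y (f \<odot>c cid \<odot>c g) (czero Y)"
  by (rule heq_zero_sandwich[OF Y X X Y fg(1) cmap_id z[unfolded kzero_def] fg(2)])
 thus ?thesis unfolding kzero_def
  using heq_trans[OF Y Y cmap_zero[OF Y Y] heq_sym[OF Y Y cmap_comp[OF fg(1,2)] cmap_id fg(4)]] by simp
qed

lemma cadd_comm: "cplx R Y ==> cmap R X Y f ==> cmap R X Y g ==> ceq X (cadd Y f g) (cadd Y g f)"
 unfolding ceq_def cadd_def fst_conv snd_conv
 by (intro conjI ballI abelian_monoid.a_comm[OF abelian_group.axioms(1)[OF right_module.axioms(2)[OF cplxD(1)]]]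
   abelian_monoid.a_comm[OF abelian_group.axioms(1)[OF right_module.axioms(2)[OF cplxD(2)]]])
  (auto intro: rlin_cl cmapD)

lemma kbip_commute:
 assumes X: "cplx R X" and b: "kbip R X Y Z"
 shows "kbip R X Z Y"
proof -
 obtain j q j' q' where m: "cmap R Y X j" "cmap R X Y q" "cmap R Z X j'" "cmap R X Z q'"
  and e: "heq R Y Y (q \<odot>c j) cid" "heq R Z Z (q' \<odot>c j') cid" "heq R Y Z (q' \<odot>c j) (czero Z)"
  "heq R Z Y (q \<odot>c j') (czero Y)" "heq R X X (cadd X (j \<odot>c q) (j' \<odot>c q')) cid"
  using b unfolding kbip_def by blast
 have "heq R X X (cadd X (j' \<odot>c q') (j \<odot>c q)) cid"
  by (rule heq_ceq_trans[OF cadd_comm[OF X cmap_comp[OF m(3,4)] cmap_comp[OF m(1,2)]] e(5)])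
 thus ?thesis unfolding kbip_def using m e by blast
qed

lemma kbip_cong:
 assumes X: "cplx R X" and Y: "cplx R Y" and Z: "cplx R Z" and X': "cplx R X'"
  and b: "kbip R X Y Z" and XX: "K_iso R X X'"
 shows "kbip R X' Y Z"
proof -
 obtain j q j' q' where m: "cmap R Y X j" "cmap R X Y q" "cmap R Z X j'" "cmap R X Z q'"
  and e: "heq R Y Y (q \<odot>c j) cid" "heq R Z Z (q' \<odot>c j') cid" "heq R Y Z (q' \<odot>c j) (czero Z)"
  "heq R Z Y (q \<odot>c j') (czero Y)" "heq R X X (cadd X (j \<odot>c q) (j' \<odot>c q')) cid"
  using b unfolding kbip_def by blast
 obtain f g where fg: "cmap R X X' f" "cmap R X' X g" "heq R X X (g \<odot>c f) cid" "heq R X' X' (f \<odot>c g) cid"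
  using XX by (rule K_isoE)
 \<comment> \<open>Inserts the composite of f and g, homotopic to the identity of X, between a
   projection and an inclusion.\<close>
 have mid: "heq R U V (p \<odot>c g \<odot>c (f \<odot>c i)) w"
  if "cplx R U" "cplx R V" "cmap R X V p" "cmap R U X i" "heq R U V (p \<odot>c i) w" "cmap R U V w"
  for U :: "('a, 'u) two_term" and V :: "('a, 'v) two_term" and p i w
  using heq_trans[OF that(1,2,6) heq_id_sandwich[OF that(1) X that(2) that(3) cmap_comp[OF fg(2,1)] fg(3) that(4)] that(5)]
  by (simp add: ccomp_assoc)
 have sum: "heq R X' X' (cadd X' (f \<odot>c j \<odot>c (q \<odot>c g)) (f \<odot>c j' \<odot>c (q' \<odot>c g))) cid"
 proof (rule heq_ceq_trans)
  show "ceq X' (cadd X' (f \<odot>c j \<odot>c (q \<odot>c g)) (f \<odot>c j' \<odot>c (q' \<odot>c g)))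
    (f \<odot>c cadd X (j \<odot>c q) (j' \<odot>c q') \<odot>c g)" unfolding ceq_def cadd_def
   by (simp add: rlin_add[OF cmapD(1)[OF fg(1)]] rlin_add[OF cmapD(2)[OF fg(1)]] rlin_cl[OF cmapD(1)[OF m(1)]]
    rlin_cl[OF cmapD(1)[OF m(2)]] rlin_cl[OF cmapD(1)[OF m(3)]] rlin_cl[OF cmapD(1)[OF m(4)]]
    rlin_cl[OF cmapD(1)[OF fg(2)]]  rlin_cl[OF cmapD(2)[OF m(1)]]
    rlin_cl[OF cmapD(2)[OF m(2)]] rlin_cl[OF cmapD(2)[OF m(3)]] rlin_cl[OF cmapD(2)[OF m(4)]]
    rlin_cl[OF cmapD(2)[OF fg(2)]])
  show "heq R X' X' (f \<odot>c cadd X (j \<odot>c q) (j' \<odot>c q') \<odot>c g) cid"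
   by (rule heq_trans[OF X' X' cmap_id heq_id_sandwich[OF X' X X' fg(1) cmap_add[OF X cmap_comp[OF m(1,2)] cmap_comp[OF m(3,4)]] e(5) fg(2)] fg(4)])
 qed
 show ?thesis unfolding kbip_def
  by (rule exI[of _ "f \<odot>c j"], rule exI[of _ "q \<odot>c g"], rule exI[of _ "f \<odot>c j'"], rule exI[of _ "q' \<odot>c g"],
    intro conjI cmap_comp[OF fg(1) m(1)] cmap_comp[OF m(2) fg(2)] cmap_comp[OF fg(1) m(3)] cmap_comp[OF m(4) fg(2)] sum
    mid[OF Y Y m(2,1) e(1) cmap_id] mid[OF Z Z m(4,3) e(2) cmap_id] mid[OF Y Z m(4,1) e(3) cmap_zero[OF Y Z]]
    mid[OF Z Y m(2,3) e(4) cmap_zero[OF Z Y]])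
qed

lemma kbip_cong_left:
 assumes X: "cplx R X" and Y: "cplx R Y" and Z: "cplx R Z" and Y': "cplx R Y'"
  and b: "kbip R X Y Z" and YY: "K_iso R Y Y'"
 shows "kbip R X Y' Z"
proof -
 obtain j q j' q' where m: "cmap R Y X j" "cmap R X Y q" "cmap R Z X j'" "cmap R X Z q'"
  and e: "heq R Y Y (q \<odot>c j) cid" "heq R Z Z (q' \<odot>c j') cid" "heq R Y Z (q' \<odot>c j) (czero Z)"
  "heq R Z Y (q \<odot>c j') (czero Y)" "heq R X X (cadd X (j \<odot>c q) (j' \<odot>c q')) cid"
  using b unfolding kbip_def by blast
 obtain f g where fg: "cmap R Y Y' f" "cmap R Y' Y g" "heq R Y Y (g \<odot>c f) cid" "heq R Y' Y' (f \<odot>c g) cid"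
  using YY by (rule K_isoE)
 have 1: "heq R Y' Y' (f \<odot>c q \<odot>c (j \<odot>c g)) cid"
  using heq_trans[OF Y' Y' cmap_id heq_id_sandwich[OF Y' Y Y' fg(1) cmap_comp[OF m(2,1)] e(1) fg(2)] fg(4)]
  by (simp add: ccomp_assoc)
 have 2: "heq R Y' Z (q' \<odot>c (j \<odot>c g)) (czero Z)"
  using heq_comp_right[OF Y Y' fg(2) e(3)] by (simp add: ccomp_assoc)
 have 3: "heq R Z Y' (f \<odot>c q \<odot>c j') (czero Y')"
  using heq_zero_sandwich[OF Z Z Y Y' fg(1) cmap_comp[OF m(2,3)] e(4) cmap_id] by (simp add: ccomp_assoc)
 have "heq R X X (j \<odot>c (g \<odot>c f) \<odot>c q) (j \<odot>c q)"
  by (rule heq_id_sandwich[OF X Y X m(1) cmap_comp[OF fg(2,1)] fg(3) m(2)])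
 hence 4: "heq R X X (cadd X (j \<odot>c g \<odot>c (f \<odot>c q)) (j' \<odot>c q')) cid"
  using heq_trans[OF X X cmap_id heq_add[OF X X cmap_comp[OF m(1,2)] cmap_comp[OF m(3,4)] _ heq_refl[OF X X cmap_comp[OF m(3,4)]]] e(5)]
  by (simp add: ccomp_assoc)
 show ?thesis unfolding kbip_def
  by (rule exI[of _ "j \<odot>c g"], rule exI[of _ "f \<odot>c q"], rule exI[of _ j'], rule exI[of _ q'],
    intro conjI cmap_comp[OF m(1) fg(2)] cmap_comp[OF fg(1) m(2)] m(3,4) 1 e(2) 2 3 4)
qed

lemma kbip_cong_right:
 assumes "cplx R X" "cplx R Y" "cplx R Z" "cplx R Z'" "kbip R X Y Z" "K_iso R Z Z'"
 shows "kbip R X Y Z'"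
 by (rule kbip_commute[OF assms(1) kbip_cong_left[OF assms(1,3,2,4) kbip_commute[OF assms(1,5)] assms(6)]])

text \<open>The composite of the two canonical comparison maps expands into four terms. The two
  diagonal ones reduce to \<open>j \<odot>c q\<close> and \<open>j' \<odot>c q'\<close>; the two
  mixed ones are null-homotopic.\<close>

lemma kbip_unique_map:
 assumes X: "cplx R X" and Y: "cplx R Y" and Z: "cplx R Z" and X': "cplx R X'"
  and m: "cmap R Y X j" "cmap R X Y q" "cmap R Z X j'" "cmap R X Z q'"
  and e: "heq R X X (cadd X (j \<odot>c q) (j' \<odot>c q')) cid"
  and n: "cmap R Y X' k" "cmap R X' Y p" "cmap R Z X' k'" "cmap R X' Z p'"
  and d: "heq R Y Y (p \<odot>c k) cid" "heq R Z Z (p' \<odot>c k') cid" "heq R Y Z (p' \<odot>c k) (czero Z)"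
  "heq R Z Y (p \<odot>c k') (czero Y)"
 shows "heq R X X (cadd X (j \<odot>c p) (j' \<odot>c p') \<odot>c cadd X' (k \<odot>c q) (k' \<odot>c q')) cid"
proof -
 interpret X1: right_module R "tm1 X" by (rule cplxD[OF X])
 interpret X0: right_module R "t0 X" by (rule cplxD[OF X])
 let ?a = "j \<odot>c (p \<odot>c k) \<odot>c q" and ?b = "j \<odot>c (p \<odot>c k') \<odot>c q'"
  and ?c = "j' \<odot>c (p' \<odot>c k) \<odot>c q" and ?d = "j' \<odot>c (p' \<odot>c k') \<odot>c q'"
 note c1 = rlin_cl[OF cmapD(1)[OF m(1)]] rlin_cl[OF cmapD(1)[OF m(2)]] rlin_cl[OF cmapD(1)[OF m(3)]]
  rlin_cl[OF cmapD(1)[OF m(4)]] rlin_cl[OF cmapD(1)[OF n(1)]] rlin_cl[OF cmapD(1)[OF n(2)]]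
  rlin_cl[OF cmapD(1)[OF n(3)]] rlin_cl[OF cmapD(1)[OF n(4)]]
 note c0 = rlin_cl[OF cmapD(2)[OF m(1)]] rlin_cl[OF cmapD(2)[OF m(2)]] rlin_cl[OF cmapD(2)[OF m(3)]]
  rlin_cl[OF cmapD(2)[OF m(4)]] rlin_cl[OF cmapD(2)[OF n(1)]] rlin_cl[OF cmapD(2)[OF n(2)]]
  rlin_cl[OF cmapD(2)[OF n(3)]] rlin_cl[OF cmapD(2)[OF n(4)]]
 note a1 = rlin_add[OF cmapD(1)[OF m(1)]] rlin_add[OF cmapD(1)[OF m(3)]] rlin_add[OF cmapD(1)[OF n(2)]] rlin_add[OF cmapD(1)[OF n(4)]]
 note a0 = rlin_add[OF cmapD(2)[OF m(1)]] rlin_add[OF cmapD(2)[OF m(3)]] rlin_add[OF cmapD(2)[OF n(2)]] rlin_add[OF cmapD(2)[OF n(4)]]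
 have 1: "ceq X (cadd X (j \<odot>c p) (j' \<odot>c p') \<odot>c cadd X' (k \<odot>c q) (k' \<odot>c q')) (cadd X (cadd X ?a ?b) (cadd X ?c ?d))"
  unfolding ceq_def cadd_def by (simp add: c1 c0 a1 a0)
 have z: "cmap R X X (czero X)" by (rule cmap_zero[OF X X])
 have jq: "cmap R X X (j \<odot>c q)" "cmap R X X (j' \<odot>c q')" by (rule cmap_comp[OF m(1,2)] cmap_comp[OF m(3,4)])+
 have "heq R X X (cadd X (cadd X ?a ?b) (cadd X ?c ?d)) (cadd X (cadd X (j \<odot>c q) (czero X)) (cadd X (czero X) (j' \<odot>c q')))"
  by (intro heq_add[OF X X] cmap_add[OF X] jq z heq_id_sandwich[OF X Y X m(1) cmap_comp[OF n(2,1)] d(1) m(2)]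
   heq_id_sandwich[OF X Z X m(3) cmap_comp[OF n(4,3)] d(2) m(4)]
   heq_zero_sandwich[OF X Z Y X m(1) cmap_comp[OF n(2,3)] d(4) m(4)]
   heq_zero_sandwich[OF X Y Z X m(3) cmap_comp[OF n(4,1)] d(3) m(2)])
 moreover have "heq R X X (cadd X (cadd X (j \<odot>c q) (czero X)) (cadd X (czero X) (j' \<odot>c q'))) cid"
  by (rule heq_ceq_trans[OF _ e]) (simp add: ceq_def cadd_def czero_def c1 c0)
 ultimately show ?thesis by (intro heq_ceq_trans[OF 1]) (rule heq_trans[OF X X cmap_id])
qed

lemma kbip_unique:
 assumes X: "cplx R X" and Y: "cplx R Y" and Z: "cplx R Z" and X': "cplx R X'"
  and b: "kbip R X Y Z" and b': "kbip R X' Y Z"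
 shows "K_iso R X X'"
proof -
 obtain j q j' q' where m: "cmap R Y X j" "cmap R X Y q" "cmap R Z X j'" "cmap R X Z q'"
  and e: "heq R Y Y (q \<odot>c j) cid" "heq R Z Z (q' \<odot>c j') cid" "heq R Y Z (q' \<odot>c j) (czero Z)"
  "heq R Z Y (q \<odot>c j') (czero Y)" "heq R X X (cadd X (j \<odot>c q) (j' \<odot>c q')) cid"
  using b unfolding kbip_def by blast
 obtain k p k' p' where n: "cmap R Y X' k" "cmap R X' Y p" "cmap R Z X' k'" "cmap R X' Z p'"
  and d: "heq R Y Y (p \<odot>c k) cid" "heq R Z Z (p' \<odot>c k') cid" "heq R Y Z (p' \<odot>c k) (czero Z)"
  "heq R Z Y (p \<odot>c k') (czero Y)" "heq R X' X' (cadd X' (k \<odot>c p) (k' \<odot>c p')) cid"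
  using b' unfolding kbip_def by blast
 show ?thesis
  by (rule K_isoI[OF X X' cmap_add[OF X' cmap_comp[OF n(1) m(2)] cmap_comp[OF n(3) m(4)]]
     cmap_add[OF X cmap_comp[OF m(1) n(2)] cmap_comp[OF m(3) n(4)]]
     kbip_unique_map[OF X Y Z X' m e(5) n d(1-4)] kbip_unique_map[OF X' Y Z X n d(5) m e(1-4)]])
qed

text \<open>A contractible summand contributes the null-homotopic term \<open>j' \<odot>c q'\<close>
  to the identity of X, so j and q alone are inverse up to homotopy.\<close>

lemma kbip_kzero:
 assumes X: "cplx R X" and Y: "cplx R Y" and Z: "cplx R Z"
  and b: "kbip R X Y Z" and z: "kzero R Z"
 shows "K_iso R X Y"
proof -
 interpret X1: right_module R "tm1 X" by (rule cplxD[OF X])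
 interpret X0: right_module R "t0 X" by (rule cplxD[OF X])
 obtain j q j' q' where m: "cmap R Y X j" "cmap R X Y q" "cmap R Z X j'" "cmap R X Z q'"
  and e: "heq R Y Y (q \<odot>c j) cid" "heq R X X (cadd X (j \<odot>c q) (j' \<odot>c q')) cid"
  using b unfolding kbip_def by blast
 have jq: "cmap R X X (j \<odot>c q)" "cmap R X X (j' \<odot>c q')" by (rule cmap_comp[OF m(1,2)] cmap_comp[OF m(3,4)])+
 have z': "cmap R X X (czero X)" by (rule cmap_zero[OF X X])
 have "heq R X X (j' \<odot>c cid \<odot>c q') (czero X)"
  by (rule heq_zero_sandwich[OF X Z Z X m(3) cmap_id z[unfolded kzero_def] m(4)])
 hence "heq R X X (czero X) (j' \<odot>c q')" using heq_sym[OF X X jq(2) z'] by simp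
 hence "heq R X X (cadd X (j \<odot>c q) (czero X)) (cadd X (j \<odot>c q) (j' \<odot>c q'))"
  by (rule heq_add[OF X X jq heq_refl[OF X X jq(1)]])
 hence "heq R X X (cadd X (j \<odot>c q) (czero X)) cid" by (rule heq_trans[OF X X cmap_id _ e(2)])
 hence "heq R X X (j \<odot>c q) cid"
  by (rule heq_ceq_trans[rotated]) (simp add: ceq_def cadd_def czero_def rlin_cl[OF cmapD(1)[OF jq(1)], simplified]
   rlin_cl[OF cmapD(2)[OF jq(1)], simplified])
 thus ?thesis by (intro K_isoI[OF X Y m(2,1) _ e(1)])
qed

lemma ceq_iso_K_iso:
 assumes X: "cplx R X" and Y: "cplx R Y" and f: "cmap R X Y f" and g: "cmap R Y X g"
  and "ceq X (g \<odot>c f) cid" "ceq Y (f \<odot>c g) cid"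
 shows "K_iso R X Y"
 by (rule K_isoI[OF X Y f g heq_ceq[OF X X cmap_id assms(5)] heq_ceq[OF Y Y cmap_id assms(6)]])

lemma K_dsum_simps:
 "tm1 (K_dsum Xs) = rmod_dsum (map tm1 Xs)" "t0 (K_dsum Xs) = rmod_dsum (map t0 Xs)"
 "x \<in> car (rmod_dsum (map tm1 Xs)) ==>
  tdiff (K_dsum Xs) x = (\<lambda>j\<in>{..<length Xs}. tdiff (Xs ! j) (x j))"
 by (simp_all add: K_dsum_def)

lemma tdiff_K_dsum_ext: "tdiff (K_dsum Xs) \<in> extensional (car (tm1 (K_dsum Xs)))"
 by (simp add: K_dsum_def)

lemma K_dsum_cplx:
 assumes R: "ring R" and "\<And>X. X \<in> set Xs ==> cplx R X"
 shows "cplx R (K_dsum Xs)"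
proof -
 have c: "cplx R (Xs ! j)" if "j < length Xs" for j using assms(2) that by simp
 note l = cplxD(3)[OF c]
 have m: "right_module R (rmod_dsum (map tm1 Xs))" "right_module R (rmod_dsum (map t0 Xs))"
 proof -
  have "right_module R M" if M: "M \<in> set (map tm1 Xs)" for M
  proof -
   obtain X where "X \<in> set Xs" "M = tm1 X" using M by auto
   thus ?thesis using cplxD(1)[OF assms(2)] by simp
  qed
  thus "right_module R (rmod_dsum (map tm1 Xs))" by (rule dsum_module[OF R])
  have "right_module R M" if M: "M \<in> set (map t0 Xs)" for M
  proof -
   obtain X where "X \<in> set Xs" "M = t0 X" using M by auto
   thus ?thesis using cplxD(2)[OF assms(2)] by simp
  qed
  thus "right_module R (rmod_dsum (map t0 Xs))" by (rule dsum_module[OF R])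
 qed
 have mem: "x j \<in> car (tm1 (Xs ! j))" if x: "x \<in> car (rmod_dsum (map tm1 Xs))" and j: "j < length Xs" for x j
  using PiE_mem[OF x[unfolded dsum_simps(1)], of j] j by simp
 interpret M: right_module R "rmod_dsum (map tm1 Xs)" by (rule m)
 have "rlin R (tm1 (K_dsum Xs)) (t0 (K_dsum Xs)) (tdiff (K_dsum Xs))" unfolding K_dsum_simps(1,2)
 proof (rule rlinI)
  fix x assume x: "x \<in> car (rmod_dsum (map tm1 Xs))"
  show "tdiff (K_dsum Xs) x \<in> car (rmod_dsum (map t0 Xs))"
   unfolding K_dsum_simps(3)[OF x] dsum_simps(1) length_map restrict_PiE_iff
  proof
   fix j assume "j \<in> {..<length Xs}"
   hence j: "j < length Xs" by simp
   show "tdiff (Xs ! j) (x j) \<in> car (map t0 Xs ! j)"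
    unfolding nth_map[OF j] by (rule rlin_cl[OF l[OF j] mem[OF x j]])
  qed
  fix a assume a: "a \<in> car R"
  show "tdiff (K_dsum Xs) (a \<odot>\<^bsub>rmod_dsum (map tm1 Xs)\<^esub> x) = a \<odot>\<^bsub>rmod_dsum (map t0 Xs)\<^esub> tdiff (K_dsum Xs) x"
   unfolding K_dsum_simps(3)[OF x] K_dsum_simps(3)[OF M.act_closed[OF a x]]
   by (rule dsum_cong[of _ "length Xs"]) (simp_all add: dsum_simps rlin_act[OF l a mem[OF x]])
 next
  fix x y assume x: "x \<in> car (rmod_dsum (map tm1 Xs))" and y: "y \<in> car (rmod_dsum (map tm1 Xs))"
  show "tdiff (K_dsum Xs) (x \<oplus>\<^bsub>rmod_dsum (map tm1 Xs)\<^esub> y) = tdiff (K_dsum Xs) x \<oplus>\<^bsub>rmod_dsum (map t0 Xs)\<^esub> tdiff (K_dsum Xs) y"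
   unfolding K_dsum_simps(3)[OF x] K_dsum_simps(3)[OF y] K_dsum_simps(3)[OF M.M.add.m_closed[OF x y]]
   by (rule dsum_cong[of _ "length Xs"]) (simp_all add: dsum_simps rlin_add[OF l mem[OF x] mem[OF y]])
 qed
 with m show ?thesis by (simp add: cplx_def K_dsum_simps)
qed

lemma tdiff_K_dsum_Cons:
 assumes "x \<in> car (rmod_dsum (map tm1 (Y # Ys)))"
 shows "tdiff (K_dsum (Y # Ys)) x = dcons (length Ys) (tdiff Y (x 0)) (tdiff (K_dsum Ys) (dtl (length Ys) x))"
proof -
 have t: "dtl (length Ys) x \<in> car (rmod_dsum (map tm1 Ys))"
  using dtl_closed[of x "tm1 Y" "map tm1 Ys"] assms by simp
 show ?thesis unfolding K_dsum_simps(3)[OF assms] K_dsum_simps(3)[OF t]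
  by (rule dsum_cong[of _ "Suc (length Ys)"]) (auto simp: dcons_def dtl_def split: nat.split)
qed

text \<open>The differential of a sum acts componentwise, so the module biproducts in the two
  degrees assemble to chain maps, and the identities even hold strictly.\<close>

lemma kbip_K_dsum:
 assumes R: "ring R" and Y: "cplx R Y" and Ys: "\<And>X. X \<in> set Ys ==> cplx R X"
 shows "kbip R (K_dsum (Y # Ys)) Y (K_dsum Ys)"
proof -
 let ?X = "K_dsum (Y # Ys)" and ?Z = "K_dsum Ys" and ?n = "length Ys"
 have Z: "cplx R ?Z" by (rule K_dsum_cplx[OF R Ys])
 have X: "cplx R ?X" by (rule K_dsum_cplx[OF R]) (use Y Ys in auto)
 note z = cplxD[OF Z, unfolded K_dsum_simps(1,2)]
 note b1 = dsum_biproduct[OF cplxD(1)[OF Y] z(1), unfolded length_map]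
  and b0 = dsum_biproduct[OF cplxD(2)[OF Y] z(2), unfolded length_map]
 note h1 = rlin_dhd[of R "tm1 Y" "map tm1 Ys"] rlin_dtl[of R "tm1 Y" "map tm1 Ys", unfolded length_map]
  and h0 = rlin_dhd[of R "t0 Y" "map t0 Ys"] rlin_dtl[of R "t0 Y" "map t0 Ys", unfolded length_map]
 let ?j = "(dinl (map tm1 Ys), dinl (map t0 Ys))" and ?q = "(\<lambda>x. x 0, \<lambda>x. x 0)"
  and ?j' = "(dinr (tm1 Y) (map tm1 Ys), dinr (t0 Y) (map t0 Ys))" and ?q' = "(dtl ?n, dtl ?n)"
 have d: "tdiff ?X x = dcons ?n (tdiff Y (x 0)) (tdiff ?Z (dtl ?n x))" if "x \<in> car (rmod_dsum (tm1 Y # map tm1 Ys))" for x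
  using tdiff_K_dsum_Cons[of x Y Ys] that by simp
 have ez: "tdiff ?Z y \<in> extensional {..<?n}" if "y \<in> car (rmod_dsum (map tm1 Ys))" for y
  using rmod_dsum_ext[OF rlin_cl[OF z(3) that]] by simp
 have j: "cmap R Y ?X ?j" unfolding cmap_def K_dsum_simps(1,2) list.map fst_conv snd_conv
  using b1(1) b0(1) d[OF rlin_cl[OF b1(1)]] b1(3,4) rlin_zero[OF z]
  by (simp add: dinl_def[of "map t0 Ys"])
 have j': "cmap R ?Z ?X ?j'" unfolding cmap_def K_dsum_simps(1,2) list.map fst_conv snd_conv
  using b1(2) b0(2) d[OF rlin_cl[OF b1(2)]] b1(5,6) rlin_zero[OF cplxD[OF Y]]
  by (simp add: dinr_def[of "t0 Y"])
 have q: "cmap R ?X Y ?q" unfolding cmap_def K_dsum_simps(1,2) list.map fst_conv snd_conv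
  using h1(1) h0(1) d by simp
 have q': "cmap R ?X ?Z ?q'" unfolding cmap_def K_dsum_simps(1,2) list.map fst_conv snd_conv
  using h1(2) h0(2) d ez[OF rlin_cl[OF h1(2)]] by simp
 show ?thesis unfolding kbip_def
  by (rule exI[of _ ?j], rule exI[of _ ?q], rule exI[of _ ?j'], rule exI[of _ ?q'], intro conjI j q j' q'
    heq_ceq[OF Y Y cmap_id] heq_ceq[OF Z Z cmap_id] heq_ceq[OF Y Z cmap_zero[OF Y Z]]
    heq_ceq[OF Z Y cmap_zero[OF Z Y]] heq_ceq[OF X X cmap_id])
   (simp_all add: ceq_def czero_def cadd_def K_dsum_simps(1,2) b1(3-7) b0(3-7))
qed

lemma kzero_K_dsum_Nil:
 assumes "ring R"
 shows "kzero R (K_dsum ([] :: ('a, 'm) two_term list))"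
proof -
 have "cplx R (K_dsum ([] :: ('a, 'm) two_term list))" by (rule K_dsum_cplx[OF assms]) simp
 thus ?thesis unfolding kzero_def
  by (intro heq_ceq cmap_zero) (auto simp: ceq_def czero_def K_dsum_simps dsum_simps restrict_def)
qed

lemma K_zero_iff:
 fixes X :: "('a, 'm) two_term"
 assumes R: "ring R" and X: "cplx R X"
 shows "K_zero R X \<longleftrightarrow> kzero R X"
proof -
 have N: "cplx R (K_dsum ([] :: ('a, 'm) two_term list))" by (rule K_dsum_cplx[OF R]) simp
 show ?thesis unfolding K_zero_def
  using kzero_iso[OF X N _ kzero_K_dsum_Nil[OF R]] kzero_cong[OF N X K_iso_sym[OF X N] kzero_K_dsum_Nil[OF R]]
  by blast
qed

lemma K_dsum_single:
 assumes R: "ring R" and X: "cplx R X"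
 shows "K_iso R (K_dsum [X]) X"
 by (rule kbip_kzero[OF K_dsum_cplx[OF R] X K_dsum_cplx[OF R] kbip_K_dsum[OF R X] kzero_K_dsum_Nil[OF R]])
  (use X in auto)

lemma K_iso_pair_iff:
 assumes R: "ring R" and X: "cplx R X" and Y: "cplx R Y" and Z: "cplx R Z"
 shows "K_iso R X (K_dsum [Y, Z]) \<longleftrightarrow> kbip R X Y Z"
proof -
 have c: "cplx R (K_dsum [Y, Z])" "cplx R (K_dsum [Z])"
  by (rule K_dsum_cplx[OF R], use Y Z in auto)+
 have b: "kbip R (K_dsum [Y, Z]) Y Z"
  by (rule kbip_cong_right[OF c(1) Y c(2) Z kbip_K_dsum[OF R Y] K_dsum_single[OF R Z]]) (use Z in auto)
 show ?thesis
  using kbip_cong[OF c(1) Y Z X b K_iso_sym[OF X c(1)]] kbip_unique[OF X Y Z c(1) _ b] by blast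
qed

text \<open>Up to isomorphism a finitely generated projective module lives on the type of the free
 modules.\<close>

lemma fg_projective_copy:
 fixes P :: "('a, 'm) module" and R :: "('a, 'r) ring_scheme"
 assumes "fg_projective R P"
 obtains P' :: "('a, nat => 'a) module" and f g where "fg_projective R P'" "rlin R P P' f" "rlin R P' P g"
  "\<And>x. x \<in> car P ==> g (f x) = x" "\<And>y. y \<in> car P' ==> f (g y) = y"
proof -
 note P = fg_projective_module[OF assms]
 interpret P: right_module R P by (rule P)
 obtain k i p where ip: "rlin R P (free_module R k) i" "rlin R (free_module R k) P p"
  "\<And>x. x \<in> car P ==> p (i x) = x" using fg_projectiveE[OF assms] by metis
 let ?P' = "(free_module R k)\<lparr>carrier := i ` car P\<rparr>"
 note F = P.R.free_module_is_module[of k]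
 have m: "right_module R ?P'"
  by (rule right_module_image[OF P P.R.ring_axioms P.R.id_ring_hom, of i])
   (simp_all add: rlin_zero[OF P F ip(1)] rlin_add[OF ip(1)] rlin_act[OF ip(1)])
 have i: "rlin R P ?P' i" by (rule rlinI) (simp_all add: rlin_add[OF ip(1)] rlin_act[OF ip(1)])
 have p: "rlin R ?P' P p"
  using rlin_cl[OF ip(1)] by (intro rlinI) (auto simp: rlin_cl[OF ip(2)] rlin_add[OF ip(2)] rlin_act[OF ip(2)])
 have pi: "i (p y) = y" if "y \<in> car ?P'" for y using that ip(3) by auto
 show thesis by (rule that[OF fg_projective_retract[OF assms m p i pi] i p ip(3) pi])
qed

text \<open>\<open>indec_K\<close> and \<open>ind_K\<close> speak about complexes over
  \<open>nat => 'a\<close> only; complexes with other element types are moved there first.\<close>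

lemma two_term_copy:
 fixes X :: "('a, 'm) two_term" and R :: "('a, 'r) ring_scheme"
 assumes "two_term_proj R X"
 obtains X' :: "('a, nat => 'a) two_term" where "two_term_proj R X'" "K_iso R X X'"
proof -
 have X: "fg_projective R (tm1 X)" "fg_projective R (t0 X)" "rlin R (tm1 X) (t0 X) (tdiff X)"
  using assms by (auto simp: two_term_proj_def rhom_iff)
 obtain P :: "('a, nat => 'a) module" and f g where P: "fg_projective R P" "rlin R (tm1 X) P f" "rlin R P (tm1 X) g"
  "\<And>x. x \<in> car (tm1 X) ==> g (f x) = x" "\<And>y. y \<in> car P ==> f (g y) = y"
  using fg_projective_copy[OF X(1)] by metis
 obtain Q :: "('a, nat => 'a) module" and k l where Q: "fg_projective R Q" "rlin R (t0 X) Q k" "rlin R Q (t0 X) l"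
  "\<And>x. x \<in> car (t0 X) ==> l (k x) = x" "\<And>y. y \<in> car Q ==> k (l y) = y"
  using fg_projective_copy[OF X(2)] by metis
 let ?X' = "\<lparr>tm1 = P, t0 = Q, tdiff = restrict (k \<circ> (tdiff X \<circ> g)) (car P)\<rparr>"
 have X': "two_term_proj R ?X'"
  using P Q by (simp add: two_term_proj_def rlin_restrict[OF fg_projective_module[OF P(1)] rlin_o[OF Q(2) rlin_o[OF X(3) P(3)]]])
 note c = ttp_cplx[OF assms] ttp_cplx[OF X']
 have "K_iso R X ?X'" by (rule ceq_iso_K_iso[OF c, of "(f, k)" "(g, l)"])
   (simp_all add: cmap_def ceq_def P Q rlin_cl[OF P(2)] rlin_cl[OF P(3)] rlin_cl[OF X(3)])
 with X' show thesis by (rule that)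
qed

text \<open>Apply the alternative to e = j q, which is idempotent only up to homotopy. If e is
  nilpotent then Y is contractible, and if e is bijective then Z is.\<close>

lemma kbip_zero_cases:
 assumes X: "cplx R X" and Y: "cplx R Y" and Z: "cplx R Z" and b: "kbip R X Y Z"
  and loc: "\<And>f. cmap R X X f ==>
   (\<exists>n. (\<forall>x\<in>car (tm1 X). (fst f ^^ n) x = \<zero>\<^bsub>tm1 X\<^esub>) \<and> (\<forall>x\<in>car (t0 X). (snd f ^^ n) x = \<zero>\<^bsub>t0 X\<^esub>)) \<or>
   bij_betw (fst f) (car (tm1 X)) (car (tm1 X)) \<and> bij_betw (snd f) (car (t0 X)) (car (t0 X))"
 shows "kzero R Y \<or> kzero R Z"
proof -
 obtain j q j' q' where m: "cmap R Y X j" "cmap R X Y q" "cmap R Z X j'" "cmap R X Z q'"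
  and e: "heq R Y Y (q \<odot>c j) cid" "heq R Z Z (q' \<odot>c j') cid" "heq R Z Y (q \<odot>c j') (czero Y)"
  using b unfolding kbip_def by blast
 let ?e = "j \<odot>c q"
 have em: "cmap R X X ?e" by (rule cmap_comp[OF m(1,2)])
 from loc[OF em] show ?thesis
 proof (elim disjE exE conjE)
  fix n assume n: "\<forall>x\<in>car (tm1 X). (fst ?e ^^ n) x = \<zero>\<^bsub>tm1 X\<^esub>" "\<forall>x\<in>car (t0 X). (snd ?e ^^ n) x = \<zero>\<^bsub>t0 X\<^esub>"
  \<comment> \<open>The composite q e^k j is a power of q j, hence homotopic to the identity of Y;
    for nilpotent e it eventually vanishes.\<close>
  have pw: "cmap R X X (fst ?e ^^ k, snd ?e ^^ k) \<and> heq R Y Y (q \<odot>c (fst ?e ^^ k, snd ?e ^^ k) \<odot>c j) cid" for k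
  proof (induction k)
   case 0
   thus ?case using e(1) cmap_id by (simp add: id_def[symmetric])
  next
   case (Suc k)
   let ?p = "(fst ?e ^^ k, snd ?e ^^ k)"
   have s: "(fst ?e ^^ Suc k, snd ?e ^^ Suc k) = ?e \<odot>c ?p" by (simp add: ccomp_def)
   have c: "cmap R X X (?e \<odot>c ?p)" by (rule cmap_comp[OF em conjunct1[OF Suc]])
   have "heq R Y Y (cid \<odot>c (q \<odot>c j) \<odot>c (q \<odot>c ?p \<odot>c j)) (cid \<odot>c (q \<odot>c ?p \<odot>c j))"
    by (rule heq_id_sandwich[OF Y Y Y cmap_id cmap_comp[OF m(2,1)] e(1)]) (intro cmap_comp[OF _ m(1)] cmap_comp[OF m(2)] conjunct1[OF Suc])
   hence "heq R Y Y (q \<odot>c (?e \<odot>c ?p) \<odot>c j) (q \<odot>c ?p \<odot>c j)"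
    by (simp only: ccomp_assoc ccomp_id)
   hence "heq R Y Y (q \<odot>c (?e \<odot>c ?p) \<odot>c j) cid"
    by (rule heq_trans[OF Y Y cmap_id _ conjunct2[OF Suc]])
   with c show ?case unfolding s by blast
  qed
  let ?p = "(fst ?e ^^ n, snd ?e ^^ n)"
  have "ceq Y (q \<odot>c ?p \<odot>c j) (czero Y)"
   using n by (simp add: ceq_def czero_def rlin_cl[OF cmapD(1)[OF m(1)]] rlin_cl[OF cmapD(2)[OF m(1)]]
    rlin_zero[OF cplxD(1)[OF X] cplxD(1)[OF Y] cmapD(1)[OF m(2)]] rlin_zero[OF cplxD(2)[OF X] cplxD(2)[OF Y] cmapD(2)[OF m(2)]])
  hence z: "heq R Y Y (q \<odot>c ?p \<odot>c j) (czero Y)"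
   by (rule heq_ceq[OF Y Y cmap_zero[OF Y Y]])
  have c: "cmap R Y Y (q \<odot>c ?p \<odot>c j)"
   by (intro cmap_comp[OF _ m(1)] cmap_comp[OF m(2)] conjunct1[OF pw])
  have "kzero R Y" unfolding kzero_def
   by (rule heq_trans[OF Y Y cmap_zero[OF Y Y] heq_sym[OF Y Y c cmap_id conjunct2[OF pw]] z])
  thus ?thesis ..
 next
  \<comment> \<open>A bijective e has a strict inverse d. Since e j' = j (q j') is null-homotopic,
    so is q' j' = q' d e j', which is also homotopic to the identity of Z.\<close>
  assume bij: "bij_betw (fst ?e) (car (tm1 X)) (car (tm1 X))" "bij_betw (snd ?e) (car (t0 X)) (car (t0 X))"
  obtain d1 where d1: "rlin R (tm1 X) (tm1 X) d1" "\<And>x. x \<in> car (tm1 X) ==> d1 (fst ?e x) = x"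
   "\<And>x. x \<in> car (tm1 X) ==> fst ?e (d1 x) = x"
   using rlin_inverse[OF cplxD(1)[OF X] cmapD(1)[OF em] bij(1)] by metis
  obtain d0 where d0: "rlin R (t0 X) (t0 X) d0" "\<And>x. x \<in> car (t0 X) ==> d0 (snd ?e x) = x"
   using rlin_inverse[OF cplxD(2)[OF X] cmapD(2)[OF em] bij(2)] by metis
  have "d0 (tdiff X x) = tdiff X (d1 x)" if x: "x \<in> car (tm1 X)" for x
  proof -
   have "tdiff X x = snd ?e (tdiff X (d1 x))"
    using cmapD(3)[OF em rlin_cl[OF d1(1) x]] d1(3)[OF x] by simp
   thus ?thesis using d0(2)[OF rlin_cl[OF cplxD(3)[OF X] rlin_cl[OF d1(1) x]]] by simp
  qed
  hence d: "cmap R X X (d1, d0)" by (simp add: cmap_def d1 d0)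
  have "heq R Z X (j \<odot>c (q \<odot>c j') \<odot>c cid) (czero X)"
   by (rule heq_zero_sandwich[OF Z Z Y X m(1) cmap_comp[OF m(2,3)] e(3) cmap_id])
  hence "heq R Z X (?e \<odot>c j') (czero X)" by (simp add: ccomp_assoc)
  hence "heq R Z Z (q' \<odot>c (d1, d0) \<odot>c (?e \<odot>c j') \<odot>c cid) (czero Z)"
   by (intro heq_zero_sandwich[OF Z Z X Z cmap_comp[OF m(4) d] cmap_comp[OF em m(3)] _ cmap_id])
  moreover have "ceq Z (q' \<odot>c j') (q' \<odot>c (d1, d0) \<odot>c (?e \<odot>c j') \<odot>c cid)"
   using d1(2)[OF rlin_cl[OF cmapD(1)[OF m(3)]]] d0(2)[OF rlin_cl[OF cmapD(2)[OF m(3)]]]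
   by (simp add: ceq_def)
  ultimately have "heq R Z Z (q' \<odot>c j') (czero Z)" by (rule heq_ceq_trans[rotated])
  hence "kzero R Z" unfolding kzero_def
   by (rule heq_trans[OF Z Z cmap_zero[OF Z Z] heq_sym[OF Z Z cmap_comp[OF m(4,3)] cmap_id e(2)]])
  thus ?thesis ..
 qed
qed

section \<open>Fitting decompositions and complexes with local endomorphisms\<close>

definition eloc :: "('a, 'r) ring_scheme => ('a, 'm) module => bool" where
 "eloc R M \<longleftrightarrow> (\<forall>f. rlin R M M f \<longrightarrow>
  (\<exists>n. \<forall>x\<in>car M. (f ^^ n) x = \<zero>\<^sub>M) \<or> bij_betw f (car M) (car M))"

text \<open>Like \<open>eloc\<close>, this is locality of the endomorphism ring in Fitting form, now
  for chain endomorphisms: one exponent serves both degrees and homotopies are not involved. Zero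
  objects satisfy both conditions.\<close>

definition cloc :: "('a, 'r) ring_scheme => ('a, 'm) two_term => bool" where
 "cloc R X \<longleftrightarrow> (\<forall>f. cmap R X X f \<longrightarrow>
   (\<exists>n. (\<forall>x\<in>car (tm1 X). (fst f ^^ n) x = \<zero>\<^bsub>tm1 X\<^esub>) \<and> (\<forall>x\<in>car (t0 X). (snd f ^^ n) x = \<zero>\<^bsub>t0 X\<^esub>)) \<or>
   bij_betw (fst f) (car (tm1 X)) (car (tm1 X)) \<and> bij_betw (snd f) (car (t0 X)) (car (t0 X)))"

lemma rlin_funpow: "rlin R M M f ==> rlin R M M (f ^^ n)"
proof (induction n)
 case 0
 thus ?case using rlin_id[of R M] by (simp add: id_def)
next
 case (Suc n)
 thus ?case unfolding funpow.simps(2) by (intro rlin_o)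
qed

lemma bij_betw_of_funpow:
 assumes "f \<in> S \<rightarrow> S" "bij_betw (f ^^ n) S S" "n \<ge> 1"
 shows "bij_betw f S S"
proof -
 obtain m where n: "n = Suc m" using assms(3) by (cases n) auto
 have cl: "(f ^^ k) x \<in> S" if "x \<in> S" for k x using that assms(1) by (induction k) auto
 show ?thesis
 proof (rule bij_betw_imageI)
  show "inj_on f S"
  proof (rule inj_onI)
   fix x y assume xy: "x \<in> S" "y \<in> S" "f x = f y"
   hence "(f ^^ n) x = (f ^^ n) y" by (simp add: n funpow_swap1)
   thus "x = y" using assms(2) xy by (auto simp: bij_betw_def dest: inj_onD)
  qed
  show "f ` S = S"
  proof
   show "f ` S \<subseteq> S" using assms(1) by auto
   show "S \<subseteq> f ` S"
   proof
    fix y assume "y \<in> S"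
    hence "y \<in> (f ^^ n) ` S" using assms(2) by (simp add: bij_betw_def)
    then obtain x where "x \<in> S" "y = (f ^^ n) x" by blast
    hence "y = f ((f ^^ m) x)" "(f ^^ m) x \<in> S" using cl by (simp_all add: n)
    thus "y \<in> f ` S" by blast
   qed
  qed
 qed
qed

text \<open>For an idempotent chain endomorphism this is a direct summand
  (\<open>kbip_csub\<close>). It keeps the element type of X, so repeated splitting stays within one
  type.\<close>

definition csub :: "('a, 'm) two_term => ('m => 'm) \<times> ('m => 'm) => ('a, 'm) two_term" where
 "csub X e = \<lparr>tm1 = (tm1 X)\<lparr>carrier := fst e ` car (tm1 X)\<rparr>, t0 = (t0 X)\<lparr>carrier := snd e ` car (t0 X)\<rparr>,
   tdiff = restrict (tdiff X) (fst e ` car (tm1 X))\<rparr>"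

definition ccompl :: "('a, 'm) two_term => ('m => 'm) \<times> ('m => 'm) => ('m => 'm) \<times> ('m => 'm)" where
 "ccompl X e = (\<lambda>x. x \<ominus>\<^bsub>tm1 X\<^esub> fst e x, \<lambda>x. x \<ominus>\<^bsub>t0 X\<^esub> snd e x)"

definition midem :: "('a, 'r) ring_scheme => ('a, 'm) module => ('m => 'm) => bool" where
 "midem R M e \<longleftrightarrow> rlin R M M e \<and> (\<forall>x\<in>car M. e (e x) = e x)"

lemma midem_facts:
 assumes M: "right_module R M" and e: "midem R M e"
 defines "N \<equiv> M\<lparr>carrier := e ` car M\<rparr>"
 shows "right_module R N" "rlin R M N e" "rlin R N M id" "\<And>y. y \<in> car N ==> e y = y"
  "midem R M (\<lambda>x. x \<ominus>\<^sub>M e x)"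
  "\<And>x. x \<in> car M ==> e (x \<ominus>\<^sub>M e x) = \<zero>\<^sub>M" "\<And>x. x \<in> car M ==> e x \<oplus>\<^sub>M (x \<ominus>\<^sub>M e x) = x"
proof -
 interpret M: right_module R M by fact
 have l: "rlin R M M e" and ee: "\<And>x. x \<in> car M ==> e (e x) = e x"
  using e by (auto simp: midem_def)
 show "right_module R N" unfolding N_def
  by (rule M.submodule_is_module[OF rlin_image_submodule[OF M M l]])
 show "rlin R M N e" "rlin R N M id" using l by (auto simp: N_def rlin_def)
 show "e y = y" if "y \<in> car N" for y using that ee by (auto simp: N_def)
 have c: "rlin R M M (\<lambda>x. x \<ominus>\<^sub>M e x)"
  unfolding a_minus_def using rlin_plus[OF M rlin_id rlin_uminus[OF M l]] by simp
 show ez: "e (x \<ominus>\<^sub>M e x) = \<zero>\<^sub>M" if x: "x \<in> car M" for x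
  using x rlin_cl[OF l] by (simp add: a_minus_def rlin_add[OF l] rlin_minus[OF M M l] ee M.M.r_neg)
 show "midem R M (\<lambda>x. x \<ominus>\<^sub>M e x)"
  unfolding midem_def using c ez rlin_cl[OF c] by (auto simp: a_minus_def M.M.minus_equality[of "\<zero>\<^sub>M" "\<zero>\<^sub>M"])
 show "e x \<oplus>\<^sub>M (x \<ominus>\<^sub>M e x) = x" if x: "x \<in> car M" for x
  using x rlin_cl[OF l x] M.M.a_comm[of x "\<ominus>\<^sub>M e x"] by (simp add: a_minus_def M.M.a_assoc[symmetric] M.M.r_neg)
qed

lemma csub_two_term_proj:
 assumes X: "two_term_proj R X" and e: "cmap R X X e" "midem R (tm1 X) (fst e)" "midem R (t0 X) (snd e)"
 shows "two_term_proj R (csub X e)"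
proof -
 have P: "fg_projective R (tm1 X)" "fg_projective R (t0 X)" "rlin R (tm1 X) (t0 X) (tdiff X)"
  using X by (auto simp: two_term_proj_def rhom_iff)
 note m1 = midem_facts[OF fg_projective_module[OF P(1)] e(2)] and m0 = midem_facts[OF fg_projective_module[OF P(2)] e(3)]
 have "fg_projective R (tm1 (csub X e))" unfolding csub_def two_term.select_convs
  by (rule fg_projective_retract[OF P(1) m1(1,3,2)], unfold id_apply, rule m1(4))
 moreover have "fg_projective R (t0 (csub X e))" unfolding csub_def two_term.select_convs
  by (rule fg_projective_retract[OF P(2) m0(1,3,2)], unfold id_apply, rule m0(4))
 moreover have "rlin R (tm1 (csub X e)) (t0 (csub X e)) (tdiff X)"
 proof (rule rlinI)
  fix x assume "x \<in> car (tm1 (csub X e))"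
  then obtain y where y: "y \<in> car (tm1 X)" "x = fst e y" by (auto simp: csub_def)
  hence "tdiff X x = snd e (tdiff X y)" using cmapD(3)[OF e(1)] by simp
  thus "tdiff X x \<in> car (t0 (csub X e))" using rlin_cl[OF P(3) y(1)] by (simp add: csub_def)
 qed (use rlin_cl[OF m1(3)] in \<open>auto simp: csub_def rlin_add[OF P(3)] rlin_act[OF P(3)]\<close>)
 ultimately show ?thesis
  using rlin_restrict[OF fg_projective_module, of R "tm1 (csub X e)" "t0 (csub X e)" "tdiff X"]
  by (simp add: two_term_proj_def csub_def)
qed

lemma ccompl_facts:
 assumes X: "cplx R X" and e: "cmap R X X e" "midem R (tm1 X) (fst e)" "midem R (t0 X) (snd e)"
 shows "cmap R X X (ccompl X e)" "midem R (tm1 X) (fst (ccompl X e))" "midem R (t0 X) (snd (ccompl X e))"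
proof -
 note m1 = midem_facts[OF cplxD(1)[OF X] e(2)] and m0 = midem_facts[OF cplxD(2)[OF X] e(3)]
 show 1: "midem R (tm1 X) (fst (ccompl X e))" "midem R (t0 X) (snd (ccompl X e))"
  using m1(5) m0(5) by (simp_all add: ccompl_def)
 interpret X1: right_module R "tm1 X" by (rule cplxD[OF X])
 show "cmap R X X (ccompl X e)" unfolding cmap_def using 1 rlin_cl[OF cmapD(1)[OF e(1)]]
  by (simp add: midem_def ccompl_def a_minus_def rlin_add[OF cplxD(3)[OF X]] rlin_minus[OF cplxD(1,2,3)[OF X]] cmapD(3)[OF e(1)])
qed

text \<open>X splits strictly into the images of e and of 1 - e; the inclusions are the identity on
  elements, and the projections are e and 1 - e.\<close>

lemma kbip_csub:
 assumes X: "two_term_proj R X" and e: "cmap R X X e" "midem R (tm1 X) (fst e)" "midem R (t0 X) (snd e)"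
 shows "kbip R X (csub X e) (csub X (ccompl X e))"
proof -
 note cX = ttp_cplx[OF X]
 note c = ccompl_facts[OF cX e]
 let ?c = "ccompl X e" and ?Y = "csub X e" and ?Z = "csub X (ccompl X e)"
 note cY = ttp_cplx[OF csub_two_term_proj[OF X e]]
 note cZ = ttp_cplx[OF csub_two_term_proj[OF X c]]
 note m1 = midem_facts[OF cplxD(1)[OF cX] e(2)] and m0 = midem_facts[OF cplxD(2)[OF cX] e(3)]
 note n1 = midem_facts[OF cplxD(1)[OF cX] c(2)] and n0 = midem_facts[OF cplxD(2)[OF cX] c(3)]
 interpret X1: right_module R "tm1 X" by (rule cplxD[OF cX])
 interpret X0: right_module R "t0 X" by (rule cplxD[OF cX])
 have j: "cmap R ?Y X cid" using m1(3) m0(3) by (simp add: cmap_def csub_def)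
 have j': "cmap R ?Z X cid" using n1(3) n0(3) by (simp add: cmap_def csub_def)
 have q: "cmap R X ?Y e" using m1(2) m0(2) cmapD(3)[OF e(1)] by (simp add: cmap_def csub_def)
 have q': "cmap R X ?Z ?c" using n1(2) n0(2) cmapD(3)[OF c(1)] by (simp add: cmap_def csub_def)
 have f: "\<And>x. x \<in> car (tm1 X) ==> fst ?c (fst e x) = \<zero>\<^bsub>tm1 X\<^esub>" "\<And>x. x \<in> car (t0 X) ==> snd ?c (snd e x) = \<zero>\<^bsub>t0 X\<^esub>"
  using e(2,3) rlin_cl[OF cmapD(1)[OF e(1)]] rlin_cl[OF cmapD(2)[OF e(1)]]
  by (simp_all add: ccompl_def midem_def a_minus_def X1.M.r_neg X0.M.r_neg)
 have g: "\<And>x. x \<in> car (tm1 X) ==> fst e (fst ?c x) = \<zero>\<^bsub>tm1 X\<^esub>" "\<And>x. x \<in> car (t0 X) ==> snd e (snd ?c x) = \<zero>\<^bsub>t0 X\<^esub>"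
  using m1(6) m0(6) by (simp_all add: ccompl_def)
 have f': "\<And>x. x \<in> fst e ` car (tm1 X) ==> fst ?c x = \<zero>\<^bsub>tm1 X\<^esub>" "\<And>x. x \<in> snd e ` car (t0 X) ==> snd ?c x = \<zero>\<^bsub>t0 X\<^esub>"
  using f by blast+
 have g': "\<And>x. x \<in> fst ?c ` car (tm1 X) ==> fst e x = \<zero>\<^bsub>tm1 X\<^esub>" "\<And>x. x \<in> snd ?c ` car (t0 X) ==> snd e x = \<zero>\<^bsub>t0 X\<^esub>"
  using g by blast+
 have ide: "\<And>x. x \<in> fst e ` car (tm1 X) ==> fst e x = x" "\<And>x. x \<in> snd e ` car (t0 X) ==> snd e x = x"
  using e(2,3) unfolding midem_def by blast+
 have idc: "\<And>x. x \<in> fst ?c ` car (tm1 X) ==> fst ?c x = x" "\<And>x. x \<in> snd ?c ` car (t0 X) ==> snd ?c x = x"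
  using c(2,3) unfolding midem_def by blast+
 have sc: "car (tm1 (csub X u)) = fst u ` car (tm1 X)" "car (t0 (csub X u)) = snd u ` car (t0 X)"
  "\<zero>\<^bsub>tm1 (csub X u)\<^esub> = \<zero>\<^bsub>tm1 X\<^esub>" "\<zero>\<^bsub>t0 (csub X u)\<^esub> = \<zero>\<^bsub>t0 X\<^esub>" for u
  by (simp_all add: csub_def)
 show ?thesis unfolding kbip_def
 proof (rule exI[of _ cid], rule exI[of _ e], rule exI[of _ cid], rule exI[of _ ?c], intro conjI j q j' q'
    heq_ceq[OF cY cY cmap_id] heq_ceq[OF cZ cZ cmap_id] heq_ceq[OF cY cZ cmap_zero[OF cY cZ]]
    heq_ceq[OF cZ cY cmap_zero[OF cZ cY]] heq_ceq[OF cX cX cmap_id])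
  show "ceq ?Y (e \<odot>c cid) cid" unfolding ceq_def sc ccomp_id fst_conv snd_conv id_apply by (intro conjI ballI ide)
  show "ceq ?Z (?c \<odot>c cid) cid" unfolding ceq_def sc ccomp_id fst_conv snd_conv id_apply by (intro conjI ballI idc)
  show "ceq ?Y (?c \<odot>c cid) (czero ?Z)" unfolding ceq_def czero_def sc ccomp_id fst_conv snd_conv by (intro conjI ballI f')
  show "ceq ?Z (e \<odot>c cid) (czero ?Y)" unfolding ceq_def czero_def sc ccomp_id fst_conv snd_conv by (intro conjI ballI g')
  show "ceq X (cadd X (cid \<odot>c e) (cid \<odot>c ?c)) cid" using m1(7) m0(7) by (simp add: ceq_def cadd_def ccompl_def)
 qed
qed

lemma same_dim_subspace:
 assumes V: "vectorspace CC V" and W: "VectorSpace.subspace CC W V" and fd: "vectorspace.fin_dim CC V"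
 shows "cdim (V\<lparr>carrier := W\<rparr>) \<le> cdim V" and "cdim (V\<lparr>carrier := W\<rparr>) = cdim V ==> W = car V"
proof -
 interpret V: vectorspace CC V by (rule V)
 interpret W: vectorspace CC "V\<lparr>carrier := W\<rparr>" using V.subspace_is_vs[OF W] .
 have sub: "LinearCombinations.submodule CC W V" and Wc: "W \<subseteq> car V"
  using W submodule.subset by (auto simp: VectorSpace.subspace_def)
 have lin: "linear_map CC (V\<lparr>carrier := W\<rparr>) V id"
  using Wc by (intro linear_mapI W.vectorspace_axioms V) auto
 interpret i: linear_map CC "V\<lparr>carrier := W\<rparr>" V id by (rule lin)
 have fdW: "W.fin_dim" "W.dim \<le> V.dim" using i.inj_fin_dim[OF _ fd] by auto
 show "cdim (V\<lparr>carrier := W\<rparr>) \<le> cdim V" by (rule fdW)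
 assume eq: "cdim (V\<lparr>carrier := W\<rparr>) = cdim V"
 obtain B where B: "finite B" "W.basis B" using W.finite_basis_exists[OF fdW(1)] by blast
 hence BW: "B \<subseteq> W" "W.module.lin_indpt B" by (auto simp: W.basis_def)
 have "V.lin_indpt (id ` B)" by (rule i.lin_indpt_inj_image) (use B BW in auto)
 hence "V.basis B" using B BW Wc W.dim_basis[OF B] eq by (intro V.dim_li_is_basis[OF fd]) auto
 hence "car V = V.span B" by (simp add: V.basis_def)
 also have "\<dots> \<subseteq> W" by (rule V.span_is_subset[OF BW(1) sub])
 finally show "W = car V" using Wc by blast
qed

context fd_algebra
begin

lemma submodule_subspace:
 assumes M: "right_module R M" and N: "right_submodule R M N"
 shows "VectorSpace.subspace CC N (cspace R M)"
 using cspace_vs[OF M] N vectorspace.axioms(1)[OF cspace_vs[OF M]]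
 by (simp add: VectorSpace.subspace_def submodule_def right_submodule_def)

definition mdim :: "('a, 'm) module => nat" where
 "mdim M = cdim (cspace R M)"

lemma cspace_carrier_update: "cspace R (M\<lparr>carrier := N\<rparr>) = (cspace R M)\<lparr>carrier := N\<rparr>"
 by (simp add: cspace_def)

lemma mdim_submodule:
 assumes M: "fd_right_module R M" and N: "right_submodule R M N"
 shows "mdim (M\<lparr>carrier := N\<rparr>) \<le> mdim M" and "N \<noteq> car M ==> mdim (M\<lparr>carrier := N\<rparr>) < mdim M"
 using same_dim_subspace[OF cspace_vs[OF fdD[OF M]] submodule_subspace[OF fdD[OF M] N]] M
 unfolding mdim_def cspace_carrier_update fd_right_module_def by fastforce+

text \<open>Describes the projection e onto the image of \<open>f ^^ n\<close> along the kernel of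
  \<open>f ^^ n\<close>.\<close>

definition fidem :: "('a, 'm) module => ('m => 'm) => nat => ('m => 'm) => bool" where
 "fidem M f n e \<longleftrightarrow> midem R M e \<and>
  (\<forall>x\<in>car M. e x \<in> (f ^^ n) ` car M \<and> (f ^^ n) (x \<ominus>\<^sub>M e x) = \<zero>\<^sub>M) \<and>
  (\<forall>x\<in>(f ^^ n) ` car M. e x = x) \<and> (\<forall>x\<in>car M. (f ^^ n) x = \<zero>\<^sub>M \<longrightarrow> e x = \<zero>\<^sub>M)"

text \<open>Fitting's lemma. It is stated for all large n, so that the two degrees of a complex can
  be given a common exponent.\<close>

lemma fitting:
 assumes M: "fd_right_module R M" and f: "rlin R M M f"
 shows "\<exists>n0. \<forall>n\<ge>n0. \<exists>e. fidem M f n e"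
proof -
 note m = fdD[OF M]
 interpret M: right_module R M by (rule m)
 let ?I = "\<lambda>n. (f ^^ n) ` car M"
 let ?r = "\<lambda>n. mdim (M\<lparr>carrier := ?I n\<rparr>)"
 note fp = rlin_funpow[OF f]
 have sub: "right_submodule R M (?I n)" for n by (rule rlin_image_submodule[OF m m fp])
 have mono: "?I n \<subseteq> ?I k" if "k \<le> n" for k n
 proof
  fix y assume "y \<in> ?I n"
  then obtain x where x: "x \<in> car M" "y = (f ^^ n) x" by blast
  have "y = (f ^^ k) ((f ^^ (n - k)) x)" using x funpow_add[of k "n - k" f] that by simp
  thus "y \<in> ?I k" using rlin_cl[OF fp x(1)] by blast
 qed
 \<comment> \<open>n0 minimises the dimension of the image; images of powers decrease, so from n0 on
   they are all equal.\<close>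
 obtain n0 where n0: "\<And>k. ?r n0 \<le> ?r k"
  using ex_has_least_nat[of "\<lambda>_. True" 0 ?r] by blast
 have stab: "?I n = ?I k" if "n0 \<le> k" "k \<le> n" for k n
 proof (rule ccontr)
  assume ne: "?I n \<noteq> ?I k"
  have "right_submodule R (M\<lparr>carrier := ?I k\<rparr>) (?I n)"
   using sub[of n] mono[OF that(2)] by (simp add: right_submodule_def)
  from mdim_submodule(2)[OF fd_submodule[OF M sub] this] ne have "?r n < ?r k" by simp
  moreover have "?r k \<le> ?r n0"
  proof -
   have "right_submodule R (M\<lparr>carrier := ?I n0\<rparr>) (?I k)"
    using sub[of k] mono[OF that(1)] by (simp add: right_submodule_def)
   from mdim_submodule(1)[OF fd_submodule[OF M sub] this] show ?thesis by simp
  qed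
  ultimately show False using n0[of n] by simp
 qed
 show ?thesis
 proof (rule exI[of _ n0], intro allI impI)
  fix n assume n: "n0 \<le> n"
  let ?g = "f ^^ n" and ?N = "M\<lparr>carrier := ?I n\<rparr>"
  note g = fp[of n]
  have Ic: "x \<in> car M" if "x \<in> ?I n" for x using that mono[of 0 n] by auto
  have gI: "?g x \<in> ?I n" if "x \<in> car M" for x using that by (rule imageI)
  have gN: "rlin R ?N ?N ?g"
  proof (rule rlinI)
   fix x assume "x \<in> car ?N"
   hence x: "x \<in> ?I n" by simp
   show "?g x \<in> car ?N" using gI[OF Ic[OF x]] by simp
   show "?g (a \<odot>\<^sub>?N x) = a \<odot>\<^sub>?N ?g x" if "a \<in> car R" for a
    using rlin_act[OF g that Ic[OF x]] by simp
   fix y assume "y \<in> car ?N"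
   hence y: "y \<in> ?I n" by simp
   show "?g (x \<oplus>\<^sub>?N y) = ?g x \<oplus>\<^sub>?N ?g y"
    using rlin_add[OF g Ic[OF x] Ic[OF y]] by simp
  qed
  have fdN: "fd_right_module R ?N" by (rule fd_submodule[OF M sub])
  have surj: "?g ` ?I n = ?I n"
  proof -
   have "?g ` ?I n = ?I (n + n)" by (simp add: funpow_add image_comp)
   also have "\<dots> = ?I n" by (rule stab[OF n]) simp
   finally show ?thesis .
  qed
  interpret G: linear_map CC "cspace R ?N" "cspace R ?N" ?g
   by (rule rlin_linear_map[OF fdD[OF fdN] fdD[OF fdN] gN])
  have fdG: "G.V.fin_dim" using fdN by (simp add: fd_right_module_def)
  \<comment> \<open>The power \<open>f ^^ n\<close> maps its own image onto itself, so rank-nullity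
    leaves no kernel there.\<close>
  have k0: "cdim ((cspace R ?N)\<lparr>carrier := G.kerT\<rparr>) = 0"
  proof -
   have "(cspace R ?N)\<lparr>carrier := G.imT\<rparr> = cspace R ?N"
    using surj G.im_def by (simp add: cspace_def)
   thus ?thesis using G.rank_nullity[OF fdG] by simp
  qed
  interpret K: vectorspace CC "(cspace R ?N)\<lparr>carrier := G.kerT\<rparr>"
   using G.V.subspace_is_vs[OF G.kerT_is_subspace] .
  have fdK: "K.fin_dim"
   by (rule linear_map.inj_fin_dim(1)[OF linear_mapI[OF K.vectorspace_axioms G.V.vectorspace_axioms, of id]])
    (auto simp: fdG G.ker_def)
  obtain B where B: "finite B" "K.basis B" using K.finite_basis_exists[OF fdK] by blast
  have "B = {}" using K.dim_basis[OF B] k0 B(1) by simp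
  hence kz: "G.kerT = {\<zero>\<^sub>M}" using B(2) K.span_empty by (simp add: K.basis_def)
  have inj: "x = \<zero>\<^sub>M" if "x \<in> ?I n" "?g x = \<zero>\<^sub>M" for x
   using that kz by (auto simp: G.ker_def)
  have ginj: "x = y" if x: "x \<in> ?I n" and y: "y \<in> ?I n" and eq: "?g x = ?g y" for x y
  proof -
   have c: "x \<in> car M" "y \<in> car M" using x y mono[of 0 n] by auto
   have "x \<ominus>\<^sub>M y \<in> ?I n"
    using M.submodule_minus[OF sub y] sub[of n] x by (auto simp: a_minus_def right_submodule_def)
   moreover have "?g (x \<ominus>\<^sub>M y) = \<zero>\<^sub>M"
    using c eq rlin_cl[OF g] by (simp add: a_minus_def rlin_add[OF g] rlin_minus[OF m m g] M.M.r_neg)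
   ultimately have "x \<ominus>\<^sub>M y = \<zero>\<^sub>M" by (rule inj)
   moreover have "x = (x \<ominus>\<^sub>M y) \<oplus>\<^sub>M y"
    using c by (simp add: a_minus_def M.M.a_assoc M.M.l_neg)
   ultimately show ?thesis using c by simp
  qed
  obtain h where h: "rlin R ?N ?N h" "\<And>x. x \<in> car ?N ==> h (?g x) = x" "\<And>x. x \<in> car ?N ==> ?g (h x) = x"
  proof -
   have "bij_betw ?g (car ?N) (car ?N)" unfolding bij_betw_def inj_on_def using surj ginj by simp
   from rlin_inverse[OF fdD[OF fdN] gN this] that show thesis by metis
  qed
  \<comment> \<open>As h inverts \<open>f ^^ n\<close> on its image, h after \<open>f ^^ n\<close>
    fixes that image and has the kernel of \<open>f ^^ n\<close>.\<close>
  let ?e = "h \<circ> ?g"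
  have gMN: "rlin R M ?N ?g" by (rule rlinI) (auto simp: rlin_add[OF g] rlin_act[OF g])
  have eMN: "rlin R M ?N ?e" by (rule rlin_o[OF h(1) gMN])
  have eI: "?e x \<in> ?I n" if "x \<in> car M" for x using rlin_cl[OF eMN that] by simp
  have eid: "?e x = x" if "x \<in> ?I n" for x using h(2)[of x] that by simp
  have lin: "rlin R M M ?e" using rlin_o[OF rlin_submodule_incl[OF sub] eMN] by simp
  have ge: "?g (x \<ominus>\<^sub>M ?e x) = \<zero>\<^sub>M" if x: "x \<in> car M" for x
   using x Ic[OF eI[OF x]] rlin_cl[OF g x] h(3)[of "?g x"]
   by (simp add: a_minus_def rlin_add[OF g] rlin_minus[OF m m g] M.M.r_neg)
  have "h \<zero>\<^sub>M = \<zero>\<^sub>M" using rlin_zero[OF fdD[OF fdN] fdD[OF fdN] h(1)] by simp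
  thus "\<exists>e. fidem M f n e" unfolding fidem_def
   by (intro exI[of _ ?e] conjI ballI impI eI ge eid) (simp_all add: midem_def lin eid[OF eI, simplified])
 qed
qed

end

context fd_algebra
begin

lemma midem_surj: "midem R M e ==> e ` car M = car M ==> x \<in> car M ==> e x = x"
 unfolding midem_def by (metis imageE)

text \<open>If the projection is zero, the kernel of \<open>f ^^ n\<close> is everything; if it is
  the identity, the kernel is zero and the image is everything. A positive exponent is what allows
  bijectivity to pass from the power to f.\<close>

lemma fidem_cases:
 assumes M: "fd_right_module R M" and f: "rlin R M M f" and fe: "fidem M f n e" and n: "1 \<le> n"
 shows "\<forall>x\<in>car M. e x = \<zero>\<^sub>M ==> x \<in> car M ==> (f ^^ n) x = \<zero>\<^sub>M"
  and "\<forall>x\<in>car M. e x = x ==> bij_betw f (car M) (car M)"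
proof -
 note m = fdD[OF M]
 interpret M: right_module R M by (rule m)
 let ?g = "f ^^ n"
 note g = rlin_funpow[OF f, of n]
 have e: "\<forall>x\<in>car M. e x \<in> ?g ` car M \<and> ?g (x \<ominus>\<^sub>M e x) = \<zero>\<^sub>M"
  "\<forall>x\<in>car M. ?g x = \<zero>\<^sub>M \<longrightarrow> e x = \<zero>\<^sub>M" using fe unfolding fidem_def by blast+
 have mz: "\<ominus>\<^sub>M \<zero>\<^sub>M = \<zero>\<^sub>M" using M.M.l_neg[OF M.M.zero_closed] by simp
 show "?g x = \<zero>\<^sub>M" if z: "\<forall>x\<in>car M. e x = \<zero>\<^sub>M" and x: "x \<in> car M"
  using bspec[OF e(1) x] bspec[OF z x] x mz by (simp add: a_minus_def)
 show "bij_betw f (car M) (car M)" if id: "\<forall>x\<in>car M. e x = x"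
 proof (rule bij_betw_of_funpow[OF _ _ n])
  show "f \<in> car M \<rightarrow> car M" using rlin_cl[OF f] by blast
  have "x = y" if x: "x \<in> car M" and y: "y \<in> car M" and eq: "?g x = ?g y" for x y
  proof -
   have c: "x \<ominus>\<^sub>M y \<in> car M" using x y by simp
   have "?g (x \<ominus>\<^sub>M y) = \<zero>\<^sub>M"
    using x y eq rlin_cl[OF g] by (simp add: a_minus_def rlin_add[OF g] rlin_minus[OF m m g] M.M.r_neg)
   hence "x \<ominus>\<^sub>M y = \<zero>\<^sub>M" using e(2) id c by metis
   moreover have "x = (x \<ominus>\<^sub>M y) \<oplus>\<^sub>M y" using x y by (simp add: a_minus_def M.M.a_assoc M.M.l_neg)
   ultimately show ?thesis using y by simp
  qed
  moreover have "x \<in> ?g ` car M" if "x \<in> car M" for x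
   using bspec[OF e(1) that] bspec[OF id that] by simp
  ultimately show "bij_betw ?g (car M) (car M)"
   using rlin_cl[OF g] unfolding bij_betw_def inj_on_def by blast
 qed
qed

lemma eloc_idempotent:
 assumes M: "fd_right_module R M"
  and id: "\<And>e. midem R M e ==> (\<forall>x\<in>car M. e x = \<zero>\<^sub>M) \<or> (\<forall>x\<in>car M. e x = x)"
 shows "eloc R M" unfolding eloc_def
proof (intro allI impI)
 fix f assume f: "rlin R M M f"
 obtain n0 where "\<forall>n\<ge>n0. \<exists>e. fidem M f n e" using fitting[OF M f] ..
 \<comment> \<open>The successor makes the exponent positive, as \<open>fidem_cases\<close>
   demands.\<close>
 then obtain e where e: "fidem M f (Suc n0) e" by (meson le_SucI order_refl)
 note c = fidem_cases[OF M f e]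
 show "(\<exists>n. \<forall>x\<in>car M. (f ^^ n) x = \<zero>\<^sub>M) \<or> bij_betw f (car M) (car M)"
 proof (rule disjE[OF id[of e]])
  show "midem R M e" using e unfolding fidem_def by blast
 next
  assume "\<forall>x\<in>car M. e x = \<zero>\<^sub>M"
  from c(1)[OF _ this] show ?thesis by (intro disjI1 exI[of _ "Suc n0"] ballI) simp
 next
  assume "\<forall>x\<in>car M. e x = x"
  from c(2)[OF _ this] show ?thesis by simp
 qed
qed

lemma fd_two_term:
 assumes "two_term_proj R X"
 shows "fd_right_module R (tm1 X)" "fd_right_module R (t0 X)"
 using assms fd_projective unfolding two_term_proj_def by blast+

text \<open>The Fitting projections of the two components form a chain map, so the hypothesis on
  idempotents applies to the pair.\<close>

lemma cloc_idempotent: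
 assumes X: "two_term_proj R X"
  and id: "\<And>e. cmap R X X e ==> midem R (tm1 X) (fst e) ==> midem R (t0 X) (snd e) ==>
   (\<forall>x\<in>car (tm1 X). fst e x = \<zero>\<^bsub>tm1 X\<^esub>) \<and> (\<forall>x\<in>car (t0 X). snd e x = \<zero>\<^bsub>t0 X\<^esub>) \<or>
   (\<forall>x\<in>car (tm1 X). fst e x = x) \<and> (\<forall>x\<in>car (t0 X). snd e x = x)"
 shows "cloc R X" unfolding cloc_def
proof (intro allI impI)
 fix f assume f: "cmap R X X f"
 note c = ttp_cplx[OF X]
 interpret X1: right_module R "tm1 X" by (rule cplxD[OF c])
 interpret X0: right_module R "t0 X" by (rule cplxD[OF c])
 obtain n1 n0 where n1: "\<forall>n\<ge>n1. \<exists>e. fidem (tm1 X) (fst f) n e" and n0: "\<forall>n\<ge>n0. \<exists>e. fidem (t0 X) (snd f) n e"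
  using fitting[OF fd_two_term(1)[OF X] cmapD(1)[OF f]] fitting[OF fd_two_term(2)[OF X] cmapD(2)[OF f]] by blast
 define n where "n = Suc (max n1 n0)"
 have n: "n1 \<le> n" "n0 \<le> n" "1 \<le> n" by (simp_all add: n_def)
 obtain e1 e0 where f1: "fidem (tm1 X) (fst f) n e1" and f0: "fidem (t0 X) (snd f) n e0"
  using n1[rule_format, OF n(1)] n0[rule_format, OF n(2)] by blast
 have e1: "midem R (tm1 X) e1" "\<And>x. x \<in> car (tm1 X) ==> e1 x \<in> (fst f ^^ n) ` car (tm1 X)"
  "\<And>x. x \<in> car (tm1 X) ==> (fst f ^^ n) (x \<ominus>\<^bsub>tm1 X\<^esub> e1 x) = \<zero>\<^bsub>tm1 X\<^esub>"
  using f1 unfolding fidem_def by blast+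
 have e0: "midem R (t0 X) e0" "\<And>x. x \<in> (snd f ^^ n) ` car (t0 X) ==> e0 x = x"
  "\<And>x. x \<in> car (t0 X) ==> (snd f ^^ n) x = \<zero>\<^bsub>t0 X\<^esub> ==> e0 x = \<zero>\<^bsub>t0 X\<^esub>"
  using f0 unfolding fidem_def by blast+
 note c1 = fidem_cases[OF fd_two_term(1)[OF X] cmapD(1)[OF f] f1 n(3)]
  and c0 = fidem_cases[OF fd_two_term(2)[OF X] cmapD(2)[OF f] f0 n(3)]
 have fn: "(snd f ^^ k) (tdiff X x) = tdiff X ((fst f ^^ k) x)" if "x \<in> car (tm1 X)" for k x
  using that rlin_cl[OF rlin_funpow[OF cmapD(1)[OF f]]] by (induction k) (simp_all add: cmapD(3)[OF f])
 note l1 = rlin_cl[OF conjunct1[OF e1(1)[unfolded midem_def]]]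
 note d = cplxD(3)[OF c]
 \<comment> \<open>The differential carries image to image and kernel to kernel of the n-th powers;
   splitting x accordingly shows that it commutes with the projections.\<close>
 have comm: "e0 (tdiff X x) = tdiff X (e1 x)" if x: "x \<in> car (tm1 X)" for x
 proof -
  let ?y = "x \<ominus>\<^bsub>tm1 X\<^esub> e1 x"
  have y: "?y \<in> car (tm1 X)" using x l1 by simp
  have "x = e1 x \<oplus>\<^bsub>tm1 X\<^esub> ?y" using midem_facts(7)[OF cplxD(1)[OF c] e1(1) x] by simp
  hence "tdiff X x = tdiff X (e1 x) \<oplus>\<^bsub>t0 X\<^esub> tdiff X ?y"
   using rlin_add[OF d l1[OF x] y] by simp
  hence "e0 (tdiff X x) = e0 (tdiff X (e1 x)) \<oplus>\<^bsub>t0 X\<^esub> e0 (tdiff X ?y)"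
   using rlin_add[OF conjunct1[OF e0(1)[unfolded midem_def]] rlin_cl[OF d l1[OF x]] rlin_cl[OF d y]] by simp
  moreover have "e0 (tdiff X ?y) = \<zero>\<^bsub>t0 X\<^esub>"
   by (rule e0(3)[OF rlin_cl[OF d y]]) (simp add: fn[OF y] e1(3)[OF x] rlin_zero[OF cplxD(1,2,3)[OF c]])
  moreover have "e0 (tdiff X (e1 x)) = tdiff X (e1 x)"
  proof (rule e0(2))
   obtain z where z: "z \<in> car (tm1 X)" "e1 x = (fst f ^^ n) z" using e1(2)[OF x] by blast
   hence "tdiff X (e1 x) = (snd f ^^ n) (tdiff X z)" using fn by simp
   thus "tdiff X (e1 x) \<in> (snd f ^^ n) ` car (t0 X)" using rlin_cl[OF d z(1)] by blast
  qed
  ultimately show ?thesis using rlin_cl[OF d l1[OF x]] by simp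
 qed
 have "cmap R X X (e1, e0)" using e1(1) e0(1) comm by (simp add: cmap_def midem_def)
 from id[OF this, unfolded fst_conv snd_conv, OF e1(1) e0(1)]
 show "(\<exists>n. (\<forall>x\<in>car (tm1 X). (fst f ^^ n) x = \<zero>\<^bsub>tm1 X\<^esub>) \<and> (\<forall>x\<in>car (t0 X). (snd f ^^ n) x = \<zero>\<^bsub>t0 X\<^esub>)) \<or>
   bij_betw (fst f) (car (tm1 X)) (car (tm1 X)) \<and> bij_betw (snd f) (car (t0 X)) (car (t0 X))"
 proof
  assume a: "(\<forall>x\<in>car (tm1 X). e1 x = \<zero>\<^bsub>tm1 X\<^esub>) \<and> (\<forall>x\<in>car (t0 X). e0 x = \<zero>\<^bsub>t0 X\<^esub>)"
  thus ?thesis using c1(1) c0(1) by (intro disjI1 exI[of _ n]) blast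
 next
  assume a: "(\<forall>x\<in>car (tm1 X). e1 x = x) \<and> (\<forall>x\<in>car (t0 X). e0 x = x)"
  thus ?thesis using c1(2) c0(2) by blast
 qed
qed

definition cdimK :: "('a, 'm) two_term => nat" where
 "cdimK X = mdim (tm1 X) + mdim (t0 X)"

lemma csub_dim:
 assumes X: "two_term_proj R X" and e: "cmap R X X e" "midem R (tm1 X) (fst e)" "midem R (t0 X) (snd e)"
  and ne: "(\<exists>x\<in>car (tm1 X). fst e x \<noteq> x) \<or> (\<exists>x\<in>car (t0 X). snd e x \<noteq> x)"
 shows "cdimK (csub X e) < cdimK X"
proof -
 note c = ttp_cplx[OF X]
 note s1 = rlin_image_submodule[OF cplxD(1,1)[OF c] cmapD(1)[OF e(1)]]
 note s0 = rlin_image_submodule[OF cplxD(2,2)[OF c] cmapD(2)[OF e(1)]]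
 have t: "mdim (tm1 (csub X e)) \<le> mdim (tm1 X)" "fst e ` car (tm1 X) \<noteq> car (tm1 X) ==> mdim (tm1 (csub X e)) < mdim (tm1 X)"
  using mdim_submodule[OF fd_two_term(1)[OF X] s1] by (simp_all add: csub_def)
 have z: "mdim (t0 (csub X e)) \<le> mdim (t0 X)" "snd e ` car (t0 X) \<noteq> car (t0 X) ==> mdim (t0 (csub X e)) < mdim (t0 X)"
  using mdim_submodule[OF fd_two_term(2)[OF X] s0] by (simp_all add: csub_def)
 have "fst e ` car (tm1 X) \<noteq> car (tm1 X) \<or> snd e ` car (t0 X) \<noteq> car (t0 X)"
  using ne midem_surj[OF e(2)] midem_surj[OF e(3)] by blast
 thus ?thesis using t z unfolding cdimK_def by linarith
qed

definition cidem :: "('a, 'm) two_term => ('m => 'm) \<times> ('m => 'm) => bool" where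
 "cidem X e \<longleftrightarrow> cmap R X X e \<and> midem R (tm1 X) (fst e) \<and> midem R (t0 X) (snd e) \<and>
  ((\<exists>x\<in>car (tm1 X). fst e x \<noteq> \<zero>\<^bsub>tm1 X\<^esub>) \<or> (\<exists>x\<in>car (t0 X). snd e x \<noteq> \<zero>\<^bsub>t0 X\<^esub>))"

text \<open>An idempotent u of the image of e yields the idempotent u e of X, with the image of u.
  If u is neither zero nor the identity, this image is nonzero and smaller than that of e, against
  minimality.\<close>

lemma minimal_idempotent_cloc:
 assumes X: "two_term_proj R X" and e: "cidem X e"
  and min: "\<And>e'. cidem X e' ==> cdimK (csub X e) \<le> cdimK (csub X e')"
 shows "cloc R (csub X e)"
proof (rule cloc_idempotent)
 let ?Y = "csub X e"
 have em: "cmap R X X e" "midem R (tm1 X) (fst e)" "midem R (t0 X) (snd e)"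
  using e by (auto simp: cidem_def)
 show Y: "two_term_proj R ?Y" by (rule csub_two_term_proj[OF X em])
 fix u assume u: "cmap R ?Y ?Y u" "midem R (tm1 ?Y) (fst u)" "midem R (t0 ?Y) (snd u)"
 note c = ttp_cplx[OF X]
 note m1 = midem_facts[OF cplxD(1)[OF c] em(2)] and m0 = midem_facts[OF cplxD(2)[OF c] em(3)]
 have sc: "car (tm1 ?Y) = fst e ` car (tm1 X)" "car (t0 ?Y) = snd e ` car (t0 X)"
  "\<zero>\<^bsub>tm1 ?Y\<^esub> = \<zero>\<^bsub>tm1 X\<^esub>" "\<zero>\<^bsub>t0 ?Y\<^esub> = \<zero>\<^bsub>t0 X\<^esub>"
  by (simp_all add: csub_def)
 have ide: "\<And>x. x \<in> fst e ` car (tm1 X) ==> fst e x = x" "\<And>x. x \<in> snd e ` car (t0 X) ==> snd e x = x"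
  using em(2,3) unfolding midem_def by blast+
 have u1: "fst u y \<in> fst e ` car (tm1 X)" "fst u (fst u y) = fst u y" if "y \<in> fst e ` car (tm1 X)" for y
  using rlin_cl[OF cmapD(1)[OF u(1)]] u(2) that unfolding midem_def sc by blast+
 have u0: "snd u y \<in> snd e ` car (t0 X)" "snd u (snd u y) = snd u y" if "y \<in> snd e ` car (t0 X)" for y
  using rlin_cl[OF cmapD(2)[OF u(1)]] u(3) that unfolding midem_def sc by blast+
 let ?v = "u \<odot>c e"
 have jc: "cmap R ?Y X cid" using m1(3) m0(3) by (simp add: cmap_def csub_def)
 have qc: "cmap R X ?Y e" using m1(2) m0(2) cmapD(3)[OF em(1)] by (simp add: cmap_def csub_def)
 have vc: "cmap R X X ?v" using cmap_comp[OF jc cmap_comp[OF u(1) qc]] by simp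
 have v1: "fst ?v (fst ?v x) = fst ?v x" if "x \<in> car (tm1 X)" for x
 proof -
  have y: "fst e x \<in> fst e ` car (tm1 X)" using that by (rule imageI)
  show ?thesis using ide(1)[OF u1(1)[OF y]] u1(2)[OF y] by simp
 qed
 have v0: "snd ?v (snd ?v x) = snd ?v x" if "x \<in> car (t0 X)" for x
 proof -
  have y: "snd e x \<in> snd e ` car (t0 X)" using that by (rule imageI)
  show ?thesis using ide(2)[OF u0(1)[OF y]] u0(2)[OF y] by simp
 qed
 have vi: "midem R (tm1 X) (fst ?v)" "midem R (t0 X) (snd ?v)"
  unfolding midem_def using cmapD(1,2)[OF vc] v1 v0 by blast+
 have eq: "csub X ?v = csub ?Y u"
 proof -
  have "fst ?v ` car (tm1 X) = fst u ` car (tm1 ?Y)" "snd ?v ` car (t0 X) = snd u ` car (t0 ?Y)"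
   unfolding sc by (simp_all add: image_image)
  moreover have "restrict (tdiff X) (fst u ` car (tm1 ?Y)) = restrict (tdiff ?Y) (fst u ` car (tm1 ?Y))"
  proof (rule restrict_ext)
   fix x assume "x \<in> fst u ` car (tm1 ?Y)"
   hence "x \<in> fst e ` car (tm1 X)" using u1(1) unfolding sc by blast
   thus "tdiff X x = tdiff ?Y x" by (simp add: csub_def)
  qed
  ultimately show ?thesis by (simp add: csub_def)
 qed
 show "(\<forall>x\<in>car (tm1 ?Y). fst u x = \<zero>\<^bsub>tm1 ?Y\<^esub>) \<and> (\<forall>x\<in>car (t0 ?Y). snd u x = \<zero>\<^bsub>t0 ?Y\<^esub>) \<or>
   (\<forall>x\<in>car (tm1 ?Y). fst u x = x) \<and> (\<forall>x\<in>car (t0 ?Y). snd u x = x)"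
 proof (rule ccontr)
  assume "\<not> ?thesis"
  hence nz: "(\<exists>x\<in>car (tm1 ?Y). fst u x \<noteq> \<zero>\<^bsub>tm1 ?Y\<^esub>) \<or> (\<exists>x\<in>car (t0 ?Y). snd u x \<noteq> \<zero>\<^bsub>t0 ?Y\<^esub>)"
   and ni: "(\<exists>x\<in>car (tm1 ?Y). fst u x \<noteq> x) \<or> (\<exists>x\<in>car (t0 ?Y). snd u x \<noteq> x)" by blast+
  have "cidem X ?v" unfolding cidem_def using vc vi nz unfolding sc ccomp_apply by blast
  from min[OF this] csub_dim[OF Y u ni] show False unfolding eq by simp
 qed
qed

text \<open>Induction on the total dimension: split off the image of a nonzero idempotent whose
  image is as small as possible. The complement is strictly smaller.\<close>

lemma cloc_decomposition:
 fixes X :: "('a, 'm) two_term"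
 assumes "two_term_proj R X"
 shows "\<exists>Xs :: ('a, 'm) two_term list.
  (\<forall>Y\<in>set Xs. two_term_proj R Y \<and> cloc R Y \<and> \<not> kzero R Y) \<and> K_iso R X (K_dsum Xs)"
 using assms
proof (induction "cdimK X" arbitrary: X rule: less_induct)
 case less
 note X = less.prems
 note c = ttp_cplx[OF X]
 note R = ring_axioms
 show ?case
 proof (cases "(\<forall>x\<in>car (tm1 X). x = \<zero>\<^bsub>tm1 X\<^esub>) \<and> (\<forall>x\<in>car (t0 X). x = \<zero>\<^bsub>t0 X\<^esub>)")
  case True
  have N: "cplx R (K_dsum ([] :: ('a, 'm) two_term list))" by (rule K_dsum_cplx[OF R]) simp
  have "kzero R X"
   unfolding kzero_def by (rule heq_ceq[OF c c cmap_zero[OF c c]]) (use True in \<open>simp add: ceq_def czero_def\<close>)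
  hence "K_iso R X (K_dsum ([] :: ('a, 'm) two_term list))"
   by (rule kzero_iso[OF c N _ kzero_K_dsum_Nil[OF R]])
  thus ?thesis by (intro exI[of _ "[]"]) simp
 next
  case False
  have mid: "midem R M id" for M :: "('a, 'm) module" by (simp add: midem_def rlin_id)
  have "cidem X cid" using False by (auto simp: cidem_def cmap_id mid)
  then obtain e where e: "cidem X e" "\<And>e'. cidem X e' ==> cdimK (csub X e) \<le> cdimK (csub X e')"
   using ex_has_least_nat[of "cidem X" cid "\<lambda>e. cdimK (csub X e)"] by blast
  let ?Y = "csub X e" and ?Z = "csub X (ccompl X e)"
  have em: "cmap R X X e" "midem R (tm1 X) (fst e)" "midem R (t0 X) (snd e)"
   and nz: "(\<exists>x\<in>car (tm1 X). fst e x \<noteq> \<zero>\<^bsub>tm1 X\<^esub>) \<or> (\<exists>x\<in>car (t0 X). snd e x \<noteq> \<zero>\<^bsub>t0 X\<^esub>)"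
   using e(1) by (auto simp: cidem_def)
  note cc = ccompl_facts[OF c em]
  have loc: "cloc R ?Y" by (rule minimal_idempotent_cloc[OF X e])
  have Y: "two_term_proj R ?Y" and Z: "two_term_proj R ?Z"
   by (rule csub_two_term_proj[OF X em] csub_two_term_proj[OF X cc])+
  note cY = ttp_cplx[OF Y] and cZ = ttp_cplx[OF Z]
  have b: "kbip R X ?Y ?Z" by (rule kbip_csub[OF X em])
  note m1 = midem_facts[OF cplxD(1)[OF c] em(2)] and m0 = midem_facts[OF cplxD(2)[OF c] em(3)]
  have k1: "fst (ccompl X e) x \<noteq> x" if "x \<in> car (tm1 X)" "fst e x \<noteq> \<zero>\<^bsub>tm1 X\<^esub>" for x
   using m1(6)[OF that(1)] that(2) unfolding ccompl_def fst_conv by metis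
  have k0: "snd (ccompl X e) x \<noteq> x" if "x \<in> car (t0 X)" "snd e x \<noteq> \<zero>\<^bsub>t0 X\<^esub>" for x
   using m0(6)[OF that(1)] that(2) unfolding ccompl_def snd_conv by metis
  have "cdimK ?Z < cdimK X" by (rule csub_dim[OF X cc]) (use nz k1 k0 in blast)
  from less.hyps[OF this Z] obtain Zs :: "('a, 'm) two_term list" where Zs: "\<forall>W\<in>set Zs. two_term_proj R W \<and> cloc R W \<and> \<not> kzero R W"
   "K_iso R ?Z (K_dsum Zs)" by blast
  have zsc: "\<And>W. W \<in> set Zs ==> cplx R W" using Zs(1) ttp_cplx by blast
  have cZs: "cplx R (K_dsum Zs)" by (rule K_dsum_cplx[OF R zsc])
  have bZs: "kbip R (K_dsum (?Y # Zs)) ?Y (K_dsum Zs)" by (rule kbip_K_dsum[OF R cY zsc])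
  show ?thesis
  \<comment> \<open>The piece split off can be contractible although it is a nonzero complex; it is
    then dropped from the list, since it is not indecomposable up to homotopy.\<close>
  proof (cases "kzero R ?Y")
   case True
   have "K_iso R X ?Z" by (rule kbip_kzero[OF c cZ cY kbip_commute[OF c b] True])
   hence "K_iso R X (K_dsum Zs)" by (rule K_iso_trans[OF c cZ cZs _ Zs(2)])
   thus ?thesis using Zs(1) by blast
  next
   case False
   have ccons: "cplx R (K_dsum (?Y # Zs))" by (rule K_dsum_cplx[OF R]) (use cY zsc in auto)
   have "K_iso R X (K_dsum (?Y # Zs))"
    by (rule kbip_unique[OF c cY cZs ccons kbip_cong_right[OF c cY cZ cZs b Zs(2)] bZs])
   thus ?thesis using Zs(1) Y loc False by (intro exI[of _ "?Y # Zs"]) simp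
  qed
 qed
qed

lemma cloc_indec:
 fixes X :: "('a, nat => 'a) two_term"
 assumes X: "two_term_proj R X" and loc: "cloc R X" and nz: "\<not> kzero R X"
 shows "indec_K R X" unfolding indec_K_def
proof (intro conjI allI impI X)
 note c = ttp_cplx[OF X]
 show "\<not> K_zero R X" using K_zero_iff[OF ring_axioms c] nz by simp
 fix Y Z :: "('a, nat => 'a) two_term"
 assume YZ: "two_term_proj R Y \<and> two_term_proj R Z \<and> K_iso R X (K_dsum [Y, Z])"
 hence cYZ: "cplx R Y" "cplx R Z" using ttp_cplx by blast+
 hence b: "kbip R X Y Z" using K_iso_pair_iff[OF ring_axioms c] YZ by blast
 show "K_zero R Y \<or> K_zero R Z"
  unfolding K_zero_iff[OF ring_axioms cYZ(1)] K_zero_iff[OF ring_axioms cYZ(2)]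
  by (rule kbip_zero_cases[OF c cYZ b]) (use loc in \<open>simp add: cloc_def\<close>)
qed

text \<open>Guarantees that the choice in \<open>K_decomposition\<close> is a genuine decomposition.
  The additional locality clause is what \<open>eloc_H0\<close> works with.\<close>

lemma K_decomposition_exists:
 fixes X :: "('a, 'm) two_term"
 assumes "two_term_proj R X"
 shows "\<exists>Xs :: ('a, nat => 'a) two_term list. (\<forall>Y\<in>set Xs. indec_K R Y \<and> cloc R Y) \<and> K_iso R X (K_dsum Xs)"
proof -
 obtain X' :: "('a, nat => 'a) two_term" where X': "two_term_proj R X'" "K_iso R X X'"
  using two_term_copy[OF assms] by metis
 obtain Xs :: "('a, nat => 'a) two_term list" where Xs: "\<forall>Y\<in>set Xs. two_term_proj R Y \<and> cloc R Y \<and> \<not> kzero R Y" "K_iso R X' (K_dsum Xs)"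
  using cloc_decomposition[OF X'(1)] by blast
 have "cplx R (K_dsum Xs)" by (rule K_dsum_cplx[OF ring_axioms]) (use Xs(1) ttp_cplx in blast)
 hence "K_iso R X (K_dsum Xs)"
  by (rule K_iso_trans[OF ttp_cplx[OF assms] ttp_cplx[OF X'(1)] _ X'(2) Xs(2)])
 thus ?thesis using Xs(1) cloc_indec by blast
qed

lemma K_dsum_two_term_proj:
 assumes "\<And>X. X \<in> set Xs ==> two_term_proj R X"
 shows "two_term_proj R (K_dsum Xs)"
proof -
 have c: "cplx R (K_dsum Xs)" by (rule K_dsum_cplx[OF ring_axioms]) (rule ttp_cplx, rule assms)
 have "fg_projective R P" if P: "P \<in> set (map tm1 Xs)" for P
 proof -
  obtain X where "X \<in> set Xs" "P = tm1 X" using P by auto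
  thus ?thesis using assms unfolding two_term_proj_def by blast
 qed
 hence 1: "fg_projective R (tm1 (K_dsum Xs))" unfolding K_dsum_simps by (rule fg_projective_dsum)
 have "fg_projective R P" if P: "P \<in> set (map t0 Xs)" for P
 proof -
  obtain X where "X \<in> set Xs" "P = t0 X" using P by auto
  thus ?thesis using assms unfolding two_term_proj_def by blast
 qed
 hence 2: "fg_projective R (t0 (K_dsum Xs))" unfolding K_dsum_simps by (rule fg_projective_dsum)
 show ?thesis unfolding two_term_proj_def rhom_iff
  by (intro conjI 1 2 cplxD(3)[OF c] tdiff_K_dsum_ext)
qed

text \<open>Peel off one summand at a time: either it or the rest is contractible. As
  \<open>indec_K\<close> tests only complexes over \<open>nat => 'a\<close>, both parts are replaced
  by copies there.\<close>

lemma indec_K_summand: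
 fixes X :: "('a, nat => 'a) two_term" and Ys :: "('a, 'y) two_term list"
 assumes X: "indec_K R X" and "\<And>Y. Y \<in> set Ys ==> two_term_proj R Y" and "K_iso R X (K_dsum Ys)"
 shows "\<exists>Y\<in>set Ys. K_iso R X Y" using assms(2,3)
proof (induction Ys)
 case Nil
 have X': "two_term_proj R X" "\<not> K_zero R X" using X by (auto simp: indec_K_def)
 have N: "cplx R (K_dsum ([] :: ('a, 'y) two_term list))" by (rule K_dsum_cplx[OF ring_axioms]) simp
 note c = ttp_cplx[OF X'(1)]
 have "K_iso R (K_dsum ([] :: ('a, 'y) two_term list)) X"
  by (rule K_iso_sym[OF c N]) (rule Nil.prems(2))
 hence "kzero R X" by (rule kzero_cong[OF N c _ kzero_K_dsum_Nil[OF ring_axioms]])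
 hence "K_zero R X" using K_zero_iff[OF ring_axioms c] by simp
 with X'(2) show ?case ..
next
 case (Cons Y Ys)
 note R = ring_axioms
 have X': "two_term_proj R X" using X by (auto simp: indec_K_def)
 note c = ttp_cplx[OF X']
 have tY: "two_term_proj R Y" and tYs: "\<And>Y. Y \<in> set Ys ==> two_term_proj R Y"
  and tD: "two_term_proj R (K_dsum (Y # Ys))"
  using Cons.prems(1) K_dsum_two_term_proj[of "Y # Ys"] by auto
 have tZ: "two_term_proj R (K_dsum Ys)" by (rule K_dsum_two_term_proj[OF tYs])
 note cY = ttp_cplx[OF tY] and cZ = ttp_cplx[OF tZ] and cD = ttp_cplx[OF tD]
 have bYs: "kbip R (K_dsum (Y # Ys)) Y (K_dsum Ys)" by (rule kbip_K_dsum[OF R cY ttp_cplx[OF tYs]])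
 have b: "kbip R X Y (K_dsum Ys)"
  by (rule kbip_cong[OF cD cY cZ c bYs K_iso_sym[OF c cD Cons.prems(2)]])
 obtain Y' :: "('a, nat => 'a) two_term" where Y': "two_term_proj R Y'" "K_iso R Y Y'"
  using two_term_copy[OF tY] by metis
 obtain Z' :: "('a, nat => 'a) two_term" where Z': "two_term_proj R Z'" "K_iso R (K_dsum Ys) Z'"
  using two_term_copy[OF tZ] by metis
 note cY' = ttp_cplx[OF Y'(1)] and cZ' = ttp_cplx[OF Z'(1)]
 have "kbip R X Y' Z'"
  by (rule kbip_cong_right[OF c cY' cZ cZ' kbip_cong_left[OF c cY cZ cY' b Y'(2)] Z'(2)])
 hence "K_iso R X (K_dsum [Y', Z'])" using K_iso_pair_iff[OF R c cY' cZ'] by blast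
 hence "K_zero R Y' \<or> K_zero R Z'" using X Y'(1) Z'(1) unfolding indec_K_def by blast
 hence "kzero R Y \<or> kzero R (K_dsum Ys)" unfolding K_zero_iff[OF R cY'] K_zero_iff[OF R cZ']
  using kzero_cong[OF cY' cY K_iso_sym[OF cY cY' Y'(2)]] kzero_cong[OF cZ' cZ K_iso_sym[OF cZ cZ' Z'(2)]] by blast
 thus ?case
 proof
  assume "kzero R Y"
  hence "K_iso R X (K_dsum Ys)" by (rule kbip_kzero[OF c cZ cY kbip_commute[OF c b]])
  from Cons.IH[OF tYs this] show ?thesis by auto
 next
  assume "kzero R (K_dsum Ys)"
  hence "K_iso R X Y" by (rule kbip_kzero[OF c cY cZ b])
  thus ?thesis by simp
 qed
qed

text \<open>\<open>cloc\<close> is not invariant under \<open>K_iso\<close>, because adding a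
  contractible summand creates new idempotents. So an indecomposable complex itself may fail it, but
  an isomorphic complex satisfies it.\<close>

lemma indec_K_local_copy:
 fixes X :: "('a, nat => 'a) two_term"
 assumes X: "indec_K R X"
 obtains X' :: "('a, nat => 'a) two_term" where "indec_K R X'" "cloc R X'" "K_iso R X X'"
proof -
 obtain Xs :: "('a, nat => 'a) two_term list" where Xs: "\<forall>Y\<in>set Xs. indec_K R Y \<and> cloc R Y" "K_iso R X (K_dsum Xs)"
  using K_decomposition_exists[of X] X unfolding indec_K_def by blast
 have "\<exists>Y\<in>set Xs. K_iso R X Y"
  by (rule indec_K_summand[OF X _ Xs(2)]) (use Xs(1) in \<open>auto simp: indec_K_def\<close>)
 thus thesis using that Xs(1) by blast
qed

end

section \<open>Exchange for local modules and decomposition of projectives\<close>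

definition mfactor :: "('a, 'r) ring_scheme => ('a, 'm) module => ('a, 'n) module => bool" where
 "mfactor R L X \<longleftrightarrow> (\<exists>i p. rlin R L X i \<and> rlin R X L p \<and> bij_betw (\<lambda>x. p (i x)) (car L) (car L))"

text \<open>The last nonzero iterate of x is killed by f.\<close>

lemma nilpotent_kills:
 assumes "\<forall>x\<in>car M. (f ^^ n) x = \<zero>\<^sub>M" "f \<in> car M \<rightarrow> car M" "x \<in> car M" "x \<noteq> \<zero>\<^sub>M"
 obtains y where "y \<in> car M" "y \<noteq> \<zero>\<^sub>M" "f y = \<zero>\<^sub>M"
proof -
 have cl: "(f ^^ k) x \<in> car M" for k using assms(2,3) by (induction k) (simp, simp add: Pi_iff)
 define k where "k = (LEAST k. (f ^^ k) x = \<zero>\<^sub>M)"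
 have k: "(f ^^ k) x = \<zero>\<^sub>M" unfolding k_def by (rule LeastI[of _ n]) (use assms(1,3) in simp)
 have "k \<noteq> 0" using k assms(4) by (intro notI) simp
 then obtain m where m: "k = Suc m" by (cases k) simp_all
 have "(f ^^ m) x \<noteq> \<zero>\<^sub>M" using not_less_Least[of m "\<lambda>k. (f ^^ k) x = \<zero>\<^sub>M"] m by (simp add: k_def)
 thus thesis using that[of "(f ^^ m) x"] cl k m by simp
qed

text \<open>The local-ring property: if a sum is invertible, so is a summand. After multiplying by
  the inverse u the two summands add up to the identity. If both were nilpotent, a nonzero y killed
  by u f would be fixed by u g.\<close>

lemma eloc_add_bij:
 assumes M: "right_module R M" and loc: "eloc R M" and f: "rlin R M M f" and g: "rlin R M M g"
  and bij: "bij_betw (\<lambda>x. f x \<oplus>\<^sub>M g x) (car M) (car M)"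
 shows "bij_betw f (car M) (car M) \<or> bij_betw g (car M) (car M)"
proof (rule ccontr)
 assume n: "\<not> ?thesis"
 interpret M: right_module R M by fact
 note s = rlin_plus[OF M f g]
 obtain u where u: "rlin R M M u" "\<And>x. x \<in> car M ==> u (f x \<oplus>\<^sub>M g x) = x"
  "\<And>x. x \<in> car M ==> f (u x) \<oplus>\<^sub>M g (u x) = x"
  using rlin_inverse[OF M s bij] by metis
 have ubij: "bij_betw u (car M) (car M)"
  by (rule bij_betwI[of _ _ _ "\<lambda>x. f x \<oplus>\<^sub>M g x"])
   (simp_all add: u rlin_cl[OF u(1)] rlin_cl[OF f] rlin_cl[OF g])
 have bk: "bij_betw h (car M) (car M)" if "bij_betw (u \<circ> h) (car M) (car M)" "rlin R M M h" for h
 proof -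
  have c: "h \<in> car M \<rightarrow> car M" using rlin_cl[OF that(2)] by blast
  from bij_betw_comp_iff2[OF ubij, of h "car M"] c that(1) show ?thesis by blast
 qed
 have nb: "\<not> bij_betw (u \<circ> f) (car M) (car M)" "\<not> bij_betw (u \<circ> g) (car M) (car M)"
  using n bk f g by blast+
 have uf: "rlin R M M (u \<circ> f)" and ug: "rlin R M M (u \<circ> g)" by (rule rlin_o[OF u(1)], rule f g)+
 obtain k where k: "\<forall>x\<in>car M. ((u \<circ> f) ^^ k) x = \<zero>\<^sub>M"
  using loc uf nb(1) unfolding eloc_def by blast
 obtain l where l: "\<forall>x\<in>car M. ((u \<circ> g) ^^ l) x = \<zero>\<^sub>M"
  using loc ug nb(2) unfolding eloc_def by blast
 have sum: "(u \<circ> f) x \<oplus>\<^sub>M (u \<circ> g) x = x" if "x \<in> car M" for x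
  using rlin_add[OF u(1) rlin_cl[OF f that] rlin_cl[OF g that]] u(2)[OF that] by simp
 show False
 proof (cases "\<exists>x\<in>car M. x \<noteq> \<zero>\<^sub>M")
  case True
  then obtain x where x: "x \<in> car M" "x \<noteq> \<zero>\<^sub>M" by blast
  have c: "u \<circ> f \<in> car M \<rightarrow> car M" using rlin_cl[OF uf] by blast
  obtain y where y: "y \<in> car M" "y \<noteq> \<zero>\<^sub>M" "(u \<circ> f) y = \<zero>\<^sub>M"
   using nilpotent_kills[OF k c x] by metis
  have "(u \<circ> g) y = y" using sum[OF y(1)] rlin_cl[OF ug y(1)] unfolding y(3) by simp
  hence "((u \<circ> g) ^^ l) y = y" by (induction l) (simp, simp only: funpow.simps o_apply)
  thus False using l y by simp
 next
  case False
  hence "car M = {\<zero>\<^sub>M}" by auto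
  hence "bij_betw f (car M) (car M)" using rlin_cl[OF f] by (simp add: bij_betw_def)
  thus False using n by blast
 qed
qed

text \<open>\<open>mfactor\<close> expresses that L is a direct summand, with p i an automorphism
  rather than the identity. Inserting the identity of X writes p i as a sum of two maps, one through
  Y and one through Z, and \<open>eloc_add_bij\<close> selects one of them.\<close>

lemma mfactor_mbip:
 assumes L: "right_module R L" and X: "right_module R X" and loc: "eloc R L" and b: "mbip R X Y Z" and f: "mfactor R L X"
 shows "mfactor R L Y \<or> mfactor R L Z"
proof -
 interpret L: right_module R L by fact
 obtain j q j' q' where l: "rlin R Y X j" "rlin R X Y q" "rlin R Z X j'" "rlin R X Z q'"
  and e: "\<And>x. x\<in>car X ==> j (q x) \<oplus>\<^sub>X j' (q' x) = x"
  using b unfolding mbip_def by blast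
 obtain i p where ip: "rlin R L X i" "rlin R X L p" "bij_betw (\<lambda>x. p (i x)) (car L) (car L)"
  using f unfolding mfactor_def by blast
 let ?a = "(p \<circ> j) \<circ> (q \<circ> i)" and ?b = "(p \<circ> j') \<circ> (q' \<circ> i)"
 note c = rlin_o[OF ip(2) l(1)] rlin_o[OF l(2) ip(1)] rlin_o[OF ip(2) l(3)] rlin_o[OF l(4) ip(1)]
 have eq: "p (i x) = ?a x \<oplus>\<^sub>L ?b x" if x: "x \<in> car L" for x
 proof -
  have ix: "i x \<in> car X" by (rule rlin_cl[OF ip(1) x])
  have "p (i x) = p (j (q (i x)) \<oplus>\<^sub>X j' (q' (i x)))" using e[OF ix] by simp
  also have "\<dots> = ?a x \<oplus>\<^sub>L ?b x"
   using rlin_add[OF ip(2) rlin_cl[OF l(1) rlin_cl[OF l(2) ix]] rlin_cl[OF l(3) rlin_cl[OF l(4) ix]]] by simp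
  finally show ?thesis .
 qed
 have "bij_betw (\<lambda>x. ?a x \<oplus>\<^sub>L ?b x) (car L) (car L)"
  using ip(3) by (subst bij_betw_cong[of _ _ "\<lambda>x. p (i x)"]) (simp add: eq, assumption)
 from eloc_add_bij[OF L loc rlin_o[OF c(1,2)] rlin_o[OF c(3,4)] this]
 show ?thesis
 proof
  assume "bij_betw ?a (car L) (car L)"
  thus ?thesis unfolding mfactor_def using c(1,2) by (intro disjI1 exI[of _ "q \<circ> i"] exI[of _ "p \<circ> j"]) (simp add: comp_def)
 next
  assume "bij_betw ?b (car L) (car L)"
  thus ?thesis unfolding mfactor_def using c(3,4) by (intro disjI2 exI[of _ "q' \<circ> i"] exI[of _ "p \<circ> j'"]) (simp add: comp_def)
 qed
qed

text \<open>Iterates \<open>mfactor_mbip\<close> along the list; a nonzero L cannot be a summand of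
  the empty sum.\<close>

lemma mfactor_dsum:
 fixes L :: "('a, 'l) module" and Ms :: "('a, 'm) module list"
 assumes L: "right_module R L" and loc: "eloc R L" and nz: "car L \<noteq> {\<zero>\<^sub>L}"
  and "\<And>M. M \<in> set Ms ==> right_module R M" and "mfactor R L (rmod_dsum Ms)"
 shows "\<exists>M\<in>set Ms. mfactor R L M" using assms(4,5)
proof (induction Ms)
 case Nil
 interpret L: right_module R L by fact
 obtain i p where ip: "rlin R L (rmod_dsum ([] :: ('a, 'm) module list)) i" "rlin R (rmod_dsum ([] :: ('a, 'm) module list)) L p" "bij_betw (\<lambda>x. p (i x)) (car L) (car L)"
  using Nil.prems(2) unfolding mfactor_def by blast
 have "i x = i \<zero>\<^sub>L" if "x \<in> car L" for x
  using rlin_cl[OF ip(1) that] rlin_cl[OF ip(1) L.M.zero_closed] by (simp add: dsum_simps)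
 hence "x = \<zero>\<^sub>L" if "x \<in> car L" for x
  using ip(3) that L.M.zero_closed unfolding bij_betw_def inj_on_def by metis
 thus ?case using nz L.M.zero_closed by blast
next
 case (Cons M Ms)
 interpret L: right_module R L by fact
 have m: "right_module R M" "\<And>M. M \<in> set Ms ==> right_module R M" using Cons.prems(1) by simp_all
 have d: "right_module R (rmod_dsum Ms)" by (rule dsum_module[OF L.R.ring_axioms m(2)])
 have d': "right_module R (rmod_dsum (M # Ms))" by (rule dsum_module[OF L.R.ring_axioms Cons.prems(1)])
 from mfactor_mbip[OF L d' loc mbip_dsum[OF m(1) d] Cons.prems(2)]
 show ?case using Cons.IH[OF m(2)] by auto
qed

text \<open>An endomorphism u of eR is left multiplication by a = u e. If u is idempotent, e is the
  sum of the orthogonal idempotents a and e - a, so primitivity makes one of them zero.\<close>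

lemma (in ring) primitive_eloc_aux:
 assumes e: "primitive_idempotent R e" and u: "midem R (idem_proj R e) u"
 shows "(\<forall>x\<in>car (idem_proj R e). u x = \<zero>\<^bsub>idem_proj R e\<^esub>) \<or> (\<forall>x\<in>car (idem_proj R e). u x = x)"
proof -
 have ie: "idempotent_in R e" and ec: "e \<in> car R" "e \<otimes> e = e"
  using e by (auto simp: primitive_idempotent_def idempotent_in_def)
 note f = idem_proj_facts[OF ie]
 have ops: "\<zero>\<^bsub>idem_proj R e\<^esub> = \<zero>" "(\<oplus>\<^bsub>idem_proj R e\<^esub>) = (\<oplus>)" "a \<odot>\<^bsub>idem_proj R e\<^esub> x = x \<otimes> a" for a x
  by (simp_all add: idem_proj_def reg_simps)
 have lu: "rlin R (idem_proj R e) (idem_proj R e) u" and uu: "\<And>x. x \<in> car (idem_proj R e) ==> u (u x) = u x"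
  using u unfolding midem_def by blast+
 have em: "e \<in> car (idem_proj R e)" unfolding f(1) using ec by simp
 define a where "a = u e"
 have ux: "u x = a \<otimes> x" if "x \<in> car (idem_proj R e)" for x
 proof -
  have x: "x \<in> car R" "e \<otimes> x = x" using that unfolding f(1) by auto
  have "u (e \<otimes> x) = u e \<otimes> x" using rlin_act[OF lu x(1) em] unfolding ops .
  thus ?thesis using x by (simp add: a_def)
 qed
 have am: "a \<in> car (idem_proj R e)" unfolding a_def by (rule rlin_cl[OF lu em])
 hence ac: "a \<in> car R" "e \<otimes> a = a" unfolding f(1) by auto
 have aa: "a \<otimes> a = a" using uu[OF em] ux[OF am] by (simp add: a_def)
 have ae: "a \<otimes> e = a" using ux[OF em] by (simp add: a_def)
 let ?b = "e \<ominus> a"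
 have bc: "?b \<in> car R" using ec ac by simp
 have ab: "a \<otimes> ?b = \<zero>" using ec ac aa ae by (simp add: a_minus_def r_distr r_minus r_neg)
 have ba: "?b \<otimes> a = \<zero>" using ec ac aa ae by (simp add: a_minus_def l_distr l_minus r_neg)
 have eb: "e \<otimes> ?b = ?b" using ec ac by (simp add: a_minus_def r_distr r_minus)
 have bb: "?b \<otimes> ?b = ?b"
 proof -
  have "?b \<otimes> ?b = e \<otimes> ?b \<ominus> a \<otimes> ?b" using ec ac bc by (simp add: a_minus_def l_distr[of e "\<ominus> a" "e \<oplus> \<ominus> a"] l_minus)
  thus ?thesis using ab eb bc by (simp add: a_minus_def)
 qed
 have "e = a \<oplus> ?b" using ec ac a_comm[of a "e \<oplus> \<ominus> a"] by (simp add: a_minus_def a_assoc l_neg)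
 hence "a = \<zero> \<or> ?b = \<zero>"
  using e ac aa bc bb ab ba unfolding primitive_idempotent_def idempotent_in_def by blast
 thus ?thesis
 proof
  assume "a = \<zero>"
  hence "u x = \<zero>" if "x \<in> car (idem_proj R e)" for x
   using ux[OF that] that unfolding f(1) by simp
  thus ?thesis unfolding ops by blast
 next
  assume b: "?b = \<zero>"
  have "e = a \<oplus> ?b" by fact
  hence "a = e" unfolding b using ac by simp
  hence "u x = x" if "x \<in> car (idem_proj R e)" for x
   using ux[OF that] that unfolding f(1) by simp
  thus ?thesis by blast
 qed
qed

text \<open>The Peirce decomposition: i multiplies by each idempotent from the left and p adds the
  components. That p after i is the identity uses only that the idempotents sum to 1; the other
  order also uses orthogonality, which is therefore a premise of the last clause.\<close>

lemma (in ring) regular_idem_proj_maps: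
 assumes idem: "\<And>e. e \<in> set es ==> idempotent_in R e" and sum: "(\<Oplus>i\<in>{..<length es}. es ! i) = \<one>"
 obtains i p where "rlin R (right_regular R) (rmod_dsum (map (idem_proj R) es)) i"
  "rlin R (rmod_dsum (map (idem_proj R) es)) (right_regular R) p" "\<And>x. x \<in> car R ==> p (i x) = x"
  "\<And>v. (\<And>j k. j < length es ==> k < length es ==> j \<noteq> k ==> es ! j \<otimes> es ! k = \<zero>) ==>
   v \<in> car (rmod_dsum (map (idem_proj R) es)) ==> i (p v) = v"
proof -
 let ?D = "rmod_dsum (map (idem_proj R) es)" and ?n = "length es"
 have ej: "idempotent_in R (es ! j)" if "j < ?n" for j using idem that by simp
 hence ec: "es ! j \<in> car R" if "j < ?n" for j using that by (simp add: idempotent_in_def)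
 have ops: "(\<oplus>\<^bsub>idem_proj R e\<^esub>) = (\<oplus>)" "a \<odot>\<^bsub>idem_proj R e\<^esub> x = x \<otimes> a" for a x e
  by (simp_all add: idem_proj_def reg_simps)
 define i where "i x = (\<lambda>j\<in>{..<?n}. es ! j \<otimes> x)" for x
 define p where "p v = (\<Oplus>j\<in>{..<?n}. v j)" for v
 have i: "rlin R (right_regular R) ?D i"
 proof (rule rlinI)
  fix x assume "x \<in> car (right_regular R)"
  hence x: "x \<in> car R" by (simp add: reg_simps)
  show "i x \<in> car ?D" unfolding i_def dsum_simps(1) length_map restrict_PiE_iff
  proof
   fix j assume "j \<in> {..<?n}" hence j: "j < ?n" by simp
   show "es ! j \<otimes> x \<in> car (map (idem_proj R) es ! j)"
    unfolding nth_map[OF j] idem_proj_facts(1)[OF ej[OF j]]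
    using ej[OF j] x by (simp add: idempotent_in_def m_assoc[symmetric])
  qed
  fix a assume a: "a \<in> car R"
  show "i (a \<odot>\<^bsub>right_regular R\<^esub> x) = a \<odot>\<^sub>?D i x"
   by (rule dsum_cong[of _ ?n]) (use x a ec in \<open>simp_all add: i_def dsum_simps reg_simps ops m_assoc\<close>)
 next
  fix x y assume "x \<in> car (right_regular R)" "y \<in> car (right_regular R)"
  hence xy: "x \<in> car R" "y \<in> car R" by (simp_all add: reg_simps)
  show "i (x \<oplus>\<^bsub>right_regular R\<^esub> y) = i x \<oplus>\<^sub>?D i y"
   by (rule dsum_cong[of _ ?n]) (use xy ec in \<open>simp_all add: i_def dsum_simps reg_simps ops r_distr\<close>)
 qed
 have vc: "v j \<in> car R" if v: "v \<in> car ?D" and j: "j < ?n" for v j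
  using PiE_mem[OF v[unfolded dsum_simps(1)], of j] j by (simp add: idem_proj_facts(1)[OF ej[OF j]])
 have p: "rlin R ?D (right_regular R) p"
 proof (rule rlinI)
  fix v assume v: "v \<in> car ?D"
  show "p v \<in> car (right_regular R)"
   unfolding p_def reg_simps by (rule finsum_closed) (use vc[OF v] in blast)
  fix a assume a: "a \<in> car R"
  have "p (a \<odot>\<^sub>?D v) = (\<Oplus>j\<in>{..<?n}. v j \<otimes> a)"
   unfolding p_def by (rule finsum_cong') (use vc[OF v] a in \<open>simp_all add: dsum_simps ops\<close>)
  also have "\<dots> = (\<Oplus>j\<in>{..<?n}. v j) \<otimes> a"
   by (rule finsum_ldistr[symmetric]) (use vc[OF v] a in auto)
  finally show "p (a \<odot>\<^sub>?D v) = a \<odot>\<^bsub>right_regular R\<^esub> p v" by (simp add: p_def reg_simps)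
 next
  fix v w assume v: "v \<in> car ?D" and w: "w \<in> car ?D"
  have "p (v \<oplus>\<^sub>?D w) = (\<Oplus>j\<in>{..<?n}. v j \<oplus> w j)"
   unfolding p_def by (rule finsum_cong') (use vc[OF v] vc[OF w] in \<open>simp_all add: dsum_simps ops\<close>)
  also have "\<dots> = p v \<oplus> p w"
   unfolding p_def by (rule finsum_addf) (use vc[OF v] vc[OF w] in auto)
  finally show "p (v \<oplus>\<^sub>?D w) = p v \<oplus>\<^bsub>right_regular R\<^esub> p w" by (simp add: reg_simps)
 qed
 have "p (i x) = x" if x: "x \<in> car R" for x
 proof -
  have "p (i x) = (\<Oplus>j\<in>{..<?n}. es ! j \<otimes> x)"
   unfolding p_def by (rule finsum_cong') (use x ec in \<open>simp_all add: i_def\<close>)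
  also have "\<dots> = (\<Oplus>j\<in>{..<?n}. es ! j) \<otimes> x"
   by (rule finsum_ldistr[symmetric]) (use x ec in auto)
  finally show ?thesis using x sum by simp
 qed
 moreover have "i (p v) = v"
  if orth: "\<And>j k. j < ?n ==> k < ?n ==> j \<noteq> k ==> es ! j \<otimes> es ! k = \<zero>" and v: "v \<in> car ?D" for v
 proof (rule dsum_cong[of _ ?n])
  show "i (p v) \<in> extensional {..<?n}" by (simp add: i_def)
  show "v \<in> extensional {..<?n}" using rmod_dsum_ext[OF v] by simp
  fix j assume j: "j < ?n"
  have vk: "es ! k \<otimes> v k = v k" if k: "k < ?n" for k
   using PiE_mem[OF v[unfolded dsum_simps(1)], of k] k by (simp add: idem_proj_facts(1)[OF ej[OF k]])
  have "i (p v) j = (\<Oplus>k\<in>{..<?n}. es ! j \<otimes> v k)"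
   using j unfolding i_def p_def by (simp, subst finsum_rdistr) (use vc[OF v] ec in auto)
  also have "\<dots> = (\<Oplus>k\<in>{..<?n}. if j = k then v k else \<zero>)"
  proof (rule finsum_cong')
   fix k assume "k \<in> {..<?n}"
   hence k: "k < ?n" by simp
   have "es ! j \<otimes> v k = es ! j \<otimes> es ! k \<otimes> v k" using vk[OF k] ec[OF j] ec[OF k] vc[OF v k] by (simp add: m_assoc)
   thus "es ! j \<otimes> v k = (if j = k then v k else \<zero>)" using vk[OF j] orth[OF j k] vc[OF v k] by auto
  qed (use vc[OF v] in auto)
  also have "\<dots> = v j" by (rule finsum_singleton) (use j vc[OF v] in auto)
  finally show "i (p v) j = v j" .
 qed
 ultimately show thesis using i p by (rule that[rotated 2])
qed

lemma (in ring) regular_retract_idem_proj: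
 assumes idem: "\<And>e. e \<in> set es ==> idempotent_in R e" and sum: "(\<Oplus>i\<in>{..<length es}. es ! i) = \<one>"
 obtains i p where "rlin R (right_regular R) (rmod_dsum (map (idem_proj R) es)) i"
  "rlin R (rmod_dsum (map (idem_proj R) es)) (right_regular R) p" "\<And>x. x \<in> car R ==> p (i x) = x"
proof (rule regular_idem_proj_maps[OF assms])
 fix i p
 assume "rlin R (right_regular R) (rmod_dsum (map (idem_proj R) es)) i"
  "rlin R (rmod_dsum (map (idem_proj R) es)) (right_regular R) p" "\<And>x. x \<in> car R ==> p (i x) = x"
 thus thesis by (rule that)
qed

lemma rmod_isoI:
 assumes "right_module R M" "rlin R M N f" "bij_betw f (car M) (car N)"
 shows "rmod_iso R M N" unfolding rmod_iso_def
 by (rule bexI[OF _ rlin_restrict[OF assms(1,2)]]) (use assms(3) in \<open>subst bij_betw_cong[of _ _ f], simp_all\<close>)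

lemma rmod_isoE:
 assumes "rmod_iso R M N"
 obtains f where "rlin R M N f" "bij_betw f (car M) (car N)"
 using assms unfolding rmod_iso_def rhom_iff Bex_def by blast

lemma rmod_iso_dsum_Cons:
 assumes P: "right_module R P" and M: "right_module R M" and Ms: "right_module R (rmod_dsum Ms)"
  and b: "mbip R P Y Z" and f: "rlin R Y M f" "bij_betw f (car Y) (car M)"
  and g: "rlin R Z (rmod_dsum Ms) g" "bij_betw g (car Z) (car (rmod_dsum Ms))"
  and Y: "right_module R Y" and Z: "right_module R Z"
 shows "rmod_iso R P (rmod_dsum (M # Ms))"
proof -
 interpret P: right_module R P by fact
 interpret Y: right_module R Y by fact
 interpret Z: right_module R Z by fact
 obtain j q j' q' where l: "rlin R Y P j" "rlin R P Y q" "rlin R Z P j'" "rlin R P Z q'"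
  and e: "\<And>y. y\<in>car Y ==> q (j y) = y" "\<And>y. y\<in>car Y ==> q' (j y) = \<zero>\<^sub>Z"
   "\<And>z. z\<in>car Z ==> q' (j' z) = z" "\<And>z. z\<in>car Z ==> q (j' z) = \<zero>\<^sub>Y"
   "\<And>x. x\<in>car P ==> j (q x) \<oplus>\<^sub>P j' (q' x) = x"
  using b unfolding mbip_def by blast
 obtain f' where f': "rlin R M Y f'" "\<And>x. x \<in> car Y ==> f' (f x) = x" "\<And>x. x \<in> car M ==> f (f' x) = x"
  using rlin_inverse[OF Y f] by metis
 obtain g' where g': "rlin R (rmod_dsum Ms) Z g'" "\<And>x. x \<in> car Z ==> g' (g x) = x" "\<And>x. x \<in> car (rmod_dsum Ms) ==> g (g' x) = x"
  using rlin_inverse[OF Z g] by metis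
 let ?F = "\<lambda>x. dcons (length Ms) (f (q x)) (g (q' x))"
 let ?G = "\<lambda>v. j (f' (v 0)) \<oplus>\<^sub>P j' (g' (dtl (length Ms) v))"
 have F: "rlin R P (rmod_dsum (M # Ms)) ?F"
  using rlin_dcons[OF rlin_o[OF f(1) l(2)] rlin_o[OF g(1) l(4)]] by (simp add: comp_def)
 have "bij_betw ?F (car P) (car (rmod_dsum (M # Ms)))"
 proof (rule bij_betwI[of _ _ _ ?G])
  show "?F \<in> car P \<rightarrow> car (rmod_dsum (M # Ms))" using rlin_cl[OF F] by blast
  show "?G \<in> car (rmod_dsum (M # Ms)) \<rightarrow> car P"
   using rlin_cl[OF l(1) rlin_cl[OF f'(1) dhd_closed]] rlin_cl[OF l(3) rlin_cl[OF g'(1) dtl_closed]] by blast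
  show "?G (?F x) = x" if x: "x \<in> car P" for x
   using e(5)[OF x] f'(2)[OF rlin_cl[OF l(2) x]] g'(2)[OF rlin_cl[OF l(4) x]]
    rmod_dsum_ext[OF rlin_cl[OF g(1) rlin_cl[OF l(4) x]]] by simp
  show "?F (?G v) = v" if v: "v \<in> car (rmod_dsum (M # Ms))" for v
  proof -
   let ?y = "f' (v 0)" and ?z = "g' (dtl (length Ms) v)"
   have y: "?y \<in> car Y" by (rule rlin_cl[OF f'(1) dhd_closed[OF v]])
   have z: "?z \<in> car Z" by (rule rlin_cl[OF g'(1) dtl_closed[OF v]])
   have "q (?G v) = ?y" using rlin_add[OF l(2) rlin_cl[OF l(1) y] rlin_cl[OF l(3) z]] e(1)[OF y] e(4)[OF z] y by simp
   moreover have "q' (?G v) = ?z" using rlin_add[OF l(4) rlin_cl[OF l(1) y] rlin_cl[OF l(3) z]] e(2)[OF y] e(3)[OF z] z by simp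
   ultimately show ?thesis using f'(3)[OF dhd_closed[OF v]] g'(3)[OF dtl_closed[OF v]] dcons_hd_tl[OF v] by simp
  qed
 qed
 with P F show ?thesis by (rule rmod_isoI)
qed

lemma fg_projective_mfactor:
 assumes "fg_projective R P"
 obtains k where "mfactor R P (free_module R k)"
proof (rule fg_projectiveE[OF assms])
 fix k i p
 assume ip: "rlin R P (free_module R k) i" "rlin R (free_module R k) P p" "\<And>x. x \<in> car P ==> p (i x) = x"
 have "bij_betw (\<lambda>x. p (i x)) (car P) (car P)"
  by (subst bij_betw_cong[of _ _ id]) (simp_all add: ip(3))
 with ip(1,2) show thesis by (intro that[of k]) (unfold mfactor_def, blast)
qed

lemma midem_mbip:
 assumes M: "right_module R M" and e: "midem R M e"
 shows "mbip R M (M\<lparr>carrier := e ` car M\<rparr>) (M\<lparr>carrier := (\<lambda>x. x \<ominus>\<^sub>M e x) ` car M\<rparr>)"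
proof -
 interpret M: right_module R M by fact
 let ?c = "\<lambda>x. x \<ominus>\<^sub>M e x"
 note f = midem_facts[OF M e]
 note g = midem_facts[OF M f(5)]
 have ec: "\<And>x. x \<in> ?c ` car M ==> e x = \<zero>\<^sub>M" using f(6) by blast
 have ee: "\<And>x. x \<in> e ` car M ==> e x = x" using e unfolding midem_def by blast
 have cc: "\<And>x. x \<in> ?c ` car M ==> ?c x = x" using f(5) unfolding midem_def by blast
 have ce: "\<And>x. x \<in> e ` car M ==> ?c x = \<zero>\<^sub>M"
 proof -
  fix x assume x: "x \<in> e ` car M"
  hence "x \<in> car M" using rlin_cl[OF conjunct1[OF e[unfolded midem_def]]] by blast
  thus "?c x = \<zero>\<^sub>M" unfolding ee[OF x] by (simp add: a_minus_def M.M.r_neg)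
 qed
 have 1: "\<forall>y\<in>car (M\<lparr>carrier := e ` car M\<rparr>). e (id y) = y \<and> ?c (id y) = \<zero>\<^bsub>M\<lparr>carrier := ?c ` car M\<rparr>\<^esub>"
 proof
  fix y assume "y \<in> car (M\<lparr>carrier := e ` car M\<rparr>)"
  hence y: "y \<in> e ` car M" by simp
  show "e (id y) = y \<and> ?c (id y) = \<zero>\<^bsub>M\<lparr>carrier := ?c ` car M\<rparr>\<^esub>" using ee[OF y] ce[OF y] by simp
 qed
 have 2: "\<forall>y\<in>car (M\<lparr>carrier := ?c ` car M\<rparr>). ?c (id y) = y \<and> e (id y) = \<zero>\<^bsub>M\<lparr>carrier := e ` car M\<rparr>\<^esub>"
 proof
  fix y assume "y \<in> car (M\<lparr>carrier := ?c ` car M\<rparr>)"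
  hence y: "y \<in> ?c ` car M" by simp
  show "?c (id y) = y \<and> e (id y) = \<zero>\<^bsub>M\<lparr>carrier := e ` car M\<rparr>\<^esub>" using cc[OF y] ec[OF y] by simp
 qed
 have 3: "\<forall>x\<in>car M. id (e x) \<oplus>\<^sub>M id (?c x) = x" using f(7) by simp
 show ?thesis unfolding mbip_def using f(2,3) g(2,3) 1 2 3 by blast
qed

context fd_algebra
begin

lemma eloc_idem_proj:
 assumes "primitive_idempotent R e"
 shows "eloc R (idem_proj R e)"
proof -
 have "idempotent_in R e" using assms by (simp add: primitive_idempotent_def)
 thus ?thesis
  using eloc_idempotent[OF fd_projective[OF idem_proj_projective]] primitive_eloc_aux[OF assms] by blast
qed

text \<open>By locality of Q the endomorphism i p is nilpotent or bijective. Nilpotency would make a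
  power of the automorphism p i vanish on the nonzero L; bijectivity makes i surjective, and i is
  injective anyway.\<close>

lemma eloc_factor_iso:
 assumes L: "right_module R L" and nz: "car L \<noteq> {\<zero>\<^sub>L}" and Q: "right_module R Q" and locQ: "eloc R Q" and f: "mfactor R L Q"
 obtains g where "rlin R L Q g" "bij_betw g (car L) (car Q)"
proof -
 interpret L: right_module R L by fact
 obtain i p where ip: "rlin R L Q i" "rlin R Q L p" "bij_betw (\<lambda>x. p (i x)) (car L) (car L)"
  using f unfolding mfactor_def by blast
 let ?u = "i \<circ> p"
 have u: "rlin R Q Q ?u" by (rule rlin_o[OF ip(1,2)])
 have "\<not> (\<exists>n. \<forall>x\<in>car Q. (?u ^^ n) x = \<zero>\<^sub>Q)"
 proof
  assume "\<exists>n. \<forall>x\<in>car Q. (?u ^^ n) x = \<zero>\<^sub>Q"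
  then obtain n where n: "\<forall>x\<in>car Q. (?u ^^ n) x = \<zero>\<^sub>Q" ..
  have sw: "(?u ^^ n) (i x) = i (((p \<circ> i) ^^ n) x)" for x by (induction n) simp_all
  have pz: "p ((?u ^^ n) (i x)) = \<zero>\<^sub>L" if "x \<in> car L" for x
   using n rlin_cl[OF ip(1) that] rlin_zero[OF Q L ip(2)] by simp
  have bij: "bij_betw (p \<circ> i) (car L) (car L)" using ip(3) by (simp add: comp_def)
  have pi: "rlin R L L (p \<circ> i)" by (rule rlin_o[OF ip(2,1)])
  have "bij_betw ((p \<circ> i) ^^ k) (car L) (car L)" for k
   by (induction k) (simp_all add: bij_betw_trans[OF _ bij] del: o_apply, simp add: id_def[symmetric])
  from bij_betw_imp_inj_on[OF this[of "Suc n"]] have inj: "inj_on ((p \<circ> i) ^^ Suc n) (car L)" .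
  have "x = \<zero>\<^sub>L" if x: "x \<in> car L" for x
  proof (rule inj_onD[OF inj _ x L.M.zero_closed])
   have "((p \<circ> i) ^^ Suc n) x = \<zero>\<^sub>L" if "x \<in> car L" for x using pz[OF that] sw by simp
   from this[OF x] this[OF L.M.zero_closed] show "((p \<circ> i) ^^ Suc n) x = ((p \<circ> i) ^^ Suc n) \<zero>\<^sub>L" by (rule trans[OF _ sym])
  qed
  thus False using nz L.M.zero_closed by blast
 qed
 hence b: "bij_betw ?u (car Q) (car Q)" using locQ u unfolding eloc_def by blast
 have "bij_betw i (car L) (car Q)"
 proof (rule bij_betw_imageI)
  show "inj_on i (car L)"
  proof (rule inj_onI)
   fix x y assume xy: "x \<in> car L" "y \<in> car L" "i x = i y"
   hence "p (i x) = p (i y)" by simp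
   thus "x = y" using inj_onD[OF bij_betw_imp_inj_on[OF ip(3)]] xy by blast
  qed
  show "i ` car L = car Q"
  proof
   show "i ` car L \<subseteq> car Q" using rlin_cl[OF ip(1)] by blast
   show "car Q \<subseteq> i ` car L"
   proof
    fix y assume "y \<in> car Q"
    hence "y \<in> ?u ` car Q" using bij_betw_imp_surj_on[OF b] by blast
    then obtain z where z: "z \<in> car Q" "y = i (p z)" by (metis comp_apply imageE)
    thus "y \<in> i ` car L" using rlin_cl[OF ip(2) z(1)] by blast
   qed
  qed
 qed
 with ip(1) show thesis by (rule that)
qed

lemma minimal_idempotent_eloc:
 assumes M: "fd_right_module R M" and e: "midem R M e" "\<exists>x\<in>car M. e x \<noteq> \<zero>\<^sub>M"
  and min: "\<And>e'. midem R M e' ==> \<exists>x\<in>car M. e' x \<noteq> \<zero>\<^sub>M ==>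
   mdim (M\<lparr>carrier := e ` car M\<rparr>) \<le> mdim (M\<lparr>carrier := e' ` car M\<rparr>)"
 shows "eloc R (M\<lparr>carrier := e ` car M\<rparr>)"
proof (rule eloc_idempotent)
 let ?N = "M\<lparr>carrier := e ` car M\<rparr>"
 note m = fdD[OF M]
 note f = midem_facts[OF m e(1)]
 have le: "rlin R M M e" using e(1) by (simp add: midem_def)
 show N: "fd_right_module R ?N" by (rule fd_submodule[OF M rlin_image_submodule[OF m m le]])
 fix u assume u: "midem R ?N u"
 have lu: "rlin R ?N ?N u" and uu: "\<And>y. y \<in> e ` car M ==> u (u y) = u y" using u by (auto simp: midem_def)
 have uc: "\<And>y. y \<in> e ` car M ==> u y \<in> e ` car M" using rlin_cl[OF lu] by simp
 have ee: "\<And>x. x \<in> e ` car M ==> e x = x" using e unfolding midem_def by blast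
 let ?v = "u \<circ> e"
 have "rlin R M M ?v" using rlin_o[OF f(3) rlin_o[OF lu f(2)]] by simp
 moreover have "?v (?v x) = ?v x" if "x \<in> car M" for x
 proof -
  have y: "e x \<in> e ` car M" using that by (rule imageI)
  show ?thesis using ee[OF uc[OF y]] uu[OF y] by simp
 qed
 ultimately have v: "midem R M ?v" unfolding midem_def by blast
 have im: "?v ` car M = u ` car ?N" by (simp add: image_image)
 show "(\<forall>x\<in>car ?N. u x = \<zero>\<^sub>?N) \<or> (\<forall>x\<in>car ?N. u x = x)"
 proof (rule ccontr)
  assume "\<not> ?thesis"
  then obtain y z where y: "y \<in> car ?N" "u y \<noteq> \<zero>\<^sub>?N" and z: "z \<in> car ?N" "u z \<noteq> z" by blast
  have "\<exists>x\<in>car M. ?v x \<noteq> \<zero>\<^sub>M" using y by auto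
  from min[OF v this] have "mdim ?N \<le> mdim (?N\<lparr>carrier := u ` car ?N\<rparr>)" unfolding im by simp
  moreover have "u ` car ?N \<noteq> car ?N" using midem_surj[OF u] z by blast
  ultimately show False
   using mdim_submodule(2)[OF N rlin_image_submodule[OF fdD[OF N] fdD[OF N] lu]] by simp
 qed
qed

text \<open>Shows that the choice in \<open>proj_decomposition\<close> is meaningful. An idempotent
  with smallest nonzero image splits off a local summand. It is a summand of a free module, hence of
  the regular module, hence of some eR with e in \<open>es\<close>; as eR is local too, the two are
  isomorphic.\<close>

lemma projective_decomposition:
 assumes es: "complete_primitive_idempotents R es" and "fg_projective R P"
 shows "\<exists>is. set is \<subseteq> {..<length es} \<and> rmod_iso R P (rmod_dsum (map (\<lambda>i. idem_proj R (es ! i)) is))"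
 using assms(2)
proof (induction "mdim P" arbitrary: P rule: less_induct)
 case less
 note P = fg_projective_module[OF less.prems] and fP = fd_projective[OF less.prems]
 interpret P: right_module R P by (rule P)
 have prim: "\<And>e. e \<in> set es ==> primitive_idempotent R e" and sum: "(\<Oplus>i\<in>{..<length es}. es ! i) = \<one>"
  using es by (auto simp: complete_primitive_idempotents_def)
 hence idem: "\<And>e. e \<in> set es ==> idempotent_in R e" by (simp add: primitive_idempotent_def)
 show ?case
 proof (cases "\<forall>x\<in>car P. x = \<zero>\<^sub>P")
  case True
  have "right_module R (rmod_dsum ([] :: ('a, 'a) module list))" by (rule dsum_module[OF ring_axioms]) simp
  hence "rlin R P (rmod_dsum ([] :: ('a, 'a) module list)) (\<lambda>_. \<zero>\<^bsub>rmod_dsum ([] :: ('a, 'a) module list)\<^esub>)" by (rule rlin_const_zero)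
  moreover have "car P = {\<zero>\<^sub>P}" using True P.M.zero_closed by blast
  ultimately have "rmod_iso R P (rmod_dsum ([] :: ('a, 'a) module list))"
   by (intro rmod_isoI[OF P]) (simp_all add: bij_betw_def dsum_simps restrict_def)
  thus ?thesis by (intro exI[of _ "[]"]) simp
 next
  case False
  have "midem R P id \<and> (\<exists>x\<in>car P. id x \<noteq> \<zero>\<^sub>P)" using False by (simp add: midem_def rlin_id)
  then obtain e where e: "midem R P e" "\<exists>x\<in>car P. e x \<noteq> \<zero>\<^sub>P"
   and min: "\<And>e'. midem R P e' ==> \<exists>x\<in>car P. e' x \<noteq> \<zero>\<^sub>P ==>
   mdim (P\<lparr>carrier := e ` car P\<rparr>) \<le> mdim (P\<lparr>carrier := e' ` car P\<rparr>)"
   using ex_has_least_nat[of "\<lambda>e. midem R P e \<and> (\<exists>x\<in>car P. e x \<noteq> \<zero>\<^sub>P)" id "\<lambda>e. mdim (P\<lparr>carrier := e ` car P\<rparr>)"]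
   by blast
  let ?L = "P\<lparr>carrier := e ` car P\<rparr>" and ?c = "\<lambda>x. x \<ominus>\<^sub>P e x"
  let ?Z = "P\<lparr>carrier := ?c ` car P\<rparr>"
  note f = midem_facts[OF P e(1)]
  note g = midem_facts[OF P f(5)]
  have loc: "eloc R ?L" by (rule minimal_idempotent_eloc[OF fP e min])
  have pL: "fg_projective R ?L" by (rule fg_projective_retract[OF less.prems f(1,3,2)]) (unfold id_apply, rule f(4))
  have pZ: "fg_projective R ?Z" by (rule fg_projective_retract[OF less.prems g(1,3,2)]) (unfold id_apply, rule g(4))
  have nz: "car ?L \<noteq> {\<zero>\<^sub>?L}" using e(2) by auto
  note b = midem_mbip[OF P e(1)]
  have "\<exists>x\<in>car P. e x \<noteq> \<zero>\<^sub>P" by (rule e(2))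
  then obtain x where x: "x \<in> car P" "e x \<noteq> \<zero>\<^sub>P" by blast
  have lc: "rlin R P P ?c" using f(5) by (simp add: midem_def)
  have "?c x \<noteq> x" using x f(6)[OF x(1)] by metis
  hence "?c ` car P \<noteq> car P" using midem_surj[OF f(5)] x(1) by blast
  hence "mdim ?Z < mdim P" by (rule mdim_submodule(2)[OF fP rlin_image_submodule[OF P P lc]])
  from less.hyps[OF this pZ] obtain "is" where is_: "set is \<subseteq> {..<length es}"
   "rmod_iso R ?Z (rmod_dsum (map (\<lambda>i. idem_proj R (es ! i)) is))" by blast
  obtain h where h: "rlin R ?Z (rmod_dsum (map (\<lambda>i. idem_proj R (es ! i)) is)) h"
   "bij_betw h (car ?Z) (car (rmod_dsum (map (\<lambda>i. idem_proj R (es ! i)) is)))"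
   by (rule rmod_isoE[OF is_(2)])
  obtain k where "mfactor R ?L (free_module R k)" by (rule fg_projective_mfactor[OF pL])
  hence "\<exists>M\<in>set (replicate k (right_regular R)). mfactor R ?L M"
   by (rule mfactor_dsum[OF f(1) loc nz, rotated]) (metis right_regular_is_module in_set_replicate)
  hence "mfactor R ?L (right_regular R)" by (metis in_set_replicate)
  then obtain i' p' where ip': "rlin R ?L (right_regular R) i'" "rlin R (right_regular R) ?L p'"
   "bij_betw (\<lambda>x. p' (i' x)) (car ?L) (car ?L)" unfolding mfactor_def by blast
  obtain i'' p'' where ip'': "rlin R (right_regular R) (rmod_dsum (map (idem_proj R) es)) i''"
   "rlin R (rmod_dsum (map (idem_proj R) es)) (right_regular R) p''" "\<And>x. x \<in> car R ==> p'' (i'' x) = x"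
   using regular_retract_idem_proj[OF idem sum] by metis
  have "bij_betw (\<lambda>x. (p' \<circ> p'') ((i'' \<circ> i') x)) (car ?L) (car ?L)"
  proof (subst bij_betw_cong[of _ _ "\<lambda>x. p' (i' x)"])
   fix x assume "x \<in> car ?L"
   hence "i' x \<in> car R" using rlin_cl[OF ip'(1)] by (simp add: reg_simps)
   thus "(p' \<circ> p'') ((i'' \<circ> i') x) = p' (i' x)" using ip''(3) by simp
  qed (rule ip'(3))
  hence "mfactor R ?L (rmod_dsum (map (idem_proj R) es))"
   unfolding mfactor_def using rlin_o[OF ip''(1) ip'(1)] rlin_o[OF ip'(2) ip''(2)] by blast
  hence "\<exists>M\<in>set (map (idem_proj R) es). mfactor R ?L M"
  proof (rule mfactor_dsum[OF f(1) loc nz, rotated])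
   fix M assume "M \<in> set (map (idem_proj R) es)"
   then obtain e' where "e' \<in> set es" "M = idem_proj R e'" by auto
   thus "right_module R M" using idem_proj_is_module[OF idem] by simp
  qed
  then obtain n where n: "n < length es" "mfactor R ?L (idem_proj R (es ! n))"
   by (auto simp: in_set_conv_nth)
  have pn: "primitive_idempotent R (es ! n)" and iN: "idempotent_in R (es ! n)" using prim idem n(1) by simp_all
  obtain v where v: "rlin R ?L (idem_proj R (es ! n)) v" "bij_betw v (car ?L) (car (idem_proj R (es ! n)))"
   using eloc_factor_iso[OF f(1) nz idem_proj_is_module[OF iN] eloc_idem_proj[OF pn] n(2)] by metis
  have dm: "right_module R (rmod_dsum (map (\<lambda>i. idem_proj R (es ! i)) is))"
  proof (rule dsum_module[OF ring_axioms])
   fix M assume "M \<in> set (map (\<lambda>i. idem_proj R (es ! i)) is)"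
   then obtain i where "i \<in> set is" "M = idem_proj R (es ! i)" by auto
   thus "right_module R M" using idem_proj_is_module[OF idem] is_(1) by auto
  qed
  have "rmod_iso R P (rmod_dsum (idem_proj R (es ! n) # map (\<lambda>i. idem_proj R (es ! i)) is))"
   by (rule rmod_iso_dsum_Cons[OF P idem_proj_is_module[OF iN] dm b v h f(1) g(1)])
  thus ?thesis using is_(1) n(1) by (intro exI[of _ "n # is"]) simp
 qed
qed

end

section \<open>The functor H^0 on complexes up to homotopy\<close>

definition H0_class :: "('a, 'm) two_term => 'm => 'm set" where
 "H0_class X x = (tdiff X ` car (tm1 X)) +>\<^bsub>t0 X\<^esub> x"

lemma H0_facts:
 assumes X: "cplx R X"
 shows H0_is_module: "right_module R (H0 X)"
  and H0_carrier: "car (H0 X) = H0_class X ` car (t0 X)"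
  and H0_class_rlin: "rlin R (t0 X) (H0 X) (H0_class X)"
  and H0_class_eq_iff: "x \<in> car (t0 X) ==> y \<in> car (t0 X) ==>
   H0_class X x = H0_class X y \<longleftrightarrow> (\<exists>z\<in>car (tm1 X). x = y \<oplus>\<^bsub>t0 X\<^esub> tdiff X z)"
proof -
 note c = cplxD[OF X]
 interpret P: right_module R "t0 X" by (rule c)
 note s = rlin_image_submodule[OF c]
 note q = quotient_module_facts[OF c(2) s]
 have e: "(\<lambda>x. H0_class X x) = (\<lambda>x. (tdiff X ` car (tm1 X)) +>\<^bsub>t0 X\<^esub> x)" by (simp add: H0_class_def fun_eq_iff)
 show "right_module R (H0 X)" unfolding H0_def by (rule q(4))
 show "car (H0 X) = H0_class X ` car (t0 X)" unfolding H0_def q(1) e ..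
 show "rlin R (t0 X) (H0 X) (H0_class X)" unfolding H0_def using q(2) by (simp add: H0_class_def[abs_def])
 show "H0_class X x = H0_class X y \<longleftrightarrow> (\<exists>z\<in>car (tm1 X). x = y \<oplus>\<^bsub>t0 X\<^esub> tdiff X z)"
  if x: "x \<in> car (t0 X)" and y: "y \<in> car (t0 X)"
 proof -
  have "H0_class X x = H0_class X y \<longleftrightarrow> x \<ominus>\<^bsub>t0 X\<^esub> y \<in> tdiff X ` car (tm1 X)"
   unfolding H0_class_def by (rule q(5)[OF x y])
  also have "\<dots> \<longleftrightarrow> (\<exists>z\<in>car (tm1 X). x \<ominus>\<^bsub>t0 X\<^esub> y = tdiff X z)" by blast
  also have "\<dots> \<longleftrightarrow> (\<exists>z\<in>car (tm1 X). x = y \<oplus>\<^bsub>t0 X\<^esub> tdiff X z)"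
  proof (rule bex_cong[OF refl])
   fix z assume z: "z \<in> car (tm1 X)"
   have d: "tdiff X z \<in> car (t0 X)" by (rule rlin_cl[OF c(3) z])
   show "x \<ominus>\<^bsub>t0 X\<^esub> y = tdiff X z \<longleftrightarrow> x = y \<oplus>\<^bsub>t0 X\<^esub> tdiff X z"
   proof
    assume "x \<ominus>\<^bsub>t0 X\<^esub> y = tdiff X z"
    hence "y \<oplus>\<^bsub>t0 X\<^esub> tdiff X z = y \<oplus>\<^bsub>t0 X\<^esub> (x \<ominus>\<^bsub>t0 X\<^esub> y)" by simp
    also have "\<dots> = x \<oplus>\<^bsub>t0 X\<^esub> (y \<oplus>\<^bsub>t0 X\<^esub> \<ominus>\<^bsub>t0 X\<^esub> y)" using x y by (simp add: a_minus_def P.M.a_lcomm)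
    also have "\<dots> = x" using x y by (simp add: P.M.r_neg)
    finally show "x = y \<oplus>\<^bsub>t0 X\<^esub> tdiff X z" ..
   next
    assume h: "x = y \<oplus>\<^bsub>t0 X\<^esub> tdiff X z"
    have "x \<ominus>\<^bsub>t0 X\<^esub> y = tdiff X z \<oplus>\<^bsub>t0 X\<^esub> (y \<oplus>\<^bsub>t0 X\<^esub> \<ominus>\<^bsub>t0 X\<^esub> y)"
     unfolding h using y d by (simp add: a_minus_def P.M.a_comm[OF y d] P.M.a_assoc)
    thus "x \<ominus>\<^bsub>t0 X\<^esub> y = tdiff X z" using y d by (simp add: P.M.r_neg)
   qed
  qed
  finally show ?thesis .
 qed
qed

text \<open>A homotopy alters the degree-zero component by elements in the image of the
  differential, which H^0 does not see.\<close>

lemma H0_class_heq: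
 assumes X: "cplx R X" and Y: "cplx R Y" and f: "cmap R X Y f" and g: "cmap R X Y g" and h: "heq R X Y f g"
  and x: "x \<in> car (t0 X)"
 shows "H0_class Y (snd f x) = H0_class Y (snd g x)"
proof -
 obtain h where h: "rlin R (t0 X) (tm1 Y) h" "\<forall>x\<in>car (t0 X). snd f x = snd g x \<oplus>\<^bsub>t0 Y\<^esub> tdiff Y (h x)"
  using h unfolding heq_def by blast
 have "\<exists>z\<in>car (tm1 Y). snd f x = snd g x \<oplus>\<^bsub>t0 Y\<^esub> tdiff Y z"
  using bspec[OF h(2) x] rlin_cl[OF h(1) x] by blast
 thus ?thesis
  using H0_class_eq_iff[OF Y rlin_cl[OF cmapD(2)[OF f] x] rlin_cl[OF cmapD(2)[OF g] x]] by blast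
qed

text \<open>A chain map sends boundaries to boundaries, so the degree-zero component is constant on
  the fibres of the class map and factors through it.\<close>

lemma H0_map:
 assumes X: "cplx R X" and Y: "cplx R Y" and f: "cmap R X Y f"
 obtains F where "rlin R (H0 X) (H0 Y) F" "\<And>x. x \<in> car (t0 X) ==> F (H0_class X x) = H0_class Y (snd f x)"
proof -
 interpret Y0: right_module R "t0 Y" by (rule cplxD[OF Y])
 have eq: "(H0_class Y \<circ> snd f) x = (H0_class Y \<circ> snd f) y"
  if x: "x \<in> car (t0 X)" and y: "y \<in> car (t0 X)" and xy: "H0_class X x = H0_class X y" for x y
 proof -
  obtain z where z: "z \<in> car (tm1 X)" "x = y \<oplus>\<^bsub>t0 X\<^esub> tdiff X z"
   using xy H0_class_eq_iff[OF X x y] by blast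
  have "snd f x = snd f y \<oplus>\<^bsub>t0 Y\<^esub> tdiff Y (fst f z)"
   unfolding z(2) using rlin_add[OF cmapD(2)[OF f] y rlin_cl[OF cplxD(3)[OF X] z(1)]] cmapD(3)[OF f z(1)] by simp
  thus ?thesis
   using H0_class_eq_iff[OF Y rlin_cl[OF cmapD(2)[OF f] x] rlin_cl[OF cmapD(2)[OF f] y]] rlin_cl[OF cmapD(1)[OF f] z(1)]
   by auto
 qed
 obtain F where "rlin R (H0 X) (H0 Y) F" "\<And>x. x \<in> car (t0 X) ==> F (H0_class X x) = (H0_class Y \<circ> snd f) x"
  using rlin_factor[OF cplxD(2)[OF X] H0_class_rlin[OF X] H0_carrier[OF X, symmetric] rlin_o[OF H0_class_rlin[OF Y] cmapD(2)[OF f]] eq]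
  by metis
 thus thesis using that by simp
qed

lemma H0_iso:
 assumes X: "cplx R X" and Y: "cplx R Y" and i: "K_iso R X Y"
 obtains F where "rlin R (H0 X) (H0 Y) F" "bij_betw F (car (H0 X)) (car (H0 Y))"
proof -
 obtain f g where fg: "cmap R X Y f" "cmap R Y X g" "heq R X X (g \<odot>c f) cid" "heq R Y Y (f \<odot>c g) cid"
  using i by (rule K_isoE)
 obtain F where F: "rlin R (H0 X) (H0 Y) F" "\<And>x. x \<in> car (t0 X) ==> F (H0_class X x) = H0_class Y (snd f x)"
  using H0_map[OF X Y fg(1)] by metis
 obtain G where G: "rlin R (H0 Y) (H0 X) G" "\<And>x. x \<in> car (t0 Y) ==> G (H0_class Y x) = H0_class X (snd g x)"
  using H0_map[OF Y X fg(2)] by metis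
 have GF: "G (F c) = c" if c: "c \<in> car (H0 X)" for c
 proof -
  obtain x where x: "x \<in> car (t0 X)" "c = H0_class X x" using c H0_carrier[OF X] by auto
  show ?thesis
   using H0_class_heq[OF X X cmap_comp[OF fg(2,1)] cmap_id fg(3) x(1)] F(2)[OF x(1)] G(2)[OF rlin_cl[OF cmapD(2)[OF fg(1)] x(1)]]
   by (simp add: x(2))
 qed
 have FG: "F (G c) = c" if c: "c \<in> car (H0 Y)" for c
 proof -
  obtain x where x: "x \<in> car (t0 Y)" "c = H0_class Y x" using c H0_carrier[OF Y] by auto
  show ?thesis
   using H0_class_heq[OF Y Y cmap_comp[OF fg(1,2)] cmap_id fg(4) x(1)] G(2)[OF x(1)] F(2)[OF rlin_cl[OF cmapD(2)[OF fg(2)] x(1)]]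
   by (simp add: x(2))
 qed
 have "bij_betw F (car (H0 X)) (car (H0 Y))"
  by (rule bij_betwI[of _ _ _ G]) (use rlin_cl[OF F(1)] rlin_cl[OF G(1)] GF FG in auto)
 with F(1) show thesis by (rule that)
qed

lemma H0_mbip:
 assumes X: "cplx R X" and Y: "cplx R Y" and Z: "cplx R Z" and b: "kbip R X Y Z"
 shows "mbip R (H0 X) (H0 Y) (H0 Z)"
proof -
 obtain j q j' q' where m: "cmap R Y X j" "cmap R X Y q" "cmap R Z X j'" "cmap R X Z q'"
  and e: "heq R Y Y (q \<odot>c j) cid" "heq R Z Z (q' \<odot>c j') cid" "heq R Y Z (q' \<odot>c j) (czero Z)"
  "heq R Z Y (q \<odot>c j') (czero Y)" "heq R X X (cadd X (j \<odot>c q) (j' \<odot>c q')) cid"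
  using b unfolding kbip_def by blast
 obtain J where J: "rlin R (H0 Y) (H0 X) J" "\<And>x. x \<in> car (t0 Y) ==> J (H0_class Y x) = H0_class X (snd j x)"
  using H0_map[OF Y X m(1)] by metis
 obtain Q where Q: "rlin R (H0 X) (H0 Y) Q" "\<And>x. x \<in> car (t0 X) ==> Q (H0_class X x) = H0_class Y (snd q x)"
  using H0_map[OF X Y m(2)] by metis
 obtain J' where J': "rlin R (H0 Z) (H0 X) J'" "\<And>x. x \<in> car (t0 Z) ==> J' (H0_class Z x) = H0_class X (snd j' x)"
  using H0_map[OF Z X m(3)] by metis
 obtain Q' where Q': "rlin R (H0 X) (H0 Z) Q'" "\<And>x. x \<in> car (t0 X) ==> Q' (H0_class X x) = H0_class Z (snd q' x)"
  using H0_map[OF X Z m(4)] by metis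
 have hz: "H0_class W (snd (czero W) x) = \<zero>\<^bsub>H0 W\<^esub>" if "cplx R W" for W :: "('a, 'w) two_term" and x :: 'v
  using rlin_zero[OF cplxD(2)[OF that] H0_is_module[OF that] H0_class_rlin[OF that]] by (simp add: czero_def)
 have 1: "Q (J y) = y \<and> Q' (J y) = \<zero>\<^bsub>H0 Z\<^esub>" if y: "y \<in> car (H0 Y)" for y
 proof -
  obtain x where x: "x \<in> car (t0 Y)" "y = H0_class Y x" using y H0_carrier[OF Y] by auto
  note jx = rlin_cl[OF cmapD(2)[OF m(1)] x(1)]
  show ?thesis unfolding x(2) J(2)[OF x(1)] Q(2)[OF jx] Q'(2)[OF jx]
   using H0_class_heq[OF Y Y cmap_comp[OF m(2,1)] cmap_id e(1) x(1)] H0_class_heq[OF Y Z cmap_comp[OF m(4,1)] cmap_zero[OF Y Z] e(3) x(1)] hz[OF Z, of x]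
   by simp
 qed
 have 2: "Q' (J' y) = y \<and> Q (J' y) = \<zero>\<^bsub>H0 Y\<^esub>" if y: "y \<in> car (H0 Z)" for y
 proof -
  obtain x where x: "x \<in> car (t0 Z)" "y = H0_class Z x" using y H0_carrier[OF Z] by auto
  note jx = rlin_cl[OF cmapD(2)[OF m(3)] x(1)]
  show ?thesis unfolding x(2) J'(2)[OF x(1)] Q(2)[OF jx] Q'(2)[OF jx]
   using H0_class_heq[OF Z Z cmap_comp[OF m(4,3)] cmap_id e(2) x(1)] H0_class_heq[OF Z Y cmap_comp[OF m(2,3)] cmap_zero[OF Z Y] e(4) x(1)] hz[OF Y, of x]
   by simp
 qed
 have 3: "J (Q y) \<oplus>\<^bsub>H0 X\<^esub> J' (Q' y) = y" if y: "y \<in> car (H0 X)" for y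
 proof -
  obtain x where x: "x \<in> car (t0 X)" "y = H0_class X x" using y H0_carrier[OF X] by auto
  note qx = rlin_cl[OF cmapD(2)[OF m(2)] x(1)] and qx' = rlin_cl[OF cmapD(2)[OF m(4)] x(1)]
  show ?thesis unfolding x(2) Q(2)[OF x(1)] Q'(2)[OF x(1)] J(2)[OF qx] J'(2)[OF qx']
   using H0_class_heq[OF X X cmap_add[OF X cmap_comp[OF m(1,2)] cmap_comp[OF m(3,4)]] cmap_id e(5) x(1)]
    rlin_add[OF H0_class_rlin[OF X] rlin_cl[OF cmapD(2)[OF m(1)] qx] rlin_cl[OF cmapD(2)[OF m(3)] qx']]
   by (simp add: cadd_def)
 qed
 show ?thesis unfolding mbip_def
  by (rule exI[of _ J], rule exI[of _ Q], rule exI[of _ J'], rule exI[of _ Q'], intro conjI J(1) Q(1) J'(1) Q'(1))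
   (rule ballI, (erule 1 | erule 2 | erule 3))+
qed

section \<open>Hom dimensions out of complexes\<close>

context fd_algebra
begin

text \<open>The zero module is the direct sum of two copies of itself, so additivity says that the
  dimension equals its double.\<close>

lemma hom_dim_zero:
 assumes M: "right_module R M" and z: "car M = {\<zero>\<^sub>M}" and N: "fd_right_module R N"
 shows "hom_dim R M N = 0"
proof -
 interpret M: right_module R M by fact
 have z': "\<And>x. x \<in> car M ==> x = \<zero>\<^sub>M" using z by blast
 have "mbip R M M M" unfolding mbip_def
 proof (rule exI[of _ id], rule exI[of _ id], rule exI[of _ id], rule exI[of _ id], intro conjI ballI rlin_id)
  fix x assume "x \<in> car M"
  hence x: "x = \<zero>\<^sub>M" by (rule z')
  show "id (id x) = x" "id (id x) = \<zero>\<^sub>M" "id (id x) \<oplus>\<^sub>M id (id x) = x" by (simp_all add: x)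
  show "id (id x) = x" "id (id x) = \<zero>\<^sub>M" by (simp_all add: x)
 qed
 from hom_dim_mbip[OF M fd_trivial[OF M z] fd_trivial[OF M z] N this] show ?thesis by simp
qed

lemma hom_dim_iso:
 assumes "fd_right_module R P" "fd_right_module R Q" "fd_right_module R N" "rlin R P Q f" "bij_betw f (car P) (car Q)"
 shows "hom_dim R P N = hom_dim R Q N"
proof -
 obtain g where g: "rlin R Q P g" "\<And>x. x \<in> car P ==> g (f x) = x" "\<And>y. y \<in> car Q ==> f (g y) = y"
  using rlin_inverse[OF fdD[OF assms(1)] assms(4,5)] by metis
 have "x \<in> g ` car Q" if "x \<in> car P" for x
  using g(2)[OF that] rlin_cl[OF assms(4) that] by (metis imageI)
 hence "g ` car Q = car P" using rlin_cl[OF g(1)] by blast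
 thus ?thesis
  using hom_dim_le_of_surj[OF assms(1) fdD[OF assms(2)] assms(3,4) bij_betw_imp_surj_on[OF assms(5)]]
   hom_dim_le_of_surj[OF assms(2) fdD[OF assms(1)] assms(3) g(1)] by simp
qed

lemma hom_dim_iso_right:
 assumes "fd_right_module R P" "fd_right_module R N" "fd_right_module R N'" "rlin R N N' f" "bij_betw f (car N) (car N')"
 shows "hom_dim R P N = hom_dim R P N'"
proof -
 obtain g where g: "rlin R N' N g" "\<And>x. x \<in> car N ==> g (f x) = x" "\<And>y. y \<in> car N' ==> f (g y) = y"
  using rlin_inverse[OF fdD[OF assms(2)] assms(4,5)] by metis
 have "inj_on g (car N')" by (rule inj_on_inverseI[of _ f]) (rule g(3))
 thus ?thesis
  using hom_dim_le_of_inj[OF assms(1) fdD[OF assms(2)] assms(3,4) bij_betw_imp_inj_on[OF assms(5)]]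
   hom_dim_le_of_inj[OF assms(1) fdD[OF assms(3)] assms(2) g(1)] by simp
qed

lemma hom_dim_dsum:
 fixes Ms :: "('a, 'm) module list"
 assumes "\<And>M. M \<in> set Ms ==> fd_right_module R M" and N: "fd_right_module R N"
 shows "hom_dim R (rmod_dsum Ms) N = (\<Sum>M\<leftarrow>Ms. hom_dim R M N)" using assms(1)
proof (induction Ms)
 case Nil
 have "right_module R (rmod_dsum ([] :: ('a, 'm) module list))" by (rule dsum_module[OF ring_axioms]) simp
 moreover have "car (rmod_dsum ([] :: ('a, 'm) module list)) = {\<zero>\<^bsub>rmod_dsum ([] :: ('a, 'm) module list)\<^esub>}"
  by (simp add: dsum_simps restrict_def)
 ultimately show ?case using hom_dim_zero[OF _ _ N] by simp
next
 case (Cons M Ms)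
 have f: "fd_right_module R M" and fs: "\<And>M. M \<in> set Ms ==> fd_right_module R M" using Cons.prems by simp_all
 have d: "fd_right_module R (rmod_dsum Ms)" by (rule fd_dsum[OF fs])
 have d': "fd_right_module R (rmod_dsum (M # Ms))" by (rule fd_dsum[OF Cons.prems])
 show ?case
  using hom_dim_mbip[OF fdD[OF d'] f d N mbip_dsum[OF fdD[OF f] fdD[OF d]]] Cons.IH[OF fs] by simp
qed

text \<open>Evaluation at e identifies Hom(eR, N) with Ne: a homomorphism is determined by its value
  at e, and that value is fixed by e.\<close>

lemma hom_dim_idem_proj:
 assumes e: "idempotent_in R e" and N: "fd_right_module R N"
 shows "hom_dim R (idem_proj R e) N = cdim ((cspace R N)\<lparr>carrier := (\<lambda>x. e \<odot>\<^sub>N x) ` car N\<rparr>)"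
proof -
 let ?P = "idem_proj R e" and ?W = "(cspace R N)\<lparr>carrier := (\<lambda>x. e \<odot>\<^sub>N x) ` car N\<rparr>"
 note n = fdD[OF N]
 interpret N: right_module R N by (rule n)
 note f = idem_proj_facts[OF e]
 have ec: "e \<in> car R" "e \<otimes> e = e" using e by (auto simp: idempotent_in_def)
 have em: "e \<in> car ?P" unfolding f(1) using ec by simp
 have actP: "a \<odot>\<^sub>?P x = x \<otimes> a" for a x by (simp add: idem_proj_def reg_simps)
 interpret E: linear_map CC "cspace R N" "cspace R N" "\<lambda>x. e \<odot>\<^sub>N x"
  by (rule linear_mapI[OF cspace_vs[OF n] cspace_vs[OF n]])
   (simp_all add: ec N.act_closed N.act_add N.act_act[symmetric] sc_comm)
 have imE: "E.imT = (\<lambda>x. e \<odot>\<^sub>N x) ` car N" by (simp add: E.im_def)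
 have vsE: "vectorspace CC ?W"
  using vectorspace.subspace_is_vs[OF cspace_vs[OF n] E.imT_is_subspace] unfolding imE .
 have fe: "h e = e \<odot>\<^sub>N h e" if "rlin R ?P N h" for h
  using rlin_act[OF that ec(1) em] by (simp add: actP ec)
 have fx: "h x = x \<odot>\<^sub>N h e" if "rlin R ?P N h" "x \<in> car ?P" for h x
 proof -
  have x: "x \<in> car R" "e \<otimes> x = x" using that(2) unfolding f(1) by auto
  show ?thesis using rlin_act[OF that(1) x(1) em] by (simp add: actP x)
 qed
 interpret ev: linear_map CC "hom_space R ?P N" "cspace R N" "\<lambda>h. h e" by (rule hom_evaluation[OF f(3) n em])
 have lin: "linear_map CC (hom_space R ?P N) ?W (\<lambda>h. h e)"
 proof (rule linear_mapI[OF ev.V.vectorspace_axioms vsE])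
  fix h assume "h \<in> car (hom_space R ?P N)"
  hence h: "rlin R ?P N h" by (simp add: hom_space_simps rhom_iff)
  show "h e \<in> car ?W"
  proof -
   have "h e \<in> (\<lambda>x. e \<odot>\<^sub>N x) ` car N"
    using fe[OF h] rlin_cl[OF h em] by (rule image_eqI)
   thus ?thesis by simp
  qed
 qed simp_all
 have inj: "inj_on (\<lambda>h. h e) (car (hom_space R ?P N))"
 proof (rule inj_onI)
  fix h k assume hk: "h \<in> car (hom_space R ?P N)" "k \<in> car (hom_space R ?P N)" and eq: "h e = k e"
  hence l: "rlin R ?P N h" "rlin R ?P N k" and x: "h \<in> extensional (car ?P)" "k \<in> extensional (car ?P)"
   by (simp_all add: hom_space_simps rhom_iff)
  show "h = k" by (rule extensionalityI[OF x]) (use fx[OF l(1)] fx[OF l(2)] eq in simp)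
 qed
 have surj: "(\<lambda>h. h e) ` car (hom_space R ?P N) = car ?W"
 proof
  show "(\<lambda>h. h e) ` car (hom_space R ?P N) \<subseteq> car ?W"
   using linear_map.axioms(3)[OF lin] by (auto simp: mod_hom_def mod_hom_axioms_def module_hom_def)
  show "car ?W \<subseteq> (\<lambda>h. h e) ` car (hom_space R ?P N)"
  proof
   fix y assume "y \<in> car ?W"
   then obtain x where x: "x \<in> car N" "y = e \<odot>\<^sub>N x" by auto
   let ?h = "restrict ((\<lambda>a. a \<odot>\<^sub>N x) \<circ> id) (car ?P)"
   have "?h \<in> car (hom_space R ?P N)"
    unfolding hom_space_simps by (rule rlin_restrict[OF f(3) rlin_o[OF rlin_from_regular[OF n x(1)] f(6)]])
   moreover have "y = ?h e" using em x(2) by simp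
   ultimately show "y \<in> (\<lambda>h. h e) ` car (hom_space R ?P N)" by (rule image_eqI[where f = "\<lambda>h. h e", rotated])
  qed
 qed
 show ?thesis unfolding hom_dim_def
  by (rule linear_map.dim_eq[OF lin hom_space_fin_dim[OF fd_projective[OF f(4)] N] inj surj])
qed

text \<open>By \<open>g_vector_chi\<close> this is the pairing of the g-vector of X with the
  dimension vector of N, in a form free of idempotents and chosen decompositions.\<close>

definition chi :: "('a, 'm) two_term => ('a, 'n) module => int" where
 "chi X N = int (hom_dim R (t0 X) N) - int (hom_dim R (tm1 X) N)"

text \<open>A homotopy equivalence makes \<open>(x, w) \<mapsto> (f\<^sub>0 x + d w, - h x - g\<^sub>1 w)\<close> a surjection from
 \<open>X\<^sup>0 \<oplus> Y\<^sup>-\<^sup>1\<close> onto \<open>Y\<^sup>0 \<oplus> X\<^sup>-\<^sup>1\<close>.\<close>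

lemma chi_le:
 assumes X: "cplx R X" "fd_right_module R (tm1 X)" "fd_right_module R (t0 X)"
  and Y: "cplx R Y" "fd_right_module R (tm1 Y)" "fd_right_module R (t0 Y)"
  and XY: "K_iso R X Y" and N: "fd_right_module R N"
 shows "chi Y N \<le> chi X N"
proof -
 interpret X1: right_module R "tm1 X" by (rule cplxD[OF X(1)])
 interpret X0: right_module R "t0 X" by (rule cplxD[OF X(1)])
 interpret Y1: right_module R "tm1 Y" by (rule cplxD[OF Y(1)])
 interpret Y0: right_module R "t0 Y" by (rule cplxD[OF Y(1)])
 obtain f g where fg: "cmap R X Y f" "cmap R Y X g" "heq R X X (g \<odot>c f) cid" "heq R Y Y (f \<odot>c g) cid"
  using XY by (rule K_isoE)
 obtain h where h: "rlin R (t0 X) (tm1 X) h" "\<And>x. x \<in> car (tm1 X) ==> fst g (fst f x) = x \<oplus>\<^bsub>tm1 X\<^esub> h (tdiff X x)"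
  using fg(3) unfolding heq_def by auto
 obtain k where k: "rlin R (t0 Y) (tm1 Y) k" "\<And>y. y \<in> car (t0 Y) ==> snd f (snd g y) = y \<oplus>\<^bsub>t0 Y\<^esub> tdiff Y (k y)"
  using fg(4) unfolding heq_def by auto
 let ?pair = "\<lambda>M N. direct_sum M N :: ('a, _ \<times> _) module"
 \<comment> \<open>X and Y may have different element types, so the binary \<open>direct_sum\<close>
   of pairs takes the place of \<open>rmod_dsum\<close>.\<close>
 have dm: "right_module R (direct_sum M N)" and db: "mbip R (direct_sum M N) M N"
  if M: "right_module R M" and N: "right_module R N" for M :: "('a, 'u) module" and N :: "('a, 'v) module"
 proof -
  interpret M: right_module R M by fact
  interpret N: right_module R N by fact
  show "right_module R (direct_sum M N)" by (rule right_moduleI[OF ring_axioms])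
    (auto simp: direct_sum_def M.act_closed N.act_closed M.M.a_assoc N.M.a_assoc M.zero_act N.zero_act
     M.act_add_scalar N.act_add_scalar M.act_add N.act_add M.act_act N.act_act M.act_one N.act_one intro: M.M.a_comm N.M.a_comm)
  have l: "rlin R M (direct_sum M N) (\<lambda>x. (x, \<zero>\<^sub>N))" "rlin R N (direct_sum M N) (\<lambda>y. (\<zero>\<^sub>M, y))"
   "rlin R (direct_sum M N) M fst" "rlin R (direct_sum M N) N snd"
   by (rule rlinI; simp add: direct_sum_def M.act_zero N.act_zero mem_Times_iff)+
  show "mbip R (direct_sum M N) M N" unfolding mbip_def
   by (rule exI[of _ "\<lambda>x. (x, \<zero>\<^sub>N)"], rule exI[of _ fst], rule exI[of _ "\<lambda>y. (\<zero>\<^sub>M, y)"], rule exI[of _ snd])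
    (use l in \<open>auto simp: direct_sum_def\<close>)
 qed
 let ?Q = "direct_sum (t0 X) (tm1 Y)" and ?P = "direct_sum (t0 Y) (tm1 X)"
 have Qm: "right_module R ?Q" and Qb: "mbip R ?Q (t0 X) (tm1 Y)"
  by (rule dm[OF cplxD(2)[OF X(1)] cplxD(1)[OF Y(1)]] db[OF cplxD(2)[OF X(1)] cplxD(1)[OF Y(1)]])+
 have Pm: "right_module R ?P" and Pb: "mbip R ?P (t0 Y) (tm1 X)"
  by (rule dm[OF cplxD(2)[OF Y(1)] cplxD(1)[OF X(1)]] db[OF cplxD(2)[OF Y(1)] cplxD(1)[OF X(1)]])+
 have fQ: "fd_right_module R ?Q" by (rule fd_mbip[OF Qm X(3) Y(2) Qb])
 let ?t = "\<lambda>(x, w). (snd f x \<oplus>\<^bsub>t0 Y\<^esub> tdiff Y w, \<ominus>\<^bsub>tm1 X\<^esub> (h x \<oplus>\<^bsub>tm1 X\<^esub> fst g w))"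
 note cl = rlin_cl[OF cmapD(2)[OF fg(1)]] rlin_cl[OF cplxD(3)[OF Y(1)]] rlin_cl[OF h(1)] rlin_cl[OF cmapD(1)[OF fg(2)]]
  rlin_cl[OF cmapD(1)[OF fg(1)]] rlin_cl[OF cplxD(3)[OF X(1)]] rlin_cl[OF cmapD(2)[OF fg(2)]] rlin_cl[OF k(1)]
 have tl: "rlin R ?Q ?P ?t"
 proof (rule rlinI)
  fix p assume "p \<in> car ?Q"
  then obtain x w where p: "p = (x, w)" "x \<in> car (t0 X)" "w \<in> car (tm1 Y)" by (auto simp: direct_sum_def)
  show "?t p \<in> car ?P" using p cl by (simp add: direct_sum_def)
  fix a assume a: "a \<in> car R"
  show "?t (a \<odot>\<^sub>?Q p) = a \<odot>\<^sub>?P ?t p"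
   using p a cl by (simp add: direct_sum_def rlin_act[OF cmapD(2)[OF fg(1)]] rlin_act[OF cplxD(3)[OF Y(1)]] rlin_act[OF h(1)]
     rlin_act[OF cmapD(1)[OF fg(2)]] Y0.act_add X1.act_add X1.act_minus)
 next
  fix p p' assume "p \<in> car ?Q" "p' \<in> car ?Q"
  then obtain x w x' w' where p: "p = (x, w)" "x \<in> car (t0 X)" "w \<in> car (tm1 Y)"
   and p': "p' = (x', w')" "x' \<in> car (t0 X)" "w' \<in> car (tm1 Y)" by (auto simp: direct_sum_def)
  show "?t (p \<oplus>\<^sub>?Q p') = ?t p \<oplus>\<^sub>?P ?t p'"
   using p p' cl by (simp add: direct_sum_def rlin_add[OF cmapD(2)[OF fg(1)]] rlin_add[OF cplxD(3)[OF Y(1)]] rlin_add[OF h(1)]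
     rlin_add[OF cmapD(1)[OF fg(2)]] Y0.M.add.m_ac X1.M.add.m_ac X1.M.minus_add)
 qed
 \<comment> \<open>The preimage of (0, v) is (d v, - f v). The first coordinate cancels because f is
   a chain map, the second is v because g f = 1 + h d in degree -1.\<close>
 have s2: "(\<zero>\<^bsub>t0 Y\<^esub>, v) \<in> ?t ` car ?Q" if v: "v \<in> car (tm1 X)" for v
 proof (rule image_eqI)
  show "(tdiff X v, \<ominus>\<^bsub>tm1 Y\<^esub> fst f v) \<in> car ?Q" using v cl by (simp add: direct_sum_def)
  have 1: "snd f (tdiff X v) \<oplus>\<^bsub>t0 Y\<^esub> tdiff Y (\<ominus>\<^bsub>tm1 Y\<^esub> fst f v) = \<zero>\<^bsub>t0 Y\<^esub>"
   using v cl cmapD(3)[OF fg(1) v] by (simp add: rlin_minus[OF cplxD(1,2,3)[OF Y(1)]] Y0.M.r_neg)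
  have "h (tdiff X v) \<oplus>\<^bsub>tm1 X\<^esub> fst g (\<ominus>\<^bsub>tm1 Y\<^esub> fst f v) = h (tdiff X v) \<oplus>\<^bsub>tm1 X\<^esub> \<ominus>\<^bsub>tm1 X\<^esub> (v \<oplus>\<^bsub>tm1 X\<^esub> h (tdiff X v))"
   using v cl h(2)[OF v] by (simp add: rlin_minus[OF cplxD(1)[OF Y(1)] cplxD(1)[OF X(1)] cmapD(1)[OF fg(2)]])
  also have "\<dots> = \<ominus>\<^bsub>tm1 X\<^esub> v \<oplus>\<^bsub>tm1 X\<^esub> (h (tdiff X v) \<oplus>\<^bsub>tm1 X\<^esub> \<ominus>\<^bsub>tm1 X\<^esub> h (tdiff X v))"
   using v cl by (simp add: X1.M.minus_add X1.M.a_lcomm)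
  also have "\<dots> = \<ominus>\<^bsub>tm1 X\<^esub> v" using v cl by (simp add: X1.M.r_neg)
  finally show "(\<zero>\<^bsub>t0 Y\<^esub>, v) = ?t (tdiff X v, \<ominus>\<^bsub>tm1 Y\<^esub> fst f v)" using 1 v by simp
 qed
 \<comment> \<open>The element (g y, - k y) hits y in the first coordinate because f g = 1 + d k in
   degree 0. The second coordinate is some u, corrected afterwards by adding the element (0, v - u)
   of the image.\<close>
 have s1: "\<exists>u. u \<in> car (tm1 X) \<and> (y, u) \<in> ?t ` car ?Q" if y: "y \<in> car (t0 Y)" for y
 proof -
  let ?q = "(snd g y, \<ominus>\<^bsub>tm1 Y\<^esub> k y)"
  have q: "?q \<in> car ?Q" using y cl by (simp add: direct_sum_def)
  have "snd f (snd g y) \<oplus>\<^bsub>t0 Y\<^esub> tdiff Y (\<ominus>\<^bsub>tm1 Y\<^esub> k y) = y"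
   using y cl k(2)[OF y] by (simp add: rlin_minus[OF cplxD(1,2,3)[OF Y(1)]] Y0.M.r_neg Y0.M.a_assoc)
  hence e: "(y, \<ominus>\<^bsub>tm1 X\<^esub> (h (snd g y) \<oplus>\<^bsub>tm1 X\<^esub> fst g (\<ominus>\<^bsub>tm1 Y\<^esub> k y))) = ?t ?q" by simp
  moreover have "\<ominus>\<^bsub>tm1 X\<^esub> (h (snd g y) \<oplus>\<^bsub>tm1 X\<^esub> fst g (\<ominus>\<^bsub>tm1 Y\<^esub> k y)) \<in> car (tm1 X)" using y cl by simp
  ultimately show ?thesis using image_eqI[where f = ?t, OF e q] by blast
 qed
 have "?t ` car ?Q = car ?P"
 proof
  show "?t ` car ?Q \<subseteq> car ?P" using rlin_cl[OF tl] by blast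
  show "car ?P \<subseteq> ?t ` car ?Q"
  proof
   fix p assume "p \<in> car ?P"
   then obtain y v where p: "p = (y, v)" "y \<in> car (t0 Y)" "v \<in> car (tm1 X)" by (auto simp: direct_sum_def)
   obtain u where u: "u \<in> car (tm1 X)" "(y, u) \<in> ?t ` car ?Q" using s1[OF p(2)] by blast
   have "(\<zero>\<^bsub>t0 Y\<^esub>, v \<ominus>\<^bsub>tm1 X\<^esub> u) \<in> ?t ` car ?Q" by (rule s2) (use p u in simp)
   moreover have "p = (y, u) \<oplus>\<^sub>?P (\<zero>\<^bsub>t0 Y\<^esub>, v \<ominus>\<^bsub>tm1 X\<^esub> u)"
    using p u X1.M.a_lcomm[of u v "\<ominus>\<^bsub>tm1 X\<^esub> u"] by (simp add: direct_sum_def a_minus_def X1.M.r_neg)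
   moreover have "right_submodule R ?P (?t ` car ?Q)" by (rule rlin_image_submodule[OF Qm Pm tl])
   ultimately show "p \<in> ?t ` car ?Q" using u(2) unfolding right_submodule_def by blast
  qed
 qed
 from hom_dim_le_of_surj[OF fQ Pm N tl this]
 have "hom_dim R ?P N \<le> hom_dim R ?Q N" .
 thus ?thesis
  unfolding chi_def hom_dim_mbip[OF Qm X(3) Y(2) N Qb] hom_dim_mbip[OF Pm Y(3) X(2) N Pb] by linarith
qed

lemma chi_iso:
 assumes "two_term_proj R X" "two_term_proj R Y" "K_iso R X Y" and "fd_right_module R N"
 shows "chi X N = chi Y N"
 using chi_le[OF ttp_cplx[OF assms(1)] fd_two_term[OF assms(1)] ttp_cplx[OF assms(2)] fd_two_term[OF assms(2)] assms(3,4)]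
  chi_le[OF ttp_cplx[OF assms(2)] fd_two_term[OF assms(2)] ttp_cplx[OF assms(1)] fd_two_term[OF assms(1)]
   K_iso_sym[OF ttp_cplx[OF assms(1)] ttp_cplx[OF assms(2)] assms(3)] assms(4)] by simp

lemma chi_K_dsum:
 assumes "\<And>X. X \<in> set Xs ==> two_term_proj R X" and N: "fd_right_module R N"
 shows "chi (K_dsum Xs) N = (\<Sum>X\<leftarrow>Xs. chi X N)"
proof -
 have 1: "fd_right_module R M" if M: "M \<in> set (map tm1 Xs)" for M
 proof -
  obtain X where "X \<in> set Xs" "M = tm1 X" using M by auto
  thus ?thesis using fd_two_term(1)[OF assms(1)] by simp
 qed
 have 0: "fd_right_module R M" if M: "M \<in> set (map t0 Xs)" for M
 proof -
  obtain X where "X \<in> set Xs" "M = t0 X" using M by auto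
  thus ?thesis using fd_two_term(2)[OF assms(1)] by simp
 qed
 have sums: "int (\<Sum>x\<leftarrow>Xs. f x) - int (\<Sum>x\<leftarrow>Xs. g x) = (\<Sum>x\<leftarrow>Xs. int (f x) - int (g x))" for f g :: "_ => nat"
  by (induction Xs) simp_all
 have "hom_dim R (rmod_dsum (map tm1 Xs)) N = (\<Sum>M\<leftarrow>map tm1 Xs. hom_dim R M N)"
  "hom_dim R (rmod_dsum (map t0 Xs)) N = (\<Sum>M\<leftarrow>map t0 Xs. hom_dim R M N)"
  by (rule hom_dim_dsum[OF 1 N], assumption, rule hom_dim_dsum[OF 0 N], assumption)
 thus ?thesis unfolding chi_def K_dsum_simps by (simp only: map_map comp_def sums)
qed

lemma fd_H0:
 assumes "two_term_proj R X"
 shows "fd_right_module R (H0 X)"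
 by (rule fd_surj_image[OF fd_two_term(2)[OF assms] H0_is_module H0_class_rlin H0_carrier[symmetric]])
  (rule ttp_cplx[OF assms])+

lemma hom_dim_H0_iso:
 assumes "two_term_proj R X" "two_term_proj R Y" "K_iso R X Y" and N: "fd_right_module R N"
 shows "hom_dim R (H0 X) N = hom_dim R (H0 Y) N"
proof -
 obtain F where "rlin R (H0 X) (H0 Y) F" "bij_betw F (car (H0 X)) (car (H0 Y))"
  using H0_iso[OF ttp_cplx[OF assms(1)] ttp_cplx[OF assms(2)] assms(3)] by metis
 thus ?thesis by (rule hom_dim_iso[OF fd_H0[OF assms(1)] fd_H0[OF assms(2)] N])
qed

lemma hom_dim_H0_K_dsum:
 fixes Xs :: "('a, 'c) two_term list"
 assumes "\<And>X. X \<in> set Xs ==> two_term_proj R X" and N: "fd_right_module R N"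
 shows "hom_dim R (H0 (K_dsum Xs)) N = (\<Sum>X\<leftarrow>Xs. hom_dim R (H0 X) N)" using assms(1)
proof (induction Xs)
 case Nil
 have c: "cplx R (K_dsum ([] :: ('a, 'c) two_term list))" by (rule K_dsum_cplx[OF ring_axioms]) simp
 note m = H0_is_module[OF c]
 interpret H: right_module R "H0 (K_dsum ([] :: ('a, 'c) two_term list))" by (rule m)
 have "\<exists>u. car (H0 (K_dsum ([] :: ('a, 'c) two_term list))) = {u}"
  unfolding H0_carrier[OF c] by (simp add: K_dsum_simps dsum_simps)
 hence "car (H0 (K_dsum ([] :: ('a, 'c) two_term list))) = {\<zero>\<^bsub>H0 (K_dsum ([] :: ('a, 'c) two_term list))\<^esub>}"
  using H.M.zero_closed by (metis singletonD)
 thus ?case using hom_dim_zero[OF m _ N] by simp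
next
 case (Cons X Xs)
 have X: "two_term_proj R X" and Xs: "\<And>X. X \<in> set Xs ==> two_term_proj R X" using Cons.prems by simp_all
 have D: "two_term_proj R (K_dsum Xs)" by (rule K_dsum_two_term_proj[OF Xs])
 have D': "two_term_proj R (K_dsum (X # Xs))" by (rule K_dsum_two_term_proj[OF Cons.prems])
 have b: "kbip R (K_dsum (X # Xs)) X (K_dsum Xs)"
  by (rule kbip_K_dsum[OF ring_axioms ttp_cplx[OF X]]) (rule ttp_cplx, rule Xs)
 note mb = H0_mbip[OF ttp_cplx[OF D'] ttp_cplx[OF X] ttp_cplx[OF D] b]
 show ?case
  using hom_dim_mbip[OF fdD[OF fd_H0[OF D']] fd_H0[OF X] fd_H0[OF D] N mb] Cons.IH[OF Xs] by simp
qed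

lemma chi_le_hom_H0:
 assumes X: "two_term_proj R X" and N: "fd_right_module R N"
 shows "chi X N \<le> int (hom_dim R (H0 X) N)"
 using hom_dim_le_coker[OF fd_two_term(2,1)[OF X] N cplxD(3)[OF ttp_cplx[OF X]]]
 unfolding chi_def H0_def by linarith

end

section \<open>Euler characteristics and Grassmannians under isomorphisms\<close>

lemma comm_group_hom_finprod:
 assumes G: "comm_group G" and H: "comm_group H" and h: "h \<in> hom G H"
  and S: "finite S" and "f \<in> S \<rightarrow> car G"
 shows "h (\<Otimes>\<^bsub>G\<^esub>x\<in>S. f x) = (\<Otimes>\<^bsub>H\<^esub>x\<in>S. h (f x))"
 using S assms(5)
proof (induction S rule: finite_induct)
 interpret G: comm_group G by fact
 interpret H: comm_group H by fact
 interpret h: group_hom G H h by (unfold_locales) (rule h)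
 case empty
 show ?case by simp
next
 interpret G: comm_group G by fact
 interpret H: comm_group H by fact
 interpret h: group_hom G H h by (unfold_locales) (rule h)
 case (insert x F)
 have f: "f \<in> F \<rightarrow> car G" "f x \<in> car G" using insert.prems by auto
 have hf: "(\<lambda>x. h (f x)) \<in> F \<rightarrow> car H" "h (f x) \<in> car H"
  using h.hom_closed[OF funcset_mem[OF f(1)]] h.hom_closed[OF f(2)] by blast+
 show ?case unfolding G.finprod_insert[OF insert.hyps f] H.finprod_insert[OF insert.hyps hf]
  using insert.IH[OF f(1)] f G.finprod_closed[OF f(1)] by simp
qed

text \<open>The sets over whose sizes \<open>abelian_rank\<close> takes its supremum.\<close>

definition z_independent :: "('g, 'r) monoid_scheme => 'g set => bool" where
 "z_independent G S \<longleftrightarrow> finite S \<and> S \<subseteq> car G \<and>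
   (\<forall>n :: 'g => int. (\<Otimes>\<^bsub>G\<^esub>x\<in>S. x [^]\<^bsub>G\<^esub> n x) = \<one>\<^sub>G \<longrightarrow> (\<forall>x\<in>S. n x = 0))"

lemma z_independent_image:
 fixes G :: "('g, 'r) monoid_scheme" and H :: "('h, 's) monoid_scheme"
 assumes G: "comm_group G" and H: "comm_group H" and iso: "G \<cong> H" and S: "z_independent G S"
 shows "\<exists>T. z_independent H T \<and> card T = card S"
proof -
 interpret G: comm_group G by fact
 interpret H: comm_group H by fact
 obtain h where h: "h \<in> hom G H" "bij_betw h (car G) (car H)"
  using iso by (auto simp: is_iso_def iso_def)
 interpret h: group_hom G H h by (unfold_locales) (rule h)
 have s: "finite S" "\<And>x. x \<in> S ==> x \<in> car G" using S by (auto simp: z_independent_def)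
 have inj: "inj_on h (car G)" using h(2) by (rule bij_betw_imp_inj_on)
 have injS: "inj_on h S" by (rule inj_on_subset[OF inj]) (use s in blast)
 have ind: "\<forall>x\<in>S. m x = 0" if "(\<Otimes>\<^bsub>G\<^esub>x\<in>S. x [^]\<^bsub>G\<^esub> m x) = \<one>\<^sub>G" for m :: "'g => int"
  using S that unfolding z_independent_def by blast
 have "n y = 0"
  if n: "(\<Otimes>\<^bsub>H\<^esub>y\<in>h ` S. y [^]\<^bsub>H\<^esub> n y) = \<one>\<^sub>H" and y: "y \<in> h ` S" for n :: "'h => int" and y
 proof -
  have c: "(\<lambda>x. x [^]\<^bsub>G\<^esub> n (h x)) \<in> S \<rightarrow> car G" using s(2) G.int_pow_closed by blast
  have ch: "(\<lambda>x. h x [^]\<^bsub>H\<^esub> n (h x)) \<in> S \<rightarrow> car H" using s(2) H.int_pow_closed by auto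
  have cy: "(\<lambda>y. y [^]\<^bsub>H\<^esub> n y) \<in> h ` S \<rightarrow> car H" using s(2) H.int_pow_closed by auto
  have "h (\<Otimes>\<^bsub>G\<^esub>x\<in>S. x [^]\<^bsub>G\<^esub> n (h x)) = (\<Otimes>\<^bsub>H\<^esub>x\<in>S. h (x [^]\<^bsub>G\<^esub> n (h x)))"
   by (rule comm_group_hom_finprod[OF G H h(1) s(1) c])
  also have "\<dots> = (\<Otimes>\<^bsub>H\<^esub>x\<in>S. h x [^]\<^bsub>H\<^esub> n (h x))"
   by (rule H.finprod_cong'[OF refl ch]) (use s(2) in \<open>simp add: h.hom_int_pow\<close>)
  also have "\<dots> = (\<Otimes>\<^bsub>H\<^esub>y\<in>h ` S. y [^]\<^bsub>H\<^esub> n y)"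
   by (rule H.finprod_reindex[symmetric, OF cy injS])
  also have "\<dots> = h \<one>\<^sub>G" using n by simp
  finally have "(\<Otimes>\<^bsub>G\<^esub>x\<in>S. x [^]\<^bsub>G\<^esub> n (h x)) = \<one>\<^sub>G"
   using inj_onD[OF inj] G.finprod_closed[OF c] by blast
  hence "\<forall>x\<in>S. n (h x) = 0" by (rule ind)
  thus ?thesis using y by blast
 qed
 hence "z_independent H (h ` S)" using s unfolding z_independent_def by auto
 thus ?thesis using card_image[OF injS] by blast
qed

text \<open>Independent sets correspond in both directions with equal sizes, so both suprema are
  taken over the same set of numbers.\<close>

lemma abelian_rank_iso:
 fixes G :: "('g, 'r) monoid_scheme" and H :: "('h, 's) monoid_scheme"
 assumes G: "comm_group G" and H: "comm_group H" and iso: "G \<cong> H"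
 shows "abelian_rank G = abelian_rank H"
proof -
 have iso': "H \<cong> G" using group.iso_sym[OF comm_group.axioms(2)[OF G] iso] .
 have "{card S | S. z_independent G S} = {card S | S. z_independent H S}"
 proof (intro equalityI subsetI)
  fix n assume "n \<in> {card S | S. z_independent G S}"
  then obtain S where "z_independent G S" "n = card S" by blast
  with z_independent_image[OF G H iso this(1)] show "n \<in> {card S | S. z_independent H S}" by force
 next
  fix n assume "n \<in> {card S | S. z_independent H S}"
  then obtain S where "z_independent H S" "n = card S" by blast
  with z_independent_image[OF H G iso' this(1)] show "n \<in> {card S | S. z_independent G S}" by force
 qed
 thus ?thesis unfolding abelian_rank_def z_independent_def by simp
qed

lemma euler_char_homeomorphic:
 assumes "X homeomorphic_space Y"
 shows "euler_char X = euler_char Y"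
 using abelian_rank_iso[OF abelian_homology_group abelian_homology_group homeomorphic_space_imp_isomorphic_homology_groups[OF assms]]
 by (simp add: euler_char_def)

context linear_map
begin

lemma image_finsum:
 assumes "finite I" "v \<in> I \<rightarrow> car V"
 shows "T (\<Oplus>\<^bsub>V\<^esub>i\<in>I. v i) = (\<Oplus>\<^bsub>W\<^esub>i\<in>I. T (v i))"
 using assms
proof (induction I rule: finite_induct)
 case empty
 show ?case by (simp add: T0_is_0)
next
 case (insert x F)
 have f: "v \<in> F \<rightarrow> car V" "v x \<in> car V" using insert.prems by auto
 have tf: "(\<lambda>i. T (v i)) \<in> F \<rightarrow> car W" "T (v x) \<in> car W" using f by auto
 have c: "(\<Oplus>\<^bsub>V\<^esub>i\<in>F. v i) \<in> car V" by (rule V.module.M.finsum_closed[OF f(1)])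
 show ?case
  unfolding V.module.M.finsum_insert[OF insert.hyps f] W.module.M.finsum_insert[OF insert.hyps tf]
  using insert.IH[OF f(1)] T_add[OF f(2) c] by simp
qed

text \<open>For an isomorphism the opposite inclusion is this one applied to the inverse map, as
  \<open>row_span_image\<close> does.\<close>

lemma span_image_subset:
 assumes S: "S \<subseteq> car V"
 shows "W.module.span (T ` S) \<subseteq> T ` V.module.span S"
proof (rule W.module.span_is_subset)
 show "T ` S \<subseteq> T ` V.module.span S" using V.module.in_own_span[OF S] by blast
 have U: "submodule K (V.module.span S) V" by (rule V.module.span_is_submodule[OF S])
 note Uc = submodule.subset[OF U]
 show "submodule K (T ` V.module.span S) W"
 proof (unfold_locales)
  show "T ` V.module.span S \<subseteq> car W" using Uc by auto
  show "\<zero>\<^sub>W \<in> T ` V.module.span S" using submodule.zero_closed[OF U] T0_is_0 by (metis imageI)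
  fix x y assume "x \<in> T ` V.module.span S" "y \<in> T ` V.module.span S"
  then obtain v w where v: "v \<in> V.module.span S" "x = T v" and w: "w \<in> V.module.span S" "y = T w" by blast
  show "x \<oplus>\<^sub>W y \<in> T ` V.module.span S"
   using T_add[OF subsetD[OF Uc v(1)] subsetD[OF Uc w(1)]] submodule.m_closed[OF U v(1) w(1)] unfolding v w by (metis imageI)
 next
  fix c x assume c: "c \<in> car K" and "x \<in> T ` V.module.span S"
  then obtain v where v: "v \<in> V.module.span S" "x = T v" by blast
  show "c \<odot>\<^sub>W x \<in> T ` V.module.span S"
   using T_smult[OF c subsetD[OF Uc v(1)]] submodule.smult_closed[OF U c v(1)] unfolding v by (metis imageI)
 qed
qed

end

lemma linear_map_bij_inverse:
 assumes "linear_map K V W f" "bij_betw f (car V) (car W)"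
 obtains g where "linear_map K W V g" "bij_betw g (car W) (car V)"
  "\<And>x. x \<in> car V ==> g (f x) = x" "\<And>y. y \<in> car W ==> f (g y) = y"
proof -
 interpret f: linear_map K V W f by fact
 define g where "g = inv_into (car V) f"
 have gf: "g (f x) = x" if "x \<in> car V" for x
  unfolding g_def by (rule inv_into_f_f[OF bij_betw_imp_inj_on[OF assms(2)] that])
 have fg: "f (g y) = y" if "y \<in> car W" for y
  unfolding g_def using f_inv_into_f[of y f "car V"] that bij_betw_imp_surj_on[OF assms(2)] by simp
 have gb: "bij_betw g (car W) (car V)" unfolding g_def by (rule bij_betw_inv_into[OF assms(2)])
 hence gc: "g y \<in> car V" if "y \<in> car W" for y using that by (rule bij_betw_apply)
 have "linear_map K W V g"
 proof (rule linear_mapI[OF f.W.vectorspace_axioms f.V.vectorspace_axioms gc])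
  fix x y assume x: "x \<in> car W" and y: "y \<in> car W"
  have "g (f (g x \<oplus>\<^sub>V g y)) = g x \<oplus>\<^sub>V g y" by (rule gf) (simp add: gc x y)
  thus "g (x \<oplus>\<^sub>W y) = g x \<oplus>\<^sub>V g y" by (simp add: f.T_add[OF gc[OF x] gc[OF y]] fg x y)
 next
  fix c x assume c: "c \<in> car K" and x: "x \<in> car W"
  have "g (f (c \<odot>\<^sub>V g x)) = c \<odot>\<^sub>V g x" by (rule gf) (simp add: gc x c)
  thus "g (c \<odot>\<^sub>W x) = c \<odot>\<^sub>V g x" by (simp add: f.T_smult[OF c gc[OF x]] fg x)
 qed
 from this gb gf fg show thesis by (rule that)
qed

lemma row_span_image:
 assumes f: "linear_map CC V W f" "bij_betw f (car V) (car W)" and vs: "set vs \<subseteq> car V"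
 shows "row_span W k (map f vs) c = f ` row_span V k vs c"
proof -
 interpret f: linear_map CC V W f by fact
 obtain g where g: "linear_map CC W V g" "bij_betw g (car W) (car V)"
  "\<And>x. x \<in> car V ==> g (f x) = x" "\<And>y. y \<in> car W ==> f (g y) = y"
  using linear_map_bij_inverse[OF f] by metis
 interpret g: linear_map CC W V g by fact
 let ?r = "\<lambda>i. \<Oplus>\<^bsub>V\<^esub>j\<in>{..<length vs}. c i j \<odot>\<^sub>V vs ! j"
 have t: "(\<lambda>j. c i j \<odot>\<^sub>V vs ! j) \<in> {..<length vs} \<rightarrow> car V" for i
  using subsetD[OF vs nth_mem] by (auto intro!: f.V.module.smult_closed simp: class_ring_simps)
 have rc: "?r i \<in> car V" for i by (rule f.V.module.M.finsum_closed[OF t])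
 have "(\<Oplus>\<^bsub>W\<^esub>j\<in>{..<length (map f vs)}. c i j \<odot>\<^sub>W map f vs ! j) = f (?r i)" for i
 proof -
  have "f (?r i) = (\<Oplus>\<^bsub>W\<^esub>j\<in>{..<length vs}. f (c i j \<odot>\<^sub>V vs ! j))" by (rule f.image_finsum[OF _ t]) simp
  also have "\<dots> = (\<Oplus>\<^bsub>W\<^esub>j\<in>{..<length vs}. c i j \<odot>\<^sub>W map f vs ! j)"
  proof (rule f.W.module.M.finsum_cong')
   show "(\<lambda>j. c i j \<odot>\<^sub>W map f vs ! j) \<in> {..<length vs} \<rightarrow> car W"
    using subsetD[OF vs nth_mem] by (auto intro!: f.W.module.smult_closed simp: class_ring_simps)
   fix j assume "j \<in> {..<length vs}"
   thus "f (c i j \<odot>\<^sub>V vs ! j) = c i j \<odot>\<^sub>W map f vs ! j"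
    using f.T_smult[of "c i j" "vs ! j"] subsetD[OF vs nth_mem] by (simp add: class_ring_simps)
  qed simp
  finally show ?thesis by simp
 qed
 hence e: "row_span W k (map f vs) c = f.W.module.span (f ` ?r ` {..<k})"
  unfolding row_span_def by (simp add: image_image)
 let ?S = "?r ` {..<k}"
 have S: "?S \<subseteq> car V" using rc by blast
 have fS: "f ` ?S \<subseteq> car W" using rc by auto
 have "g ` f ` ?S = ?S" using g(3)[OF rc] by (simp add: image_image)
 hence "f.V.module.span ?S \<subseteq> g ` f.W.module.span (f ` ?S)" using g.span_image_subset[OF fS] by simp
 hence "f ` f.V.module.span ?S \<subseteq> f ` g ` f.W.module.span (f ` ?S)" by blast
 also have "\<dots> = f.W.module.span (f ` ?S)"
  using g(4)[OF subsetD[OF f.W.module.span_is_subset2[OF fS]]] by (simp add: image_image)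
 finally show ?thesis unfolding e using f.span_image_subset[OF S] by (auto simp: row_span_def)
qed

lemma subspaces_of_dim_image:
 assumes f: "linear_map CC V W f" "bij_betw f (car V) (car W)" and V: "vectorspace.fin_dim CC V" and U: "U \<in> subspaces_of_dim V k"
 shows "f ` U \<in> subspaces_of_dim W k"
proof -
 interpret f: linear_map CC V W f by fact
 have U': "VectorSpace.subspace CC U V" "cdim (V\<lparr>carrier := U\<rparr>) = k" using U by (auto simp: subspaces_of_dim_def)
 note sm = subspace.submod[OF U'(1)]
 note Uc = submodule.subset[OF sm]
 have fU: "VectorSpace.subspace CC (f ` U) W"
 proof (intro subspace.intro f.W.vectorspace_axioms, unfold_locales)
  show "f ` U \<subseteq> car W" using Uc by auto
  show "\<zero>\<^sub>W \<in> f ` U" using submodule.zero_closed[OF sm] f.T0_is_0 by (metis imageI)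
  fix x y assume "x \<in> f ` U" "y \<in> f ` U"
  then obtain v w where v: "v \<in> U" "x = f v" and w: "w \<in> U" "y = f w" by blast
  show "x \<oplus>\<^sub>W y \<in> f ` U"
   using f.T_add[OF subsetD[OF Uc v(1)] subsetD[OF Uc w(1)]] submodule.m_closed[OF sm v(1) w(1)] unfolding v w by (metis imageI)
 next
  fix c x assume c: "c \<in> car CC" and "x \<in> f ` U"
  then obtain v where v: "v \<in> U" "x = f v" by blast
  show "c \<odot>\<^sub>W x \<in> f ` U"
   using f.T_smult[OF c subsetD[OF Uc v(1)]] submodule.smult_closed[OF sm c v(1)] unfolding v by (metis imageI)
 qed
 have vU: "vectorspace CC (V\<lparr>carrier := U\<rparr>)" by (rule f.V.subspace_is_vs[OF U'(1)])
 have vfU: "vectorspace CC (W\<lparr>carrier := f ` U\<rparr>)" by (rule f.W.subspace_is_vs[OF fU])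
 have wfd: "f.W.fin_dim" by (rule f.surj_dim_le(1)[OF bij_betw_imp_surj_on[OF f(2)] V])
 interpret i: linear_map CC "W\<lparr>carrier := f ` U\<rparr>" W id
  by (rule linear_mapI[OF vfU f.W.vectorspace_axioms]) (use Uc in auto)
 have fd: "vectorspace.fin_dim CC (W\<lparr>carrier := f ` U\<rparr>)" by (rule i.inj_fin_dim(1)[OF _ wfd]) simp
 interpret g: linear_map CC "V\<lparr>carrier := U\<rparr>" "W\<lparr>carrier := f ` U\<rparr>" f
  by (rule linear_mapI[OF vU vfU]) (use f.T_add f.T_smult Uc in \<open>auto simp: subset_eq\<close>)
 have "bij_betw f (car (V\<lparr>carrier := U\<rparr>)) (car (W\<lparr>carrier := f ` U\<rparr>))"
  using inj_on_subset[OF bij_betw_imp_inj_on[OF f(2)] Uc] by (simp add: bij_betw_def)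
 from g.bij_dim(2)[OF this fd] show ?thesis using fU U'(2) by (simp add: subspaces_of_dim_def)
qed

lemma topspace_grassmannian: "topspace (grassmannian V k) \<subseteq> subspaces_of_dim V k"
 using openin_topspace[of "grassmannian V k"] unfolding openin_grassmannian by blast

text \<open>A coordinate matrix with respect to \<open>vs\<close> spans U exactly when the same
  matrix with respect to \<open>map f vs\<close> spans the image of U. So the set of matrices to be
  tested for openness is one that T already provides.\<close>

lemma grassmannian_preimage_open:
 assumes f: "linear_map CC V W f" "bij_betw f (car V) (car W)" and V: "vectorspace.fin_dim CC V"
  and T: "openin (grassmannian W k) T"
 shows "openin (grassmannian V k) {U \<in> subspaces_of_dim V k. f ` U \<in> T}"
proof -
 interpret f: linear_map CC V W f by fact
 obtain g where g: "linear_map CC W V g" "bij_betw g (car W) (car V)"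
  "\<And>x. x \<in> car V ==> g (f x) = x" "\<And>y. y \<in> car W ==> f (g y) = y"
  using linear_map_bij_inverse[OF f] by metis
 have wfd: "f.W.fin_dim" by (rule f.surj_dim_le(1)[OF bij_betw_imp_surj_on[OF f(2)] V])
 show ?thesis unfolding openin_grassmannian
 proof (intro conjI allI impI)
  fix vs assume vs: "set vs \<subseteq> car V"
  have rs: "row_span V k vs c \<subseteq> car V" for c
   unfolding row_span_def using subsetD[OF vs nth_mem]
   by (intro f.V.module.span_is_subset2) (auto intro!: f.V.module.M.finsum_closed f.V.module.smult_closed simp: class_ring_simps)
  have gfr: "g ` f ` row_span V k vs c = row_span V k vs c" for c
   using g(3)[OF subsetD[OF rs[of c]]] by (simp add: image_image)
  have "{c. row_span V k vs c \<in> {U \<in> subspaces_of_dim V k. f ` U \<in> T}} = {c. row_span W k (map f vs) c \<in> T}"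
  proof (rule Collect_cong)
   fix c
   have "row_span V k vs c \<in> subspaces_of_dim V k" if "f ` row_span V k vs c \<in> T"
   proof -
    have "f ` row_span V k vs c \<in> subspaces_of_dim W k" using T that unfolding openin_grassmannian by blast
    from subspaces_of_dim_image[OF g(1,2) wfd this] show ?thesis by (simp only: gfr)
   qed
   thus "row_span V k vs c \<in> {U \<in> subspaces_of_dim V k. f ` U \<in> T} \<longleftrightarrow> row_span W k (map f vs) c \<in> T"
    unfolding row_span_image[OF f vs] by blast
  qed
  moreover have "set (map f vs) \<subseteq> car W" using vs by auto
  ultimately show "open {c. row_span V k vs c \<in> {U \<in> subspaces_of_dim V k. f ` U \<in> T}}"
   using T unfolding openin_grassmannian by simp
 qed blast
qed

lemma subspaces_of_dim_subset: "U \<in> subspaces_of_dim V k ==> U \<subseteq> car V"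
 unfolding subspaces_of_dim_def using submodule.subset[OF subspace.submod] by blast

lemma grassmannian_continuous_map:
 assumes f: "linear_map CC V W f" "bij_betw f (car V) (car W)" and V: "vectorspace.fin_dim CC V"
 shows "continuous_map (grassmannian V k) (grassmannian W k) ((`) f)"
proof -
 interpret f: linear_map CC V W f by fact
 obtain g where g: "linear_map CC W V g" "bij_betw g (car W) (car V)"
  "\<And>x. x \<in> car V ==> g (f x) = x" "\<And>y. y \<in> car W ==> f (g y) = y"
  using linear_map_bij_inverse[OF f] by metis
 have wfd: "f.W.fin_dim" by (rule f.surj_dim_le(1)[OF bij_betw_imp_surj_on[OF f(2)] V])
 have gf: "g ` f ` U = U" if "U \<in> subspaces_of_dim V k" for U
  using g(3)[OF subsetD[OF subspaces_of_dim_subset[OF that]]] by (simp add: image_image)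
 have ot: "{U \<in> subspaces_of_dim W k. g ` U \<in> topspace (grassmannian V k)} \<subseteq> topspace (grassmannian W k)"
  by (rule openin_subset[OF grassmannian_preimage_open[OF g(1,2) wfd openin_topspace]])
 have top: "f ` U \<in> topspace (grassmannian W k)" if U: "U \<in> topspace (grassmannian V k)" for U
 proof -
  have Us: "U \<in> subspaces_of_dim V k" using U topspace_grassmannian by blast
  show ?thesis using subspaces_of_dim_image[OF f V Us] gf[OF Us] U ot by auto
 qed
 show ?thesis unfolding continuous_map_def
 proof (intro conjI allI impI)
  show "(`) f \<in> topspace (grassmannian V k) \<rightarrow> topspace (grassmannian W k)" using top by blast
  fix T assume T: "openin (grassmannian W k) T"
  have "{U \<in> topspace (grassmannian V k). f ` U \<in> T} = topspace (grassmannian V k) \<inter> {U \<in> subspaces_of_dim V k. f ` U \<in> T}"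
   using topspace_grassmannian by blast
  thus "openin (grassmannian V k) {U \<in> topspace (grassmannian V k). f ` U \<in> T}"
   using openin_Int[OF openin_topspace grassmannian_preimage_open[OF f V T]] by simp
 qed
qed

lemma grassmannian_homeomorphic:
 assumes f: "linear_map CC V W f" "bij_betw f (car V) (car W)" and V: "vectorspace.fin_dim CC V"
  and S: "S \<subseteq> Pow (car V)" and ST: "T = (`) f ` S"
 shows "subtopology (grassmannian V k) S homeomorphic_space subtopology (grassmannian W k) T"
proof -
 interpret f: linear_map CC V W f by fact
 obtain g where g: "linear_map CC W V g" "bij_betw g (car W) (car V)"
  "\<And>x. x \<in> car V ==> g (f x) = x" "\<And>y. y \<in> car W ==> f (g y) = y"
  using linear_map_bij_inverse[OF f] by metis
 have wfd: "f.W.fin_dim" by (rule f.surj_dim_le(1)[OF bij_betw_imp_surj_on[OF f(2)] V])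
 have gf: "g ` f ` U = U" if "U \<subseteq> car V" for U
  using g(3)[OF subsetD[OF that]] by (simp add: image_image)
 have fg: "f ` g ` U = U" if "U \<subseteq> car W" for U
  using g(4)[OF subsetD[OF that]] by (simp add: image_image)
 have tV: "U \<subseteq> car V" if "U \<in> topspace (grassmannian V k)" for U
  using that topspace_grassmannian subspaces_of_dim_subset by blast
 have tW: "U \<subseteq> car W" if "U \<in> topspace (grassmannian W k)" for U
  using that topspace_grassmannian subspaces_of_dim_subset by blast
 note cf = grassmannian_continuous_map[OF f V, of k] and cg = grassmannian_continuous_map[OF g(1,2) wfd, of k]
 have "homeomorphic_maps (grassmannian V k) (grassmannian W k) ((`) f) ((`) g)"
  unfolding homeomorphic_maps_def by (intro conjI ballI cf cg gf[OF tV] fg[OF tW])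
 moreover have "(`) f ` (topspace (grassmannian V k) \<inter> S) = topspace (grassmannian W k) \<inter> T"
 proof (intro equalityI subsetI)
  fix X assume "X \<in> (`) f ` (topspace (grassmannian V k) \<inter> S)"
  thus "X \<in> topspace (grassmannian W k) \<inter> T"
   using funcset_mem[OF continuous_map_funspace[OF cf]] unfolding ST by blast
 next
  fix X assume X: "X \<in> topspace (grassmannian W k) \<inter> T"
  then obtain U where U: "U \<in> S" "X = f ` U" unfolding ST by blast
  have "g ` X \<in> topspace (grassmannian V k)" using X funcset_mem[OF continuous_map_funspace[OF cg]] by blast
  moreover have "g ` X = U" unfolding U(2) by (rule gf) (use U(1) S in blast)
  ultimately have "U \<in> topspace (grassmannian V k)" by simp
  thus "X \<in> (`) f ` (topspace (grassmannian V k) \<inter> S)" using U by blast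
 qed
 ultimately show ?thesis
  unfolding homeomorphic_space_def by (intro exI homeomorphic_maps_subtopologies)
qed

section \<open>Exponents, g-vectors and multiplicities\<close>

context fd_algebra
begin

abbreviation sub_module :: "('a, 'm) module => 'm set => ('a, 'm) module" where
 "sub_module M N \<equiv> M\<lparr>carrier := N\<rparr>"

lemma complete_idempotents:
 assumes "complete_primitive_idempotents R es" "i < length es"
 shows "idempotent_in R (es ! i)"
 using assms by (auto simp: complete_primitive_idempotents_def primitive_idempotent_def)

lemma dim_vector_hom:
 assumes es: "complete_primitive_idempotents R es" and M: "fd_right_module R M" and N: "right_submodule R M N"
  and i: "i < length es"
 shows "dim_vector R es M N i = hom_dim R (idem_proj R (es ! i)) (sub_module M N)"
 using i unfolding hom_dim_idem_proj[OF complete_idempotents[OF es i] fd_submodule[OF M N]] dim_vector_def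
 by (simp add: cspace_carrier_update)

lemma hom_dim_projective:
 fixes P :: "('a, 'p) module" and N :: "('a, 'n) module"
 assumes es: "complete_primitive_idempotents R es" and P: "fg_projective R P" and N: "fd_right_module R N"
 shows "hom_dim R P N = (\<Sum>i<length es. count_list (proj_decomposition R es P) i * hom_dim R (idem_proj R (es ! i)) N)"
proof -
 let ?is = "proj_decomposition R es P" and ?P = "\<lambda>i. idem_proj R (es ! i)"
 have "set ?is \<subseteq> {..<length es} \<and> rmod_iso R P (rmod_dsum (map ?P ?is))"
  unfolding proj_decomposition_def by (rule someI_ex[OF projective_decomposition[OF es P]])
 hence s: "set ?is \<subseteq> {..<length es}" and iso: "rmod_iso R P (rmod_dsum (map ?P ?is))" by blast+
 obtain f where f: "rlin R P (rmod_dsum (map ?P ?is)) f" "bij_betw f (car P) (car (rmod_dsum (map ?P ?is)))"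
  by (rule rmod_isoE[OF iso])
 have pi: "fd_right_module R M" if "M \<in> set (map ?P ?is)" for M
 proof -
  obtain i where i: "i \<in> set ?is" "M = ?P i" using \<open>M \<in> set (map ?P ?is)\<close> by auto
  hence "i < length es" using s by auto
  thus ?thesis unfolding i(2) by (rule fd_projective[OF idem_proj_facts(4)[OF complete_idempotents[OF es]]])
 qed
 have "hom_dim R P N = hom_dim R (rmod_dsum (map ?P ?is)) N"
  by (rule hom_dim_iso[OF fd_projective[OF P] fd_dsum[OF pi] N f])
 also have "\<dots> = (\<Sum>M\<leftarrow>map ?P ?is. hom_dim R M N)" by (rule hom_dim_dsum[OF pi N])
 also have "\<dots> = (\<Sum>i\<leftarrow>?is. hom_dim R (?P i) N)" by (simp add: comp_def)
 also have "\<dots> = (\<Sum>i<length es. count_list ?is i * hom_dim R (?P i) N)"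
  by (rule sum_list_map_eq_sum_count2[OF s]) simp
 finally show ?thesis .
qed

text \<open>The i-th entry of the dimension vector is hom(P_i, N) by evaluation at the idempotent.
  Weighting these by the multiplicities of P_i in a projective gives its Hom dimension into N, and
  the two terms of X enter with opposite signs.\<close>

lemma g_vector_chi:
 assumes es: "complete_primitive_idempotents R es" and X: "two_term_proj R X"
  and M: "fd_right_module R M" and N: "right_submodule R M N"
 shows "(\<Sum>i<length es. g_vector R es X i * int (dim_vector R es M N i)) = chi X (sub_module M N)"
proof -
 have P: "fg_projective R (t0 X)" "fg_projective R (tm1 X)" using X by (auto simp: two_term_proj_def)
 have "(\<Sum>i<length es. g_vector R es X i * int (dim_vector R es M N i)) =
  (\<Sum>i<length es. g_vector R es X i * int (hom_dim R (idem_proj R (es ! i)) (sub_module M N)))"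
  by (rule sum.cong) (simp_all add: dim_vector_hom[OF es M N])
 also have "\<dots> = chi X (sub_module M N)"
  unfolding chi_def hom_dim_projective[OF es P(1) fd_submodule[OF M N]] hom_dim_projective[OF es P(2) fd_submodule[OF M N]]
  by (simp add: g_vector_def left_diff_distrib sum_subtractf)
 finally show ?thesis .
qed

lemma idem_proj_one: "idem_proj R \<one> = right_regular R"
proof -
 have "{\<one> \<otimes> x | x. x \<in> car R} = car R" by force
 thus ?thesis by (simp add: idem_proj_def right_regular_def)
qed

lemma hom_dim_regular:
 assumes N: "fd_right_module R N"
 shows "hom_dim R (right_regular R) N = mdim N"
proof -
 interpret N: right_module R N by (rule fdD[OF N])
 have "idempotent_in R \<one>" by (simp add: idempotent_in_def)
 from hom_dim_idem_proj[OF this N] have "hom_dim R (right_regular R) N = cdim ((cspace R N)\<lparr>carrier := (\<lambda>x. \<one> \<odot>\<^sub>N x) ` car N\<rparr>)"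
  unfolding idem_proj_one .
 moreover have "(\<lambda>x. \<one> \<odot>\<^sub>N x) ` car N = car N" using N.act_one by force
 moreover have "(cspace R N)\<lparr>carrier := car N\<rparr> = cspace R N" by (simp add: cspace_def)
 ultimately show ?thesis by (simp add: mdim_def)
qed

text \<open>The regular module is the sum of the P_i and represents the underlying vector space. The
  total dimension is thus independent of the list of idempotents, which is needed because
  \<open>Gr\<close> takes it as the dimension of its subspaces.\<close>

lemma sum_dim_vector:
 assumes es: "complete_primitive_idempotents R es" and M: "fd_right_module R M" and N: "right_submodule R M N"
 shows "(\<Sum>i<length es. dim_vector R es M N i) = mdim (sub_module M N)"
proof -
 let ?N = "sub_module M N" and ?D = "rmod_dsum (map (idem_proj R) es)"
 have fN: "fd_right_module R ?N" by (rule fd_submodule[OF M N])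
 have idem: "idempotent_in R e" if "e \<in> set es" for e
  using es that by (auto simp: complete_primitive_idempotents_def primitive_idempotent_def)
 have orth: "\<And>j k. j < length es ==> k < length es ==> j \<noteq> k ==> es ! j \<otimes> es ! k = \<zero>"
  and sum: "(\<Oplus>i\<in>{..<length es}. es ! i) = \<one>"
  using es by (auto simp: complete_primitive_idempotents_def)
 have pi: "fd_right_module R P" if "P \<in> set (map (idem_proj R) es)" for P
  using that fd_projective[OF idem_proj_facts(4)[OF idem]] by auto
 obtain i p where ip: "rlin R (right_regular R) ?D i" "rlin R ?D (right_regular R) p" "\<And>x. x \<in> car R ==> p (i x) = x"
  "\<And>v. v \<in> car ?D ==> i (p v) = v" using regular_idem_proj_maps[OF idem sum] orth by metis
 have "bij_betw i (car (right_regular R)) (car ?D)"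
  by (rule bij_betwI[of _ _ _ p]) (use rlin_cl[OF ip(1)] rlin_cl[OF ip(2)] ip(3,4) in \<open>auto simp: reg_simps\<close>)
 from hom_dim_iso[OF fd_regular fd_dsum[OF pi] fN ip(1) this]
 have "mdim ?N = hom_dim R ?D ?N" unfolding hom_dim_regular[OF fN] .
 also have "\<dots> = (\<Sum>P\<leftarrow>map (idem_proj R) es. hom_dim R P ?N)" by (rule hom_dim_dsum[OF pi fN])
 also have "\<dots> = (\<Sum>i<length es. hom_dim R (idem_proj R (es ! i)) ?N)"
  by (simp add: sum_list_sum_nth atLeast0LessThan)
 also have "\<dots> = (\<Sum>i<length es. dim_vector R es M N i)"
  by (rule sum.cong) (simp_all add: dim_vector_hom[OF es M N])
 finally show ?thesis ..
qed

text \<open>The exponent of u_X in the term of F-hat belonging to the dimension vector of N,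
  expressed through the submodule N itself.\<close>

definition expo :: "('a, 'x) two_term => ('a, 'm) module => 'm set => int" where
 "expo X M N = int (hom_dim R (H0 X) M) - chi X (sub_module M N)"

text \<open>chi(X, N) is at most hom(H^0 X, N), which is at most hom(H^0 X, M) since N embeds in M.
  The conversion to natural numbers in \<open>F_hat\<close> is therefore faithful.\<close>

lemma expo_nonneg:
 assumes X: "two_term_proj R X" and M: "fd_right_module R M" and N: "right_submodule R M N"
 shows "0 \<le> expo X M N"
proof -
 have fN: "fd_right_module R (sub_module M N)" by (rule fd_submodule[OF M N])
 have "hom_dim R (H0 X) (sub_module M N) \<le> hom_dim R (H0 X) M"
  by (rule hom_dim_le_of_inj[OF fd_H0[OF X] fdD[OF fN] M rlin_submodule_incl[OF N]]) simp
 thus ?thesis using chi_le_hom_H0[OF X fN] unfolding expo_def by linarith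
qed

lemma expo_iso:
 assumes "two_term_proj R X" "two_term_proj R Y" "K_iso R X Y" and M: "fd_right_module R M" and N: "right_submodule R M N"
 shows "expo X M N = expo Y M N"
 unfolding expo_def chi_iso[OF assms(1-3) fd_submodule[OF M N]] hom_dim_H0_iso[OF assms(1-3) M] ..

lemma expo_K_dsum:
 assumes "\<And>X. X \<in> set Xs ==> two_term_proj R X" and M: "fd_right_module R M" and N: "right_submodule R M N"
 shows "expo (K_dsum Xs) M N = (\<Sum>X\<leftarrow>Xs. expo X M N)"
proof -
 have s: "int (\<Sum>X\<leftarrow>Xs. f X) - (\<Sum>X\<leftarrow>Xs. g X) = (\<Sum>X\<leftarrow>Xs. int (f X) - g X)" for f and g :: "_ => int"
  by (induction Xs) simp_all
 have "chi (K_dsum Xs) (sub_module M N) = (\<Sum>X\<leftarrow>Xs. chi X (sub_module M N))"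
  by (rule chi_K_dsum[OF assms(1) fd_submodule[OF M N]])
 moreover have "hom_dim R (H0 (K_dsum Xs)) M = (\<Sum>X\<leftarrow>Xs. hom_dim R (H0 X) M)"
  by (rule hom_dim_H0_K_dsum[OF assms(1) M])
 ultimately show ?thesis unfolding expo_def by (simp only: s)
qed

text \<open>Members of a class are isomorphic to each other, so invariants may be computed from any
  of them instead of the one chosen by \<open>K_rep\<close>.\<close>

lemma K_class_facts:
 assumes V: "V \<in> ind_K R"
 shows K_rep_in: "K_rep V \<in> V" and ind_K_two_term_proj: "Y \<in> V ==> two_term_proj R Y"
  and ind_K_iso: "Y \<in> V ==> Z \<in> V ==> K_iso R Y Z"
  and ind_K_eq: "Y \<in> V ==> V = K_class R Y"
proof -
 obtain X where X: "V = K_class R X" "indec_K R X" using V unfolding ind_K_def by blast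
 have pX: "two_term_proj R X" using X(2) by (simp add: indec_K_def)
 note cX = ttp_cplx[OF pX]
 have "X \<in> V" unfolding X(1) K_class_def using pX K_iso_refl[OF cX] by blast
 thus "K_rep V \<in> V" unfolding K_rep_def by (rule someI)
 show p: "two_term_proj R Y" if "Y \<in> V" for Y using that unfolding X(1) K_class_def by blast
 have i: "K_iso R X Y" if "Y \<in> V" for Y using that unfolding X(1) K_class_def by blast
 show i2: "K_iso R Y Z" if "Y \<in> V" "Z \<in> V" for Y Z
  using K_iso_trans[OF _ cX _ K_iso_sym[OF cX _ i[OF that(1)]] i[OF that(2)]] ttp_cplx[OF p] that by blast
 show "V = K_class R Y" if Y: "Y \<in> V"
 proof (intro equalityI subsetI)
  fix Z assume "Z \<in> V"
  thus "Z \<in> K_class R Y" using p i2[OF Y] unfolding K_class_def by blast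
 next
  fix Z assume "Z \<in> K_class R Y"
  hence Z: "two_term_proj R Z" "K_iso R Y Z" unfolding K_class_def by blast+
  have "K_iso R X Z"
   by (rule K_iso_trans[OF cX ttp_cplx[OF p[OF Y]] ttp_cplx[OF Z(1)] i[OF Y] Z(2)])
  thus "Z \<in> V" using Z(1) unfolding X(1) K_class_def by blast
 qed
qed

lemma indec_K_class:
 assumes X: "indec_K R X"
 shows "K_class R X \<in> ind_K R" "X \<in> K_class R X"
proof -
 have p: "two_term_proj R X" using X by (simp add: indec_K_def)
 show "K_class R X \<in> ind_K R" using X unfolding ind_K_def by blast
 show "X \<in> K_class R X" using p K_iso_refl[OF ttp_cplx[OF p]] unfolding K_class_def by blast
qed

text \<open>Each indecomposable lies in exactly one class, so a sum over a list can be grouped by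
  classes, the length of a filtered list being the multiplicity.\<close>

lemma sum_list_classes:
 fixes f :: "('a, nat => 'a) two_term => int"
 assumes fin: "finite (ind_K R)" and Ys: "\<forall>Y\<in>set Ys. indec_K R Y"
  and inv: "\<And>X Y. two_term_proj R X ==> two_term_proj R Y ==> K_iso R X Y ==> f X = f Y"
 shows "(\<Sum>Y\<leftarrow>Ys. f Y) = (\<Sum>V\<in>ind_K R. int (length (filter (\<lambda>Y. Y \<in> V) Ys)) * f (K_rep V))"
 using Ys
proof (induction Ys)
 case Nil
 show ?case by simp
next
 case (Cons Y Ys)
 have Y: "indec_K R Y" using Cons.prems by simp
 note c = indec_K_class[OF Y]
 have eq: "Y \<in> V \<longleftrightarrow> V = K_class R Y" if "V \<in> ind_K R" for V
  using ind_K_eq[OF that] c(2) by blast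
 have "f Y = f (K_rep (K_class R Y))"
  by (rule inv[OF ind_K_two_term_proj[OF c(1) c(2)] ind_K_two_term_proj[OF c(1) K_rep_in[OF c(1)]] ind_K_iso[OF c(1) c(2) K_rep_in[OF c(1)]]])
 also have "\<dots> = (\<Sum>V\<in>ind_K R. if V = K_class R Y then f (K_rep V) else 0)"
  using fin c(1) by simp
 finally have fY: "f Y = (\<Sum>V\<in>ind_K R. if V = K_class R Y then f (K_rep V) else 0)" .
 have "(\<Sum>Y\<leftarrow>Y # Ys. f Y) = (\<Sum>V\<in>ind_K R. (if V = K_class R Y then f (K_rep V) else 0) + int (length (filter (\<lambda>Y. Y \<in> V) Ys)) * f (K_rep V))"
  using Cons by (simp add: fY sum.distrib)
 also have "\<dots> = (\<Sum>V\<in>ind_K R. int (length (filter (\<lambda>Z. Z \<in> V) (Y # Ys))) * f (K_rep V))"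
  by (rule sum.cong[OF refl]) (simp add: eq distrib_right)
 finally show ?case .
qed

text \<open>Additivity of \<open>expo\<close> is applied to the very decomposition chosen by
  \<open>K_decomposition\<close>, from which \<open>K_mult\<close> also reads its numbers.\<close>

lemma expo_K_mult:
 fixes X :: "('a, 'x) two_term"
 assumes fin: "finite (ind_K R)" and X: "two_term_proj R X" and M: "fd_right_module R M" and N: "right_submodule R M N"
 shows "expo X M N = (\<Sum>V\<in>ind_K R. int (K_mult R X V) * expo (K_rep V) M N)"
proof -
 let ?Xs = "K_decomposition R X"
 have "\<exists>Xs :: ('a, nat => 'a) two_term list. (\<forall>Y\<in>set Xs. indec_K R Y) \<and> K_iso R X (K_dsum Xs)"
  using K_decomposition_exists[OF X] by blast
 hence "(\<forall>Y\<in>set ?Xs. indec_K R Y) \<and> K_iso R X (K_dsum ?Xs)"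
  unfolding K_decomposition_def by (rule someI_ex)
 hence Xs: "\<forall>Y\<in>set ?Xs. indec_K R Y" and iso: "K_iso R X (K_dsum ?Xs)" by blast+
 have p: "two_term_proj R Y" if "Y \<in> set ?Xs" for Y using Xs that by (simp add: indec_K_def)
 have "expo X M N = expo (K_dsum ?Xs) M N" by (rule expo_iso[OF X K_dsum_two_term_proj[OF p] iso M N])
 also have "\<dots> = (\<Sum>Y\<leftarrow>?Xs. expo Y M N)" by (rule expo_K_dsum[OF p M N])
 also have "\<dots> = (\<Sum>V\<in>ind_K R. int (length (filter (\<lambda>Y. Y \<in> V) ?Xs)) * expo (K_rep V) M N)"
  by (rule sum_list_classes[OF fin Xs]) (rule expo_iso[OF _ _ _ M N])
 finally show ?thesis unfolding K_mult_def .
qed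

text \<open>N picks one submodule for each dimension vector; by \<open>g_vector_chi\<close> the
  exponent depends on that submodule only through d.\<close>

lemma F_hat_expo:
 assumes es: "complete_primitive_idempotents R es" and M: "fd_right_module R M"
  and N: "\<And>d. submodules_of_dim R es M d \<noteq> {} ==> N d \<in> submodules_of_dim R es M d"
 shows "F_hat R es M = (\<Sum>d | submodules_of_dim R es M d \<noteq> {}.
  of_int (euler_char (Gr R es M d)) * (\<Prod>V\<in>ind_K R. poly_var V ^ nat (expo (K_rep V) M (N d))))"
 unfolding F_hat_def
proof (rule sum.cong[OF refl], rule arg_cong2[where f = "(*)", OF refl], rule prod.cong[OF refl])
 fix d V
 assume "d \<in> {d. submodules_of_dim R es M d \<noteq> {}}" and V: "V \<in> ind_K R"
 hence n: "right_submodule R M (N d)" "dim_vector R es M (N d) = d" using N[of d] by (auto simp: submodules_of_dim_def)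
 show "poly_var V ^ nat (int (hom_dim R (H0 (K_rep V)) M) - (\<Sum>i<length es. g_vector R es (K_rep V) i * int (d i))) =
  poly_var V ^ nat (expo (K_rep V) M (N d))"
  using g_vector_chi[OF es ind_K_two_term_proj[OF V K_rep_in[OF V]] M n(1)] unfolding n(2) expo_def by simp
qed

text \<open>Taking images under f preserves submodules and dimension vectors and is a homeomorphism
  of Grassmannians, and Hom into M and into M' have equal dimensions.\<close>

lemma F_hat_iso:
 fixes M :: "('a, 'm) module" and M' :: "('a, 'n) module"
 assumes es: "complete_primitive_idempotents R es" and M: "fd_right_module R M" and M': "fd_right_module R M'"
  and f: "rlin R M M' f" "bij_betw f (car M) (car M')"
 shows "F_hat R es M = F_hat R es M'"
proof -
 note mM = fdD[OF M] and mM' = fdD[OF M']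
 have half: "right_submodule R M' (f ` N) \<and> dim_vector R es M' (f ` N) = dim_vector R es M N"
  if M: "fd_right_module R M" and M': "fd_right_module R M'" and f: "rlin R M M' f" "bij_betw f (car M) (car M')"
   and N: "right_submodule R M N" for M :: "('a, 'u) module" and M' :: "('a, 'v) module" and f N
 proof -
  have fN: "fd_right_module R (sub_module M N)" by (rule fd_submodule[OF M N])
  have l: "rlin R (sub_module M N) M' f" using rlin_o[OF f(1) rlin_submodule_incl[OF N]] by simp
  have s: "right_submodule R M' (f ` N)" using rlin_image_submodule[OF fdD[OF fN] fdD[OF M'] l] by simp
  have l': "rlin R (sub_module M N) (sub_module M' (f ` N)) f" using l unfolding rlin_def by auto
  have b: "bij_betw f (car (sub_module M N)) (car (sub_module M' (f ` N)))"
   using inj_on_subset[OF bij_betw_imp_inj_on[OF f(2)], of N] N by (simp add: bij_betw_def right_submodule_def)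
  have "dim_vector R es M' (f ` N) = dim_vector R es M N"
  proof
   fix i
   show "dim_vector R es M' (f ` N) i = dim_vector R es M N i"
   proof (cases "i < length es")
    case True
    note P = fd_projective[OF idem_proj_facts(4)[OF complete_idempotents[OF es True]]]
    show ?thesis unfolding dim_vector_hom[OF es M' s True] dim_vector_hom[OF es M N True]
     by (rule hom_dim_iso_right[OF P fN fd_submodule[OF M' s] l' b, symmetric])
   qed (simp add: dim_vector_def)
  qed
  with s show ?thesis by blast
 qed
 obtain g where g: "rlin R M' M g" "\<And>x. x \<in> car M ==> g (f x) = x" "\<And>y. y \<in> car M' ==> f (g y) = y"
  using rlin_inverse[OF mM f] by metis
 have gb: "bij_betw g (car M') (car M)"
  by (rule bij_betwI[of _ _ _ f]) (use rlin_cl[OF g(1)] rlin_cl[OF f(1)] g(2,3) in auto)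
 have im: "submodules_of_dim R es M' d = (`) f ` submodules_of_dim R es M d" for d
 proof (intro equalityI subsetI)
  fix N assume "N \<in> submodules_of_dim R es M' d"
  hence N: "right_submodule R M' N" "dim_vector R es M' N = d" by (auto simp: submodules_of_dim_def)
  have "g ` N \<in> submodules_of_dim R es M d" using half[OF M' M g(1) gb N(1)] N(2) by (simp add: submodules_of_dim_def)
  moreover have "f ` g ` N = N" using g(3)[OF subsetD, of N] N(1) by (simp add: image_image right_submodule_def)
  ultimately show "N \<in> (`) f ` submodules_of_dim R es M d" by (metis imageI)
 next
  fix N assume "N \<in> (`) f ` submodules_of_dim R es M d"
  thus "N \<in> submodules_of_dim R es M' d" using half[OF M M' f] by (auto simp: submodules_of_dim_def)
 qed
 have lm: "linear_map CC (cspace R M) (cspace R M') f" by (rule rlin_linear_map[OF mM mM' f(1)])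
 have fdc: "vectorspace.fin_dim CC (cspace R M)" using M by (simp add: fd_right_module_def)
 have "euler_char (Gr R es M d) = euler_char (Gr R es M' d)" for d unfolding Gr_def
  by (rule euler_char_homeomorphic[OF grassmannian_homeomorphic[OF lm _ fdc _ im]])
   (use f(2) in \<open>auto simp: submodules_of_dim_def right_submodule_def\<close>)
 moreover have "hom_dim R (H0 (K_rep V)) M = hom_dim R (H0 (K_rep V)) M'" if "V \<in> ind_K R" for V
  by (rule hom_dim_iso_right[OF fd_H0[OF ind_K_two_term_proj[OF that K_rep_in[OF that]]] M M' f])
 ultimately show ?thesis unfolding F_hat_def im by simp
qed

end

text \<open>Projectivity lifts an endomorphism of H^0 to a chain endomorphism, which is nilpotent or
  bijective; either alternative passes to the cokernel.\<close>

lemma eloc_H0: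
 assumes X: "two_term_proj R X" and loc: "cloc R X"
 shows "eloc R (H0 X)" unfolding eloc_def
proof (intro allI impI)
 fix f assume f: "rlin R (H0 X) (H0 X) f"
 note c = ttp_cplx[OF X]
 note d = cplxD[OF c] and m = H0_is_module[OF c] and k = H0_class_rlin[OF c]
 have P: "fg_projective R (t0 X)" "fg_projective R (tm1 X)" using X by (auto simp: two_term_proj_def)
 interpret T: right_module R "t0 X" by (rule d)
 interpret T1: right_module R "tm1 X" by (rule d)
 interpret H: right_module R "H0 X" by (rule m)
 obtain u0 where u0: "rlin R (t0 X) (t0 X) u0" "\<And>x. x \<in> car (t0 X) ==> H0_class X (u0 x) = f (H0_class X x)"
  using fg_projective_lift[OF P(1) d(2) m k H0_carrier[OF c, symmetric] rlin_o[OF f k]] by auto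
 have dz: "H0_class X (tdiff X z) = \<zero>\<^bsub>H0 X\<^esub>" if z: "z \<in> car (tm1 X)" for z
 proof -
  have "\<exists>w\<in>car (tm1 X). tdiff X z = \<zero>\<^bsub>t0 X\<^esub> \<oplus>\<^bsub>t0 X\<^esub> tdiff X w"
   using z rlin_cl[OF d(3) z] by (intro bexI[of _ z]) simp_all
  hence "H0_class X (tdiff X z) = H0_class X \<zero>\<^bsub>t0 X\<^esub>"
   using H0_class_eq_iff[OF c rlin_cl[OF d(3) z] T.M.zero_closed] by blast
  thus ?thesis using rlin_zero[OF d(2) m k] by simp
 qed
 \<comment> \<open>u0 preserves the boundaries B because it induces a map on their cosets. The
   differential maps X^-1 onto B, so u0 after the differential lifts to u1 by projectivity of
   X^-1.\<close>
 let ?B = "(t0 X)\<lparr>carrier := tdiff X ` car (tm1 X)\<rparr>"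
 have B: "right_module R ?B" by (rule T.submodule_is_module[OF rlin_image_submodule[OF d]])
 have ud: "rlin R (tm1 X) ?B (u0 \<circ> tdiff X)"
 proof (rule rlinI)
  fix z assume z: "z \<in> car (tm1 X)"
  note tz = rlin_cl[OF d(3) z]
  have "H0_class X (u0 (tdiff X z)) = H0_class X \<zero>\<^bsub>t0 X\<^esub>"
   unfolding u0(2)[OF tz] dz[OF z] rlin_zero[OF m m f] rlin_zero[OF d(2) m k] ..
  then obtain w where w: "w \<in> car (tm1 X)" "u0 (tdiff X z) = \<zero>\<^bsub>t0 X\<^esub> \<oplus>\<^bsub>t0 X\<^esub> tdiff X w"
   using H0_class_eq_iff[OF c rlin_cl[OF u0(1) tz] T.M.zero_closed] by blast
  hence "u0 (tdiff X z) = tdiff X w" using rlin_cl[OF d(3) w(1)] by simp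
  thus "(u0 \<circ> tdiff X) z \<in> car ?B" using w(1) by simp
 qed (simp_all add: rlin_add[OF d(3)] rlin_act[OF d(3)] rlin_add[OF u0(1)] rlin_act[OF u0(1)] rlin_cl[OF d(3)])
 have db: "rlin R (tm1 X) ?B (tdiff X)" using d(3) unfolding rlin_def by auto
 obtain u1 where u1: "rlin R (tm1 X) (tm1 X) u1" "\<And>x. x \<in> car (tm1 X) ==> tdiff X (u1 x) = u0 (tdiff X x)"
  using fg_projective_lift[OF P(2) d(1) B db _ ud] by auto
 have "cmap R X X (u1, u0)" using u0(1) u1 by (simp add: cmap_def)
 then consider n where "\<forall>x\<in>car (t0 X). (u0 ^^ n) x = \<zero>\<^bsub>t0 X\<^esub>"
  | "bij_betw u1 (car (tm1 X)) (car (tm1 X))" "bij_betw u0 (car (t0 X)) (car (t0 X))"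
  using loc unfolding cloc_def by fastforce
 thus "(\<exists>n. \<forall>x\<in>car (H0 X). (f ^^ n) x = \<zero>\<^bsub>H0 X\<^esub>) \<or> bij_betw f (car (H0 X)) (car (H0 X))"
 proof cases
  case 1
  have "(f ^^ n) (H0_class X x) = H0_class X ((u0 ^^ n) x) \<and> (u0 ^^ n) x \<in> car (t0 X)" if x: "x \<in> car (t0 X)" for x n
   using x by (induction n) (simp_all add: u0(2) rlin_cl[OF u0(1)])
  hence "\<forall>x\<in>car (H0 X). (f ^^ n) x = \<zero>\<^bsub>H0 X\<^esub>"
   unfolding H0_carrier[OF c] using 1 rlin_zero[OF d(2) m k] by simp
  thus ?thesis by blast
 next
  case 2
  have "inj_on f (car (H0 X))"
  proof (rule inj_onI)
   fix a b assume "a \<in> car (H0 X)" "b \<in> car (H0 X)" and ab: "f a = f b"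
   then obtain x y where x: "x \<in> car (t0 X)" "a = H0_class X x" and y: "y \<in> car (t0 X)" "b = H0_class X y"
    unfolding H0_carrier[OF c] by blast
   have "H0_class X (u0 x) = H0_class X (u0 y)" using ab unfolding x(2) y(2) u0(2)[OF x(1)] u0(2)[OF y(1)] .
   then obtain z where z: "z \<in> car (tm1 X)" "u0 x = u0 y \<oplus>\<^bsub>t0 X\<^esub> tdiff X z"
    using H0_class_eq_iff[OF c rlin_cl[OF u0(1) x(1)] rlin_cl[OF u0(1) y(1)]] by blast
   \<comment> \<open>Surjectivity of u1 turns the boundary of z into u0 of a boundary; then
     injectivity of u0 applies.\<close>
   obtain w where w: "w \<in> car (tm1 X)" "z = u1 w" using z(1) bij_betw_imp_surj_on[OF 2(1)] by blast
   have "u0 x = u0 (y \<oplus>\<^bsub>t0 X\<^esub> tdiff X w)"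
    unfolding z(2) w(2) u1(2)[OF w(1)] rlin_add[OF u0(1) y(1) rlin_cl[OF d(3) w(1)]] ..
   hence "x = y \<oplus>\<^bsub>t0 X\<^esub> tdiff X w"
    by (rule inj_onD[OF bij_betw_imp_inj_on[OF 2(2)]]) (use x(1) y(1) rlin_cl[OF d(3) w(1)] in simp_all)
   thus "a = b" unfolding x(2) y(2) H0_class_eq_iff[OF c x(1) y(1)] using w(1) by blast
  qed
  moreover have "f ` car (H0 X) = car (H0 X)"
  proof
   show "f ` car (H0 X) \<subseteq> car (H0 X)" using rlin_cl[OF f] by blast
   show "car (H0 X) \<subseteq> f ` car (H0 X)"
   proof
    fix a assume "a \<in> car (H0 X)"
    then obtain x where x: "x \<in> car (t0 X)" "a = H0_class X x" unfolding H0_carrier[OF c] by blast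
    obtain y where y: "y \<in> car (t0 X)" "x = u0 y" using x(1) bij_betw_imp_surj_on[OF 2(2)] by blast
    have "a = f (H0_class X y)" unfolding x(2) y(2) u0(2)[OF y(1)] ..
    moreover have "H0_class X y \<in> car (H0 X)" by (rule rlin_cl[OF k y(1)])
    ultimately show "a \<in> f ` car (H0 X)" by (rule image_eqI)
   qed
  qed
  ultimately show ?thesis by (simp add: bij_betw_def)
 qed
qed

section \<open>Realising a local module as H^0 of an indecomposable complex\<close>

lemma mbip_left:
 "mbip R X Y Z ==> \<exists>j q. rlin R Y X j \<and> rlin R X Y q \<and> (\<forall>y\<in>car Y. q (j y) = y)"
 unfolding mbip_def by blast

context fd_algebra
begin

lemma fg_projective_free: "fg_projective R (free_module R k)"
 by (rule fg_projectiveI[OF free_module_is_module rlin_id rlin_id]) simp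

lemma zero_submodule_H0_dsum:
 "car (H0 (K_dsum ([] :: ('a, 'c) two_term list))) = {\<zero>\<^bsub>H0 (K_dsum ([] :: ('a, 'c) two_term list))\<^esub>}"
proof -
 have c: "cplx R (K_dsum ([] :: ('a, 'c) two_term list))" by (rule K_dsum_cplx[OF ring_axioms]) simp
 interpret H: right_module R "H0 (K_dsum ([] :: ('a, 'c) two_term list))" by (rule H0_is_module[OF c])
 have "\<exists>u. car (H0 (K_dsum ([] :: ('a, 'c) two_term list))) = {u}"
  unfolding H0_carrier[OF c] by (simp add: K_dsum_simps dsum_simps)
 thus ?thesis using H.M.zero_closed by (metis singletonD)
qed

text \<open>H^0 sends each splitting of the sum to a biproduct of modules, so the exchange lemma can
  be applied along the list of complexes.\<close>

lemma mfactor_H0_K_dsum: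
 fixes Xs :: "('a, 'c) two_term list"
 assumes M: "right_module R M" and loc: "eloc R M" and nz: "car M \<noteq> {\<zero>\<^sub>M}"
  and "\<And>X. X \<in> set Xs ==> cplx R X" and "mfactor R M (H0 (K_dsum Xs))"
 shows "\<exists>X\<in>set Xs. mfactor R M (H0 X)" using assms(4,5)
proof (induction Xs)
 case Nil
 let ?Z = "H0 (K_dsum ([] :: ('a, 'c) two_term list))"
 have c: "cplx R (K_dsum ([] :: ('a, 'c) two_term list))" by (rule K_dsum_cplx[OF ring_axioms]) simp
 interpret M: right_module R M by fact
 obtain i p where ip: "rlin R M ?Z i" "rlin R ?Z M p" "bij_betw (\<lambda>x. p (i x)) (car M) (car M)"
  using Nil.prems(2) unfolding mfactor_def by blast
 have "i x = \<zero>\<^sub>?Z" if "x \<in> car M" for x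
  using rlin_cl[OF ip(1) that] unfolding zero_submodule_H0_dsum by simp
 hence "(\<lambda>x. p (i x)) ` car M \<subseteq> {\<zero>\<^sub>M}" using rlin_zero[OF H0_is_module[OF c] M ip(2)] by auto
 thus ?case using bij_betw_imp_surj_on[OF ip(3)] nz M.M.zero_closed by auto
next
 case (Cons X Xs)
 have X: "cplx R X" and Xs: "\<And>X. X \<in> set Xs ==> cplx R X" using Cons.prems(1) by simp_all
 have D: "cplx R (K_dsum Xs)" by (rule K_dsum_cplx[OF ring_axioms Xs])
 have D': "cplx R (K_dsum (X # Xs))" by (rule K_dsum_cplx[OF ring_axioms Cons.prems(1)])
 have b: "kbip R (K_dsum (X # Xs)) X (K_dsum Xs)" by (rule kbip_K_dsum[OF ring_axioms X Xs])
 from mfactor_mbip[OF M H0_is_module[OF D'] loc H0_mbip[OF D' X D b] Cons.prems(2)]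
 show ?case using Cons.IH[OF Xs] by auto
qed

text \<open>A free cover of M followed by a free cover of its kernel. It may be far from minimal;
  \<open>local_module_H0\<close> afterwards selects the summand that matters.\<close>

lemma presentation:
 fixes M :: "('a, 'm) module"
 assumes M: "fd_right_module R M"
 obtains X :: "('a, nat => 'a) two_term" and h where "two_term_proj R X" "rlin R M (H0 X) h" "bij_betw h (car M) (car (H0 X))"
proof -
 note mM = fdD[OF M]
 interpret M: right_module R M by (rule mM)
 obtain k q where q: "rlin R (free_module R k) M q" "q ` car (free_module R k) = car M"
  using fd_finitely_generated[OF M] by blast
 let ?F = "free_module R k"
 interpret F: right_module R ?F by (rule free_module_is_module)
 define K where "K = {x \<in> car ?F. q x = \<zero>\<^sub>M}"
 have K: "right_submodule R ?F K" unfolding right_submodule_def K_def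
  using F.M.zero_closed F.M.add.m_closed F.act_closed
  by (auto simp del: dsum_simps simp: rlin_add[OF q(1)] rlin_act[OF q(1)] rlin_zero[OF F.right_module_axioms mM q(1)] M.act_zero)
 have fK: "fd_right_module R (sub_module ?F K)" by (rule fd_submodule[OF fd_free K])
 obtain l r where r: "rlin R (free_module R l) (sub_module ?F K) r" "r ` car (free_module R l) = K"
  using fd_finitely_generated[OF fK] by auto
 have r': "rlin R (free_module R l) ?F r" using rlin_o[OF rlin_submodule_incl[OF K] r(1)] by simp
 define X where "X = \<lparr>tm1 = free_module R l, t0 = ?F, tdiff = restrict r (car (free_module R l))\<rparr>"
 have X: "two_term_proj R X"
  unfolding two_term_proj_def X_def using fg_projective_free rlin_restrict[OF free_module_is_module r'] by simp
 note c = ttp_cplx[OF X]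
 have t0: "t0 X = ?F" by (simp add: X_def)
 have td: "tdiff X z \<in> K" if "z \<in> car (tm1 X)" for z using that r(2) by (auto simp: X_def)
 have Ktd: "\<exists>z\<in>car (tm1 X). x = tdiff X z" if "x \<in> K" for x using that r(2) unfolding X_def by force
 have eq: "H0_class X x = H0_class X y \<longleftrightarrow> q x = q y" if x: "x \<in> car ?F" and y: "y \<in> car ?F" for x y
 proof
  assume "H0_class X x = H0_class X y"
  then obtain z where z: "z \<in> car (tm1 X)" "x = y \<oplus>\<^sub>?F tdiff X z"
   using H0_class_eq_iff[OF c, of x y] x y unfolding t0 by blast
  have t: "tdiff X z \<in> car ?F" "q (tdiff X z) = \<zero>\<^sub>M" using td[OF z(1)] by (simp_all only: K_def mem_Collect_eq)
  show "q x = q y" unfolding z(2) rlin_add[OF q(1) y t(1)] t(2) using rlin_cl[OF q(1) y] by simp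
 next
  assume xy: "q x = q y"
  have my: "\<ominus>\<^sub>?F y \<in> car ?F" by (rule F.M.a_inv_closed[OF y])
  have "q (x \<oplus>\<^sub>?F \<ominus>\<^sub>?F y) = \<zero>\<^sub>M"
   unfolding rlin_add[OF q(1) x my] rlin_minus[OF F.right_module_axioms mM q(1) y] xy
   by (rule M.M.r_neg[OF rlin_cl[OF q(1) y]])
  hence "x \<oplus>\<^sub>?F \<ominus>\<^sub>?F y \<in> K" unfolding K_def using F.M.a_closed[OF x my] by blast
  then obtain z where z: "z \<in> car (tm1 X)" "x \<oplus>\<^sub>?F \<ominus>\<^sub>?F y = tdiff X z" using Ktd by blast
  have "x = y \<oplus>\<^sub>?F tdiff X z"
   unfolding z(2)[symmetric] F.M.a_lcomm[OF y x my] F.M.r_neg[OF y] by (rule F.M.r_zero[OF x, symmetric])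
  thus "H0_class X x = H0_class X y" using H0_class_eq_iff[OF c, of x y] x y z(1) unfolding t0 by blast
 qed
 have "\<exists>h. rlin R M (H0 X) h \<and> (\<forall>x\<in>car ?F. h (q x) = H0_class X x)"
 proof -
  have eq': "H0_class X x = H0_class X y" if "x \<in> car ?F" "y \<in> car ?F" "q x = q y" for x y
   using eq[OF that(1,2)] that(3) by simp
  note r = H0_class_rlin[OF c, unfolded t0]
  show ?thesis by (rule rlin_factor[OF F.right_module_axioms q r eq'], assumption+) (intro exI conjI ballI)
 qed
 then obtain h where h: "rlin R M (H0 X) h" "\<forall>x\<in>car ?F. h (q x) = H0_class X x" by (elim exE conjE)
 have "inj_on h (car M)"
 proof (rule inj_onI)
  fix a b assume "a \<in> car M" "b \<in> car M" and ab: "h a = h b"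
  then obtain x y where x: "x \<in> car ?F" "a = q x" and y: "y \<in> car ?F" "b = q y" unfolding q(2)[symmetric] by blast
  show "a = b" using ab unfolding x(2) y(2) bspec[OF h(2) x(1)] bspec[OF h(2) y(1)] eq[OF x(1) y(1)] .
 qed
 moreover have "h ` car M = car (H0 X)"
  unfolding H0_carrier[OF c] t0 q(2)[symmetric] image_image by (rule image_cong[OF refl bspec[OF h(2)]])
 ultimately show thesis using that[OF X h(1)] by (simp add: bij_betw_def)
qed

text \<open>Decompose a presentation of M. By exchange a nonzero local M is a summand of H^0 of one
  indecomposable piece, and it is isomorphic to that H^0, which is local too. The zero module needs
  a complex of its own.\<close>

lemma local_module_H0:
 fixes M :: "('a, 'm) module"
 assumes M: "fd_right_module R M" and loc: "eloc R M" and nz: "\<one> \<noteq> \<zero>"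
 obtains X f where "indec_K R X" "rlin R M (H0 X) f" "bij_betw f (car M) (car (H0 X))"
proof (cases "car M = {\<zero>\<^sub>M}")
 case False
 note mM = fdD[OF M]
 obtain X :: "('a, nat => 'a) two_term" and h where X: "two_term_proj R X"
  and h: "rlin R M (H0 X) h" "bij_betw h (car M) (car (H0 X))" by (rule presentation[OF M])
 obtain Xs :: "('a, nat => 'a) two_term list" where Xs: "\<forall>Y\<in>set Xs. indec_K R Y \<and> cloc R Y" and iso: "K_iso R X (K_dsum Xs)"
  using K_decomposition_exists[OF X] by blast
 have p: "two_term_proj R Y" if "Y \<in> set Xs" for Y using Xs that by (simp add: indec_K_def)
 note D = K_dsum_two_term_proj[OF p]
 have D: "two_term_proj R (K_dsum Xs)" by (rule K_dsum_two_term_proj[OF p])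
 obtain F where F: "rlin R (H0 X) (H0 (K_dsum Xs)) F" "bij_betw F (car (H0 X)) (car (H0 (K_dsum Xs)))"
  by (rule H0_iso[OF ttp_cplx[OF X] ttp_cplx[OF D] iso])
 have Fh: "rlin R M (H0 (K_dsum Xs)) (F \<circ> h)" "bij_betw (F \<circ> h) (car M) (car (H0 (K_dsum Xs)))"
  by (rule rlin_o[OF F(1) h(1)], rule bij_betw_trans[OF h(2) F(2)])
 obtain g where g: "rlin R (H0 (K_dsum Xs)) M g" "\<And>x. x \<in> car M ==> g ((F \<circ> h) x) = x"
  using rlin_inverse[OF mM Fh] by metis
 have "bij_betw (\<lambda>x. g ((F \<circ> h) x)) (car M) (car M)"
  by (subst bij_betw_cong[of _ _ id]) (simp_all only: g(2) id_apply bij_betw_id)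
 hence "mfactor R M (H0 (K_dsum Xs))" unfolding mfactor_def using Fh(1) g(1) by blast
 hence "\<exists>Y\<in>set Xs. mfactor R M (H0 Y)"
  by (rule mfactor_H0_K_dsum[OF mM loc False ttp_cplx[OF p], rotated])
 then obtain Y where Y: "Y \<in> set Xs" "mfactor R M (H0 Y)" by blast
 have e: "eloc R (H0 Y)" using eloc_H0[OF p[OF Y(1)]] Xs Y(1) by blast
 obtain f where "rlin R M (H0 Y) f" "bij_betw f (car M) (car (H0 Y))"
  by (rule eloc_factor_iso[OF mM False fdD[OF fd_H0[OF p[OF Y(1)]]] e Y(2)])
 with Xs Y(1) show thesis by (intro that) blast+
next
 case True
 \<comment> \<open>The complex R -> 0 has zero H^0, yet is not contractible because 1 and 0 differ
   in R. Hence it has an indecomposable summand, whose H^0 is zero as well.\<close>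
 define X where "X = \<lparr>tm1 = free_module R 1, t0 = free_module R 0, tdiff = restrict (\<lambda>_. \<zero>\<^bsub>free_module R 0\<^esub>) (car (free_module R 1))\<rparr>"
 have X: "two_term_proj R X" unfolding two_term_proj_def X_def two_term.simps
  by (intro conjI fg_projective_free rlin_restrict[OF free_module_is_module rlin_const_zero[OF free_module_is_module]])
 note cX = ttp_cplx[OF X]
 obtain Xs :: "('a, nat => 'a) two_term list" where Xs: "\<forall>Y\<in>set Xs. indec_K R Y \<and> cloc R Y" and iso: "K_iso R X (K_dsum Xs)"
  using K_decomposition_exists[OF X] by blast
 have p: "two_term_proj R Y" if "Y \<in> set Xs" for Y using Xs that by (simp add: indec_K_def)
 have D: "two_term_proj R (K_dsum Xs)" by (rule K_dsum_two_term_proj[OF p])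
 have "\<not> kzero R X"
 proof
  assume "kzero R X"
  then obtain k where k: "rlin R (t0 X) (tm1 X) k" "\<forall>x\<in>car (tm1 X). fst cid x = fst (czero X) x \<oplus>\<^bsub>tm1 X\<^esub> k (tdiff X x)"
   unfolding kzero_def heq_def by blast
  \<comment> \<open>The generator of the free module of rank one. A contraction would recover it
    from its image in the zero module.\<close>
  let ?e = "\<lambda>j\<in>{..<1::nat}. \<one>"
  have e: "?e \<in> car (tm1 X)" by (simp add: X_def dsum_simps reg_simps)
  interpret T: right_module R "tm1 X" by (rule cplxD[OF cX])
  have "tdiff X ?e = \<zero>\<^bsub>t0 X\<^esub>" using e by (simp add: X_def)
  hence "k (tdiff X ?e) = \<zero>\<^bsub>tm1 X\<^esub>" using rlin_zero[OF cplxD(2,1)[OF cX] k(1)] by simp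
  hence "?e = \<zero>\<^bsub>tm1 X\<^esub>" using bspec[OF k(2) e] by (simp add: czero_def)
  hence "?e 0 = \<zero>\<^bsub>tm1 X\<^esub> 0" by (rule arg_cong)
  thus False using nz by (simp add: X_def dsum_simps reg_simps)
 qed
 hence "Xs \<noteq> []"
  using kzero_cong[OF K_dsum_cplx[OF ring_axioms] cX K_iso_sym[OF cX ttp_cplx[OF D] iso]] kzero_K_dsum_Nil[OF ring_axioms] by auto
 then obtain Y Ys where Ys: "Xs = Y # Ys" by (cases Xs) auto
 have Y: "two_term_proj R Y" using p Ys by simp
 have cYs: "\<And>Z. Z \<in> set Ys ==> cplx R Z" using p Ys by (simp add: ttp_cplx)
 note cY = ttp_cplx[OF Y] and cD = ttp_cplx[OF D]
 have cDs: "cplx R (K_dsum Ys)" by (rule K_dsum_cplx[OF ring_axioms cYs])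
 have "kbip R (K_dsum Xs) Y (K_dsum Ys)" unfolding Ys by (rule kbip_K_dsum[OF ring_axioms cY cYs])
 hence mb: "mbip R (H0 (K_dsum Xs)) (H0 Y) (H0 (K_dsum Ys))" by (rule H0_mbip[OF cD cY cDs])
 obtain F where F: "rlin R (H0 X) (H0 (K_dsum Xs)) F" "bij_betw F (car (H0 X)) (car (H0 (K_dsum Xs)))"
  by (rule H0_iso[OF cX cD iso])
 have tX: "car (t0 X) = {\<lambda>_. undefined}" by (simp add: X_def dsum_simps)
 have uu: "{F (H0_class X (\<lambda>_. undefined))} = car (H0 (K_dsum Xs))"
  using bij_betw_imp_surj_on[OF F(2)] unfolding H0_carrier[OF cX] tX by simp
 obtain u where u: "car (H0 (K_dsum Xs)) = {u}" by (rule that[OF uu[symmetric]])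
 have "\<zero>\<^bsub>H0 (K_dsum Xs)\<^esub> \<in> car (H0 (K_dsum Xs))"
  using H0_is_module[OF cD] by (simp add: right_module_def abelian_group_def abelian_monoid.zero_closed)
 hence z: "x = \<zero>\<^bsub>H0 (K_dsum Xs)\<^esub>" if "x \<in> car (H0 (K_dsum Xs))" for x
  using that unfolding u singleton_iff by simp
 obtain j q where jq: "rlin R (H0 Y) (H0 (K_dsum Xs)) j" "rlin R (H0 (K_dsum Xs)) (H0 Y) q" "\<forall>y\<in>car (H0 Y). q (j y) = y"
  using mbip_left[OF mb] by (elim exE conjE)
 have y0: "y = \<zero>\<^bsub>H0 Y\<^esub>" if y: "y \<in> car (H0 Y)" for y
  using bspec[OF jq(3) y] unfolding z[OF rlin_cl[OF jq(1) y]] rlin_zero[OF H0_is_module[OF cD] H0_is_module[OF cY] jq(2)] ..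
 have "\<zero>\<^bsub>H0 Y\<^esub> \<in> car (H0 Y)"
  using H0_is_module[OF cY] by (simp add: right_module_def abelian_group_def abelian_monoid.zero_closed)
 hence "car (H0 Y) = {\<zero>\<^bsub>H0 Y\<^esub>}" using y0 by blast
 hence "bij_betw (\<lambda>_. \<zero>\<^bsub>H0 Y\<^esub>) (car M) (car (H0 Y))" unfolding True by (simp add: bij_betw_def)
 thus thesis using that[OF _ rlin_const_zero[OF H0_is_module[OF cY]]] Xs Ys by auto
qed

end

section \<open>The quotient algebra\<close>

locale quotient_setting = fd_algebra R + I: ideal J R
 for R :: "(complex, 'a) module" (structure) and J :: "'a set" +
 fixes A :: "(complex, 'a set) module"
 assumes A_eq: "A = quotient_algebra R J"
begin

definition \<rho> :: "'a => 'a set" where "\<rho> x = J +> x"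

lemma A_simps: "car A = car (R Quot J)" "monoid.mult A = monoid.mult (R Quot J)" "one A = one (R Quot J)"
 "ring.zero A = ring.zero (R Quot J)" "ring.add A = ring.add (R Quot J)" "smult A = (\<lambda>c C. \<Union>x\<in>C. J +> (c \<odot> x))"
 by (simp_all add: A_eq quotient_algebra_def)

lemma \<rho>_hom: "\<rho> \<in> Ring.ring_hom R A"
 using I.rcos_ring_hom unfolding Ring.ring_hom_def by (simp add: A_simps \<rho>_def[abs_def])

lemma \<rho>_simps:
 shows \<rho>_closed: "x \<in> car R ==> \<rho> x \<in> car A"
  and \<rho>_mult: "x \<in> car R ==> y \<in> car R ==> \<rho> (x \<otimes> y) = \<rho> x \<otimes>\<^sub>A \<rho> y"
  and \<rho>_add: "x \<in> car R ==> y \<in> car R ==> \<rho> (x \<oplus> y) = \<rho> x \<oplus>\<^sub>A \<rho> y"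
  and \<rho>_one: "\<rho> \<one> = \<one>\<^sub>A"
 using \<rho>_hom unfolding Ring.ring_hom_def by auto

lemma \<rho>_surj: "\<rho> ` car R = car A"
 unfolding A_simps FactRing_def by (auto simp: A_RCOSETS_def' \<rho>_def)

lemma \<rho>_zero: "\<rho> \<zero> = \<zero>\<^sub>A"
 unfolding A_simps \<rho>_def by (simp add: FactRing_def I.a_subset a_coset_add_zero)

lemma \<rho>_eq_iff: "x \<in> car R ==> y \<in> car R ==> \<rho> x = \<rho> y \<longleftrightarrow> x \<ominus> y \<in> J"
 unfolding \<rho>_def using quotient_eq_iff_same_a_r_cos[OF I.ideal_axioms] by simp

text \<open>A complex multiple is a product with the algebra element \<open>sc c\<close>, so a ring
  ideal is automatically a complex subspace. This makes the scalar multiplication on cosets well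
  defined.\<close>

lemma J_scale: "x \<in> J ==> c \<odot> x \<in> J"
 using I.I_l_closed[of x "sc c"] I.a_subset by (auto simp: sc_mult_left)

lemma \<rho>_smult:
 assumes x: "x \<in> car R"
 shows "\<rho> (c \<odot> x) = c \<odot>\<^sub>A \<rho> x"
proof -
 have xc: "x \<in> J +> x" by (rule I.a_rcos_self[OF x])
 have "J +> (c \<odot> y) = J +> (c \<odot> x)" if y: "y \<in> J +> x" for y
 proof -
  have yc: "y \<in> car R" using y I.a_subset x a_r_coset_subset_G by blast
  have "\<rho> y = \<rho> x" using a_repr_independence[OF y x I.a_subgroup] by (simp add: \<rho>_def)
  hence "y \<ominus> x \<in> J" using \<rho>_eq_iff[OF yc x] by simp
  hence "c \<odot> (y \<ominus> x) \<in> J" by (rule J_scale)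
  moreover have "c \<odot> (y \<ominus> x) = c \<odot> y \<ominus> c \<odot> x"
   using x yc by (simp add: sc_mult_left[symmetric] r_minus a_minus_def r_distr)
  moreover have "c \<odot> y \<in> car R" "c \<odot> x \<in> car R" using x yc by (simp_all add: sc_mult_left[symmetric])
  ultimately have "\<rho> (c \<odot> y) = \<rho> (c \<odot> x)" using \<rho>_eq_iff by simp
  thus ?thesis by (simp add: \<rho>_def)
 qed
 hence "(\<Union>y\<in>J +> x. J +> (c \<odot> y)) = J +> (c \<odot> x)" using xc by blast
 thus ?thesis unfolding A_simps \<rho>_def by simp
qed

text \<open>\<open>A\<close> and \<open>R Quot J\<close> have the same ring operations but are
  records of different types, so the axioms are carried over one by one.\<close>

lemma ring_A: "ring A"
proof -
 interpret Q: ring "R Quot J" by (rule I.quotient_is_ring)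
 show ?thesis
 proof (intro ringI abelian_groupI monoidI)
  fix x assume "x \<in> car A"
  thus "\<exists>y\<in>car A. y \<oplus>\<^sub>A x = \<zero>\<^sub>A" unfolding A_simps by (intro bexI[of _ "\<ominus>\<^bsub>R Quot J\<^esub> x"] Q.l_neg Q.a_inv_closed)
 qed (unfold A_simps, (rule Q.a_closed Q.zero_closed Q.a_assoc Q.a_comm Q.l_zero Q.m_closed Q.one_closed Q.m_assoc
    Q.l_one Q.r_one Q.l_distr Q.r_distr; assumption)+)
qed

lemma A_vectorspace: "vectorspace CC A"
proof -
 interpret A: ring A by (rule ring_A)
 have cl: "c \<odot> x \<in> car R" if "x \<in> car R" for c x using that by (simp add: sc_mult_left[symmetric])
 have e: "\<exists>y\<in>car R. x = \<rho> y" if "x \<in> car A" for x using that \<rho>_surj by blast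
 have "Module.module CC A"
 proof (rule Module.moduleI)
  show "cring CC" by (rule domain.axioms(1)[OF field.axioms(1)[OF class_field]])
  show "abelian_group A" by (rule A.abelian_group_axioms)
  fix a x assume "x \<in> car A"
  then obtain y where y: "y \<in> car R" "x = \<rho> y" using e by blast
  show "a \<odot>\<^sub>A x \<in> car A" unfolding y(2) \<rho>_smult[OF y(1), symmetric] by (rule \<rho>_closed[OF cl[OF y(1)]])
  show "\<one>\<^sub>CC \<odot>\<^sub>A x = x" unfolding y(2) \<rho>_smult[OF y(1), symmetric] using cvs.module.smult_one[OF y(1)] by simp
  fix b
  show "(a \<oplus>\<^sub>CC b) \<odot>\<^sub>A x = a \<odot>\<^sub>A x \<oplus>\<^sub>A b \<odot>\<^sub>A x"
   unfolding y(2) \<rho>_smult[OF y(1), symmetric] \<rho>_add[OF cl[OF y(1)] cl[OF y(1)], symmetric]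
   using cvs.module.smult_l_distr[of a b y] y(1) by (simp add: class_ring_simps)
  show "(a \<otimes>\<^sub>CC b) \<odot>\<^sub>A x = a \<odot>\<^sub>A (b \<odot>\<^sub>A x)"
   unfolding y(2) \<rho>_smult[OF y(1), symmetric] \<rho>_smult[OF cl[OF y(1)], symmetric]
   using cvs.module.smult_assoc1[of a b y] y(1) by (simp add: class_ring_simps)
  fix x' assume "x' \<in> car A"
  then obtain y' where y': "y' \<in> car R" "x' = \<rho> y'" using e by blast
  show "a \<odot>\<^sub>A (x \<oplus>\<^sub>A x') = a \<odot>\<^sub>A x \<oplus>\<^sub>A a \<odot>\<^sub>A x'"
   unfolding y(2) y'(2) \<rho>_smult[OF y(1), symmetric] \<rho>_smult[OF y'(1), symmetric] \<rho>_add[OF y(1) y'(1), symmetric]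
    \<rho>_smult[OF a_closed[OF y(1) y'(1)], symmetric] \<rho>_add[OF cl[OF y(1)] cl[OF y'(1)], symmetric]
   by (simp add: cvs.module.smult_r_distr[OF _ y(1) y'(1)] class_ring_simps)
 qed
 thus ?thesis using class_field by (simp add: vectorspace_def)
qed

lemma fd_complex_algebra_A: "fd_complex_algebra A"
proof -
 interpret A: ring A by (rule ring_A)
 interpret A: vectorspace CC A by (rule A_vectorspace)
 have cl: "c \<odot> x \<in> car R" if "x \<in> car R" for c x using that by (simp add: sc_mult_left[symmetric])
 have e: "\<exists>y\<in>car R. x = \<rho> y" if "x \<in> car A" for x using that \<rho>_surj by blast
 interpret r: linear_map CC R A \<rho>
  by (rule linear_mapI[OF cvs.vectorspace_axioms A.vectorspace_axioms]) (simp_all add: \<rho>_closed \<rho>_add \<rho>_smult)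
 show ?thesis
 proof unfold_locales
  fix x y c assume "x \<in> car A" "y \<in> car A"
  then obtain v w where v: "v \<in> car R" "x = \<rho> v" and w: "w \<in> car R" "y = \<rho> w" using e by blast
  show "(c \<odot>\<^sub>A x) \<otimes>\<^sub>A y = c \<odot>\<^sub>A (x \<otimes>\<^sub>A y)"
   unfolding v(2) w(2) \<rho>_smult[OF v(1), symmetric] \<rho>_mult[OF v(1) w(1), symmetric]
    \<rho>_smult[OF m_closed[OF v(1) w(1)], symmetric] \<rho>_mult[OF cl[OF v(1)] w(1), symmetric] smult_mult_left[OF v(1) w(1)] ..
  show "x \<otimes>\<^sub>A (c \<odot>\<^sub>A y) = c \<odot>\<^sub>A (x \<otimes>\<^sub>A y)"
   unfolding v(2) w(2) \<rho>_smult[OF w(1), symmetric] \<rho>_mult[OF v(1) w(1), symmetric]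
    \<rho>_smult[OF m_closed[OF v(1) w(1)], symmetric] \<rho>_mult[OF v(1) cl[OF w(1)], symmetric] smult_mult_right[OF v(1) w(1)] ..
 qed (rule r.surj_dim_le(1)[OF \<rho>_surj finite_dimensional])
qed

end

section \<open>Restriction of scalars and the module P/PJ\<close>

context quotient_setting
begin

sublocale A: fd_algebra A by (rule fd_algebra.intro[OF fd_complex_algebra_A])

text \<open>Restriction of scalars. Only the action changes, so submodules, homomorphisms and the
  underlying complex space of M and \<open>rs M\<close> are literally the same objects.\<close>

definition rs :: "('a set, 'm) module => ('a, 'm) module" where
 "rs M = \<lparr>carrier = car M, monoid.mult = monoid.mult M, one = one M, ring.zero = ring.zero M,
  ring.add = ring.add M, smult = (\<lambda>a x. \<rho> a \<odot>\<^sub>M x)\<rparr>"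

lemma rs_simps [simp]:
 "car (rs M) = car M" "\<zero>\<^bsub>rs M\<^esub> = \<zero>\<^sub>M" "(\<oplus>\<^bsub>rs M\<^esub>) = (\<oplus>\<^bsub>M\<^esub>)" "a \<odot>\<^bsub>rs M\<^esub> x = \<rho> a \<odot>\<^sub>M x"
 by (simp_all add: rs_def)

lemma sc_A: "A.sc c = \<rho> (sc c)"
 unfolding A.sc_def sc_def \<rho>_smult[OF one_closed] \<rho>_one ..

lemma rs_module:
 assumes "right_module A M"
 shows "right_module R (rs M)"
proof -
 interpret M: right_module A M by fact
 show ?thesis by (rule right_moduleI[OF ring_axioms])
   (simp_all add: \<rho>_closed M.act_closed M.M.add.m_ac \<rho>_zero M.zero_act \<rho>_add M.act_add_scalar M.act_add
    \<rho>_mult M.act_act \<rho>_one M.act_one)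
qed

lemma rlin_rs: "rlin R (rs M) (rs N) f \<longleftrightarrow> rlin A M N f"
 unfolding rlin_def \<rho>_surj[symmetric] by simp

lemma right_submodule_rs: "right_submodule R (rs M) N \<longleftrightarrow> right_submodule A M N"
 unfolding right_submodule_def \<rho>_surj[symmetric] by simp

lemma rhom_rs: "rhom R (rs M) (rs N) = rhom A M N" by (simp add: set_eq_iff rhom_iff rlin_rs)

lemma cspace_rs: "cspace R (rs M) = cspace A M"
 using sc_A unfolding cspace_def rs_def A.sc_def sc_def by (simp add: fun_eq_iff)

lemma hom_dim_rs: "hom_dim R (rs M) (rs N) = hom_dim A M N"
proof -
 have "hom_space R (rs M) (rs N) = hom_space A M N"
  using sc_A unfolding hom_space_def rhom_rs A.sc_def sc_def by (simp add: fun_eq_iff)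
 thus ?thesis by (simp add: hom_dim_def)
qed

lemma fd_rs: "fd_right_module A M ==> fd_right_module R (rs M)"
 unfolding fd_right_module_def cspace_rs using rs_module by blast

lemma rs_sub_module: "rs (A.sub_module M N) = sub_module (rs M) N" by (simp add: rs_def)

lemma eloc_rs: "eloc A M ==> eloc R (rs M)" unfolding eloc_def rlin_rs by simp

text \<open>U is a submodule that contains PJ, so that P/U is annihilated by J.\<close>

definition JS :: "('a, 'm) module => 'm set => bool" where
 "JS P U \<longleftrightarrow> right_submodule R P U \<and> (\<forall>p\<in>car P. \<forall>j\<in>J. j \<odot>\<^sub>P p \<in> U)"

text \<open>Characterises Q as P/PJ without constructing it: the kernel of \<open>\<eta>\<close>
  lies in every submodule that contains PJ, and it is itself such a submodule by
  \<open>JS_kernel\<close>. Tensor products, idempotent projectives, sums and cokernels can thus be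
  treated alike.\<close>

definition BC :: "('a, 'm) module => ('a set, 'n) module => ('m => 'n) => bool" where
 "BC P Q \<eta> \<longleftrightarrow> right_module R P \<and> right_module A Q \<and> rlin R P (rs Q) \<eta> \<and> \<eta> ` car P = car Q \<and>
  (\<forall>x\<in>car P. \<eta> x = \<zero>\<^sub>Q \<longrightarrow> (\<forall>U. JS P U \<longrightarrow> x \<in> U))"

lemma BCD:
 assumes "BC P Q \<eta>"
 shows "right_module R P" "right_module A Q" "rlin R P (rs Q) \<eta>" "\<eta> ` car P = car Q"
  "\<And>x U. x \<in> car P ==> \<eta> x = \<zero>\<^sub>Q ==> JS P U ==> x \<in> U"
  "right_module R (rs Q)" using assms rs_module unfolding BC_def by blast+

lemma JS_preimage:
 assumes P: "right_module R P" and P': "right_module R P'" and f: "rlin R P P' f" and U: "JS P' U"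
 shows "JS P {x \<in> car P. f x \<in> U}"
proof -
 interpret P: right_module R P by fact
 have U': "right_submodule R P' U" "\<And>p j. p \<in> car P' ==> j \<in> J ==> j \<odot>\<^sub>P' p \<in> U" using U unfolding JS_def by blast+
 have jc: "j \<in> car R" if "j \<in> J" for j using that I.a_subset by blast
 show ?thesis unfolding JS_def right_submodule_def using U'(1) unfolding right_submodule_def
  by (auto simp: rlin_add[OF f] rlin_act[OF f] rlin_zero[OF P P' f] P.act_closed jc U'(2) rlin_cl[OF f])
qed

lemma J_kills: "right_module A Q ==> j \<in> J ==> x \<in> car Q ==> \<rho> j \<odot>\<^sub>Q x = \<zero>\<^sub>Q"
proof -
 assume Q: "right_module A Q" and j: "j \<in> J" and x: "x \<in> car Q"
 have jc: "j \<in> car R" using j I.a_subset by blast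
 have "\<rho> j = \<rho> \<zero>" unfolding \<rho>_eq_iff[OF jc zero_closed] using j jc by (simp add: a_minus_def)
 thus ?thesis unfolding \<rho>_zero using right_module.zero_act[OF Q x] by simp
qed

lemma JS_kernel:
 assumes P: "right_module R P" and N: "right_module A N" and f: "rlin R P (rs N) f"
 shows "JS P {x \<in> car P. f x = \<zero>\<^sub>N}"
proof -
 interpret N: right_module A N by fact
 have "JS (rs N) {\<zero>\<^sub>N}"
  unfolding JS_def right_submodule_def using N.act_zero \<rho>_closed J_kills[OF N] by simp
 from JS_preimage[OF P rs_module[OF N] f this] show ?thesis by simp
qed

lemma BC_eqD:
 assumes b: "BC P Q \<eta>" and xy: "x \<in> car P" "y \<in> car P" "\<eta> x = \<eta> y" and U: "JS P U"
 shows "x \<oplus>\<^sub>P \<ominus>\<^sub>P y \<in> U"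
proof -
 note d = BCD[OF b]
 interpret P: right_module R P by (rule d)
 interpret Q: right_module R "rs Q" by (rule d)
 have "\<eta> (x \<oplus>\<^sub>P \<ominus>\<^sub>P y) = \<eta> y \<oplus>\<^bsub>rs Q\<^esub> \<ominus>\<^bsub>rs Q\<^esub> \<eta> y"
  unfolding rlin_add[OF d(3) xy(1) P.M.a_inv_closed[OF xy(2)]] rlin_minus[OF d(1,6,3) xy(2)] xy(3) ..
 also have "\<dots> = \<zero>\<^sub>Q" using Q.M.r_neg[OF rlin_cl[OF d(3) xy(2)]] by simp
 finally show ?thesis by (rule d(5)[rotated, OF _ U]) (use xy in simp)
qed

text \<open>The kernel of f contains PJ because J annihilates N, hence it contains the kernel of
  \<open>\<eta>\<close>, and f factors through Q.\<close>

lemma BC_factor: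
 assumes b: "BC P Q \<eta>" and N: "right_module A N" and f: "rlin R P (rs N) f"
 shows "\<exists>g. rlin A Q N g \<and> (\<forall>x\<in>car P. g (\<eta> x) = f x)"
proof -
 note d = BCD[OF b]
 interpret P: right_module R P by (rule d)
 interpret N: right_module R "rs N" by (rule rs_module[OF N])
 have eq: "f x = f y" if xy: "x \<in> car P" "y \<in> car P" "\<eta> x = \<eta> y" for x y
 proof -
  have my: "\<ominus>\<^sub>P y \<in> car P" by (rule P.M.a_inv_closed[OF xy(2)])
  have "f (x \<oplus>\<^sub>P \<ominus>\<^sub>P y) = \<zero>\<^bsub>rs N\<^esub>" using BC_eqD[OF b xy JS_kernel[OF d(1) N f]] by simp
  hence "f x \<oplus>\<^bsub>rs N\<^esub> \<ominus>\<^bsub>rs N\<^esub> f y = \<zero>\<^bsub>rs N\<^esub>"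
   unfolding rlin_add[OF f xy(1) my] rlin_minus[OF d(1) rs_module[OF N] f xy(2)] .
  note z = this and fx = rlin_cl[OF f xy(1)] and fy = rlin_cl[OF f xy(2)]
  have "f x = f x \<oplus>\<^bsub>rs N\<^esub> (\<ominus>\<^bsub>rs N\<^esub> f y \<oplus>\<^bsub>rs N\<^esub> f y)"
   unfolding N.M.l_neg[OF fy] N.M.r_zero[OF fx] ..
  also have "\<dots> = f y"
   unfolding N.M.a_assoc[OF fx N.M.a_inv_closed[OF fy] fy, symmetric] z by (rule N.M.l_zero[OF fy])
  finally show "f x = f y" .
 qed
 have s: "\<eta> ` car P = car (rs Q)" using d(4) by simp
 have "\<exists>g. rlin R (rs Q) (rs N) g \<and> (\<forall>x\<in>car P. g (\<eta> x) = f x)"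
  by (rule rlin_factor[OF d(1) d(3) s f eq], assumption+) (intro exI conjI ballI)
 thus ?thesis unfolding rlin_rs .
qed

lemma BC_map:
 assumes "BC P Q \<eta>" "BC P' Q' \<eta>'" "rlin R P P' f"
 shows "\<exists>g. rlin A Q Q' g \<and> (\<forall>x\<in>car P. g (\<eta> x) = \<eta>' (f x))"
 using BC_factor[OF assms(1) BCD(2)[OF assms(2)] rlin_o[OF BCD(3)[OF assms(2)] assms(3)]] by simp

text \<open>Maps out of Q are compared on the image of \<open>\<eta>\<close>, which is all of
  Q.\<close>

lemma BC_ext:
 assumes b: "BC P Q \<eta>" and "\<And>x. x \<in> car P ==> f (\<eta> x) = g (\<eta> x)" and y: "y \<in> car Q"
 shows "f y = g y"
proof -
 obtain x where "x \<in> car P" "y = \<eta> x" using y unfolding BCD(4)[OF b, symmetric] by blast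
 thus ?thesis using assms(2) by simp
qed

text \<open>The adjunction between extension and restriction of scalars: precomposition with
  \<open>\<eta>\<close> is a linear bijection of Hom spaces.\<close>

lemma BC_hom_dim:
 assumes b: "BC P Q \<eta>" and P: "fd_right_module R P" and N: "fd_right_module A N"
 shows "hom_dim A Q N = hom_dim R P (rs N)"
proof -
 note d = BCD[OF b]
 have N': "fd_right_module R (rs N)" by (rule fd_rs[OF N])
 note n = fdD[OF N']
 let ?T = "\<lambda>f. restrict (f \<circ> \<eta>) (car P)"
 interpret T: linear_map CC "hom_space R (rs Q) (rs N)" "hom_space R P (rs N)" ?T
  by (rule hom_precompose[OF d(1) d(6) n d(3)])
 have "inj_on ?T (rhom R (rs Q) (rs N))"
 proof (rule inj_onI)
  fix f g assume f: "f \<in> rhom R (rs Q) (rs N)" and g: "g \<in> rhom R (rs Q) (rs N)" and e: "?T f = ?T g"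
  show "f = g"
  proof (rule extensionalityI[of _ "car Q"])
   show "f \<in> extensional (car Q)" "g \<in> extensional (car Q)" using f g by (simp_all add: rhom_iff)
   fix y assume y: "y \<in> car Q"
   show "f y = g y"
   proof (rule BC_ext[OF b _ y])
    fix x assume x: "x \<in> car P"
    show "f (\<eta> x) = g (\<eta> x)" using fun_cong[OF e, of x] x by simp
   qed
  qed
 qed
 moreover have "?T ` rhom R (rs Q) (rs N) = rhom R P (rs N)"
 proof
  show "?T ` rhom R (rs Q) (rs N) \<subseteq> rhom R P (rs N)" using T.T_im by (auto simp: hom_space_simps)
  show "rhom R P (rs N) \<subseteq> ?T ` rhom R (rs Q) (rs N)"
  proof
   fix f assume f: "f \<in> rhom R P (rs N)"
   hence fl: "rlin R P (rs N) f" "f \<in> extensional (car P)" by (simp_all add: rhom_iff)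
   obtain g where g: "rlin A Q N g" "\<forall>x\<in>car P. g (\<eta> x) = f x" using BC_factor[OF b A.fdD[OF N] fl(1)] by blast
   have "restrict g (car (rs Q)) \<in> rhom R (rs Q) (rs N)" by (rule rlin_restrict[OF d(6)]) (simp add: rlin_rs g(1))
   moreover have "f = ?T (restrict g (car (rs Q)))"
   proof (rule extensionalityI[OF fl(2)])
    fix x assume x: "x \<in> car P"
    show "f x = ?T (restrict g (car (rs Q))) x" using x bspec[OF g(2) x] rlin_cl[OF d(3) x] by simp
   qed simp
   ultimately show "f \<in> ?T ` rhom R (rs Q) (rs N)" by (rule image_eqI[where f = ?T, rotated])
  qed
 qed
 ultimately have bij: "bij_betw ?T (car (hom_space R (rs Q) (rs N))) (car (hom_space R P (rs N)))"
  by (simp add: bij_betw_def hom_space_simps)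
 have "hom_dim R (rs Q) (rs N) = hom_dim R P (rs N)"
  unfolding hom_dim_def by (rule T.bij_dim(2)[OF bij hom_space_fin_dim[OF P N']])
 thus ?thesis unfolding hom_dim_rs .
qed

lemma BC_cong_left:
 assumes b: "BC P Q \<eta>" and P': "right_module R P'" and f: "rlin R P' P f" "bij_betw f (car P') (car P)"
 shows "BC P' Q (\<eta> \<circ> f)"
proof -
 note d = BCD[OF b]
 obtain g where g: "rlin R P P' g" "\<And>x. x \<in> car P' ==> g (f x) = x" using rlin_inverse[OF P' f] by metis
 show ?thesis unfolding BC_def
 proof (intro conjI ballI impI allI)
  show "rlin R P' (rs Q) (\<eta> \<circ> f)" by (rule rlin_o[OF d(3) f(1)])
  show "(\<eta> \<circ> f) ` car P' = car Q" unfolding image_comp[symmetric] bij_betw_imp_surj_on[OF f(2)] by (rule d)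
  fix x U assume x: "x \<in> car P'" "(\<eta> \<circ> f) x = \<zero>\<^sub>Q" and U: "JS P' U"
  have "f x \<in> {x \<in> car P. g x \<in> U}"
   by (rule d(5)[OF rlin_cl[OF f(1) x(1)] _ JS_preimage[OF d(1) P' g(1) U]]) (use x(2) in simp)
  thus "x \<in> U" using g(2)[OF x(1)] by simp
 qed (rule P' d)+
qed

lemma BC_cong_right:
 assumes b: "BC P Q \<eta>" and Q': "right_module A Q'" and f: "rlin A Q Q' f" "bij_betw f (car Q) (car Q')"
 shows "BC P Q' (f \<circ> \<eta>)"
proof -
 note d = BCD[OF b]
 show ?thesis unfolding BC_def
 proof (intro conjI ballI impI allI)
  show "rlin R P (rs Q') (f \<circ> \<eta>)" by (rule rlin_o[OF _ d(3)]) (simp add: rlin_rs f(1))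
  show "(f \<circ> \<eta>) ` car P = car Q'" unfolding image_comp[symmetric] d(4) by (rule bij_betw_imp_surj_on[OF f(2)])
  fix x U assume x: "x \<in> car P" "(f \<circ> \<eta>) x = \<zero>\<^sub>Q'" and U: "JS P U"
  have z: "\<zero>\<^sub>Q \<in> car Q"
   using d(2) by (simp add: right_module_def abelian_group_def abelian_monoid.zero_closed)
  have "f (\<eta> x) = f \<zero>\<^sub>Q" using x(2) rlin_zero[OF d(2) Q' f(1)] by simp
  hence "\<eta> x = \<zero>\<^sub>Q" by (rule inj_onD[OF bij_betw_imp_inj_on[OF f(2)]]) (use rlin_cl[OF d(3) x(1)] z in simp_all)
  thus "x \<in> U" by (rule d(5)[OF x(1) _ U])
 qed (rule d Q')+
qed

text \<open>A kernel element is the sum of its head and tail components. Each lies in U, because the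
  preimage of U under the inclusion of a summand again contains the J-multiples of that
  summand.\<close>

lemma BC_dsum_Cons:
 fixes Ms :: "('a, 'm) module list" and Ns :: "('a set, 'n) module list"
 assumes b: "BC M N \<eta>" and bs: "BC (rmod_dsum Ms) (rmod_dsum Ns) \<theta>"
  and D: "right_module R (rmod_dsum (M # Ms))" and E: "right_module A (rmod_dsum (N # Ns))"
 shows "BC (rmod_dsum (M # Ms)) (rmod_dsum (N # Ns)) (\<lambda>v. dcons (length Ns) (\<eta> (v 0)) (\<theta> (dtl (length Ms) v)))"
proof -
 note d = BCD[OF b] and ds = BCD[OF bs]
 let ?D = "rmod_dsum (M # Ms)" and ?E = "rmod_dsum (N # Ns)"
 let ?h = "\<lambda>v. dcons (length Ns) (\<eta> (v 0)) (\<theta> (dtl (length Ms) v))"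
 interpret U: right_module R ?D by (rule D)
 have e0: "\<eta> (v 0) \<in> car N" if "v \<in> car ?D" for v using rlin_cl[OF d(3) dhd_closed[OF that]] by simp
 have et: "\<theta> (dtl (length Ms) v) \<in> car (rmod_dsum Ns)" if "v \<in> car ?D" for v
  using rlin_cl[OF ds(3) dtl_closed[OF that]] by simp
 have h: "rlin R ?D (rs ?E) ?h"
 proof (rule rlinI)
  fix v assume v: "v \<in> car ?D"
  show "?h v \<in> car (rs ?E)" using dcons_closed[OF e0[OF v] et[OF v]] by simp
  fix a assume a: "a \<in> car R"
  show "?h (a \<odot>\<^sub>?D v) = a \<odot>\<^bsub>rs ?E\<^esub> ?h v"
   unfolding rs_simps dcons_act rlin_act[OF rlin_dhd a v] rlin_act[OF rlin_dtl a v]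
    rlin_act[OF d(3) a dhd_closed[OF v]] rlin_act[OF ds(3) a dtl_closed[OF v]] ..
 next
  fix v w assume v: "v \<in> car ?D" and w: "w \<in> car ?D"
  show "?h (v \<oplus>\<^sub>?D w) = ?h v \<oplus>\<^bsub>rs ?E\<^esub> ?h w"
   unfolding rs_simps dcons_add rlin_add[OF rlin_dhd v w] rlin_add[OF rlin_dtl v w]
    rlin_add[OF d(3) dhd_closed[OF v] dhd_closed[OF w]] rlin_add[OF ds(3) dtl_closed[OF v] dtl_closed[OF w]] ..
 qed
 show ?thesis unfolding BC_def
 proof (intro conjI ballI impI allI)
  show "?h ` car ?D = car ?E"
  proof
   show "?h ` car ?D \<subseteq> car ?E" using rlin_cl[OF h] by auto
   show "car ?E \<subseteq> ?h ` car ?D"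
   proof
    fix w assume w: "w \<in> car ?E"
    obtain x where x: "x \<in> car M" "w 0 = \<eta> x" using dhd_closed[OF w] unfolding d(4)[symmetric] by blast
    obtain y where y: "y \<in> car (rmod_dsum Ms)" "dtl (length Ns) w = \<theta> y" using dtl_closed[OF w] unfolding ds(4)[symmetric] by blast
    let ?v = "dcons (length Ms) x y"
    have "?h ?v = dcons (length Ns) (w 0) (dtl (length Ns) w)"
     unfolding dcons_0 dtl_dcons[OF rmod_dsum_ext[OF y(1)]] x(2) y(2) ..
    hence "w = ?h ?v" unfolding dcons_hd_tl[OF w] ..
    moreover have "?v \<in> car ?D" by (rule dcons_closed[OF x(1) y(1)])
    ultimately show "w \<in> ?h ` car ?D" by (rule image_eqI)
   qed
  qed
  fix v U assume v: "v \<in> car ?D" and z: "?h v = \<zero>\<^sub>?E" and U: "JS ?D U"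
  have "?h v 0 = \<zero>\<^sub>?E 0" "dtl (length Ns) (?h v) = dtl (length Ns) \<zero>\<^sub>?E" using z by simp_all
  hence z0: "\<eta> (v 0) = \<zero>\<^sub>N" and zt: "\<theta> (dtl (length Ms) v) = \<zero>\<^bsub>rmod_dsum Ns\<^esub>"
   using dtl_dcons[OF rmod_dsum_ext[OF et[OF v]]] dtl_dcons[of "\<zero>\<^bsub>rmod_dsum Ns\<^esub>" "length Ns" "\<zero>\<^sub>N"]
   unfolding dcons_zero[symmetric] by (simp_all add: dsum_simps)
  note bp = dsum_biproduct[OF d(1) ds(1)]
  have 1: "dinl Ms (v 0) \<in> U" using d(5)[OF dhd_closed[OF v] z0 JS_preimage[OF d(1) D bp(1) U]] by simp
  have 2: "dinr M Ms (dtl (length Ms) v) \<in> U" using ds(5)[OF dtl_closed[OF v] zt JS_preimage[OF ds(1) D bp(2) U]] by simp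
  show "v \<in> U" using U 1 2 bp(7)[OF v] unfolding JS_def right_submodule_def by metis
 qed (rule D E h)+
qed

lemma BC_dsum_Nil: "BC (rmod_dsum ([] :: ('a, 'm) module list)) (rmod_dsum ([] :: ('a set, 'n) module list)) (\<lambda>_ _. undefined)"
proof -
 have m: "right_module R (rmod_dsum ([] :: ('a, 'm) module list))" by (rule dsum_module[OF ring_axioms]) simp
 have n: "right_module A (rmod_dsum ([] :: ('a set, 'n) module list))" by (rule dsum_module[OF A.ring_axioms]) simp
 show ?thesis unfolding BC_def
  by (intro conjI m n rlinI) (auto simp: dsum_simps JS_def right_submodule_def restrict_def)
qed

text \<open>If \<open>\<rho> x\<close> is zero then x lies in J, and x = e x is the generator e
  acted on by x, hence an element of (eR)J.\<close>

lemma BC_idem_proj: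
 assumes e: "idempotent_in R e"
 shows "BC (idem_proj R e) (idem_proj A (\<rho> e)) \<rho>"
proof -
 have ec: "e \<in> car R" "e \<otimes> e = e" using e by (auto simp: idempotent_in_def)
 have e': "idempotent_in A (\<rho> e)" using ec unfolding idempotent_in_def by (simp add: \<rho>_closed \<rho>_mult[symmetric])
 note f = idem_proj_facts[OF e] and f' = A.idem_proj_facts[OF e']
 have ops: "(\<oplus>\<^bsub>idem_proj R e\<^esub>) = (\<oplus>)" "a \<odot>\<^bsub>idem_proj R e\<^esub> x = x \<otimes> a"
  "(\<oplus>\<^bsub>idem_proj A (\<rho> e)\<^esub>) = (\<oplus>\<^bsub>A\<^esub>)" "b \<odot>\<^bsub>idem_proj A (\<rho> e)\<^esub> y = y \<otimes>\<^sub>A b" "\<zero>\<^bsub>idem_proj A (\<rho> e)\<^esub> = \<zero>\<^sub>A" for a x b y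
  by (simp_all add: idem_proj_def reg_simps)
 show ?thesis unfolding BC_def
 proof (intro conjI ballI impI allI f(3) f'(3))
  show "rlin R (idem_proj R e) (rs (idem_proj A (\<rho> e))) \<rho>"
   by (rule rlinI) (auto simp: ops f(1) f'(1) \<rho>_closed \<rho>_mult[symmetric] \<rho>_add ec)
  show "\<rho> ` car (idem_proj R e) = car (idem_proj A (\<rho> e))"
  proof
   show "\<rho> ` car (idem_proj R e) \<subseteq> car (idem_proj A (\<rho> e))"
    by (auto simp: f(1) f'(1) \<rho>_closed \<rho>_mult[symmetric] ec)
   show "car (idem_proj A (\<rho> e)) \<subseteq> \<rho> ` car (idem_proj R e)"
   proof
    fix y assume "y \<in> car (idem_proj A (\<rho> e))"
    hence y: "y \<in> car A" "\<rho> e \<otimes>\<^sub>A y = y" unfolding f'(1) by blast+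
    obtain x where x: "x \<in> car R" "y = \<rho> x" using y(1) \<rho>_surj by blast
    have "y = \<rho> (e \<otimes> x)" using y(2) x ec by (simp add: \<rho>_mult)
    moreover have "e \<otimes> x \<in> car (idem_proj R e)" unfolding f(1) using x(1) ec by (simp add: m_assoc[symmetric])
    ultimately show "y \<in> \<rho> ` car (idem_proj R e)" by (rule image_eqI)
   qed
  qed
  fix x U assume "x \<in> car (idem_proj R e)" and z: "\<rho> x = \<zero>\<^bsub>idem_proj A (\<rho> e)\<^esub>" and U: "JS (idem_proj R e) U"
  hence x: "x \<in> car R" "e \<otimes> x = x" unfolding f(1) by blast+
  have "\<rho> x = \<rho> \<zero>" using z unfolding ops \<rho>_zero .
  hence "x \<in> J" unfolding \<rho>_eq_iff[OF x(1) zero_closed] using x(1) by (simp add: a_minus_def)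
  moreover have "e \<in> car (idem_proj R e)" unfolding f(1) using ec by simp
  ultimately have "x \<odot>\<^bsub>idem_proj R e\<^esub> e \<in> U" using U unfolding JS_def by blast
  thus "x \<in> U" unfolding ops x(2) .
 qed
qed

lemma BC_regular: "BC (right_regular R) (right_regular A) \<rho>"
 using BC_idem_proj[of \<one>] unfolding \<rho>_one idem_proj_one A.idem_proj_one by (simp add: idempotent_in_def)

lemma BC_free: "\<exists>\<theta>. BC (free_module R k) (free_module A k) \<theta>"
proof (induction k)
 case 0
 show ?case using BC_dsum_Nil by auto
next
 case (Suc k)
 then obtain \<theta> where t: "BC (free_module R k) (free_module A k) \<theta>" ..
 show ?case
  using BC_dsum_Cons[OF BC_regular t free_module_is_module[of "Suc k", unfolded replicate_Suc]
    A.free_module_is_module[of "Suc k", unfolded replicate_Suc]] unfolding replicate_Suc by blast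
qed

text \<open>The maps that split P off a free module descend to Q and to the free A-module of the
  same rank, and still compose to the identity.\<close>

lemma BC_projective:
 assumes b: "BC P Q \<eta>" and P: "fg_projective R P"
 shows "fg_projective A Q"
proof -
 note d = BCD[OF b]
 obtain k i p where ip: "rlin R P (free_module R k) i" "rlin R (free_module R k) P p" "\<forall>x\<in>car P. p (i x) = x"
  using fg_projectiveE[OF P] by metis
 obtain \<theta> where t: "BC (free_module R k) (free_module A k) \<theta>" using BC_free by blast
 obtain i' where i': "rlin A Q (free_module A k) i'" "\<forall>x\<in>car P. i' (\<eta> x) = \<theta> (i x)" using BC_map[OF b t ip(1)] by blast
 obtain p' where p': "rlin A (free_module A k) Q p'" "\<forall>x\<in>car (free_module R k). p' (\<theta> x) = \<eta> (p x)"
  using BC_map[OF t b ip(2)] by blast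
 show ?thesis
 proof (rule fg_projectiveI[OF d(2) i'(1) p'(1)])
  fix y assume y: "y \<in> car Q"
  have "(\<lambda>y. p' (i' y)) y = id y"
  proof (rule BC_ext[OF b _ y])
   fix x assume x: "x \<in> car P"
   show "p' (i' (\<eta> x)) = id (\<eta> x)"
    unfolding bspec[OF i'(2) x] bspec[OF p'(2) rlin_cl[OF ip(1) x]] bspec[OF ip(3) x] by simp
  qed
  thus "p' (i' y) = y" by simp
 qed
qed

text \<open>An endomorphism of Q lifts to P by projectivity. Nilpotency descends along the
  surjection, and a bijective lift has an inverse that descends as well.\<close>

lemma BC_eloc:
 assumes b: "BC P Q \<eta>" and P: "fg_projective R P" and loc: "eloc R P"
 shows "eloc A Q" unfolding eloc_def
proof (intro allI impI)
 fix u assume u: "rlin A Q Q u"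
 note d = BCD[OF b]
 have s: "\<eta> ` car P = car (rs Q)" using d(4) by simp
 have "rlin R P (rs Q) (u \<circ> \<eta>)" by (rule rlin_o[OF _ d(3)]) (simp add: rlin_rs u)
 from fg_projective_lift[OF P d(1) d(6) d(3) s this]
 obtain v where v: "rlin R P P v" "\<forall>x\<in>car P. \<eta> (v x) = u (\<eta> x)" by auto
 consider n where "\<forall>x\<in>car P. (v ^^ n) x = \<zero>\<^sub>P" | "bij_betw v (car P) (car P)"
  using loc v(1) unfolding eloc_def by blast
 thus "(\<exists>n. \<forall>x\<in>car Q. (u ^^ n) x = \<zero>\<^sub>Q) \<or> bij_betw u (car Q) (car Q)"
 proof cases
  case 1
  have p: "(u ^^ n) (\<eta> x) = \<eta> ((v ^^ n) x) \<and> (v ^^ n) x \<in> car P" if x: "x \<in> car P" for x n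
   using x by (induction n) (simp_all add: v(2) rlin_cl[OF v(1)])
  have "(u ^^ n) y = (\<lambda>_. \<zero>\<^sub>Q) y" if y: "y \<in> car Q" for y
  proof (rule BC_ext[OF b _ y])
   fix x assume x: "x \<in> car P"
   show "(u ^^ n) (\<eta> x) = \<zero>\<^sub>Q" using p[OF x, of n] bspec[OF 1 x] rlin_zero[OF d(1) d(6) d(3)] by simp
  qed
  thus ?thesis by blast
 next
  case 2
  obtain w where w: "rlin R P P w" "\<And>x. x \<in> car P ==> w (v x) = x" "\<And>x. x \<in> car P ==> v (w x) = x"
   using rlin_inverse[OF d(1) v(1) 2] by metis
  obtain W where W: "rlin A Q Q W" "\<forall>x\<in>car P. W (\<eta> x) = \<eta> (w x)" using BC_map[OF b b w(1)] by blast
  have 1: "(\<lambda>y. W (u y)) y = id y" if y: "y \<in> car Q" for y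
  proof (rule BC_ext[OF b _ y])
   fix x assume x: "x \<in> car P"
   show "W (u (\<eta> x)) = id (\<eta> x)"
    unfolding bspec[OF v(2) x, symmetric] bspec[OF W(2) rlin_cl[OF v(1) x]] w(2)[OF x] by simp
  qed
  have 2: "(\<lambda>y. u (W y)) y = id y" if y: "y \<in> car Q" for y
  proof (rule BC_ext[OF b _ y])
   fix x assume x: "x \<in> car P"
   show "u (W (\<eta> x)) = id (\<eta> x)"
    unfolding bspec[OF W(2) x] bspec[OF v(2) rlin_cl[OF w(1) x], symmetric] w(3)[OF x] by simp
  qed
  have "bij_betw u (car Q) (car Q)"
   by (rule bij_betwI[of _ _ _ W]) (use rlin_cl[OF u] rlin_cl[OF W(1)] 1 2 in auto)
  thus ?thesis ..
 qed
qed

end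

section \<open>The tensor product with A as an instance of P/PJ\<close>

context quotient_setting
begin

abbreviation TK :: "('a, 'm) module => ('m \<times> 'a set \<Rightarrow>\<^sub>0 int) set" where
 "TK P \<equiv> tensor_kernel R A \<rho> P"

abbreviation bc :: "('a, 'm) module => ('a set, ('m \<times> 'a set \<Rightarrow>\<^sub>0 int) set) module" where
 "bc P \<equiv> base_change R A \<rho> P"

definition tcl :: "('a, 'm) module => ('m \<times> 'a set \<Rightarrow>\<^sub>0 int) => ('m \<times> 'a set \<Rightarrow>\<^sub>0 int) set" where
 "tcl P c = TK P +>\<^bsub>tensor_free P A\<^esub> c"

text \<open>The unit of the adjunction, x to x tensor 1.\<close>

definition eta :: "('a, 'm) module => 'm => ('m \<times> 'a set \<Rightarrow>\<^sub>0 int) set" where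
 "eta P x = tcl P (frag_of (x, \<one>\<^sub>A))"

lemma tcl_eq: "tcl P c = (\<lambda>k. k + c) ` TK P"
 unfolding tcl_def a_r_coset_def' by (auto simp: tensor_free_def)

lemma tensor_relations_cases:
 assumes "r \<in> tensor_relations R A \<rho> P"
 obtains (add) x y s where "r = frag_of (x \<oplus>\<^sub>P y, s) - frag_of (x, s) - frag_of (y, s)" "x \<in> car P" "y \<in> car P" "s \<in> car A"
  | (scalar) x s t where "r = frag_of (x, s \<oplus>\<^sub>A t) - frag_of (x, s) - frag_of (x, t)" "x \<in> car P" "s \<in> car A" "t \<in> car A"
  | (act) x a s where "r = frag_of (a \<odot>\<^sub>P x, s) - frag_of (x, \<rho> a \<otimes>\<^sub>A s)" "x \<in> car P" "a \<in> car R" "s \<in> car A"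
 using assms unfolding tensor_relations_def by blast

lemma tensor_relationsI:
 "x \<in> car P ==> y \<in> car P ==> s \<in> car A ==>
  frag_of (x \<oplus>\<^sub>P y, s) - frag_of (x, s) - frag_of (y, s) \<in> tensor_relations R A \<rho> P"
 "x \<in> car P ==> s \<in> car A ==> t \<in> car A ==>
  frag_of (x, s \<oplus>\<^sub>A t) - frag_of (x, s) - frag_of (x, t) \<in> tensor_relations R A \<rho> P"
 "x \<in> car P ==> a \<in> car R ==> s \<in> car A ==>
  frag_of (a \<odot>\<^sub>P x, s) - frag_of (x, \<rho> a \<otimes>\<^sub>A s) \<in> tensor_relations R A \<rho> P"
 unfolding tensor_relations_def by blast+

lemma tensor_relations_closed:
 assumes P: "right_module R P"
 shows "tensor_relations R A \<rho> P \<subseteq> car (free_Abelian_group (car P \<times> car A))"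
proof -
 interpret P: right_module R P by fact
 have d: "Poly_Mapping.keys (a - b) \<subseteq> S" if "Poly_Mapping.keys a \<subseteq> S" "Poly_Mapping.keys b \<subseteq> S"
  for a b :: "'m \<times> 'a set \<Rightarrow>\<^sub>0 int" and S
  using keys_diff[of a b] that by blast
 have f: "Poly_Mapping.keys (frag_of p) \<subseteq> S" if "p \<in> S" for p :: "'m \<times> 'a set" and S using that by simp
 show ?thesis
 proof
  fix r assume "r \<in> tensor_relations R A \<rho> P"
  hence "Poly_Mapping.keys r \<subseteq> car P \<times> car A"
   by (cases rule: tensor_relations_cases; simp only:; intro d f SigmaI, simp_all add: P.act_closed \<rho>_closed)
  thus "r \<in> car (free_Abelian_group (car P \<times> car A))" by simp
 qed
qed

lemma TK_facts:
 assumes P: "right_module R P"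
 shows TK_closed: "TK P \<subseteq> car (free_Abelian_group (car P \<times> car A))"
  and TK_subgroup: "subgroup (TK P) (free_Abelian_group (car P \<times> car A))"
  and TK_zero: "0 \<in> TK P"
  and TK_add: "a \<in> TK P ==> b \<in> TK P ==> a + b \<in> TK P"
  and TK_minus: "a \<in> TK P ==> - a \<in> TK P"
  and TK_diff: "a \<in> TK P ==> b \<in> TK P ==> a - b \<in> TK P"
  and TK_rel: "r \<in> tensor_relations R A \<rho> P ==> r \<in> TK P"
proof -
 let ?F = "free_Abelian_group (car P \<times> car A)"
 show s: "subgroup (TK P) ?F"
  unfolding tensor_kernel_def by (rule group.generate_is_subgroup[OF group_free_Abelian_group tensor_relations_closed[OF P]])
 show c: "TK P \<subseteq> car ?F" by (rule subgroup.subset[OF s])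
 show "0 \<in> TK P" using subgroup.one_closed[OF s] by simp
 show ad: "a + b \<in> TK P" if "a \<in> TK P" "b \<in> TK P" for a b using subgroup.m_closed[OF s that] by simp
 show mi: "- a \<in> TK P" if "a \<in> TK P" for a
 proof -
  have "Poly_Mapping.keys a \<subseteq> car P \<times> car A" using subsetD[OF c that] by simp
  from inv_free_Abelian_group[OF this] show ?thesis using subgroup.m_inv_closed[OF s that] by simp
 qed
 show "a - b \<in> TK P" if "a \<in> TK P" "b \<in> TK P" for a b using ad[OF that(1) mi[OF that(2)]] by simp
 show "r \<in> TK P" if "r \<in> tensor_relations R A \<rho> P"
  unfolding tensor_kernel_def by (rule generate.incl[OF that])
qed

lemma tcl_eq_iff:
 assumes P: "right_module R P"
 shows "tcl P c = tcl P d \<longleftrightarrow> c - d \<in> TK P"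
proof
 assume e: "tcl P c = tcl P d"
 have "0 + c \<in> tcl P c" unfolding tcl_eq by (rule imageI[OF TK_zero[OF P]])
 then obtain k where k: "k \<in> TK P" "c = k + d" unfolding e unfolding tcl_eq by auto
 thus "c - d \<in> TK P" by simp
next
 assume cd: "c - d \<in> TK P"
 show "tcl P c = tcl P d"
 proof (intro equalityI subsetI)
  fix u assume "u \<in> tcl P c"
  then obtain k where k: "k \<in> TK P" "u = k + c" unfolding tcl_eq by auto
  have "u = (k + (c - d)) + d" using k(2) by simp
  thus "u \<in> tcl P d" unfolding tcl_eq by (rule image_eqI) (rule TK_add[OF P k(1) cd])
 next
  fix u assume "u \<in> tcl P d"
  then obtain k where k: "k \<in> TK P" "u = k + d" unfolding tcl_eq by auto
  have "u = (k - (c - d)) + c" using k(2) by simp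
  thus "u \<in> tcl P c" unfolding tcl_eq by (rule image_eqI) (rule TK_diff[OF P k(1) cd])
 qed
qed

text \<open>Serves two purposes: with f the identity and t a right multiplication it makes the
  A-action on the tensor product well defined, and with t the identity it makes tensoring
  functorial.\<close>

lemma tensor_map_TK:
 assumes P: "right_module R P" and P': "right_module R P'" and f: "rlin R P P' f"
  and t: "\<And>s. s \<in> car A ==> t s \<in> car A" "\<And>s s'. s \<in> car A ==> s' \<in> car A ==> t (s \<oplus>\<^sub>A s') = t s \<oplus>\<^sub>A t s'"
   "\<And>r s. r \<in> car A ==> s \<in> car A ==> t (r \<otimes>\<^sub>A s) = r \<otimes>\<^sub>A t s"
  and k: "k \<in> TK P"
 shows "frag_extend (\<lambda>(m, s). frag_of (f m, t s)) k \<in> TK P'"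
proof -
 let ?E = "frag_extend (\<lambda>(m, s). frag_of (f m, t s))"
 let ?F = "free_Abelian_group (car P \<times> car A)"
 let ?H = "{k \<in> car ?F. ?E k \<in> TK P'}"
 have "subgroup ?H ?F"
 proof (rule group.subgroupI[OF group_free_Abelian_group])
  show "?H \<noteq> {}" using TK_zero[OF P'] by (auto intro!: exI[of _ 0])
  fix a assume a: "a \<in> ?H"
  thus "inv\<^bsub>?F\<^esub> a \<in> ?H" using TK_minus[OF P'] by (auto simp: frag_extend_minus)
  fix b assume b: "b \<in> ?H"
  show "a \<otimes>\<^sub>?F b \<in> ?H" using a b TK_add[OF P'] keys_add[of a b] by (auto simp: frag_extend_add)
 qed blast
 moreover have "tensor_relations R A \<rho> P \<subseteq> ?H"
 proof
  fix r assume r: "r \<in> tensor_relations R A \<rho> P"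
  have "?E r \<in> tensor_relations R A \<rho> P'" using r
  proof (cases rule: tensor_relations_cases)
   case (add x y s)
   thus ?thesis
    using tensor_relationsI(1)[of "f x" P' "f y" "t s"] t(1) by (simp add: frag_extend_diff rlin_add[OF f] rlin_cl[OF f])
  next
   case (scalar x s s')
   thus ?thesis
    using tensor_relationsI(2)[of "f x" P' "t s" "t s'"] t(1) by (simp add: frag_extend_diff t(2) rlin_cl[OF f])
  next
   case (act x a s)
   thus ?thesis using tensor_relationsI(3)[of "f x" P' a "t s"] t(1)
    by (simp add: frag_extend_diff t(3) \<rho>_closed rlin_act[OF f] rlin_cl[OF f])
  qed
  thus "r \<in> ?H" using TK_rel[OF P'] tensor_relations_closed[OF P] r by blast
 qed
 ultimately have "TK P \<subseteq> ?H" unfolding tensor_kernel_def by (intro group.generate_subgroup_incl[OF group_free_Abelian_group])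
 thus ?thesis using k by blast
qed

lemma eta_add:
 assumes P: "right_module R P" and x: "x \<in> car P" and y: "y \<in> car P"
 shows "eta P (x \<oplus>\<^sub>P y) = tcl P (frag_of (x, \<one>\<^sub>A) + frag_of (y, \<one>\<^sub>A))"
proof -
 show ?thesis using TK_rel[OF P tensor_relationsI(1)[OF x y A.one_closed]] unfolding eta_def tcl_eq_iff[OF P] by (simp add: algebra_simps)
qed

lemma eta_act:
 assumes P: "right_module R P" and x: "x \<in> car P" and r: "r \<in> car R"
 shows "tcl P (frag_of (x, \<rho> r)) = eta P (r \<odot>\<^sub>P x)"
proof -
 have "eta P (r \<odot>\<^sub>P x) = tcl P (frag_of (x, \<rho> r))"
  using TK_rel[OF P tensor_relationsI(3)[OF x r A.one_closed]] unfolding eta_def tcl_eq_iff[OF P] by (simp add: \<rho>_closed r)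
 thus ?thesis ..
qed

lemma eta_zero:
 assumes P: "right_module R P"
 shows "eta P \<zero>\<^sub>P = tcl P 0"
proof -
 interpret P: right_module R P by fact
 from eta_add[OF P P.M.zero_closed P.M.zero_closed]
 have "eta P \<zero>\<^sub>P = tcl P (frag_of (\<zero>\<^sub>P, \<one>\<^sub>A) + frag_of (\<zero>\<^sub>P, \<one>\<^sub>A))" by simp
 hence "- frag_of (\<zero>\<^sub>P, \<one>\<^sub>A) \<in> TK P" unfolding eta_def tcl_eq_iff[OF P] by simp
 from TK_minus[OF P this] show ?thesis unfolding eta_def tcl_eq_iff[OF P] by simp
qed

lemma eta_minus:
 assumes P: "right_module R P" and x: "x \<in> car P" and y: "y \<in> car P"
  and c: "tcl P c = eta P x" and d: "tcl P d = eta P y"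
 shows "tcl P (c - d) = eta P (x \<ominus>\<^sub>P y)"
proof -
 interpret P: right_module R P by fact
 have "tcl P (frag_of (x \<ominus>\<^sub>P y, \<one>\<^sub>A) + frag_of (y, \<one>\<^sub>A)) = eta P ((x \<ominus>\<^sub>P y) \<oplus>\<^sub>P y)"
  by (rule eta_add[OF P, symmetric]) (simp_all add: x y)
 moreover have "(x \<ominus>\<^sub>P y) \<oplus>\<^sub>P y = x" using x y by (simp add: a_minus_def P.M.a_assoc P.M.l_neg)
 ultimately have 1: "frag_of (x \<ominus>\<^sub>P y, \<one>\<^sub>A) + frag_of (y, \<one>\<^sub>A) - frag_of (x, \<one>\<^sub>A) \<in> TK P"
  unfolding eta_def by (simp add: tcl_eq_iff[OF P])
 have 2: "c - frag_of (x, \<one>\<^sub>A) \<in> TK P" "d - frag_of (y, \<one>\<^sub>A) \<in> TK P" using c d unfolding eta_def tcl_eq_iff[OF P] by simp_all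
 have "c - d - frag_of (x \<ominus>\<^sub>P y, \<one>\<^sub>A) = (c - frag_of (x, \<one>\<^sub>A)) - (d - frag_of (y, \<one>\<^sub>A))
  - (frag_of (x \<ominus>\<^sub>P y, \<one>\<^sub>A) + frag_of (y, \<one>\<^sub>A) - frag_of (x, \<one>\<^sub>A))" by simp
 thus ?thesis unfolding eta_def tcl_eq_iff[OF P] using TK_diff[OF P TK_diff[OF P 2] 1] by simp
qed

text \<open>A generator x tensor \<open>\<rho> r\<close> equals xr tensor 1, and differences of
  elements in the image of \<open>eta P\<close> stay there.\<close>

lemma eta_surj:
 assumes P: "right_module R P" and c: "Poly_Mapping.keys c \<subseteq> car P \<times> car A"
 shows "\<exists>x\<in>car P. tcl P c = eta P x" using c
proof (induction c rule: frag_induction)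
 case zero
 interpret P: right_module R P by fact
 show ?case using eta_zero[OF P] P.M.zero_closed by metis
next
 case (one p)
 interpret P: right_module R P by fact
 obtain x s where p: "p = (x, s)" "x \<in> car P" "s \<in> car A" using one by auto
 obtain r where r: "r \<in> car R" "s = \<rho> r" using p(3) \<rho>_surj by blast
 show ?case unfolding p(1) r(2) eta_act[OF P p(2) r(1)] using P.act_closed[OF r(1) p(2)] by blast
next
 case (diff a b)
 interpret P: right_module R P by fact
 show ?case using diff eta_minus[OF P] P.M.minus_closed by metis
qed

lemma bc_simps:
 shows bc_carrier: "car (bc P) = tcl P ` {c. Poly_Mapping.keys c \<subseteq> car P \<times> car A}"
  and bc_zero: "\<zero>\<^bsub>bc P\<^esub> = TK P"
  and bc_add: "X \<oplus>\<^bsub>bc P\<^esub> Y = (\<Union>h\<in>X. \<Union>k\<in>Y. {h + k})"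
  and bc_act: "a \<odot>\<^bsub>bc P\<^esub> X = (\<Union>c\<in>X. tcl P (frag_extend (\<lambda>(m, s). frag_of (m, s \<otimes>\<^sub>A a)) c))"
proof -
 show "car (bc P) = tcl P ` {c. Poly_Mapping.keys c \<subseteq> car P \<times> car A}"
  unfolding base_change_def quotient_module_simps A_RCOSETS_def' tcl_def by (auto simp: tensor_free_def)
 show "\<zero>\<^bsub>bc P\<^esub> = TK P" unfolding base_change_def quotient_module_simps ..
 show "X \<oplus>\<^bsub>bc P\<^esub> Y = (\<Union>h\<in>X. \<Union>k\<in>Y. {h + k})"
  unfolding base_change_def quotient_module_simps set_add_def' by (simp add: tensor_free_def)
 show "a \<odot>\<^bsub>bc P\<^esub> X = (\<Union>c\<in>X. tcl P (frag_extend (\<lambda>(m, s). frag_of (m, s \<otimes>\<^sub>A a)) c))"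
  unfolding base_change_def quotient_module_def tcl_def by (simp add: tensor_free_def)
qed

text \<open>\<open>base_change\<close> and \<open>base_change_map\<close> define operations by
  unions over representatives; the union is a single class once the relations are preserved.\<close>

lemma tcl_const:
 assumes P: "right_module R P" and P': "right_module R P'"
  and E: "\<And>k. k \<in> TK P ==> frag_extend g k \<in> TK P'"
 shows "(\<Union>c\<in>tcl P d. tcl P' (frag_extend g c)) = tcl P' (frag_extend g d)"
proof -
 have "tcl P' (frag_extend g c) = tcl P' (frag_extend g d)" if c: "c \<in> tcl P d" for c
 proof -
  obtain k where "k \<in> TK P" "c = k + d" using c unfolding tcl_eq by blast
  thus ?thesis unfolding tcl_eq_iff[OF P'] using E by (simp add: frag_extend_add)
 qed
 moreover have "0 + d \<in> tcl P d" unfolding tcl_eq by (rule imageI[OF TK_zero[OF P]])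
 ultimately show ?thesis by blast
qed

text \<open>To bound the kernel of \<open>eta P\<close> by a submodule U that contains PJ, test
  against P/U: sending (y, \<open>\<rho> r\<close>) to the class of yr is well defined and kills all
  tensor relations, so x tensor 1 being zero forces x into U.\<close>

lemma base_change_BC:
 assumes P: "right_module R P"
 shows "BC P (bc P) (eta P)"
proof -
 interpret P: right_module R P by fact
 have im: "eta P ` car P = car (bc P)"
 proof
  show "eta P ` car P \<subseteq> car (bc P)" unfolding bc_carrier eta_def by auto
  show "car (bc P) \<subseteq> eta P ` car P" unfolding bc_carrier using eta_surj[OF P] by blast
 qed
 have zero: "\<zero>\<^bsub>bc P\<^esub> = eta P \<zero>\<^sub>P" unfolding bc_zero eta_zero[OF P] tcl_eq by simp
 have add: "eta P (x \<oplus>\<^sub>P y) = eta P x \<oplus>\<^bsub>bc P\<^esub> eta P y" if x: "x \<in> car P" and y: "y \<in> car P" for x y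
 proof -
  let ?x = "frag_of (x, \<one>\<^sub>A)" and ?y = "frag_of (y, \<one>\<^sub>A)"
  have "(\<Union>h\<in>tcl P ?x. \<Union>k\<in>tcl P ?y. {h + k}) = tcl P (?x + ?y)"
  proof (intro equalityI subsetI)
   fix u assume "u \<in> (\<Union>h\<in>tcl P ?x. \<Union>k\<in>tcl P ?y. {h + k})"
   then obtain h k where hk: "h \<in> TK P" "k \<in> TK P" "u = (h + ?x) + (k + ?y)" unfolding tcl_eq by blast
   have "u = (h + k) + (?x + ?y)" unfolding hk(3) by (simp add: algebra_simps)
   thus "u \<in> tcl P (?x + ?y)" unfolding tcl_eq by (rule image_eqI) (rule TK_add[OF P hk(1,2)])
  next
   fix u assume "u \<in> tcl P (?x + ?y)"
   then obtain h where h: "h \<in> TK P" "u = h + (?x + ?y)" unfolding tcl_eq by blast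
   have "u = (h + ?x) + (0 + ?y)" unfolding h(2) by (simp add: algebra_simps)
   moreover have "h + ?x \<in> tcl P ?x" "0 + ?y \<in> tcl P ?y" unfolding tcl_eq by (rule imageI, rule h TK_zero[OF P])+
   ultimately show "u \<in> (\<Union>h\<in>tcl P ?x. \<Union>k\<in>tcl P ?y. {h + k})" by blast
  qed
  thus ?thesis unfolding eta_add[OF P x y] bc_add unfolding eta_def by (rule sym)
 qed
 have act: "eta P (r \<odot>\<^sub>P x) = \<rho> r \<odot>\<^bsub>bc P\<^esub> eta P x" if r: "r \<in> car R" and x: "x \<in> car P" for r x
 proof -
  have "\<rho> r \<odot>\<^bsub>bc P\<^esub> eta P x = tcl P (frag_extend (\<lambda>(m, s). frag_of (m, s \<otimes>\<^sub>A \<rho> r)) (frag_of (x, \<one>\<^sub>A)))"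
   unfolding bc_act eta_def
  proof (rule tcl_const[OF P P])
   fix k assume k: "k \<in> TK P"
   show "frag_extend (\<lambda>(m, s). frag_of (m, s \<otimes>\<^sub>A \<rho> r)) k \<in> TK P"
    using tensor_map_TK[OF P P rlin_id, of "\<lambda>s. s \<otimes>\<^sub>A \<rho> r", OF _ _ _ k] \<rho>_closed[OF r]
    by (simp add: A.l_distr A.m_assoc)
  qed
  also have "\<dots> = tcl P (frag_of (x, \<rho> r))" by (simp add: \<rho>_closed[OF r])
  also have "\<dots> = eta P (r \<odot>\<^sub>P x)" by (rule eta_act[OF P x r])
  finally show ?thesis ..
 qed
 have Q: "right_module A (bc P)"
  by (rule right_module_image[OF P A.ring_axioms \<rho>_hom \<rho>_surj im zero add act])
 have l: "rlin R P (rs (bc P)) (eta P)" by (rule rlinI) (use im add act in auto)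
 show ?thesis unfolding BC_def
 proof (intro conjI ballI impI allI P Q l im)
  fix x U assume x: "x \<in> car P" and z: "eta P x = \<zero>\<^bsub>bc P\<^esub>" and U: "JS P U"
  have U': "right_submodule R P U" "\<And>p j. p \<in> car P ==> j \<in> J ==> j \<odot>\<^sub>P p \<in> U" using U unfolding JS_def by blast+
  let ?G = "quotient_module P U" and ?q = "\<lambda>x. U +>\<^bsub>P\<^esub> x"
  note q = quotient_module_facts[OF P U'(1)]
  interpret G: right_module R ?G by (rule q(4))
  \<comment> \<open>Picks a preimage of s in the big algebra. Another choice changes the value of f
    by an element of PJ, which vanishes modulo U.\<close>
  define sel where "sel s = (SOME r. r \<in> car R \<and> \<rho> r = s)" for s
  have sel: "sel s \<in> car R" "\<rho> (sel s) = s" if "s \<in> car A" for s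
  proof -
   have "\<exists>r. r \<in> car R \<and> \<rho> r = s" using that unfolding \<rho>_surj[symmetric] by blast
   hence "sel s \<in> car R \<and> \<rho> (sel s) = s" unfolding sel_def by (rule someI_ex)
   thus "sel s \<in> car R" "\<rho> (sel s) = s" by blast+
  qed
  define f where "f p = ?q (sel (snd p) \<odot>\<^sub>P fst p)" for p
  have qc: "?q y \<in> car ?G" if "y \<in> car P" for y using rlin_cl[OF q(2) that] .
  have f: "f (y, \<rho> r) = ?q (r \<odot>\<^sub>P y)" if y: "y \<in> car P" and r: "r \<in> car R" for y r
  proof -
   note s = sel[OF \<rho>_closed[OF r]]
   have c: "sel (\<rho> r) \<odot>\<^sub>P y \<in> car P" "r \<odot>\<^sub>P y \<in> car P" using P.act_closed s(1) r y by blast+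
   have j: "sel (\<rho> r) \<ominus> r \<in> J" using s \<rho>_eq_iff[OF s(1) r] by simp
   have "sel (\<rho> r) \<odot>\<^sub>P y = ((sel (\<rho> r) \<ominus> r) \<oplus> r) \<odot>\<^sub>P y" using s(1) r by (simp add: a_minus_def a_assoc l_neg)
   also have "\<dots> = (sel (\<rho> r) \<ominus> r) \<odot>\<^sub>P y \<oplus>\<^sub>P r \<odot>\<^sub>P y" by (rule P.act_add_scalar) (use s(1) r y in simp_all)
   finally have e: "sel (\<rho> r) \<odot>\<^sub>P y = (sel (\<rho> r) \<ominus> r) \<odot>\<^sub>P y \<oplus>\<^sub>P r \<odot>\<^sub>P y" .
   have jy: "(sel (\<rho> r) \<ominus> r) \<odot>\<^sub>P y \<in> car P" by (rule P.act_closed) (use s(1) r y in simp_all)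
   have "sel (\<rho> r) \<odot>\<^sub>P y \<ominus>\<^sub>P r \<odot>\<^sub>P y = (sel (\<rho> r) \<ominus> r) \<odot>\<^sub>P y"
    unfolding e a_minus_def[of P] using P.M.a_assoc[OF jy c(2) P.M.a_inv_closed[OF c(2)]] jy c(2) by (simp add: P.M.r_neg)
   hence "?q (sel (\<rho> r) \<odot>\<^sub>P y) = ?q (r \<odot>\<^sub>P y)" using q(5)[OF c] U'(2)[OF y j] by simp
   thus ?thesis by (simp add: f_def)
  qed
  have fc: "f ` (car P \<times> car A) \<subseteq> car (add_monoid ?G)"
   using qc P.act_closed sel(1) by (auto simp: f_def)
  have "\<exists>h. h \<in> hom (free_Abelian_group (car P \<times> car A)) (add_monoid ?G) \<and> (\<forall>p\<in>car P \<times> car A. h (frag_of p) = f p)"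
   using comm_group.free_Abelian_group_universal[OF G.M.a_comm_group fc, of "\<exists>h. h \<in> hom (free_Abelian_group (car P \<times> car A)) (add_monoid ?G) \<and> (\<forall>p\<in>car P \<times> car A. h (frag_of p) = f p)"]
   by blast
  then obtain h where h1: "h \<in> hom (free_Abelian_group (car P \<times> car A)) (add_monoid ?G)"
   and h2: "\<forall>p\<in>car P \<times> car A. h (frag_of p) = f p" by (elim exE conjE)
  note h = h1 bspec[OF h2]
  let ?F = "free_Abelian_group (car P \<times> car A)"
  interpret h: group_hom ?F "add_monoid ?G" h
   by (intro group_hom.intro group_free_Abelian_group group_hom_axioms.intro h(1)) (rule comm_group.axioms(2)[OF G.M.a_comm_group])
  have hadd: "h (a + b) = h a \<oplus>\<^sub>?G h b" if "a \<in> car ?F" "b \<in> car ?F" for a b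
   using h.hom_mult[OF that] by simp
  have hc: "h a \<in> car ?G" if "a \<in> car ?F" for a using h.hom_closed[OF that] by simp
  \<comment> \<open>Every relation is a single generator minus a sum w of generators. Comparing h on
    d + w with h on w avoids evaluating h on differences.\<close>
  have hz: "h d = \<zero>\<^sub>?G" if d: "d \<in> car ?F" and w: "w \<in> car ?F" and e: "h (d + w) = h w" for d w
   using e hadd[OF d w] G.M.add.r_cancel_one[OF hc[OF w] hc[OF d]] by simp
  have fp: "frag_of (y, s) \<in> car ?F" if "y \<in> car P" "s \<in> car A" for y s using that by simp
  have "tensor_relations R A \<rho> P \<subseteq> kernel ?F (add_monoid ?G) h"
  proof
   fix r assume r: "r \<in> tensor_relations R A \<rho> P"
   hence rc: "r \<in> car ?F" using tensor_relations_closed[OF P] by blast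
   have "h r = \<zero>\<^sub>?G" using r
   proof (cases rule: tensor_relations_cases)
    case (add u v s)
    note e = add(1) and m = add(2-4)
    obtain a where a: "a \<in> car R" "s = \<rho> a" using m(3) unfolding \<rho>_surj[symmetric] by blast
    let ?w = "frag_of (u, s) + frag_of (v, s)"
    have w: "h ?w = ?q (a \<odot>\<^sub>P u) \<oplus>\<^sub>?G ?q (a \<odot>\<^sub>P v)"
     using hadd[OF fp fp] h(2) m f[OF _ a(1)] a(2) by simp
    have rw: "r + ?w = frag_of (u \<oplus>\<^sub>P v, s)" unfolding e by simp
    have "h (r + ?w) = ?q (a \<odot>\<^sub>P (u \<oplus>\<^sub>P v))" unfolding rw using h(2) m f[OF _ a(1)] a(2) by simp
    also have "\<dots> = h ?w" unfolding w P.act_add[OF a(1) m(1,2)] by (rule rlin_add[OF q(2)]) (use P.act_closed a m in blast)+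
    finally show ?thesis by (rule hz[OF rc, rotated]) (use m keys_add[of "frag_of (u, s)" "frag_of (v, s)"] in auto)
   next
    case (scalar u s s')
    note e = scalar(1) and m = scalar(2-4)
    obtain a where a: "a \<in> car R" "s = \<rho> a" using m(2) unfolding \<rho>_surj[symmetric] by blast
    obtain a' where a': "a' \<in> car R" "s' = \<rho> a'" using m(3) unfolding \<rho>_surj[symmetric] by blast
    let ?w = "frag_of (u, s) + frag_of (u, s')"
    have w: "h ?w = ?q (a \<odot>\<^sub>P u) \<oplus>\<^sub>?G ?q (a' \<odot>\<^sub>P u)"
     using hadd[OF fp fp] h(2) m f[OF m(1) a(1)] f[OF m(1) a'(1)] a(2) a'(2) by simp
    have rw: "r + ?w = frag_of (u, \<rho> (a \<oplus> a'))" unfolding e a(2) a'(2) \<rho>_add[OF a(1) a'(1)] by simp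
    have "h (r + ?w) = ?q ((a \<oplus> a') \<odot>\<^sub>P u)" unfolding rw using h(2) m(1) f[OF m(1)] a(1) a'(1) by (simp add: \<rho>_closed)
    also have "\<dots> = h ?w" unfolding w P.act_add_scalar[OF a(1) a'(1) m(1)] by (rule rlin_add[OF q(2)]) (use P.act_closed a a' m in blast)+
    finally show ?thesis by (rule hz[OF rc, rotated]) (use m keys_add[of "frag_of (u, s)" "frag_of (u, s')"] in auto)
   next
    case (act u b s)
    note e = act(1) and m = act(2-4)
    obtain a where a: "a \<in> car R" "s = \<rho> a" using m(3) unfolding \<rho>_surj[symmetric] by blast
    let ?w = "frag_of (u, \<rho> (b \<otimes> a))"
    have e': "r + ?w = frag_of (b \<odot>\<^sub>P u, \<rho> a)" unfolding e a(2) \<rho>_mult[OF m(2) a(1)] by simp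
    have wc: "?w \<in> car ?F" using m a by (simp add: \<rho>_closed)
    have "h (r + ?w) = ?q (a \<odot>\<^sub>P (b \<odot>\<^sub>P u))"
     unfolding e' using h(2) f[OF P.act_closed[OF m(2,1)] a(1)] P.act_closed[OF m(2,1)] a(1) by (simp add: \<rho>_closed)
    also have "\<dots> = h ?w"
     unfolding P.act_act[OF m(2) a(1) m(1), symmetric] using h(2) f[OF m(1), of "b \<otimes> a"] m a(1) by (simp add: \<rho>_closed)
    finally show ?thesis by (rule hz[OF rc wc])
   qed
   thus "r \<in> kernel ?F (add_monoid ?G) h" using rc by (simp add: kernel_def)
  qed
  hence "TK P \<subseteq> kernel ?F (add_monoid ?G) h"
   unfolding tensor_kernel_def by (rule group.generate_subgroup_incl[OF group_free_Abelian_group _ h.subgroup_kernel])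
  moreover have "frag_of (x, \<one>\<^sub>A) \<in> TK P"
   using z unfolding zero eta_zero[OF P] unfolding eta_def tcl_eq_iff[OF P] by simp
  ultimately have "h (frag_of (x, \<one>\<^sub>A)) = \<zero>\<^sub>?G" by (auto simp: kernel_def)
  moreover have "h (frag_of (x, \<rho> \<one>)) = ?q (\<one> \<odot>\<^sub>P x)" using h(2) f[OF x one_closed] x by (simp add: \<rho>_closed)
  ultimately have "?q x = ?q \<zero>\<^sub>P" using x unfolding \<rho>_one q(3) by (simp add: P.act_one)
  hence "x \<ominus>\<^sub>P \<zero>\<^sub>P \<in> U" using q(5)[OF x P.M.zero_closed] by simp
  moreover have "\<ominus>\<^sub>P \<zero>\<^sub>P = \<zero>\<^sub>P" using P.M.l_neg[OF P.M.zero_closed] by simp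
  ultimately show "x \<in> U" using x by (simp add: a_minus_def)
 qed
qed

lemma base_change_map_eta:
 assumes P: "right_module R P" and P': "right_module R P'" and f: "rlin R P P' f" and x: "x \<in> car P"
 shows "base_change_map R A \<rho> P P' f (eta P x) = eta P' (f x)"
proof -
 have c: "eta P x \<in> car (bc P)" using BCD(4)[OF base_change_BC[OF P]] x by blast
 have "base_change_map R A \<rho> P P' f (eta P x) = (\<Union>c\<in>eta P x. tcl P' (frag_extend (\<lambda>(m, s). frag_of (f m, s)) c))"
  using c by (simp add: base_change_map_def tcl_def)
 also have "\<dots> = tcl P' (frag_extend (\<lambda>(m, s). frag_of (f m, s)) (frag_of (x, \<one>\<^sub>A)))"
  unfolding eta_def by (rule tcl_const[OF P P']) (rule tensor_map_TK[OF P P' f, of "\<lambda>s. s"], simp_all)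
 finally show ?thesis by (simp add: eta_def)
qed

end

section \<open>Extension of scalars for complexes and lifting from A\<close>

context quotient_setting
begin

definition BCK :: "('a, 'm) two_term => ('a set, 'n) two_term => ('m => 'n) \<times> ('m => 'n) => bool" where
 "BCK X Y \<eta> \<longleftrightarrow> cplx R X \<and> cplx A Y \<and> BC (tm1 X) (tm1 Y) (fst \<eta>) \<and> BC (t0 X) (t0 Y) (snd \<eta>) \<and>
  (\<forall>x\<in>car (tm1 X). tdiff Y (fst \<eta> x) = snd \<eta> (tdiff X x))"

lemma BCKD:
 assumes "BCK X Y \<eta>"
 shows "cplx R X" "cplx A Y" "BC (tm1 X) (tm1 Y) (fst \<eta>)" "BC (t0 X) (t0 Y) (snd \<eta>)"
  "\<And>x. x \<in> car (tm1 X) ==> tdiff Y (fst \<eta> x) = snd \<eta> (tdiff X x)"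
 using assms unfolding BCK_def by blast+

text \<open>The second clause says that F lies over f. As \<open>\<eta>\<close> is surjective in
  both degrees, this determines F on the carriers, so identities between chain maps can be read off
  upstairs.\<close>

lemma BCK_map:
 assumes b: "BCK X X' \<eta>" and b': "BCK Y Y' \<theta>" and f: "cmap R X Y f"
 shows "\<exists>F. cmap A X' Y' F \<and> ceq X (F \<odot>c \<eta>) (\<theta> \<odot>c f)"
proof -
 note d = BCKD[OF b] and d' = BCKD[OF b'] and fc = cmapD[OF f]
 obtain F1 where F1: "rlin A (tm1 X') (tm1 Y') F1" "\<forall>x\<in>car (tm1 X). F1 (fst \<eta> x) = fst \<theta> (fst f x)"
  using BC_map[OF d(3) d'(3) fc(1)] by blast
 obtain F0 where F0: "rlin A (t0 X') (t0 Y') F0" "\<forall>x\<in>car (t0 X). F0 (snd \<eta> x) = snd \<theta> (snd f x)"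
  using BC_map[OF d(4) d'(4) fc(2)] by blast
 have "F0 (tdiff X' y) = tdiff Y' (F1 y)" if y: "y \<in> car (tm1 X')" for y
 proof (rule BC_ext[OF d(3) _ y])
  fix x assume x: "x \<in> car (tm1 X)"
  show "F0 (tdiff X' (fst \<eta> x)) = tdiff Y' (F1 (fst \<eta> x))"
   unfolding d(5)[OF x] bspec[OF F1(2) x] bspec[OF F0(2) rlin_cl[OF cplxD(3)[OF d(1)] x]]
    d'(5)[OF rlin_cl[OF fc(1) x]] fc(3)[OF x] ..
 qed
 hence "cmap A X' Y' (F1, F0)" using F1(1) F0(1) by (simp add: cmap_def)
 moreover have "ceq X ((F1, F0) \<odot>c \<eta>) (\<theta> \<odot>c f)" using F1(2) F0(2) by (simp add: ceq_def)
 ultimately show ?thesis by blast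
qed

text \<open>The homotopy descends to P/PJ just as the maps do, and the homotopy identities are
  checked on images of \<open>\<eta>\<close>.\<close>

lemma BCK_heq:
 assumes b: "BCK X X' \<eta>" and b': "BCK Y Y' \<theta>" and f: "cmap R X Y f" and g: "cmap R X Y g" and h: "heq R X Y f g"
  and F: "ceq X (F \<odot>c \<eta>) (\<theta> \<odot>c f)" and G: "ceq X (G \<odot>c \<eta>) (\<theta> \<odot>c g)"
 shows "heq A X' Y' F G"
proof -
 note d = BCKD[OF b] and d' = BCKD[OF b']
 obtain h where h: "rlin R (t0 X) (tm1 Y) h" "\<forall>x\<in>car (tm1 X). fst f x = fst g x \<oplus>\<^bsub>tm1 Y\<^esub> h (tdiff X x)"
  "\<forall>x\<in>car (t0 X). snd f x = snd g x \<oplus>\<^bsub>t0 Y\<^esub> tdiff Y (h x)"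
  using h unfolding heq_def by blast
 obtain H where H: "rlin A (t0 X') (tm1 Y') H" "\<forall>x\<in>car (t0 X). H (snd \<eta> x) = fst \<theta> (h x)"
  using BC_map[OF d(4) d'(3) h(1)] by blast
 have dX: "tdiff X x \<in> car (t0 X)" if "x \<in> car (tm1 X)" for x by (rule rlin_cl[OF cplxD(3)[OF d(1)] that])
 have dY: "tdiff Y x \<in> car (t0 Y)" if "x \<in> car (tm1 Y)" for x by (rule rlin_cl[OF cplxD(3)[OF d'(1)] that])
 note hc = rlin_cl[OF h(1)] and gc = rlin_cl[OF cmapD(1)[OF g]] rlin_cl[OF cmapD(2)[OF g]]
 note ta = rlin_add[OF BCD(3)[OF d'(3)], unfolded rs_simps] rlin_add[OF BCD(3)[OF d'(4)], unfolded rs_simps]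
 have e1: "fst F y = fst G y \<oplus>\<^bsub>tm1 Y'\<^esub> H (tdiff X' y)" if y: "y \<in> car (tm1 X')" for y
 proof (rule BC_ext[OF d(3) _ y])
  fix x assume x: "x \<in> car (tm1 X)"
  have "fst F (fst \<eta> x) = fst \<theta> (fst f x)" "fst G (fst \<eta> x) = fst \<theta> (fst g x)" using F G x by (simp_all add: ceq_def)
  thus "fst F (fst \<eta> x) = fst G (fst \<eta> x) \<oplus>\<^bsub>tm1 Y'\<^esub> H (tdiff X' (fst \<eta> x))"
   unfolding d(5)[OF x] bspec[OF H(2) dX[OF x]] using bspec[OF h(2) x] ta(1)[OF gc(1)[OF x] hc[OF dX[OF x]]] by simp
 qed
 have e2: "snd F y = snd G y \<oplus>\<^bsub>t0 Y'\<^esub> tdiff Y' (H y)" if y: "y \<in> car (t0 X')" for y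
 proof (rule BC_ext[OF d(4) _ y])
  fix x assume x: "x \<in> car (t0 X)"
  have "snd F (snd \<eta> x) = snd \<theta> (snd f x)" "snd G (snd \<eta> x) = snd \<theta> (snd g x)" using F G x by (simp_all add: ceq_def)
  thus "snd F (snd \<eta> x) = snd G (snd \<eta> x) \<oplus>\<^bsub>t0 Y'\<^esub> tdiff Y' (H (snd \<eta> x))"
   unfolding bspec[OF H(2) x] d'(5)[OF hc[OF x]] using bspec[OF h(3) x] ta(2)[OF gc(2)[OF x] dY[OF hc[OF x]]] by simp
 qed
 show ?thesis unfolding heq_def using H(1) e1 e2 by blast
qed

lemma ceq_lift_comp:
 assumes f: "cmap R X Y f" and F: "ceq X (F \<odot>c \<eta>) (\<theta> \<odot>c f)" and G: "ceq Y (G \<odot>c \<theta>) (\<zeta> \<odot>c g)"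
 shows "ceq X ((G \<odot>c F) \<odot>c \<eta>) (\<zeta> \<odot>c (g \<odot>c f))"
 using F G rlin_cl[OF cmapD(1)[OF f]] rlin_cl[OF cmapD(2)[OF f]] unfolding ceq_def by simp

lemma ceq_lift_id: "ceq X (cid \<odot>c \<eta>) (\<eta> \<odot>c cid)" by (simp add: ceq_def)

lemma ceq_lift_zero:
 assumes "BCK Y Y' \<theta>"
 shows "ceq X (czero Y' \<odot>c \<eta>) (\<theta> \<odot>c czero Y)"
 using rlin_zero[OF BCD(1)[OF BCKD(3)[OF assms]] BCD(6)[OF BCKD(3)[OF assms]] BCD(3)[OF BCKD(3)[OF assms]]]
  rlin_zero[OF BCD(1)[OF BCKD(4)[OF assms]] BCD(6)[OF BCKD(4)[OF assms]] BCD(3)[OF BCKD(4)[OF assms]]]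
 by (simp add: ceq_def czero_def)

lemma ceq_lift_add:
 assumes b: "BCK Y Y' \<theta>" and f: "cmap R X Y f" and g: "cmap R X Y g"
  and F: "ceq X (F \<odot>c \<eta>) (\<theta> \<odot>c f)" and G: "ceq X (G \<odot>c \<eta>) (\<theta> \<odot>c g)"
 shows "ceq X (cadd Y' F G \<odot>c \<eta>) (\<theta> \<odot>c cadd Y f g)"
 using F G rlin_add[OF BCD(3)[OF BCKD(3)[OF b]]] rlin_add[OF BCD(3)[OF BCKD(4)[OF b]]]
  rlin_cl[OF cmapD(1)[OF f]] rlin_cl[OF cmapD(2)[OF f]] rlin_cl[OF cmapD(1)[OF g]] rlin_cl[OF cmapD(2)[OF g]]
 unfolding ceq_def cadd_def by simp

lemma BCK_K_iso:
 assumes b: "BCK X X' \<eta>" and b': "BCK Y Y' \<theta>" and i: "K_iso R X Y"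
 shows "K_iso A X' Y'"
proof -
 obtain f g where fg: "cmap R X Y f" "cmap R Y X g" "heq R X X (g \<odot>c f) cid" "heq R Y Y (f \<odot>c g) cid"
  using i by (rule K_isoE)
 obtain F where F: "cmap A X' Y' F" "ceq X (F \<odot>c \<eta>) (\<theta> \<odot>c f)" using BCK_map[OF b b' fg(1)] by blast
 obtain G where G: "cmap A Y' X' G" "ceq Y (G \<odot>c \<theta>) (\<eta> \<odot>c g)" using BCK_map[OF b' b fg(2)] by blast
 show ?thesis by (rule K_isoI[OF BCKD(2)[OF b] BCKD(2)[OF b'] F(1) G(1)
     BCK_heq[OF b b cmap_comp[OF fg(2,1)] cmap_id fg(3) ceq_lift_comp[OF fg(1) F(2) G(2)] ceq_lift_id]
     BCK_heq[OF b' b' cmap_comp[OF fg(1,2)] cmap_id fg(4) ceq_lift_comp[OF fg(2) G(2) F(2)] ceq_lift_id]])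
qed

lemma BCK_kzero:
 assumes b: "BCK X X' \<eta>" and z: "kzero R X"
 shows "kzero A X'"
 using BCK_heq[OF b b cmap_id cmap_zero[OF BCKD(1)[OF b] BCKD(1)[OF b]] _ ceq_lift_id ceq_lift_zero[OF b]] z
 unfolding kzero_def by blast

lemma BCK_kbip:
 assumes bX: "BCK X X' \<eta>" and bY: "BCK Y Y' \<theta>" and bZ: "BCK Z Z' \<zeta>" and k: "kbip R X Y Z"
 shows "kbip A X' Y' Z'"
proof -
 obtain j q j' q' where m: "cmap R Y X j" "cmap R X Y q" "cmap R Z X j'" "cmap R X Z q'"
  and e: "heq R Y Y (q \<odot>c j) cid" "heq R Z Z (q' \<odot>c j') cid" "heq R Y Z (q' \<odot>c j) (czero Z)"
  "heq R Z Y (q \<odot>c j') (czero Y)" "heq R X X (cadd X (j \<odot>c q) (j' \<odot>c q')) cid"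
  using k unfolding kbip_def by blast
 obtain i where i: "cmap A Y' X' i" "ceq Y (i \<odot>c \<theta>) (\<eta> \<odot>c j)" using BCK_map[OF bY bX m(1)] by blast
 obtain p where p: "cmap A X' Y' p" "ceq X (p \<odot>c \<eta>) (\<theta> \<odot>c q)" using BCK_map[OF bX bY m(2)] by blast
 obtain i' where i': "cmap A Z' X' i'" "ceq Z (i' \<odot>c \<zeta>) (\<eta> \<odot>c j')" using BCK_map[OF bZ bX m(3)] by blast
 obtain p' where p': "cmap A X' Z' p'" "ceq X (p' \<odot>c \<eta>) (\<zeta> \<odot>c q')" using BCK_map[OF bX bZ m(4)] by blast
 note cX = BCKD(1)[OF bX] and cY = BCKD(1)[OF bY] and cZ = BCKD(1)[OF bZ]
 have "heq A Y' Y' (p \<odot>c i) cid"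
  by (rule BCK_heq[OF bY bY cmap_comp[OF m(2,1)] cmap_id e(1) ceq_lift_comp[OF m(1) i(2) p(2)] ceq_lift_id])
 moreover have "heq A Z' Z' (p' \<odot>c i') cid"
  by (rule BCK_heq[OF bZ bZ cmap_comp[OF m(4,3)] cmap_id e(2) ceq_lift_comp[OF m(3) i'(2) p'(2)] ceq_lift_id])
 moreover have "heq A Y' Z' (p' \<odot>c i) (czero Z')"
  by (rule BCK_heq[OF bY bZ cmap_comp[OF m(4,1)] cmap_zero[OF cY cZ] e(3) ceq_lift_comp[OF m(1) i(2) p'(2)] ceq_lift_zero[OF bZ]])
 moreover have "heq A Z' Y' (p \<odot>c i') (czero Y')"
  by (rule BCK_heq[OF bZ bY cmap_comp[OF m(2,3)] cmap_zero[OF cZ cY] e(4) ceq_lift_comp[OF m(3) i'(2) p(2)] ceq_lift_zero[OF bY]])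
 moreover have "heq A X' X' (cadd X' (i \<odot>c p) (i' \<odot>c p')) cid"
  by (rule BCK_heq[OF bX bX cmap_add[OF cX cmap_comp[OF m(1,2)] cmap_comp[OF m(3,4)]] cmap_id e(5)
     ceq_lift_add[OF bX cmap_comp[OF m(1,2)] cmap_comp[OF m(3,4)] ceq_lift_comp[OF m(2) p(2) i(2)] ceq_lift_comp[OF m(4) p'(2) i'(2)]]
     ceq_lift_id])
 ultimately show ?thesis unfolding kbip_def using i(1) p(1) i'(1) p'(1) by blast
qed

lemma quot_K_simps:
 "tm1 (quot_K R J X) = bc (tm1 X)" "t0 (quot_K R J X) = bc (t0 X)"
 "tdiff (quot_K R J X) = base_change_map R A \<rho> (tm1 X) (t0 X) (tdiff X)"
 unfolding quot_K_def base_change_K_def A_eq \<rho>_def[abs_def] by simp_all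

lemma quot_K_BCK:
 assumes c: "cplx R X"
 shows "BCK X (quot_K R J X) (eta (tm1 X), eta (t0 X))"
proof -
 note d = cplxD[OF c]
 note b1 = base_change_BC[OF d(1)] and b0 = base_change_BC[OF d(2)]
 have e: "tdiff (quot_K R J X) (eta (tm1 X) x) = eta (t0 X) (tdiff X x)" if "x \<in> car (tm1 X)" for x
  unfolding quot_K_simps by (rule base_change_map_eta[OF d that])
 obtain g where g: "rlin A (bc (tm1 X)) (bc (t0 X)) g" "\<forall>x\<in>car (tm1 X). g (eta (tm1 X) x) = eta (t0 X) (tdiff X x)"
  using BC_map[OF b1 b0 d(3)] by blast
 have "rlin A (bc (tm1 X)) (bc (t0 X)) (tdiff (quot_K R J X))"
 proof (rule rlin_cong[OF g(1) _ BCD(2)[OF b1]])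
  fix y assume y: "y \<in> car (bc (tm1 X))"
  show "g y = tdiff (quot_K R J X) y" by (rule BC_ext[OF b1 _ y]) (simp add: e g(2))
 qed
 hence "cplx A (quot_K R J X)" unfolding cplx_def quot_K_simps(1,2) using BCD(2)[OF b1] BCD(2)[OF b0] by blast
 thus ?thesis unfolding BCK_def quot_K_simps(1,2) fst_conv snd_conv using c b1 b0 e by blast
qed

lemma quot_K_two_term_proj:
 assumes X: "two_term_proj R X"
 shows "two_term_proj A (quot_K R J X)"
proof -
 note b = quot_K_BCK[OF ttp_cplx[OF X]]
 have P: "fg_projective R (tm1 X)" "fg_projective R (t0 X)" using X by (auto simp: two_term_proj_def)
 have "tdiff (quot_K R J X) \<in> extensional (car (tm1 (quot_K R J X)))"
  unfolding quot_K_simps base_change_map_def by simp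
 thus ?thesis unfolding two_term_proj_def rhom_iff
  using BC_projective[OF BCKD(3)[OF b] P(1)] BC_projective[OF BCKD(4)[OF b] P(2)] cplxD(3)[OF BCKD(2)[OF b]] by blast
qed

text \<open>Right exactness. If x represents a class that dies in H^0 Y, then \<open>\<eta>\<close>
  x is a boundary, the image of some d v. So x and d v differ by an element of every submodule that
  contains the J-multiples of X^0, and x - d v has the same class as x.\<close>

lemma BCK_H0:
 assumes b: "BCK X Y \<eta>"
 shows "\<exists>\<theta>. BC (H0 X) (H0 Y) \<theta>"
proof -
 note d = BCKD[OF b]
 note b0 = BCD[OF d(4)] and b1 = BCD[OF d(3)]
 note mX = H0_is_module[OF d(1)] and mY = H0_is_module[OF d(2)]
 note cX = H0_class_rlin[OF d(1)] and cY = H0_class_rlin[OF d(2)]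
 note dX = cplxD[OF d(1)] and dY = cplxD[OF d(2)]
 interpret X0: right_module R "t0 X" by (rule dX)
 interpret HX: right_module R "H0 X" by (rule mX)
 interpret Y0: right_module R "rs (t0 Y)" by (rule b0)
 have l: "rlin R (t0 X) (rs (H0 Y)) (H0_class Y \<circ> snd \<eta>)"
  by (rule rlin_o[OF _ b0(3)]) (simp add: rlin_rs cY)
 have eq: "(H0_class Y \<circ> snd \<eta>) x = (H0_class Y \<circ> snd \<eta>) y"
  if xy: "x \<in> car (t0 X)" "y \<in> car (t0 X)" "H0_class X x = H0_class X y" for x y
 proof -
  obtain z where z: "z \<in> car (tm1 X)" "x = y \<oplus>\<^bsub>t0 X\<^esub> tdiff X z" using xy(3) H0_class_eq_iff[OF d(1) xy(1,2)] by blast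
  have zc: "fst \<eta> z \<in> car (tm1 Y)" using rlin_cl[OF b1(3) z(1)] by simp
  have "snd \<eta> x = snd \<eta> y \<oplus>\<^bsub>t0 Y\<^esub> tdiff Y (fst \<eta> z)"
   unfolding z(2) d(5)[OF z(1)] using rlin_add[OF b0(3) xy(2) rlin_cl[OF dX(3) z(1)]] by simp
  thus ?thesis
   using H0_class_eq_iff[OF d(2), of "snd \<eta> x" "snd \<eta> y"] rlin_cl[OF b0(3) xy(1)] rlin_cl[OF b0(3) xy(2)] zc by auto
 qed
 have "\<exists>\<theta>. rlin R (H0 X) (rs (H0 Y)) \<theta> \<and> (\<forall>x\<in>car (t0 X). \<theta> (H0_class X x) = (H0_class Y \<circ> snd \<eta>) x)"
  by (rule rlin_factor[OF dX(2) cX H0_carrier[OF d(1), symmetric] l eq], assumption+) (intro exI conjI ballI)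
 then obtain \<theta> where t1: "rlin R (H0 X) (rs (H0 Y)) \<theta>"
  and "\<forall>x\<in>car (t0 X). \<theta> (H0_class X x) = (H0_class Y \<circ> snd \<eta>) x" by (elim exE conjE)
 hence t: "\<theta> (H0_class X x) = H0_class Y (snd \<eta> x)" if "x \<in> car (t0 X)" for x using that by simp
 have "BC (H0 X) (H0 Y) \<theta>" unfolding BC_def
 proof (intro conjI ballI impI allI mX mY t1)
  show "\<theta> ` car (H0 X) = car (H0 Y)"
   unfolding H0_carrier[OF d(1)] H0_carrier[OF d(2)] b0(4)[symmetric] image_image
   by (rule image_cong[OF refl t])
  fix a U assume "a \<in> car (H0 X)" and z: "\<theta> a = \<zero>\<^bsub>H0 Y\<^esub>" and U: "JS (H0 X) U"
  then obtain x where x: "x \<in> car (t0 X)" "a = H0_class X x" unfolding H0_carrier[OF d(1)] by blast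
  have ex: "snd \<eta> x \<in> car (t0 Y)" using rlin_cl[OF b0(3) x(1)] by simp
  have zY: "\<zero>\<^bsub>t0 Y\<^esub> \<in> car (t0 Y)" using Y0.M.zero_closed by simp
  have "H0_class Y (snd \<eta> x) = H0_class Y \<zero>\<^bsub>t0 Y\<^esub>" using z unfolding x(2) t[OF x(1)] rlin_zero[OF dY(2) mY cY] .
  then obtain w where w: "w \<in> car (tm1 Y)" "snd \<eta> x = \<zero>\<^bsub>t0 Y\<^esub> \<oplus>\<^bsub>t0 Y\<^esub> tdiff Y w"
   using H0_class_eq_iff[OF d(2) ex zY] by blast
  obtain v where v: "v \<in> car (tm1 X)" "w = fst \<eta> v" using w(1) unfolding b1(4)[symmetric] by blast
  have vc: "tdiff X v \<in> car (t0 X)" by (rule rlin_cl[OF dX(3) v(1)])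
  have evc: "snd \<eta> (tdiff X v) \<in> car (t0 Y)" using rlin_cl[OF b0(3) vc] by simp
  have "snd \<eta> x = snd \<eta> (tdiff X v)" unfolding w(2) v(2) d(5)[OF v(1)] using Y0.M.l_zero evc by simp
  from BC_eqD[OF d(4) x(1) vc this JS_preimage[OF dX(2) mX cX U]]
  have 1: "H0_class X (x \<oplus>\<^bsub>t0 X\<^esub> \<ominus>\<^bsub>t0 X\<^esub> tdiff X v) \<in> U" by blast
  have mv: "\<ominus>\<^bsub>tm1 X\<^esub> v \<in> car (tm1 X)"
   using abelian_group.a_inv_closed[OF right_module.axioms(2)[OF dX(1)] v(1)] .
  have xc: "x \<oplus>\<^bsub>t0 X\<^esub> \<ominus>\<^bsub>t0 X\<^esub> tdiff X v \<in> car (t0 X)" using x(1) vc by simp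
  have "H0_class X (x \<oplus>\<^bsub>t0 X\<^esub> \<ominus>\<^bsub>t0 X\<^esub> tdiff X v) = H0_class X x"
   unfolding H0_class_eq_iff[OF d(1) xc x(1)] using mv rlin_minus[OF dX v(1)] by metis
  thus "a \<in> U" using 1 x(2) by simp
 qed
 thus ?thesis by blast
qed

definition liftable :: "('a set, 'q) module => bool" where
 "liftable Q \<longleftrightarrow> (\<exists>(P :: ('a, nat => 'a) module) \<eta>. fg_projective R P \<and> BC P Q \<eta>)"

lemma liftableI:
 fixes P :: "('a, 'p) module"
 assumes P: "fg_projective R P" and b: "BC P Q \<eta>"
 shows "liftable Q"
proof -
 obtain P' :: "('a, nat => 'a) module" and f g where P': "fg_projective R P'" and f: "rlin R P P' f" and g: "rlin R P' P g"
  and gf: "\<And>x. x \<in> car P ==> g (f x) = x" and fg: "\<And>y. y \<in> car P' ==> f (g y) = y"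
  using fg_projective_copy[OF P] by metis
 have "bij_betw g (car P') (car P)"
  by (rule bij_betwI[of _ _ _ f]) (use rlin_cl[OF f] rlin_cl[OF g] gf fg in auto)
 from BC_cong_left[OF b fg_projective_module[OF P'] g this] P' show ?thesis unfolding liftable_def by blast
qed

lemma liftable_cong:
 assumes Q: "liftable Q" and Q': "right_module A Q'" and f: "rlin A Q Q' f" "bij_betw f (car Q) (car Q')"
 shows "liftable Q'" using Q BC_cong_right[OF _ Q' f] unfolding liftable_def by blast

lemma liftable_dsum:
 assumes "\<And>Q. Q \<in> set Qs ==> liftable Q"
 shows "liftable (rmod_dsum Qs)"
proof -
 have "\<exists>Ps :: ('a, nat => 'a) module list. (\<forall>P\<in>set Ps. fg_projective R P) \<and> (\<forall>Q\<in>set Qs. right_module A Q) \<and>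
  (\<exists>\<theta>. BC (rmod_dsum Ps) (rmod_dsum Qs) \<theta>)" using assms
 proof (induction Qs)
  case Nil
  show ?case using BC_dsum_Nil by (intro exI[of _ "[]"]) auto
 next
  case (Cons Q Qs)
  then obtain Ps :: "('a, nat => 'a) module list" and \<theta> where Ps: "\<forall>P\<in>set Ps. fg_projective R P" "\<forall>Q\<in>set Qs. right_module A Q"
   "BC (rmod_dsum Ps) (rmod_dsum Qs) \<theta>" by auto
  have "liftable Q" using Cons.prems by simp
  then obtain P :: "('a, nat => 'a) module" and \<eta> where P: "fg_projective R P" "BC P Q \<eta>" unfolding liftable_def by blast
  have m: "right_module R (rmod_dsum (P # Ps))"
   by (rule dsum_module[OF ring_axioms]) (use P(1) Ps(1) fg_projective_module in auto)
  have m': "right_module A (rmod_dsum (Q # Qs))"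
   by (rule dsum_module[OF A.ring_axioms]) (use BCD(2)[OF P(2)] Ps(2) in auto)
  from BC_dsum_Cons[OF P(2) Ps(3) m m'] show ?case
   using P(1) Ps(1,2) BCD(2)[OF P(2)] by (intro exI[of _ "P # Ps"]) auto
 qed
 then obtain Ps :: "('a, nat => 'a) module list" and \<theta> where Ps: "\<forall>P\<in>set Ps. fg_projective R P" "BC (rmod_dsum Ps) (rmod_dsum Qs) \<theta>" by blast
 show ?thesis by (rule liftableI[OF fg_projective_dsum Ps(2)]) (use Ps(1) in blast)
qed

text \<open>The idempotent f itself is not lifted. Its projective is a summand of the regular module
  of A, which is a retract of the sum of the projectives of \<open>\<rho> e\<close> for e in
  \<open>es\<close>. Each of these is local, as a quotient of a local projective, so the exchange
  argument makes fA isomorphic to one of them.\<close>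

lemma liftable_idem_proj:
 assumes es: "complete_primitive_idempotents R es" and f: "primitive_idempotent A f"
 shows "liftable (idem_proj A f)"
proof -
 let ?es = "map \<rho> es" and ?L = "idem_proj A f"
 have pe: "primitive_idempotent R e" if "e \<in> set es" for e using es that by (auto simp: complete_primitive_idempotents_def)
 hence ie: "idempotent_in R e" if "e \<in> set es" for e using that by (auto simp: primitive_idempotent_def)
 have fi: "idempotent_in A f" "f \<noteq> \<zero>\<^sub>A" using f by (auto simp: primitive_idempotent_def)
 note L = A.idem_proj_facts[OF fi(1)]
 have loc: "eloc A ?L" by (rule A.eloc_idem_proj[OF f])
 have "f \<in> car ?L" unfolding L(1) using fi(1) by (simp add: idempotent_in_def)
 moreover have "\<zero>\<^sub>?L = \<zero>\<^sub>A" by (simp add: idem_proj_def reg_simps)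
 ultimately have nz: "car ?L \<noteq> {\<zero>\<^sub>?L}" using fi(2) by auto
 have ie': "idempotent_in A e" if "e \<in> set ?es" for e
  using that ie by (auto simp: idempotent_in_def \<rho>_closed \<rho>_mult[symmetric])
 have ec: "es ! i \<in> car R" if "i < length es" for i using ie[OF nth_mem[OF that]] by (simp add: idempotent_in_def)
 have \<rho>sum: "\<rho> (\<Oplus>i\<in>I. es ! i) = (\<Oplus>\<^bsub>A\<^esub>i\<in>I. \<rho> (es ! i))" if "finite I" "I \<subseteq> {..<length es}" for I
  using that
 proof (induction I rule: finite_induct)
  case empty
  show ?case by (simp add: \<rho>_zero)
 next
  case (insert i I)
  have 1: "(\<lambda>i. es ! i) \<in> I \<rightarrow> car R" "es ! i \<in> car R" using insert.prems ec by auto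
  have 2: "(\<lambda>i. \<rho> (es ! i)) \<in> I \<rightarrow> car A" "\<rho> (es ! i) \<in> car A" using 1 \<rho>_closed by auto
  show ?case
   unfolding finsum_insert[OF insert.hyps 1] A.finsum_insert[OF insert.hyps 2] \<rho>_add[OF 1(2) finsum_closed[OF 1(1)]]
   using insert by simp
 qed
 have "(\<Oplus>\<^bsub>A\<^esub>i\<in>{..<length ?es}. ?es ! i) = (\<Oplus>\<^bsub>A\<^esub>i\<in>{..<length es}. \<rho> (es ! i))"
  by (rule A.finsum_cong') (use ec \<rho>_closed in auto)
 also have "\<dots> = \<rho> (\<Oplus>i\<in>{..<length es}. es ! i)" by (rule \<rho>sum[symmetric]) auto
 also have "\<dots> = \<one>\<^sub>A" using es by (simp add: complete_primitive_idempotents_def \<rho>_one)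
 finally have sum: "(\<Oplus>\<^bsub>A\<^esub>i\<in>{..<length ?es}. ?es ! i) = \<one>\<^sub>A" .
 let ?D = "rmod_dsum (map (idem_proj A) ?es)"
 obtain i p where ip: "rlin A (right_regular A) ?D i" "rlin A ?D (right_regular A) p" "\<forall>x\<in>car A. p (i x) = x"
  using A.regular_retract_idem_proj[OF ie' sum] by metis
 have "rlin A ?L ?D (i \<circ> id)" by (rule rlin_o[OF ip(1) L(6)])
 moreover have "rlin A ?D ?L ((\<lambda>x. f \<otimes>\<^sub>A x) \<circ> p)" by (rule rlin_o[OF L(5) ip(2)])
 moreover have "bij_betw (\<lambda>x. ((\<lambda>x. f \<otimes>\<^sub>A x) \<circ> p) ((i \<circ> id) x)) (car ?L) (car ?L)"
  by (subst bij_betw_cong[of _ _ id]) (use ip(3) in \<open>auto simp: L(1)\<close>)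
 ultimately have "mfactor A ?L ?D" unfolding mfactor_def by blast
 hence "\<exists>Q\<in>set (map (idem_proj A) ?es). mfactor A ?L Q"
  by (rule mfactor_dsum[OF L(3) loc nz, rotated]) (use A.idem_proj_facts(3)[OF ie'] in auto)
 then obtain e where e: "e \<in> set es" "mfactor A ?L (idem_proj A (\<rho> e))" by auto
 note b = BC_idem_proj[OF ie[OF e(1)]] and P = idem_proj_facts(4)[OF ie[OF e(1)]]
 have m: "right_module A (idem_proj A (\<rho> e))" by (rule BCD(2)[OF b])
 have loc': "eloc A (idem_proj A (\<rho> e))" by (rule BC_eloc[OF b P eloc_idem_proj[OF pe[OF e(1)]]])
 obtain g where g: "rlin A ?L (idem_proj A (\<rho> e)) g" "bij_betw g (car ?L) (car (idem_proj A (\<rho> e)))"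
  by (rule A.eloc_factor_iso[OF L(3) nz m loc' e(2)])
 obtain k where k: "rlin A (idem_proj A (\<rho> e)) ?L k" "\<And>x. x \<in> car ?L ==> k (g x) = x" "\<And>y. y \<in> car (idem_proj A (\<rho> e)) ==> g (k y) = y"
  using rlin_inverse[OF L(3) g] by metis
 have "bij_betw k (car (idem_proj A (\<rho> e))) (car ?L)"
  by (rule bij_betwI[of _ _ _ g]) (use rlin_cl[OF k(1)] rlin_cl[OF g(1)] k(2,3) in auto)
 from liftable_cong[OF liftableI[OF P b] L(3) k(1) this] show ?thesis .
qed

lemma liftable_projective:
 assumes es: "complete_primitive_idempotents R es" and fs: "complete_primitive_idempotents A fs" and Q: "fg_projective A Q"
 shows "liftable Q"
proof -
 obtain "is" where is_: "set is \<subseteq> {..<length fs}" "rmod_iso A Q (rmod_dsum (map (\<lambda>i. idem_proj A (fs ! i)) is))"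
  using A.projective_decomposition[OF fs Q] by blast
 let ?D = "rmod_dsum (map (\<lambda>i. idem_proj A (fs ! i)) is)"
 have "primitive_idempotent A (fs ! i)" if "i \<in> set is" for i
  using fs is_(1) that by (auto simp: complete_primitive_idempotents_def)
 hence "liftable M" if "M \<in> set (map (\<lambda>i. idem_proj A (fs ! i)) is)" for M using that liftable_idem_proj[OF es] by auto
 hence D: "liftable ?D" by (rule liftable_dsum)
 obtain f where f: "rlin A Q ?D f" "bij_betw f (car Q) (car ?D)" by (rule rmod_isoE[OF is_(2)])
 note mQ = fg_projective_module[OF Q]
 obtain g where g: "rlin A ?D Q g" "\<And>x. x \<in> car Q ==> g (f x) = x" "\<And>y. y \<in> car ?D ==> f (g y) = y"
  using rlin_inverse[OF mQ f] by metis
 have "bij_betw g (car ?D) (car Q)"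
  by (rule bij_betwI[of _ _ _ f]) (use rlin_cl[OF f(1)] rlin_cl[OF g(1)] g(2,3) in auto)
 from liftable_cong[OF D mQ g(1) this] show ?thesis .
qed

text \<open>Lift both terms, then lift the differential by projectivity of the lifted term in degree
  -1.\<close>

lemma two_term_lift:
 fixes Y :: "('a set, 'q) two_term"
 assumes es: "complete_primitive_idempotents R es" and fs: "complete_primitive_idempotents A fs" and Y: "two_term_proj A Y"
 obtains X :: "('a, nat => 'a) two_term" and \<eta> where "two_term_proj R X" "BCK X Y \<eta>"
proof -
 have "liftable (tm1 Y)" "liftable (t0 Y)"
  using Y by (auto simp: two_term_proj_def intro!: liftable_projective[OF es fs])
 then obtain P1 P0 :: "('a, nat => 'a) module" and \<eta>1 \<eta>0 where P1: "fg_projective R P1" "BC P1 (tm1 Y) \<eta>1"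
  and P0: "fg_projective R P0" "BC P0 (t0 Y) \<eta>0" unfolding liftable_def by blast
 note b1 = BCD[OF P1(2)] and b0 = BCD[OF P0(2)]
 note cY = ttp_cplx[OF Y]
 have s: "\<eta>0 ` car P0 = car (rs (t0 Y))" using b0(4) by simp
 have "rlin R P1 (rs (t0 Y)) (tdiff Y \<circ> \<eta>1)" by (rule rlin_o[OF _ b1(3)]) (simp add: rlin_rs cplxD(3)[OF cY])
 from fg_projective_lift[OF P1(1) b0(1) b0(6) b0(3) s this]
 obtain d where d: "rlin R P1 P0 d" "\<forall>x\<in>car P1. \<eta>0 (d x) = tdiff Y (\<eta>1 x)" by auto
 define X where "X = \<lparr>tm1 = P1, t0 = P0, tdiff = restrict d (car P1)\<rparr>"
 have X: "two_term_proj R X"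
  unfolding two_term_proj_def X_def two_term.simps using P1(1) P0(1) rlin_restrict[OF b1(1) d(1)] by blast
 have "BCK X Y (\<eta>1, \<eta>0)"
  unfolding BCK_def using ttp_cplx[OF X] cY P1(2) P0(2) d(2) by (simp add: X_def)
 with X show thesis by (rule that)
qed

text \<open>Extension of scalars preserves biproducts and contractible complexes, so it commutes
  with finite sums up to homotopy equivalence.\<close>

lemma K_iso_quot_dsum:
 fixes Xs :: "('a, 'x) two_term list" and X :: "('a, 'y) two_term" and X' :: "('a set, 'z) two_term"
 assumes "\<And>Y. Y \<in> set Xs ==> cplx R Y" and "BCK X X' \<eta>" and "K_iso R X (K_dsum Xs)"
 shows "K_iso A X' (K_dsum (map (quot_K R J) Xs))"
proof -
 have main: "K_iso A (quot_K R J (K_dsum Xs)) (K_dsum (map (quot_K R J) Xs))" using assms(1)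
 proof (induction Xs)
  case Nil
  let ?N = "K_dsum ([] :: ('a, 'x) two_term list)"
  have c: "cplx R ?N" by (rule K_dsum_cplx[OF ring_axioms]) simp
  note b = quot_K_BCK[OF c]
  show ?case unfolding list.map
   by (rule kzero_iso[OF BCKD(2)[OF b] K_dsum_cplx[OF A.ring_axioms] BCK_kzero[OF b kzero_K_dsum_Nil[OF ring_axioms]] kzero_K_dsum_Nil[OF A.ring_axioms]]) simp
 next
  case (Cons Y Ys)
  have Y: "cplx R Y" and Ys: "\<And>Z. Z \<in> set Ys ==> cplx R Z" using Cons.prems by simp_all
  have D: "cplx R (K_dsum Ys)" by (rule K_dsum_cplx[OF ring_axioms Ys])
  have D': "cplx R (K_dsum (Y # Ys))" by (rule K_dsum_cplx[OF ring_axioms Cons.prems])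
  have "kbip R (K_dsum (Y # Ys)) Y (K_dsum Ys)" by (rule kbip_K_dsum[OF ring_axioms Y Ys])
  note k = BCK_kbip[OF quot_K_BCK[OF D'] quot_K_BCK[OF Y] quot_K_BCK[OF D] this]
  note qD' = BCKD(2)[OF quot_K_BCK[OF D']] and qY = BCKD(2)[OF quot_K_BCK[OF Y]] and qD = BCKD(2)[OF quot_K_BCK[OF D]]
  have qs: "cplx A Z" if "Z \<in> set (map (quot_K R J) Ys)" for Z
  proof -
   obtain W where "W \<in> set Ys" "Z = quot_K R J W" using \<open>Z \<in> set (map (quot_K R J) Ys)\<close> by auto
   thus ?thesis using BCKD(2)[OF quot_K_BCK[OF Ys]] by simp
  qed
  have cm: "cplx A (K_dsum (map (quot_K R J) Ys))" by (rule K_dsum_cplx[OF A.ring_axioms qs])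
  have cm': "cplx A (K_dsum (quot_K R J Y # map (quot_K R J) Ys))"
   by (rule K_dsum_cplx[OF A.ring_axioms]) (use qY qs in auto)
  note k' = kbip_cong_right[OF qD' qY qD cm k Cons.IH[OF Ys]]
  show ?case unfolding list.map
   by (rule kbip_unique[OF qD' qY cm cm' k' kbip_K_dsum[OF A.ring_axioms qY qs]])
 qed
 have D: "cplx R (K_dsum Xs)" by (rule K_dsum_cplx[OF ring_axioms assms(1)])
 have "cplx A Z" if "Z \<in> set (map (quot_K R J) Xs)" for Z
 proof -
  obtain W where "W \<in> set Xs" "Z = quot_K R J W" using \<open>Z \<in> set (map (quot_K R J) Xs)\<close> by auto
  thus ?thesis using BCKD(2)[OF quot_K_BCK[OF assms(1)]] by simp
 qed
 hence "cplx A (K_dsum (map (quot_K R J) Xs))" by (rule K_dsum_cplx[OF A.ring_axioms])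
 thus ?thesis
  using K_iso_trans[OF BCKD(2)[OF assms(2)] BCKD(2)[OF quot_K_BCK[OF D]] _ BCK_K_iso[OF assms(2) quot_K_BCK[OF D] assms(3)] main] by blast
qed

text \<open>An indecomposable Y over A lifts to a complex X. Decomposing X and extending scalars
  exhibits Y as a sum of images of indecomposables, so Y is isomorphic to one of these
  images.\<close>

lemma finite_ind_K_A:
 assumes es: "complete_primitive_idempotents R es" and fs: "complete_primitive_idempotents A fs" and fin: "finite (ind_K R)"
 shows "finite (ind_K A)"
proof (rule finite_subset[OF _ finite_imageI[OF fin]])
 \<comment> \<open>The isomorphism class of the image of V. It may fail to be indecomposable, but
   these finitely many classes exhaust \<open>ind_K A\<close>.\<close>
 let ?c = "\<lambda>V. {Y :: ('a set, nat => 'a set) two_term. two_term_proj A Y \<and> K_iso A (quot_K R J (K_rep V)) Y}"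
 show "ind_K A \<subseteq> ?c ` ind_K R"
 proof
  fix W assume "W \<in> ind_K A"
  then obtain Y where Y: "W = K_class A Y" "indec_K A Y" unfolding ind_K_def by blast
  have pY: "two_term_proj A Y" using Y(2) by (simp add: indec_K_def)
  obtain X :: "('a, nat => 'a) two_term" and \<eta> where X: "two_term_proj R X" "BCK X Y \<eta>" by (rule two_term_lift[OF es fs pY])
  obtain Xs :: "('a, nat => 'a) two_term list" where Xs: "\<forall>Z\<in>set Xs. indec_K R Z \<and> cloc R Z" "K_iso R X (K_dsum Xs)"
   using K_decomposition_exists[OF X(1)] by blast
  have pXs: "two_term_proj R Z" if "Z \<in> set Xs" for Z using Xs that by (simp add: indec_K_def)
  have "K_iso A Y (K_dsum (map (quot_K R J) Xs))" by (rule K_iso_quot_dsum[OF ttp_cplx[OF pXs] X(2) Xs(2)])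
  hence "\<exists>Z\<in>set (map (quot_K R J) Xs). K_iso A Y Z"
   by (rule A.indec_K_summand[OF Y(2), rotated]) (use quot_K_two_term_proj[OF pXs] in auto)
  then obtain Z where Z: "Z \<in> set Xs" "K_iso A Y (quot_K R J Z)" by auto
  have iZ: "indec_K R Z" using Xs(1) Z(1) by blast
  note c = indec_K_class[OF iZ]
  let ?V = "K_class R Z"
  note r = K_rep_in[OF c(1)]
  have pr: "two_term_proj R (K_rep ?V)" by (rule ind_K_two_term_proj[OF c(1) r])
  have "K_iso A (quot_K R J Z) (quot_K R J (K_rep ?V))"
   by (rule BCK_K_iso[OF quot_K_BCK[OF ttp_cplx[OF pXs[OF Z(1)]]] quot_K_BCK[OF ttp_cplx[OF pr]] ind_K_iso[OF c(1) c(2) r]])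
  hence i: "K_iso A Y (quot_K R J (K_rep ?V))"
   by (rule K_iso_trans[OF ttp_cplx[OF pY] ttp_cplx[OF quot_K_two_term_proj[OF pXs[OF Z(1)]]]
      ttp_cplx[OF quot_K_two_term_proj[OF pr]] Z(2)])
  note cY = ttp_cplx[OF pY] and cQ = ttp_cplx[OF quot_K_two_term_proj[OF pr]]
  have "W = ?c ?V"
  proof (intro equalityI subsetI)
   fix T assume "T \<in> W"
   hence T: "two_term_proj A T" "K_iso A Y T" unfolding Y(1) K_class_def by blast+
   show "T \<in> ?c ?V" using T(1) K_iso_trans[OF cQ cY ttp_cplx[OF T(1)] K_iso_sym[OF cY cQ i] T(2)] by blast
  next
   fix T assume "T \<in> ?c ?V"
   hence T: "two_term_proj A T" "K_iso A (quot_K R J (K_rep ?V)) T" by blast+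
   show "T \<in> W" unfolding Y(1) K_class_def using T(1) K_iso_trans[OF cY cQ ttp_cplx[OF T(1)] i T(2)] by blast
  qed
  thus "W \<in> ?c ` ind_K R" using c(1) by blast
 qed
qed

text \<open>The exponent involves three Hom dimensions, out of H^0 and out of the two terms of the
  complex; each is transported by adjunction.\<close>

lemma expo_quot:
 assumes X: "two_term_proj R X" and M: "fd_right_module A M" and N: "right_submodule A M N"
 shows "expo X (rs M) N = A.expo (quot_K R J X) M N"
proof -
 note b = quot_K_BCK[OF ttp_cplx[OF X]]
 obtain \<theta> where t: "BC (H0 X) (H0 (quot_K R J X)) \<theta>" using BCK_H0[OF b] by blast
 note h = BC_hom_dim[OF t fd_H0[OF X] M]
 note h0 = BC_hom_dim[OF BCKD(4)[OF b] fd_two_term(2)[OF X] A.fd_submodule[OF M N]]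
 note h1 = BC_hom_dim[OF BCKD(3)[OF b] fd_two_term(1)[OF X] A.fd_submodule[OF M N]]
 show ?thesis unfolding expo_def A.expo_def chi_def A.chi_def h h0 h1 rs_sub_module ..
qed

text \<open>Since \<open>es\<close> and \<open>fs\<close> are unrelated, the two dimension vectors
  are expressed through each other: an indecomposable projective over A lifts to a projective over
  the big algebra, and one over the big algebra reduces to a projective over A. Adjunction then
  writes each entry as a fixed linear combination of the entries of the other vector.\<close>

lemma dim_vector_eq_iff:
 assumes es: "complete_primitive_idempotents R es" and fs: "complete_primitive_idempotents A fs"
  and M: "fd_right_module A M" and N: "right_submodule A M N" "right_submodule A M N'"
 shows "dim_vector R es (rs M) N = dim_vector R es (rs M) N' \<longleftrightarrow> dim_vector A fs M N = dim_vector A fs M N'"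
proof
 note M' = fd_rs[OF M]
 have N': "right_submodule R (rs M) N" "right_submodule R (rs M) N'" using N by (simp_all add: right_submodule_rs)
 {
  assume e: "dim_vector R es (rs M) N = dim_vector R es (rs M) N'"
  show "dim_vector A fs M N = dim_vector A fs M N'"
  proof
   fix i
   show "dim_vector A fs M N i = dim_vector A fs M N' i"
   proof (cases "i < length fs")
    case True
    hence "primitive_idempotent A (fs ! i)" using fs by (auto simp: complete_primitive_idempotents_def)
    then obtain P :: "('a, nat => 'a) module" and \<eta> where P: "fg_projective R P" "BC P (idem_proj A (fs ! i)) \<eta>"
     using liftable_idem_proj[OF es] unfolding liftable_def by blast
    have "dim_vector A fs M K i = (\<Sum>k<length es. count_list (proj_decomposition R es P) k * dim_vector R es (rs M) K k)"
     if K: "right_submodule A M K" "right_submodule R (rs M) K" for K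
     unfolding A.dim_vector_hom[OF fs M K(1) True] BC_hom_dim[OF P(2) fd_projective[OF P(1)] A.fd_submodule[OF M K(1)]] rs_sub_module
      hom_dim_projective[OF es P(1) fd_submodule[OF M' K(2)]]
     by (rule sum.cong[OF refl]) (simp add: dim_vector_hom[OF es M' K(2)])
    thus ?thesis using N N' e by simp
   qed (simp add: dim_vector_def)
  qed
 }
 {
  assume e: "dim_vector A fs M N = dim_vector A fs M N'"
  show "dim_vector R es (rs M) N = dim_vector R es (rs M) N'"
  proof
   fix i
   show "dim_vector R es (rs M) N i = dim_vector R es (rs M) N' i"
   proof (cases "i < length es")
    case True
    note ie = complete_idempotents[OF es True]
    note P = idem_proj_facts(4)[OF ie] and b = BC_idem_proj[OF ie]
    note Q = BC_projective[OF b P]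
    have "dim_vector R es (rs M) K i = (\<Sum>k<length fs. count_list (proj_decomposition A fs (idem_proj A (\<rho> (es ! i)))) k * dim_vector A fs M K k)"
     if K: "right_submodule A M K" "right_submodule R (rs M) K" for K
     unfolding dim_vector_hom[OF es M' K(2) True] rs_sub_module[symmetric] BC_hom_dim[OF b fd_projective[OF P] A.fd_submodule[OF M K(1)], symmetric]
      A.hom_dim_projective[OF fs Q A.fd_submodule[OF M K(1)]]
     by (rule sum.cong[OF refl]) (simp add: A.dim_vector_hom[OF fs M K(1)])
    thus ?thesis using N N' e by simp
   qed (simp add: dim_vector_def)
  qed
 }
qed

end

section \<open>Polynomial rings, substitution and the ring of relations\<close>

definition poly_carrier :: "'v set => 'v cpoly set" where
 "poly_carrier I = {p. \<forall>m\<in>Poly_Mapping.keys p. Poly_Mapping.keys m \<subseteq> I}"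

lemma poly_ring_simps:
 "car (poly_ring I) = poly_carrier I" "x \<otimes>\<^bsub>poly_ring I\<^esub> y = x * y" "\<one>\<^bsub>poly_ring I\<^esub> = 1"
 "\<zero>\<^bsub>poly_ring I\<^esub> = 0" "x \<oplus>\<^bsub>poly_ring I\<^esub> y = x + y"
 by (simp_all add: poly_ring_def poly_carrier_def)

lemma poly_carrier_zero: "0 \<in> poly_carrier I" by (simp add: poly_carrier_def)

lemma poly_carrier_add:
 assumes "p \<in> poly_carrier I" "q \<in> poly_carrier I"
 shows "p + q \<in> poly_carrier I" using assms keys_add[of p q] unfolding poly_carrier_def by blast

lemma poly_carrier_uminus: "p \<in> poly_carrier I ==> - p \<in> poly_carrier I"
 by (simp add: poly_carrier_def)

lemma poly_carrier_mult:
 assumes "p \<in> poly_carrier I" "q \<in> poly_carrier I"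
 shows "p * q \<in> poly_carrier I" unfolding poly_carrier_def
proof (intro CollectI ballI)
 fix m assume "m \<in> Poly_Mapping.keys (p * q)"
 then obtain a b where ab: "m = a + b" "a \<in> Poly_Mapping.keys p" "b \<in> Poly_Mapping.keys q" using keys_mult[of p q] by blast
 have "Poly_Mapping.keys a \<subseteq> I" "Poly_Mapping.keys b \<subseteq> I" using ab assms by (auto simp: poly_carrier_def)
 thus "Poly_Mapping.keys m \<subseteq> I" unfolding ab(1) using keys_add[of a b] by blast
qed

lemma poly_carrier_const: "poly_const c \<in> poly_carrier I"
 by (simp add: poly_carrier_def poly_const_def)

lemma poly_const_one: "poly_const 1 = 1" by (simp add: poly_const_def)

lemma poly_carrier_one: "1 \<in> poly_carrier I"
 using poly_carrier_const[of 1] by (simp add: poly_const_one)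

lemma poly_carrier_var: "v \<in> I ==> poly_var v \<in> poly_carrier I"
 by (simp add: poly_carrier_def poly_var_def)

lemma poly_carrier_power: "p \<in> poly_carrier I ==> p ^ n \<in> poly_carrier I"
 by (induction n) (simp_all add: poly_carrier_one poly_carrier_mult)

lemma poly_carrier_prod: "(\<And>i. i \<in> S ==> f i \<in> poly_carrier I) ==> prod f S \<in> poly_carrier I"
 by (induction S rule: infinite_finite_induct) (simp_all add: poly_carrier_one poly_carrier_mult)

lemma poly_carrier_sum: "(\<And>i. i \<in> S ==> f i \<in> poly_carrier I) ==> sum f S \<in> poly_carrier I"
 by (induction S rule: infinite_finite_induct) (simp_all add: poly_carrier_zero poly_carrier_add)

lemma of_int_poly_const: "of_int k = poly_const (of_int k)" by (simp add: poly_const_def)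

lemma poly_ring_cring: "cring (poly_ring I)"
proof (rule cringI)
 show "abelian_group (poly_ring I)"
 proof (rule abelian_groupI)
  fix x assume "x \<in> car (poly_ring I)"
  thus "\<exists>y\<in>car (poly_ring I). y \<oplus>\<^bsub>poly_ring I\<^esub> x = \<zero>\<^bsub>poly_ring I\<^esub>"
   by (intro bexI[of _ "- x"]) (simp_all add: poly_ring_simps poly_carrier_uminus)
 qed (simp_all add: poly_ring_simps poly_carrier_zero poly_carrier_add algebra_simps)
 show "comm_monoid (poly_ring I)"
  by (rule comm_monoidI) (simp_all add: poly_ring_simps poly_carrier_one poly_carrier_mult algebra_simps)
qed (simp add: poly_ring_simps algebra_simps)

definition mono_eval :: "('u => 'v cpoly) => ('u \<Rightarrow>\<^sub>0 nat) => 'v cpoly" where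
 "mono_eval g m = (\<Prod>v\<in>Poly_Mapping.keys m. g v ^ Poly_Mapping.lookup m v)"

definition poly_eval :: "('u => 'v cpoly) => 'u cpoly => 'v cpoly" where
 "poly_eval g p = (\<Sum>m\<in>Poly_Mapping.keys p. poly_const (Poly_Mapping.lookup p m) * mono_eval g m)"

lemma mono_eval_superset:
 assumes "finite S" "Poly_Mapping.keys m \<subseteq> S"
 shows "mono_eval g m = (\<Prod>v\<in>S. g v ^ Poly_Mapping.lookup m v)" unfolding mono_eval_def
 by (rule prod.mono_neutral_left[OF assms]) (simp add: in_keys_iff)

lemma mono_eval_add: "mono_eval g (m + n) = mono_eval g m * mono_eval g n"
proof -
 let ?S = "Poly_Mapping.keys m \<union> Poly_Mapping.keys n"
 have S: "finite ?S" by simp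
 have 1: "mono_eval g (m + n) = (\<Prod>v\<in>?S. g v ^ Poly_Mapping.lookup (m + n) v)"
  by (rule mono_eval_superset[OF S keys_add])
 have 2: "mono_eval g m = (\<Prod>v\<in>?S. g v ^ Poly_Mapping.lookup m v)" "mono_eval g n = (\<Prod>v\<in>?S. g v ^ Poly_Mapping.lookup n v)"
  by (rule mono_eval_superset[OF S]; simp)+
 show ?thesis unfolding 1 2 prod.distrib[symmetric] by (simp add: lookup_add power_add)
qed

text \<open>Lets two polynomials with different supports be evaluated over a common index set, as
  \<open>poly_eval_add\<close> requires.\<close>

lemma poly_eval_superset:
 assumes "finite S" "Poly_Mapping.keys p \<subseteq> S"
 shows "poly_eval g p = (\<Sum>m\<in>S. poly_const (Poly_Mapping.lookup p m) * mono_eval g m)"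
 unfolding poly_eval_def
 by (rule sum.mono_neutral_left[OF assms]) (simp add: in_keys_iff poly_const_def)

lemma poly_const_add: "poly_const (a + b) = poly_const a + poly_const b"
 by (simp add: poly_const_def single_add)

lemma poly_const_mult: "poly_const (a * b) = poly_const a * poly_const b"
 by (simp add: poly_const_def mult_single)

lemma poly_eval_add: "poly_eval g (p + q) = poly_eval g p + poly_eval g q"
proof -
 let ?S = "Poly_Mapping.keys p \<union> Poly_Mapping.keys q"
 have S: "finite ?S" by simp
 have 1: "poly_eval g (p + q) = (\<Sum>m\<in>?S. poly_const (Poly_Mapping.lookup (p + q) m) * mono_eval g m)"
  by (rule poly_eval_superset[OF S keys_add])
 have 2: "poly_eval g p = (\<Sum>m\<in>?S. poly_const (Poly_Mapping.lookup p m) * mono_eval g m)"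
  "poly_eval g q = (\<Sum>m\<in>?S. poly_const (Poly_Mapping.lookup q m) * mono_eval g m)"
  by (rule poly_eval_superset[OF S]; simp)+
 show ?thesis unfolding 1 2 sum.distrib[symmetric] by (simp add: lookup_add poly_const_add distrib_right)
qed

lemma poly_eval_zero: "poly_eval g 0 = 0" by (simp add: poly_eval_def)

lemma poly_eval_sum: "poly_eval g (\<Sum>i\<in>S. f i) = (\<Sum>i\<in>S. poly_eval g (f i))"
 by (induction S rule: infinite_finite_induct) (simp_all add: poly_eval_zero poly_eval_add)

lemma poly_eval_single: "poly_eval g (Poly_Mapping.single m c) = poly_const c * mono_eval g m"
 using poly_eval_superset[of "{m}" "Poly_Mapping.single m c" g] by simp

text \<open>Both factors are expanded into monomials, for which multiplicativity is
  \<open>mono_eval_add\<close>.\<close>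

lemma poly_eval_mult:
 fixes p q :: "'u cpoly"
 shows "poly_eval g (p * q) = poly_eval g p * poly_eval g q"
proof -
 let ?s = "\<lambda>(p :: 'u cpoly) m. Poly_Mapping.single m (Poly_Mapping.lookup p m)"
 have e: "p = (\<Sum>m\<in>Poly_Mapping.keys p. ?s p m)" for p :: "'u cpoly"
  by (rule poly_mapping_eqI) (simp add: lookup_sum lookup_single when_def in_keys_iff)
 have "p * q = (\<Sum>m\<in>Poly_Mapping.keys p. \<Sum>n\<in>Poly_Mapping.keys q. ?s p m * ?s q n)"
  by (subst e[of p], subst e[of q]) (simp add: sum_product)
 hence "poly_eval g (p * q) = (\<Sum>m\<in>Poly_Mapping.keys p. \<Sum>n\<in>Poly_Mapping.keys q. poly_eval g (?s p m * ?s q n))"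
  by (simp add: poly_eval_sum)
 also have "\<dots> = (\<Sum>m\<in>Poly_Mapping.keys p. \<Sum>n\<in>Poly_Mapping.keys q. poly_eval g (?s p m) * poly_eval g (?s q n))"
  by (simp add: mult_single poly_eval_single mono_eval_add poly_const_mult algebra_simps)
 also have "\<dots> = (\<Sum>m\<in>Poly_Mapping.keys p. poly_eval g (?s p m)) * (\<Sum>n\<in>Poly_Mapping.keys q. poly_eval g (?s q n))"
  by (simp add: sum_product)
 also have "\<dots> = poly_eval g p * poly_eval g q"
  unfolding poly_eval_single poly_eval_def[of g p] poly_eval_def[of g q] ..
 finally show ?thesis .
qed

lemma poly_eval_const: "poly_eval g (poly_const c) = poly_const c"
 using poly_eval_single[of g 0 c] by (simp add: poly_const_def mono_eval_def)

lemma poly_eval_one: "poly_eval g 1 = 1" using poly_eval_const[of g 1] by (simp add: poly_const_one)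

lemma poly_eval_of_int: "poly_eval g (of_int k) = of_int k"
 unfolding of_int_poly_const by (rule poly_eval_const)

lemma poly_eval_power: "poly_eval g (p ^ n) = poly_eval g p ^ n"
 by (induction n) (simp_all add: poly_eval_one poly_eval_mult)

lemma poly_eval_prod: "poly_eval g (\<Prod>i\<in>S. f i) = (\<Prod>i\<in>S. poly_eval g (f i))"
 by (induction S rule: infinite_finite_induct) (simp_all add: poly_eval_one poly_eval_mult)

lemma poly_eval_var: "poly_eval g (poly_var v) = g v"
 using poly_eval_single[of g "Poly_Mapping.single v 1" 1] by (simp add: poly_var_def mono_eval_def poly_const_one)

lemma poly_eval_carrier:
 assumes "\<And>v. g v \<in> poly_carrier I"
 shows "poly_eval g p \<in> poly_carrier I" unfolding poly_eval_def mono_eval_def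
 by (intro poly_carrier_sum poly_carrier_mult poly_carrier_const poly_carrier_prod poly_carrier_power assms)

lemma F_hat_carrier: "F_hat R es M \<in> poly_carrier (ind_K R)"
 unfolding F_hat_def of_int_poly_const
 by (intro poly_carrier_sum poly_carrier_mult poly_carrier_const poly_carrier_prod poly_carrier_power poly_carrier_var)

lemma R_facts:
 shows R_ideal_ideal: "ideal (R_ideal R es) (poly_ring (ind_K R))"
  and R_ideal_gen: "X \<in> ind_K R ==> F_hat R es (H0 (K_rep X)) - 1 \<in> R_ideal R es"
  and R_tilde_cring: "cring (R_tilde R es)"
  and R_class_hom: "R_class R es \<in> Ring.ring_hom (poly_ring (ind_K R)) (R_tilde R es)"
  and R_class_zero: "p \<in> R_ideal R es ==> R_class R es p = \<zero>\<^bsub>R_tilde R es\<^esub>"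
  and R_tilde_carrier: "car (R_tilde R es) = R_class R es ` poly_carrier (ind_K R)"
proof -
 interpret P: cring "poly_ring (ind_K R)" by (rule poly_ring_cring)
 let ?S = "{F_hat R es (H0 (K_rep X)) - 1 | X. X \<in> ind_K R}"
 have "f - 1 \<in> poly_carrier I" if "f \<in> poly_carrier I" for f :: "'b cpoly" and I
  using poly_carrier_add[OF that poly_carrier_uminus[OF poly_carrier_one]] by simp
 hence S: "?S \<subseteq> car (poly_ring (ind_K R))" unfolding poly_ring_simps using F_hat_carrier by blast
 show i: "ideal (R_ideal R es) (poly_ring (ind_K R))" unfolding R_ideal_def by (rule P.genideal_ideal[OF S])
 then interpret I: ideal "R_ideal R es" "poly_ring (ind_K R)" .
 show "F_hat R es (H0 (K_rep X)) - 1 \<in> R_ideal R es" if "X \<in> ind_K R"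
  unfolding R_ideal_def using P.genideal_self[OF S] that by blast
 show "cring (R_tilde R es)" unfolding R_tilde_def by (rule I.quotient_is_cring[OF P.cring_axioms])
 show "R_class R es \<in> Ring.ring_hom (poly_ring (ind_K R)) (R_tilde R es)"
  unfolding R_tilde_def using I.rcos_ring_hom by (simp add: R_class_def[abs_def])
 show "R_class R es p = \<zero>\<^bsub>R_tilde R es\<^esub>" if "p \<in> R_ideal R es"
  unfolding R_class_def R_tilde_def FactRing_def using I.a_rcos_const[OF that] by simp
 show "car (R_tilde R es) = R_class R es ` poly_carrier (ind_K R)"
  unfolding R_tilde_def FactRing_def by (auto simp: A_RCOSETS_def' R_class_def poly_ring_simps)
qed

lemma R_class_simps:
 assumes "p \<in> poly_carrier (ind_K R)" "q \<in> poly_carrier (ind_K R)"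
 shows "R_class R es p \<in> car (R_tilde R es)"
  and "R_class R es (p * q) = R_class R es p \<otimes>\<^bsub>R_tilde R es\<^esub> R_class R es q"
  and "R_class R es (p + q) = R_class R es p \<oplus>\<^bsub>R_tilde R es\<^esub> R_class R es q"
  and "R_class R es 1 = \<one>\<^bsub>R_tilde R es\<^esub>"
 using ring_hom_closed[OF R_class_hom] ring_hom_mult[OF R_class_hom] ring_hom_add[OF R_class_hom] ring_hom_one[OF R_class_hom] assms
 by (simp_all add: poly_ring_simps)

lemma R_class_prod:
 assumes f: "\<And>i. i \<in> S ==> f i \<in> poly_carrier (ind_K R)"
 shows "R_class R es (\<Prod>i\<in>S. f i ^ n i) = (\<Otimes>\<^bsub>R_tilde R es\<^esub>i\<in>S. R_class R es (f i) [^]\<^bsub>R_tilde R es\<^esub> n i)"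
proof -
 interpret R: cring "R_tilde R es" by (rule R_tilde_cring)
 have pw: "R_class R es (p ^ k) = R_class R es p [^]\<^bsub>R_tilde R es\<^esub> k" if p: "p \<in> poly_carrier (ind_K R)" for p and k :: nat
 proof (induction k)
  case 0
  show ?case using R_class_simps(4)[OF p p] by simp
 next
  case (Suc k)
  have "R_class R es (p ^ Suc k) = R_class R es (p ^ k) \<otimes>\<^bsub>R_tilde R es\<^esub> R_class R es p"
   unfolding power_Suc2 by (rule R_class_simps(2)[OF poly_carrier_power[OF p] p])
  thus ?case using Suc by simp
 qed
 show ?thesis using f
 proof (induction S rule: infinite_finite_induct)
  case (infinite S)
  thus ?case using R_class_simps(4)[OF poly_carrier_one poly_carrier_one] by simp
 next
  case empty
  thus ?case using R_class_simps(4)[OF poly_carrier_one poly_carrier_one] by simp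
 next
  case (insert i S)
  have c: "f i \<in> poly_carrier (ind_K R)" "\<And>j. j \<in> S ==> f j \<in> poly_carrier (ind_K R)" using insert.prems by simp_all
  have p: "(\<Prod>j\<in>S. f j ^ n j) \<in> poly_carrier (ind_K R)" by (intro poly_carrier_prod poly_carrier_power c(2))
  have 1: "(\<lambda>j. R_class R es (f j) [^]\<^bsub>R_tilde R es\<^esub> n j) \<in> S \<rightarrow> car (R_tilde R es)"
   using R_class_simps(1)[OF c(2) c(2)] by simp
  have 2: "R_class R es (f i) [^]\<^bsub>R_tilde R es\<^esub> n i \<in> car (R_tilde R es)" using R_class_simps(1)[OF c(1) c(1)] by simp
  show ?case
   unfolding prod.insert[OF insert.hyps] R_class_simps(2)[OF poly_carrier_power[OF c(1)] p] R.finprod_insert[OF insert.hyps 1 2]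
    pw[OF c(1)] using insert.IH[OF c(2)] by simp
 qed
qed

section \<open>The substitution and the induced ring map\<close>

context quotient_setting
begin

definition var_image :: "'a set K_class => 'a K_class cpoly" where
 "var_image W = (\<Prod>V\<in>ind_K R. poly_var V ^ K_mult A (quot_K R J (K_rep V)) W)"

text \<open>After interchanging the two products, the exponent of u_V is the sum over W of the
  multiplicity of W in the image of V times the exponent of W. By \<open>expo_K_mult\<close> this is
  the exponent of the image of V, and by \<open>expo_quot\<close> that of V.\<close>

lemma prod_var_image:
 assumes es: "complete_primitive_idempotents R es" and fs: "complete_primitive_idempotents A fs"
  and M: "fd_right_module A M" and N: "right_submodule A M N"
 shows "(\<Prod>W\<in>ind_K A. var_image W ^ nat (A.expo (K_rep W) M N)) = (\<Prod>V\<in>ind_K R. poly_var V ^ nat (expo (K_rep V) (rs M) N))"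
proof (cases "finite (ind_K R)")
 case False
 \<comment> \<open>A product over an infinite index set is 1 by convention, so every
   \<open>var_image\<close> is 1 here, and so are both sides.\<close>
 thus ?thesis by (simp add: var_image_def)
next
 case True
 note fin = finite_ind_K_A[OF es fs True]
 let ?m = "\<lambda>V W. K_mult A (quot_K R J (K_rep V)) W" and ?e = "\<lambda>W. nat (A.expo (K_rep W) M N)"
 have "(\<Prod>W\<in>ind_K A. var_image W ^ ?e W) = (\<Prod>W\<in>ind_K A. \<Prod>V\<in>ind_K R. poly_var V ^ (?m V W * ?e W))"
  by (simp add: var_image_def prod_power_distrib power_mult)
 also have "\<dots> = (\<Prod>V\<in>ind_K R. \<Prod>W\<in>ind_K A. poly_var V ^ (?m V W * ?e W))" by (rule prod.swap)
 also have "\<dots> = (\<Prod>V\<in>ind_K R. poly_var V ^ (\<Sum>W\<in>ind_K A. ?m V W * ?e W))" by (simp add: power_sum)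
 also have "\<dots> = (\<Prod>V\<in>ind_K R. poly_var V ^ nat (expo (K_rep V) (rs M) N))"
 proof (rule prod.cong[OF refl])
  fix V assume V: "V \<in> ind_K R"
  have p: "two_term_proj R (K_rep V)" by (rule ind_K_two_term_proj[OF V K_rep_in[OF V]])
  have nn: "0 \<le> A.expo (K_rep W) M N" if W: "W \<in> ind_K A" for W
   by (rule A.expo_nonneg[OF A.ind_K_two_term_proj[OF W A.K_rep_in[OF W]] M N])
  have "expo (K_rep V) (rs M) N = A.expo (quot_K R J (K_rep V)) M N" by (rule expo_quot[OF p M N])
  also have "\<dots> = (\<Sum>W\<in>ind_K A. int (?m V W) * A.expo (K_rep W) M N)"
   by (rule A.expo_K_mult[OF fin quot_K_two_term_proj[OF p] M N])
  also have "\<dots> = int (\<Sum>W\<in>ind_K A. ?m V W * ?e W)"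
   unfolding of_nat_sum by (rule sum.cong[OF refl]) (simp add: nn)
  finally have e: "expo (K_rep V) (rs M) N = int (\<Sum>W\<in>ind_K A. ?m V W * ?e W)" .
  show "poly_var V ^ (\<Sum>W\<in>ind_K A. ?m V W * ?e W) = poly_var V ^ nat (expo (K_rep V) (rs M) N)" unfolding e nat_int ..
 qed
 finally show ?thesis .
qed

text \<open>The sums range over dimension vectors for \<open>fs\<close> and for \<open>es\<close>.
  By \<open>dim_vector_eq_iff\<close> these are in bijection so that corresponding vectors have the
  same submodules, and the terms are matched along this bijection.\<close>

lemma poly_eval_F_hat:
 assumes es: "complete_primitive_idempotents R es" and fs: "complete_primitive_idempotents A fs"
  and M: "fd_right_module A M"
 shows "poly_eval var_image (F_hat A fs M) = F_hat R es (rs M)"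
proof -
 note M' = fd_rs[OF M]
 let ?DA = "{d. submodules_of_dim A fs M d \<noteq> {}}" and ?DL = "{d. submodules_of_dim R es (rs M) d \<noteq> {}}"
 \<comment> \<open>One submodule for each dimension vector that occurs; exponents and the bijection
   are expressed through it.\<close>
 define N where "N d = (SOME N. N \<in> submodules_of_dim A fs M d)" for d
 have N: "N d \<in> submodules_of_dim A fs M d" if "submodules_of_dim A fs M d \<noteq> {}" for d
  unfolding N_def using that by (rule some_in_eq[THEN iffD2])
 have Nd: "right_submodule A M (N d)" "dim_vector A fs M (N d) = d" if "d \<in> ?DA" for d
  using N[of d] that by (auto simp: submodules_of_dim_def)
 \<comment> \<open>Reads the dimension vector of the same submodule with respect to
   \<open>es\<close> instead of \<open>fs\<close>.\<close>
 define \<theta> where "\<theta> d = dim_vector R es (rs M) (N d)" for d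
 note iff = dim_vector_eq_iff[OF es fs M]
 have sub: "submodules_of_dim R es (rs M) (\<theta> d) = submodules_of_dim A fs M d" if d: "d \<in> ?DA" for d
 proof (rule Set.set_eqI)
  fix K
  show "K \<in> submodules_of_dim R es (rs M) (\<theta> d) \<longleftrightarrow> K \<in> submodules_of_dim A fs M d"
   using iff[of K "N d"] Nd[OF d] by (auto simp: submodules_of_dim_def right_submodule_rs \<theta>_def)
 qed
 have bij: "bij_betw \<theta> ?DA ?DL" unfolding bij_betw_def
 proof
  show inj: "inj_on \<theta> ?DA"
  proof (rule inj_onI)
   fix d d' assume d: "d \<in> ?DA" and d': "d' \<in> ?DA" and e: "\<theta> d = \<theta> d'"
   have "dim_vector A fs M (N d) = dim_vector A fs M (N d')" using e iff[OF Nd(1)[OF d] Nd(1)[OF d']] by (simp add: \<theta>_def)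
   thus "d = d'" unfolding Nd(2)[OF d] Nd(2)[OF d'] .
  qed
  show "\<theta> ` ?DA = ?DL"
  proof (intro equalityI subsetI)
   fix e assume "e \<in> \<theta> ` ?DA"
   then obtain d where d: "d \<in> ?DA" "e = \<theta> d" by blast
   thus "e \<in> ?DL" using sub[OF d(1)] by simp
  next
   fix e assume "e \<in> ?DL"
   then obtain K where K: "right_submodule A M K" "dim_vector R es (rs M) K = e" by (auto simp: submodules_of_dim_def right_submodule_rs)
   let ?d = "dim_vector A fs M K"
   have d: "?d \<in> ?DA" using K(1) by (auto simp: submodules_of_dim_def)
   have "\<theta> ?d = e" using iff[OF Nd(1)[OF d] K(1)] Nd(2)[OF d] K(2) by (simp add: \<theta>_def)
   thus "e \<in> \<theta> ` ?DA" using d by blast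
  qed
 qed
 \<comment> \<open>Both coordinate sums equal the dimension of the submodule, so the two
   Grassmannians are subspaces of the same ambient space cut out by the same set.\<close>
 have Gr: "Gr R es (rs M) (\<theta> d) = Gr A fs M d" if d: "d \<in> ?DA" for d
 proof -
  have n: "right_submodule R (rs M) (N d)" using Nd(1)[OF d] by (simp add: right_submodule_rs)
  have "(\<Sum>i<length es. \<theta> d i) = mdim (sub_module (rs M) (N d))" unfolding \<theta>_def by (rule sum_dim_vector[OF es M' n])
  also have "\<dots> = A.mdim (A.sub_module M (N d))" unfolding mdim_def A.mdim_def rs_sub_module[symmetric] cspace_rs ..
  also have "\<dots> = (\<Sum>i<length fs. d i)" using A.sum_dim_vector[OF fs M Nd(1)[OF d]] unfolding Nd(2)[OF d] by simp
  finally show ?thesis unfolding Gr_def cspace_rs sub[OF d] by simp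
 qed
 define N' where "N' e = N (inv_into ?DA \<theta> e)" for e
 have N': "N' (\<theta> d) = N d" if "d \<in> ?DA" for d
  unfolding N'_def inv_into_f_f[OF bij_betw_imp_inj_on[OF bij] that] ..
 have N'D: "N' e \<in> submodules_of_dim R es (rs M) e" if "submodules_of_dim R es (rs M) e \<noteq> {}" for e
 proof -
  have "e \<in> \<theta> ` ?DA" using that unfolding bij_betw_imp_surj_on[OF bij] by simp
  then obtain d where d: "d \<in> ?DA" "e = \<theta> d" by blast
  show ?thesis unfolding d(2) N'[OF d(1)] sub[OF d(1)] using N d(1) by blast
 qed
 have "F_hat R es (rs M) = (\<Sum>e\<in>?DL. of_int (euler_char (Gr R es (rs M) e)) * (\<Prod>V\<in>ind_K R. poly_var V ^ nat (expo (K_rep V) (rs M) (N' e))))"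
  by (rule F_hat_expo[OF es M' N'D])
 also have "\<dots> = (\<Sum>d\<in>?DA. of_int (euler_char (Gr R es (rs M) (\<theta> d))) * (\<Prod>V\<in>ind_K R. poly_var V ^ nat (expo (K_rep V) (rs M) (N' (\<theta> d)))))"
  by (rule sum.reindex_bij_betw[OF bij, symmetric])
 also have "\<dots> = (\<Sum>d\<in>?DA. of_int (euler_char (Gr A fs M d)) * (\<Prod>W\<in>ind_K A. var_image W ^ nat (A.expo (K_rep W) M (N d))))"
 proof (rule sum.cong[OF refl])
  fix d assume d: "d \<in> ?DA"
  show "of_int (euler_char (Gr R es (rs M) (\<theta> d))) * (\<Prod>V\<in>ind_K R. poly_var V ^ nat (expo (K_rep V) (rs M) (N' (\<theta> d)))) =
   of_int (euler_char (Gr A fs M d)) * (\<Prod>W\<in>ind_K A. var_image W ^ nat (A.expo (K_rep W) M (N d)))"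
   unfolding Gr[OF d] N'[OF d] prod_var_image[OF es fs M Nd(1)[OF d]] ..
 qed
 also have "\<dots> = poly_eval var_image (\<Sum>d\<in>?DA. of_int (euler_char (Gr A fs M d)) * (\<Prod>W\<in>ind_K A. poly_var W ^ nat (A.expo (K_rep W) M (N d))))"
  by (simp add: poly_eval_sum poly_eval_mult poly_eval_of_int poly_eval_prod poly_eval_power poly_eval_var)
 also have "(\<Sum>d\<in>?DA. of_int (euler_char (Gr A fs M d)) * (\<Prod>W\<in>ind_K A. poly_var W ^ nat (A.expo (K_rep W) M (N d)))) = F_hat A fs M"
  by (rule A.F_hat_expo[OF fs M N, symmetric])
 finally show ?thesis ..
qed

text \<open>Replace the representative by a copy whose chain endomorphisms are nilpotent or
  bijective. Its H^0 is local over A, hence over the big algebra since the endomorphisms are the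
  same, and \<open>local_module_H0\<close> realises it there.\<close>

lemma F_hat_restriction:
 assumes es: "complete_primitive_idempotents R es" and W: "W \<in> ind_K A"
 shows "\<exists>V\<in>ind_K R. F_hat R es (rs (H0 (K_rep W))) = F_hat R es (H0 (K_rep V))"
proof -
 obtain Y where Y: "W = K_class A Y" "indec_K A Y" using W unfolding ind_K_def by blast
 have pY: "two_term_proj A Y" and nz: "\<not> kzero A Y"
  using Y(2) K_zero_iff[OF A.ring_axioms, of Y] by (auto simp: indec_K_def ttp_cplx)
 \<comment> \<open>If 1 = 0, all modules over A vanish and Y would be contractible.
   \<open>local_module_H0\<close> uses this inequality for the case of zero H^0.\<close>
 have "\<one> \<noteq> \<zero>"
 proof
  assume "\<one> = \<zero>"
  hence "\<one>\<^sub>A = \<zero>\<^sub>A" using \<rho>_one \<rho>_zero by simp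
  hence z: "x = \<zero>\<^sub>P" if "right_module A P" "x \<in> car P" for P :: "('a set, nat => 'a set) module" and x
   using right_module.act_one[OF that] right_module.zero_act[OF that] by simp
  note c = ttp_cplx[OF pY]
  have "ceq Y cid (czero Y)" using z[OF cplxD(1)[OF c]] z[OF cplxD(2)[OF c]] by (simp add: ceq_def czero_def)
  hence "kzero A Y" unfolding kzero_def by (rule heq_ceq[OF c c cmap_zero[OF c c]])
  thus False using nz by blast
 qed
 note nz = this
 obtain Y' :: "('a set, nat => 'a set) two_term" where Y': "indec_K A Y'" "cloc A Y'" "K_iso A Y Y'"
  by (rule A.indec_K_local_copy[OF Y(2)])
 have pY': "two_term_proj A Y'" using Y'(1) by (simp add: indec_K_def)
 have pR: "two_term_proj A (K_rep W)" by (rule A.ind_K_two_term_proj[OF W A.K_rep_in[OF W]])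
 have "K_iso A Y (K_rep W)" using A.K_rep_in[OF W] unfolding Y(1) K_class_def by blast
 note c = ttp_cplx[OF pY] ttp_cplx[OF pY'] ttp_cplx[OF pR]
 have i: "K_iso A (K_rep W) Y'"
  by (rule K_iso_trans[OF c(3,1,2) K_iso_sym[OF c(1,3) \<open>K_iso A Y (K_rep W)\<close>] Y'(3)])
 obtain F where F: "rlin A (H0 (K_rep W)) (H0 Y') F" "bij_betw F (car (H0 (K_rep W))) (car (H0 Y'))"
  by (rule H0_iso[OF c(3,2) i])
 note fR = fd_rs[OF A.fd_H0[OF pR]] and fY' = fd_rs[OF A.fd_H0[OF pY']]
 have 1: "F_hat R es (rs (H0 (K_rep W))) = F_hat R es (rs (H0 Y'))"
  by (rule F_hat_iso[OF es fR fY', of F]) (simp_all add: rlin_rs F)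
 obtain Z f where Z: "indec_K R Z" "rlin R (rs (H0 Y')) (H0 Z) f" "bij_betw f (car (rs (H0 Y'))) (car (H0 Z))"
  by (rule local_module_H0[OF fY' eloc_rs[OF eloc_H0[OF pY' Y'(2)]] nz])
 have pZ: "two_term_proj R Z" using Z(1) by (simp add: indec_K_def)
 have 2: "F_hat R es (rs (H0 Y')) = F_hat R es (H0 Z)" by (rule F_hat_iso[OF es fY' fd_H0[OF pZ] Z(2,3)])
 note k = indec_K_class[OF Z(1)]
 have pV: "two_term_proj R (K_rep (K_class R Z))" by (rule ind_K_two_term_proj[OF k(1) K_rep_in[OF k(1)]])
 obtain G where G: "rlin R (H0 Z) (H0 (K_rep (K_class R Z))) G" "bij_betw G (car (H0 Z)) (car (H0 (K_rep (K_class R Z))))"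
  by (rule H0_iso[OF ttp_cplx[OF pZ] ttp_cplx[OF pV] ind_K_iso[OF k(1) k(2) K_rep_in[OF k(1)]]])
 have "F_hat R es (H0 Z) = F_hat R es (H0 (K_rep (K_class R Z)))" by (rule F_hat_iso[OF es fd_H0[OF pZ] fd_H0[OF pV] G])
 thus ?thesis using k(1) 1 2 by auto
qed

text \<open>Substitution followed by the class map sends each generating relation over A to a
  relation over the big algebra, so it kills the ideal and induces a map on the quotient.\<close>

lemma ring_map:
 assumes es: "complete_primitive_idempotents R es" and fs: "complete_primitive_idempotents A fs"
 shows "\<exists>\<phi> \<in> Ring.ring_hom (R_tilde A fs) (R_tilde R es).
  \<forall>p\<in>poly_carrier (ind_K A). \<phi> (R_class A fs p) = R_class R es (poly_eval var_image p)"
proof -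
 let ?RA = "R_tilde A fs" and ?RL = "R_tilde R es" and ?P = "poly_ring (ind_K A)"
 interpret P: cring ?P by (rule poly_ring_cring)
 interpret RL: cring ?RL by (rule R_tilde_cring)
 have v: "var_image W \<in> poly_carrier (ind_K R)" for W
  unfolding var_image_def by (intro poly_carrier_prod poly_carrier_power poly_carrier_var)
 define h where "h p = R_class R es (poly_eval var_image p)" for p
 have hh: "h \<in> Ring.ring_hom ?P ?RL" unfolding h_def by (rule ring_hom_memI)
   (use R_class_simps[OF poly_eval_carrier poly_eval_carrier, of var_image, OF v v] in
    \<open>simp_all add: poly_ring_simps poly_eval_mult poly_eval_add poly_eval_one\<close>)
 interpret h: ring_hom_ring ?P ?RL h by (intro ring_hom_ringI2 P.ring_axioms RL.ring_axioms hh)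
 have sub: "R_ideal A fs \<subseteq> a_kernel ?P ?RL h" unfolding R_ideal_def
 proof (rule P.genideal_minimal[OF h.kernel_is_ideal])
  show "{F_hat A fs (H0 (K_rep X)) - 1 | X. X \<in> ind_K A} \<subseteq> a_kernel ?P ?RL h"
  proof
   fix p assume "p \<in> {F_hat A fs (H0 (K_rep X)) - 1 | X. X \<in> ind_K A}"
   then obtain X where X: "X \<in> ind_K A" "p = F_hat A fs (H0 (K_rep X)) - 1" by blast
   \<comment> \<open>Subtraction of 1 is rewritten as addition of a constant, to match the rules for
     \<open>poly_eval\<close>.\<close>
   have pm: "p = F_hat A fs (H0 (K_rep X)) + poly_const (- 1)" unfolding X(2) by (simp add: poly_const_def single_uminus)
   have pc: "p \<in> car ?P" unfolding pm poly_ring_simps by (intro poly_carrier_add F_hat_carrier poly_carrier_const)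
   obtain V where V: "V \<in> ind_K R" "F_hat R es (rs (H0 (K_rep X))) = F_hat R es (H0 (K_rep V))"
    using F_hat_restriction[OF es X(1)] by blast
   have "poly_eval var_image p = F_hat R es (H0 (K_rep V)) - 1"
    unfolding pm poly_eval_add poly_eval_const
     poly_eval_F_hat[OF es fs A.fd_H0[OF A.ind_K_two_term_proj[OF X(1) A.K_rep_in[OF X(1)]]]] V(2)
    by (simp add: poly_const_def single_uminus)
   hence "h p = \<zero>\<^sub>?RL" unfolding h_def using R_class_zero[OF R_ideal_gen[OF V(1)]] by simp
   with pc show "p \<in> a_kernel ?P ?RL h" unfolding a_kernel_def' by (intro CollectI conjI)
  qed
 qed
 \<comment> \<open>As h kills the ideal, it maps each coset onto a single element, which
   \<open>the_elem\<close> extracts.\<close>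
 define \<phi> where "\<phi> C = the_elem (h ` C)" for C
 interpret I: ideal "R_ideal A fs" ?P by (rule R_ideal_ideal)
 have \<phi>: "\<phi> (R_class A fs p) = h p" if p: "p \<in> poly_carrier (ind_K A)" for p
 proof -
  have "h ` R_class A fs p = {h p}"
  proof (intro equalityI subsetI)
   fix y assume "y \<in> h ` R_class A fs p"
   then obtain i where i: "i \<in> R_ideal A fs" "y = h (i \<oplus>\<^sub>?P p)" unfolding R_class_def a_r_coset_def' by blast
   have "i \<in> car ?P \<and> h i = \<zero>\<^sub>?RL" using subsetD[OF sub i(1)] unfolding a_kernel_def' by (rule CollectD)
   hence "i \<in> car ?P" "h i = \<zero>\<^sub>?RL" by (rule conjunct1, rule conjunct2)
   thus "y \<in> {h p}" using i(2) p by (simp add: poly_ring_simps(1))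
  next
   fix y assume "y \<in> {h p}"
   moreover have "p \<in> R_class A fs p" unfolding R_class_def by (rule I.a_rcos_self) (use p in \<open>simp add: poly_ring_simps\<close>)
   ultimately show "y \<in> h ` R_class A fs p" by blast
  qed
  thus ?thesis by (simp add: \<phi>_def)
 qed
 have "\<phi> \<in> Ring.ring_hom ?RA ?RL"
 proof (rule ring_hom_memI)
  fix C assume "C \<in> car ?RA"
  then obtain p where p: "p \<in> poly_carrier (ind_K A)" "C = R_class A fs p" unfolding R_tilde_carrier by (rule imageE)
  show "\<phi> C \<in> car ?RL" unfolding p(2) \<phi>[OF p(1)] using h.hom_closed[of p] p(1) by (simp add: poly_ring_simps)
  fix D assume "D \<in> car ?RA"
  then obtain q where q: "q \<in> poly_carrier (ind_K A)" "D = R_class A fs q" unfolding R_tilde_carrier by (rule imageE)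
  show "\<phi> (C \<otimes>\<^sub>?RA D) = \<phi> C \<otimes>\<^sub>?RL \<phi> D"
   unfolding p(2) q(2) R_class_simps(2)[OF p(1) q(1), symmetric] \<phi>[OF p(1)] \<phi>[OF q(1)] \<phi>[OF poly_carrier_mult[OF p(1) q(1)]]
   using ring_hom_mult[OF hh, of p q] p(1) q(1) by (simp add: poly_ring_simps)
  show "\<phi> (C \<oplus>\<^sub>?RA D) = \<phi> C \<oplus>\<^sub>?RL \<phi> D"
   unfolding p(2) q(2) R_class_simps(3)[OF p(1) q(1), symmetric] \<phi>[OF p(1)] \<phi>[OF q(1)] \<phi>[OF poly_carrier_add[OF p(1) q(1)]]
   using ring_hom_add[OF hh, of p q] p(1) q(1) by (simp add: poly_ring_simps)
 next
  show "\<phi> \<one>\<^sub>?RA = \<one>\<^sub>?RL"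
   using \<phi>[OF poly_carrier_one] ring_hom_one[OF hh] R_class_simps(4)[OF poly_carrier_one poly_carrier_one, of A fs]
   by (simp add: poly_ring_simps)
 qed
 thus ?thesis using \<phi> unfolding h_def by blast
qed

end

theorem proposition11p2:
  fixes \<Lambda> :: "(complex, 'a) module" and es :: "'a list" and J :: "'a set"
    and A :: "(complex, 'a set) module" and fs :: "'a set list"
  assumes "fd_complex_algebra \<Lambda>"
    and "complete_primitive_idempotents \<Lambda> es"
    and "basic_algebra \<Lambda> es"
    and "finite_rep_type \<Lambda>"
    and "ideal J \<Lambda>"
    and "A = quotient_algebra \<Lambda> J"
    and "complete_primitive_idempotents A fs"
  shows "\<exists>\<phi> \<in> Ring.ring_hom (R_tilde A fs) (R_tilde \<Lambda> es).
    (\<forall>c. \<phi> (R_const A fs c) = R_const \<Lambda> es c) \<and>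
    (\<forall>M \<in> ind_K A. \<phi> (R_var A fs M) =
       (\<Otimes>\<^bsub>R_tilde \<Lambda> es\<^esub>N\<in>ind_K \<Lambda>.
          R_var \<Lambda> es N [^]\<^bsub>R_tilde \<Lambda> es\<^esub> K_mult A (quot_K \<Lambda> J (K_rep N)) M))"
proof -
 interpret quotient_setting \<Lambda> J A
  by (rule quotient_setting.intro[OF fd_algebra.intro[OF assms(1)] assms(5)]) (unfold_locales, rule assms(6))
 obtain \<phi> where \<phi>: "\<phi> \<in> Ring.ring_hom (R_tilde A fs) (R_tilde \<Lambda> es)"
  "\<forall>p\<in>poly_carrier (ind_K A). \<phi> (R_class A fs p) = R_class \<Lambda> es (poly_eval var_image p)"
  using ring_map[OF assms(2,7)] by blast
 show ?thesis
 proof (rule bexI[OF _ \<phi>(1)], intro conjI allI ballI)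
  fix c
  show "\<phi> (R_const A fs c) = R_const \<Lambda> es c"
   unfolding bspec[OF \<phi>(2) poly_carrier_const] poly_eval_const ..
 next
  fix M assume M: "M \<in> ind_K A"
  show "\<phi> (R_var A fs M) = (\<Otimes>\<^bsub>R_tilde \<Lambda> es\<^esub>N\<in>ind_K \<Lambda>. R_var \<Lambda> es N [^]\<^bsub>R_tilde \<Lambda> es\<^esub> K_mult A (quot_K \<Lambda> J (K_rep N)) M)"
   unfolding bspec[OF \<phi>(2) poly_carrier_var[OF M]] poly_eval_var var_image_def by (rule R_class_prod[OF poly_carrier_var])
 qed
qed

end
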